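(* The quadruple $c\mathcal{L}_\infty := (\mathrm{cL}_\infty, d_{\mathrm{cL}_\infty}, \ell_0, \langle \ell_i\rangle_{i>0})$, where $\mathrm{cL}_\infty$ is the (shifted) curved L-infinity dg operad and $\langle \ell_i\rangle_{i>0}$ is the graded symmetric sub-operad generated by the $\ell_i$ with $i>0$, is the initial object of the category $\mathrm{Curv}^\Sigma$.
   Context: Conventions. Fix a field $\mathbb{K}$ of characteristic zero. "Operad" means symmetric operad in graded $\mathbb{K}$-vector spaces (arities $n\ge0$; no operadic unit required); "dg operad" means the same in differential graded $\mathbb{K}$-vector spaces; homological degree conventions, so differentials have degree $-1$. $\vee$ denotes the coproduct of (symmetric) operads. $[\kappa]$ denotes the operad freely generated by a single operation $\kappa$ of arity $0$. For an operad $\mathrm{P}$, the coproduct $\mathrm{P}\vee[\kappa]$ has a weight grading, by the number of $\kappa$'s appearing in an expression. The category $\mathrm{Curv}^\Sigma$. Objects are quadruples $(\mathrm{Q}, d_{\mathrm{Q}}, \kappa, \mathrm{Q}_0)$ where $(\mathrm{Q}, d_{\mathrm{Q}})$ is a symmetric dg operad, $\mathrm{Q}_0$ is a symmetric sub-operad of the underlying graded (not dg) operad $\mathrm{Q}$, and $\kappa\in \mathrm{Q}\setminus\mathrm{Q}_0$ is an element of arity $0$ and degree $-1$, such that: (1) the natural morphism $\mathrm{Q}_0\vee[\kappa]\to\mathrm{Q}$ is an isomorphism; (2) for the resulting weight grading $\mathrm{Q}=\bigoplus_i \mathrm{Q}_i$ (number of $\kappa$'s), writing $d_{\mathrm{Q}}=\sum_i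 d_i$ with $d_i(\mathrm{Q}_j)\subset \mathrm{Q}_{i+j}$, all $d_i$ vanish except $d_0,d_1$; (3) $d_1\kappa=0$. Morphisms $(\mathrm{Q}, d_{\mathrm{Q}}, \kappa, \mathrm{Q}_0)\to(\mathrm{Q}', d_{\mathrm{Q}'}, \kappa', \mathrm{Q}'_0)$ are maps of symmetric dg operads $\Phi$ with $\Phi(\kappa)=\kappa'$ and $\Phi(\mathrm{Q}_0)\subset\mathrm{Q}'_0$. The dg operad $\mathrm{cL}_\infty$ is the free symmetric operad on generators $\ell_n$, $n\ge 0$, of arity $n$ and degree $-1$, with trivial symmetric group action $\ell_n^\sigma=\ell_n$ for $\sigma\in\mathbb{S}_n$, and differential $$d_{\mathrm{cL}_\infty}(\ell_n) = -\sum_{p,q\ge 0,\ p+q=n}\ \sum_{\sigma\in \mathrm{Sh}_{p,q}^{-1}}(\ell_{p+1}\circ_1\ell_q)^\sigma,$$ where the inner sum is over unshuffles, i.e. it has one term for each subset $I\subset\{1,\dots,n\}$ with $|I|=q$: the inputs labelled by $I$ are fed, in increasing order, into $\ell_q$, and the remaining inputs are fed, in increasing order, into the last $p$ slots of $\ell_{p+1}$. *)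

theory Defs
  imports "HOL-Algebra.Module" "HOL-Combinatorics.Permutations"
begin

section \<open>Symmetric operads in graded vector spaces\<close>

definition sign_of :: "('k, 'm) ring_scheme \<Rightarrow> int \<Rightarrow> 'k" where
  "sign_of K k = (if even k then \<one>\<^bsub>K\<^esub> else \<ominus>\<^bsub>K\<^esub> \<one>\<^bsub>K\<^esub>)"

text \<open>
  \<open>Sp P n d\<close> is the space of operations of arity \<open>n\<close> and homological degree \<open>d\<close>,
  \<open>pcomp P i x y\<close> is the partial composition of \<open>y\<close> into the \<open>i\<close>-th input of \<open>x\<close>
  (there is no operadic unit), and \<open>act P \<sigma> x\<close> is \<open>x\<close> acted upon from the right by \<open>\<sigma>\<close>.
  The convention for the action is that the \<open>i\<close>-th input of \<open>act P \<sigma> x\<close> is fed into the slot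
  \<open>\<sigma> i\<close> of \<open>x\<close>.
\<close>

record ('k, 'a) operad =
  Sp :: "nat \<Rightarrow> int \<Rightarrow> ('k, 'a) module"
  pcomp :: "nat \<Rightarrow> 'a \<Rightarrow> 'a \<Rightarrow> 'a"
  act :: "(nat \<Rightarrow> nat) \<Rightarrow> 'a \<Rightarrow> 'a"

text \<open>
  The two permutations in the equivariance axioms, for a composition at \<open>i\<close> with an operation
  of arity \<open>m\<close>, whose inputs become the block \<open>{i..<i + m}\<close>: \<open>block_inner i m \<tau>\<close> acts by \<open>\<tau>\<close>
  inside this block, and \<open>block_outer i m \<sigma>\<close> acts like \<open>\<sigma>\<close> on the inputs of the outer
  operation, moving the block as a whole.
\<close>

definition block_inner :: "nat \<Rightarrow> nat \<Rightarrow> (nat \<Rightarrow> nat) \<Rightarrow> nat \<Rightarrow> nat" where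
  "block_inner i m \<tau> k = (if i \<le> k \<and> k < i + m then \<tau> (k + 1 - i) + i - 1 else k)"

definition block_outer :: "nat \<Rightarrow> nat \<Rightarrow> (nat \<Rightarrow> nat) \<Rightarrow> nat \<Rightarrow> nat" where
  "block_outer i m \<sigma> k =
    (if i \<le> k \<and> k < i + m then \<sigma> i + (k - i)
     else let s = \<sigma> (if k < i then k else k + 1 - m)
          in if s < \<sigma> i then s else s + m - 1)"

locale graded_operad = field K for K :: "('k, 'm) ring_scheme" (structure) +
  fixes P :: "('k, 'a) operad"
  assumes module_Sp: "module K (Sp P n d)"
    and pcomp_closed:
      "\<lbrakk>x \<in> carrier (Sp P n d); y \<in> carrier (Sp P m e); 1 \<le> i; i \<le> n\<rbrakk>
        \<Longrightarrow> pcomp P i x y \<in> carrier (Sp P (n + m - 1) (d + e))"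
    and pcomp_add_left:
      "\<lbrakk>x \<in> carrier (Sp P n d); x' \<in> carrier (Sp P n d); y \<in> carrier (Sp P m e); 1 \<le> i; i \<le> n\<rbrakk>
        \<Longrightarrow> pcomp P i (x \<oplus>\<^bsub>Sp P n d\<^esub> x') y
            = pcomp P i x y \<oplus>\<^bsub>Sp P (n + m - 1) (d + e)\<^esub> pcomp P i x' y"
    and pcomp_add_right:
      "\<lbrakk>x \<in> carrier (Sp P n d); y \<in> carrier (Sp P m e); y' \<in> carrier (Sp P m e); 1 \<le> i; i \<le> n\<rbrakk>
        \<Longrightarrow> pcomp P i x (y \<oplus>\<^bsub>Sp P m e\<^esub> y')
            = pcomp P i x y \<oplus>\<^bsub>Sp P (n + m - 1) (d + e)\<^esub> pcomp P i x y'"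
    and pcomp_smult_left:
      "\<lbrakk>c \<in> carrier K; x \<in> carrier (Sp P n d); y \<in> carrier (Sp P m e); 1 \<le> i; i \<le> n\<rbrakk>
        \<Longrightarrow> pcomp P i (c \<odot>\<^bsub>Sp P n d\<^esub> x) y = c \<odot>\<^bsub>Sp P (n + m - 1) (d + e)\<^esub> pcomp P i x y"
    and pcomp_smult_right:
      "\<lbrakk>c \<in> carrier K; x \<in> carrier (Sp P n d); y \<in> carrier (Sp P m e); 1 \<le> i; i \<le> n\<rbrakk>
        \<Longrightarrow> pcomp P i x (c \<odot>\<^bsub>Sp P m e\<^esub> y) = c \<odot>\<^bsub>Sp P (n + m - 1) (d + e)\<^esub> pcomp P i x y"
    and act_closed:
      "\<lbrakk>x \<in> carrier (Sp P n d); \<sigma> permutes {1..n}\<rbrakk> \<Longrightarrow> act P \<sigma> x \<in> carrier (Sp P n d)"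
    and act_add:
      "\<lbrakk>x \<in> carrier (Sp P n d); y \<in> carrier (Sp P n d); \<sigma> permutes {1..n}\<rbrakk>
        \<Longrightarrow> act P \<sigma> (x \<oplus>\<^bsub>Sp P n d\<^esub> y) = act P \<sigma> x \<oplus>\<^bsub>Sp P n d\<^esub> act P \<sigma> y"
    and act_smult:
      "\<lbrakk>c \<in> carrier K; x \<in> carrier (Sp P n d); \<sigma> permutes {1..n}\<rbrakk>
        \<Longrightarrow> act P \<sigma> (c \<odot>\<^bsub>Sp P n d\<^esub> x) = c \<odot>\<^bsub>Sp P n d\<^esub> act P \<sigma> x"
    and act_id: "x \<in> carrier (Sp P n d) \<Longrightarrow> act P id x = x"
    and act_act:
      "\<lbrakk>x \<in> carrier (Sp P n d); \<sigma> permutes {1..n}; \<tau> permutes {1..n}\<rbrakk>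
        \<Longrightarrow> act P \<tau> (act P \<sigma> x) = act P (\<sigma> \<circ> \<tau>) x"
    and pcomp_sequential:
      "\<lbrakk>x \<in> carrier (Sp P n d); y \<in> carrier (Sp P m e); z \<in> carrier (Sp P l f);
        1 \<le> i; i \<le> n; 1 \<le> j; j \<le> m\<rbrakk>
        \<Longrightarrow> pcomp P (i + j - 1) (pcomp P i x y) z = pcomp P i x (pcomp P j y z)"
    and pcomp_parallel:
      "\<lbrakk>x \<in> carrier (Sp P n d); y \<in> carrier (Sp P m e); z \<in> carrier (Sp P l f);
        1 \<le> i; i < k; k \<le> n\<rbrakk>
        \<Longrightarrow> pcomp P (k + m - 1) (pcomp P i x y) z
            = sign_of K (e * f) \<odot>\<^bsub>Sp P (n + m + l - 2) (d + e + f)\<^esub> pcomp P i (pcomp P k x z) y"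
    and pcomp_act_right:
      "\<lbrakk>x \<in> carrier (Sp P n d); y \<in> carrier (Sp P m e); 1 \<le> i; i \<le> n; \<tau> permutes {1..m}\<rbrakk>
        \<Longrightarrow> pcomp P i x (act P \<tau> y) = act P (block_inner i m \<tau>) (pcomp P i x y)"
    and pcomp_act_left:
      "\<lbrakk>x \<in> carrier (Sp P n d); y \<in> carrier (Sp P m e); 1 \<le> i; i \<le> n; \<sigma> permutes {1..n}\<rbrakk>
        \<Longrightarrow> pcomp P i (act P \<sigma> x) y = act P (block_outer i m \<sigma>) (pcomp P (\<sigma> i) x y)"

locale dg_operad = graded_operad K P
  for K :: "('k, 'm) ring_scheme" (structure) and P :: "('k, 'a) operad" +
  fixes D :: "'a \<Rightarrow> 'a"
  assumes D_closed: "x \<in> carrier (Sp P n d) \<Longrightarrow> D x \<in> carrier (Sp P n (d - 1))"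
    and D_add:
      "\<lbrakk>x \<in> carrier (Sp P n d); y \<in> carrier (Sp P n d)\<rbrakk>
        \<Longrightarrow> D (x \<oplus>\<^bsub>Sp P n d\<^esub> y) = D x \<oplus>\<^bsub>Sp P n (d - 1)\<^esub> D y"
    and D_smult:
      "\<lbrakk>c \<in> carrier K; x \<in> carrier (Sp P n d)\<rbrakk>
        \<Longrightarrow> D (c \<odot>\<^bsub>Sp P n d\<^esub> x) = c \<odot>\<^bsub>Sp P n (d - 1)\<^esub> D x"
    and D_D: "x \<in> carrier (Sp P n d) \<Longrightarrow> D (D x) = \<zero>\<^bsub>Sp P n (d - 2)\<^esub>"
    and D_pcomp:
      "\<lbrakk>x \<in> carrier (Sp P n d); y \<in> carrier (Sp P m e); 1 \<le> i; i \<le> n\<rbrakk>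
        \<Longrightarrow> D (pcomp P i x y)
            = pcomp P i (D x) y \<oplus>\<^bsub>Sp P (n + m - 1) (d + e - 1)\<^esub>
              (sign_of K d \<odot>\<^bsub>Sp P (n + m - 1) (d + e - 1)\<^esub> pcomp P i x (D y))"
    and D_act:
      "\<lbrakk>x \<in> carrier (Sp P n d); \<sigma> permutes {1..n}\<rbrakk> \<Longrightarrow> D (act P \<sigma> x) = act P \<sigma> (D x)"

definition operad_hom ::
  "('k, 'm) ring_scheme \<Rightarrow> ('k, 'a) operad \<Rightarrow> ('k, 'b) operad \<Rightarrow> ('a \<Rightarrow> 'b) set" where
  "operad_hom K P Q = {f.
     (\<forall>n d. \<forall>x \<in> carrier (Sp P n d). f x \<in> carrier (Sp Q n d)) \<and>
     (\<forall>n d. \<forall>x \<in> carrier (Sp P n d). \<forall>y \<in> carrier (Sp P n d).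
        f (x \<oplus>\<^bsub>Sp P n d\<^esub> y) = f x \<oplus>\<^bsub>Sp Q n d\<^esub> f y) \<and>
     (\<forall>n d. \<forall>c \<in> carrier K. \<forall>x \<in> carrier (Sp P n d).
        f (c \<odot>\<^bsub>Sp P n d\<^esub> x) = c \<odot>\<^bsub>Sp Q n d\<^esub> f x) \<and>
     (\<forall>n d m e. \<forall>x \<in> carrier (Sp P n d). \<forall>y \<in> carrier (Sp P m e). \<forall>i \<in> {1..n}.
        f (pcomp P i x y) = pcomp Q i (f x) (f y)) \<and>
     (\<forall>n d \<sigma>. \<forall>x \<in> carrier (Sp P n d). \<sigma> permutes {1..n} \<longrightarrow> f (act P \<sigma> x) = act Q \<sigma> (f x))}"

definition operad_iso ::
  "('k, 'm) ring_scheme \<Rightarrow> ('k, 'a) operad \<Rightarrow> ('k, 'b) operad \<Rightarrow> ('a \<Rightarrow> 'b) set" where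
  "operad_iso K P Q = {f. f \<in> operad_hom K P Q \<and>
     (\<forall>n d. bij_betw f (carrier (Sp P n d)) (carrier (Sp Q n d)))}"

definition suboperad ::
  "('k, 'm) ring_scheme \<Rightarrow> ('k, 'a) operad \<Rightarrow> (nat \<Rightarrow> int \<Rightarrow> 'a set) \<Rightarrow> bool" where
  "suboperad K P H \<longleftrightarrow>
     (\<forall>n d. submodule (H n d) K (Sp P n d)) \<and>
     (\<forall>n d m e. \<forall>x \<in> H n d. \<forall>y \<in> H m e. \<forall>i \<in> {1..n}. pcomp P i x y \<in> H (n + m - 1) (d + e)) \<and>
     (\<forall>n d \<sigma>. \<forall>x \<in> H n d. \<sigma> permutes {1..n} \<longrightarrow> act P \<sigma> x \<in> H n d)"

definition restrict_operad ::
  "('k, 'a) operad \<Rightarrow> (nat \<Rightarrow> int \<Rightarrow> 'a set) \<Rightarrow> ('k, 'a) operad" where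
  "restrict_operad P H = P\<lparr>Sp := \<lambda>n d. (Sp P n d)\<lparr>carrier := H n d\<rparr>\<rparr>"

definition generated_suboperad ::
  "('k, 'm) ring_scheme \<Rightarrow> ('k, 'a) operad \<Rightarrow> (nat \<Rightarrow> int \<Rightarrow> 'a set) \<Rightarrow> nat \<Rightarrow> int \<Rightarrow> 'a set" where
  "generated_suboperad K P S n d =
     \<Inter>{H n d | H. suboperad K P H \<and> (\<forall>m e. S m e \<subseteq> H m e)}"


section \<open>Operads given by generators and relations\<close>

text \<open>
  Formal operadic expressions in generators. A generator \<open>Gen n d g\<close> carries its arity \<open>n\<close> and
  degree \<open>d\<close>, so that every expression has a unique arity and degree; likewise for \<open>Zero\<close>.
\<close>

datatype ('k, 'g) expr =
    Gen nat int 'g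
  | Zero nat int
  | Add "('k, 'g) expr" "('k, 'g) expr"
  | Smult 'k "('k, 'g) expr"
  | Comp nat "('k, 'g) expr" "('k, 'g) expr"
  | Act "nat \<Rightarrow> nat" "('k, 'g) expr"

primrec arity :: "('k, 'g) expr \<Rightarrow> nat" where
  "arity (Gen n d g) = n"
| "arity (Zero n d) = n"
| "arity (Add s t) = arity s"
| "arity (Smult c t) = arity t"
| "arity (Comp i s t) = arity s + arity t - 1"
| "arity (Act \<sigma> t) = arity t"

primrec degree :: "('k, 'g) expr \<Rightarrow> int" where
  "degree (Gen n d g) = d"
| "degree (Zero n d) = d"
| "degree (Add s t) = degree s"
| "degree (Smult c t) = degree t"
| "degree (Comp i s t) = degree s + degree t"
| "degree (Act \<sigma> t) = degree t"

primrec wf_expr ::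
  "('k, 'm) ring_scheme \<Rightarrow> (nat \<Rightarrow> int \<Rightarrow> 'g set) \<Rightarrow> ('k, 'g) expr \<Rightarrow> bool" where
  "wf_expr K G (Gen n d g) \<longleftrightarrow> g \<in> G n d"
| "wf_expr K G (Zero n d) \<longleftrightarrow> True"
| "wf_expr K G (Add s t) \<longleftrightarrow>
     wf_expr K G s \<and> wf_expr K G t \<and> arity s = arity t \<and> degree s = degree t"
| "wf_expr K G (Smult c t) \<longleftrightarrow> c \<in> carrier K \<and> wf_expr K G t"
| "wf_expr K G (Comp i s t) \<longleftrightarrow> wf_expr K G s \<and> wf_expr K G t \<and> 1 \<le> i \<and> i \<le> arity s"
| "wf_expr K G (Act \<sigma> t) \<longleftrightarrow> wf_expr K G t \<and> \<sigma> permutes {1..arity t}"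

text \<open>
  The smallest congruence on well-formed expressions that contains the relations \<open>R\<close> and all
  instances of the axioms of a symmetric operad in graded vector spaces.
\<close>

inductive_set pres_cong ::
  "('k, 'm) ring_scheme \<Rightarrow> (nat \<Rightarrow> int \<Rightarrow> 'g set) \<Rightarrow> (('k, 'g) expr \<times> ('k, 'g) expr) set
    \<Rightarrow> (('k, 'g) expr \<times> ('k, 'g) expr) set"
  for K and G and R where
  rel: "\<lbrakk>(s, t) \<in> R; wf_expr K G s; wf_expr K G t; arity s = arity t; degree s = degree t\<rbrakk>
    \<Longrightarrow> (s, t) \<in> pres_cong K G R"
| refl: "wf_expr K G t \<Longrightarrow> (t, t) \<in> pres_cong K G R"
| sym: "(s, t) \<in> pres_cong K G R \<Longrightarrow> (t, s) \<in> pres_cong K G R"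
| trans: "\<lbrakk>(r, s) \<in> pres_cong K G R; (s, t) \<in> pres_cong K G R\<rbrakk> \<Longrightarrow> (r, t) \<in> pres_cong K G R"
| cong_Add: "\<lbrakk>(s, s') \<in> pres_cong K G R; (t, t') \<in> pres_cong K G R; wf_expr K G (Add s t)\<rbrakk>
    \<Longrightarrow> (Add s t, Add s' t') \<in> pres_cong K G R"
| cong_Smult: "\<lbrakk>(t, t') \<in> pres_cong K G R; wf_expr K G (Smult c t)\<rbrakk>
    \<Longrightarrow> (Smult c t, Smult c t') \<in> pres_cong K G R"
| cong_Comp: "\<lbrakk>(s, s') \<in> pres_cong K G R; (t, t') \<in> pres_cong K G R; wf_expr K G (Comp i s t)\<rbrakk>
    \<Longrightarrow> (Comp i s t, Comp i s' t') \<in> pres_cong K G R"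
| cong_Act: "\<lbrakk>(t, t') \<in> pres_cong K G R; wf_expr K G (Act \<sigma> t)\<rbrakk>
    \<Longrightarrow> (Act \<sigma> t, Act \<sigma> t') \<in> pres_cong K G R"
| Add_assoc: "wf_expr K G (Add (Add r s) t)
    \<Longrightarrow> (Add (Add r s) t, Add r (Add s t)) \<in> pres_cong K G R"
| Add_comm: "wf_expr K G (Add s t) \<Longrightarrow> (Add s t, Add t s) \<in> pres_cong K G R"
| Add_Zero: "wf_expr K G t \<Longrightarrow> (Add (Zero (arity t) (degree t)) t, t) \<in> pres_cong K G R"
| Add_inverse: "wf_expr K G t
    \<Longrightarrow> (Add (Smult (\<ominus>\<^bsub>K\<^esub> \<one>\<^bsub>K\<^esub>) t) t, Zero (arity t) (degree t)) \<in> pres_cong K G R"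
| Smult_add_scalar: "\<lbrakk>a \<in> carrier K; b \<in> carrier K; wf_expr K G t\<rbrakk>
    \<Longrightarrow> (Smult (a \<oplus>\<^bsub>K\<^esub> b) t, Add (Smult a t) (Smult b t)) \<in> pres_cong K G R"
| Smult_Add: "\<lbrakk>a \<in> carrier K; wf_expr K G (Add s t)\<rbrakk>
    \<Longrightarrow> (Smult a (Add s t), Add (Smult a s) (Smult a t)) \<in> pres_cong K G R"
| Smult_Smult: "\<lbrakk>a \<in> carrier K; b \<in> carrier K; wf_expr K G t\<rbrakk>
    \<Longrightarrow> (Smult (a \<otimes>\<^bsub>K\<^esub> b) t, Smult a (Smult b t)) \<in> pres_cong K G R"
| Smult_one: "wf_expr K G t \<Longrightarrow> (Smult \<one>\<^bsub>K\<^esub> t, t) \<in> pres_cong K G R"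
| Comp_Add_left: "wf_expr K G (Comp i (Add s s') t)
    \<Longrightarrow> (Comp i (Add s s') t, Add (Comp i s t) (Comp i s' t)) \<in> pres_cong K G R"
| Comp_Add_right: "wf_expr K G (Comp i s (Add t t'))
    \<Longrightarrow> (Comp i s (Add t t'), Add (Comp i s t) (Comp i s t')) \<in> pres_cong K G R"
| Comp_Smult_left: "wf_expr K G (Comp i (Smult c s) t)
    \<Longrightarrow> (Comp i (Smult c s) t, Smult c (Comp i s t)) \<in> pres_cong K G R"
| Comp_Smult_right: "wf_expr K G (Comp i s (Smult c t))
    \<Longrightarrow> (Comp i s (Smult c t), Smult c (Comp i s t)) \<in> pres_cong K G R"
| Act_Add: "wf_expr K G (Act \<sigma> (Add s t))
    \<Longrightarrow> (Act \<sigma> (Add s t), Add (Act \<sigma> s) (Act \<sigma> t)) \<in> pres_cong K G R"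
| Act_Smult: "wf_expr K G (Act \<sigma> (Smult c t))
    \<Longrightarrow> (Act \<sigma> (Smult c t), Smult c (Act \<sigma> t)) \<in> pres_cong K G R"
| Act_id: "wf_expr K G t \<Longrightarrow> (Act id t, t) \<in> pres_cong K G R"
| Act_Act: "wf_expr K G (Act \<tau> (Act \<sigma> t))
    \<Longrightarrow> (Act \<tau> (Act \<sigma> t), Act (\<sigma> \<circ> \<tau>) t) \<in> pres_cong K G R"
| Comp_sequential: "\<lbrakk>wf_expr K G (Comp i r s); wf_expr K G (Comp j s t)\<rbrakk>
    \<Longrightarrow> (Comp (i + j - 1) (Comp i r s) t, Comp i r (Comp j s t)) \<in> pres_cong K G R"
| Comp_parallel: "\<lbrakk>wf_expr K G (Comp i r s); wf_expr K G (Comp k r t); i < k\<rbrakk>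
    \<Longrightarrow> (Comp (k + arity s - 1) (Comp i r s) t,
         Smult (sign_of K (degree s * degree t)) (Comp i (Comp k r t) s)) \<in> pres_cong K G R"
| Comp_Act_right: "wf_expr K G (Comp i s (Act \<tau> t))
    \<Longrightarrow> (Comp i s (Act \<tau> t), Act (block_inner i (arity t) \<tau>) (Comp i s t)) \<in> pres_cong K G R"
| Comp_Act_left: "wf_expr K G (Comp i (Act \<sigma> s) t)
    \<Longrightarrow> (Comp i (Act \<sigma> s) t, Act (block_outer i (arity t) \<sigma>) (Comp (\<sigma> i) s t)) \<in> pres_cong K G R"

definition pres_class ::
  "('k, 'm) ring_scheme \<Rightarrow> (nat \<Rightarrow> int \<Rightarrow> 'g set) \<Rightarrow> (('k, 'g) expr \<times> ('k, 'g) expr) set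
    \<Rightarrow> ('k, 'g) expr \<Rightarrow> ('k, 'g) expr set" where
  "pres_class K G R t = pres_cong K G R `` {t}"

text \<open>
  The operad with generators \<open>G\<close> (\<open>G n d\<close> being those of arity \<open>n\<close> and degree \<open>d\<close>) subject to
  the relations \<open>R\<close>. The fields \<open>mult\<close> and \<open>one\<close>, which the module record inherits from the ring
  record, have no meaning for a module.
\<close>

definition presented_operad ::
  "('k, 'm) ring_scheme \<Rightarrow> (nat \<Rightarrow> int \<Rightarrow> 'g set) \<Rightarrow> (('k, 'g) expr \<times> ('k, 'g) expr) set
    \<Rightarrow> ('k, ('k, 'g) expr set) operad" where
  "presented_operad K G R =
    \<lparr>Sp = \<lambda>n d.
       \<lparr>carrier = {t. wf_expr K G t \<and> arity t = n \<and> degree t = d} // pres_cong K G R,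
        monoid.mult = undefined,
        one = undefined,
        zero = pres_class K G R (Zero n d),
        add = \<lambda>X Y. \<Union>s\<in>X. \<Union>t\<in>Y. pres_class K G R (Add s t),
        smult = \<lambda>c X. \<Union>t\<in>X. pres_class K G R (Smult c t)\<rparr>,
     pcomp = \<lambda>i X Y. \<Union>s\<in>X. \<Union>t\<in>Y. pres_class K G R (Comp i s t),
     act = \<lambda>\<sigma> X. \<Union>t\<in>X. pres_class K G R (Act \<sigma> t)\<rparr>"

text \<open>
  The value in \<open>P\<close> of an expression under an assignment \<open>\<rho>\<close> of the generators, and the map from
  a presented operad to \<open>P\<close> that it induces.
\<close>

primrec eval_expr ::
  "('k, 'a) operad \<Rightarrow> (nat \<Rightarrow> int \<Rightarrow> 'g \<Rightarrow> 'a) \<Rightarrow> ('k, 'g) expr \<Rightarrow> 'a" where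
  "eval_expr P \<rho> (Gen n d g) = \<rho> n d g"
| "eval_expr P \<rho> (Zero n d) = \<zero>\<^bsub>Sp P n d\<^esub>"
| "eval_expr P \<rho> (Add s t) =
     eval_expr P \<rho> s \<oplus>\<^bsub>Sp P (arity s) (degree s)\<^esub> eval_expr P \<rho> t"
| "eval_expr P \<rho> (Smult c t) = c \<odot>\<^bsub>Sp P (arity t) (degree t)\<^esub> eval_expr P \<rho> t"
| "eval_expr P \<rho> (Comp i s t) = pcomp P i (eval_expr P \<rho> s) (eval_expr P \<rho> t)"
| "eval_expr P \<rho> (Act \<sigma> t) = act P \<sigma> (eval_expr P \<rho> t)"

definition induced_map ::
  "('k, 'a) operad \<Rightarrow> (nat \<Rightarrow> int \<Rightarrow> 'g \<Rightarrow> 'a) \<Rightarrow> ('k, 'g) expr set \<Rightarrow> 'a" where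
  "induced_map P \<rho> X = the_elem (eval_expr P \<rho> ` X)"

text \<open>
  The derivation of degree \<open>-1\<close> along \<open>\<rho>\<close> that has the value \<open>\<delta> n d g\<close> on the generator
  \<open>Gen n d g\<close>.
\<close>

primrec deriv_expr ::
  "('k, 'm) ring_scheme \<Rightarrow> ('k, 'a) operad \<Rightarrow> (nat \<Rightarrow> int \<Rightarrow> 'g \<Rightarrow> 'a) \<Rightarrow> (nat \<Rightarrow> int \<Rightarrow> 'g \<Rightarrow> 'a)
    \<Rightarrow> ('k, 'g) expr \<Rightarrow> 'a" where
  "deriv_expr K P \<rho> \<delta> (Gen n d g) = \<delta> n d g"
| "deriv_expr K P \<rho> \<delta> (Zero n d) = \<zero>\<^bsub>Sp P n (d - 1)\<^esub>"
| "deriv_expr K P \<rho> \<delta> (Add s t) =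
     deriv_expr K P \<rho> \<delta> s \<oplus>\<^bsub>Sp P (arity s) (degree s - 1)\<^esub> deriv_expr K P \<rho> \<delta> t"
| "deriv_expr K P \<rho> \<delta> (Smult c t) =
     c \<odot>\<^bsub>Sp P (arity t) (degree t - 1)\<^esub> deriv_expr K P \<rho> \<delta> t"
| "deriv_expr K P \<rho> \<delta> (Comp i s t) =
     (let M = Sp P (arity s + arity t - 1) (degree s + degree t - 1)
      in pcomp P i (deriv_expr K P \<rho> \<delta> s) (eval_expr P \<rho> t) \<oplus>\<^bsub>M\<^esub>
         (sign_of K (degree s) \<odot>\<^bsub>M\<^esub> pcomp P i (eval_expr P \<rho> s) (deriv_expr K P \<rho> \<delta> t)))"
| "deriv_expr K P \<rho> \<delta> (Act \<sigma> t) = act P \<sigma> (deriv_expr K P \<rho> \<delta> t)"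


section \<open>Coproducts\<close>

text \<open>
  The coproduct of \<open>P\<close> and \<open>Q\<close> is generated by the elements of \<open>P\<close> and of \<open>Q\<close>, subject to the
  relations that hold in \<open>P\<close> and in \<open>Q\<close>. Here \<open>h\<close> is the labelling of elements as generators.
\<close>

definition structure_relations ::
  "('k, 'm) ring_scheme \<Rightarrow> ('k, 'a) operad \<Rightarrow> ('a \<Rightarrow> 'g) \<Rightarrow> (('k, 'g) expr \<times> ('k, 'g) expr) set" where
  "structure_relations K P h =
     {(Add (Gen n d (h x)) (Gen n d (h y)), Gen n d (h (x \<oplus>\<^bsub>Sp P n d\<^esub> y))) | n d x y.
        x \<in> carrier (Sp P n d) \<and> y \<in> carrier (Sp P n d)} \<union>
     {(Smult c (Gen n d (h x)), Gen n d (h (c \<odot>\<^bsub>Sp P n d\<^esub> x))) | n d c x.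
        c \<in> carrier K \<and> x \<in> carrier (Sp P n d)} \<union>
     {(Comp i (Gen n d (h x)) (Gen m e (h y)), Gen (n + m - 1) (d + e) (h (pcomp P i x y))) | n d m e i x y.
        x \<in> carrier (Sp P n d) \<and> y \<in> carrier (Sp P m e) \<and> i \<in> {1..n}} \<union>
     {(Act \<sigma> (Gen n d (h x)), Gen n d (h (act P \<sigma> x))) | n d \<sigma> x.
        x \<in> carrier (Sp P n d) \<and> \<sigma> permutes {1..n}}"

definition coproduct_gens ::
  "('k, 'a) operad \<Rightarrow> ('k, 'b) operad \<Rightarrow> nat \<Rightarrow> int \<Rightarrow> ('a + 'b) set" where
  "coproduct_gens P Q n d = carrier (Sp P n d) <+> carrier (Sp Q n d)"

definition coproduct_rels ::
  "('k, 'm) ring_scheme \<Rightarrow> ('k, 'a) operad \<Rightarrow> ('k, 'b) operad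
    \<Rightarrow> (('k, 'a + 'b) expr \<times> ('k, 'a + 'b) expr) set" where
  "coproduct_rels K P Q = structure_relations K P Inl \<union> structure_relations K Q Inr"

definition coproduct ::
  "('k, 'm) ring_scheme \<Rightarrow> ('k, 'a) operad \<Rightarrow> ('k, 'b) operad
    \<Rightarrow> ('k, ('k, 'a + 'b) expr set) operad" where
  "coproduct K P Q = presented_operad K (coproduct_gens P Q) (coproduct_rels K P Q)"

definition coproduct_inl ::
  "('k, 'm) ring_scheme \<Rightarrow> ('k, 'a) operad \<Rightarrow> ('k, 'b) operad
    \<Rightarrow> nat \<Rightarrow> int \<Rightarrow> 'a \<Rightarrow> ('k, 'a + 'b) expr set" where
  "coproduct_inl K P Q n d x =
     pres_class K (coproduct_gens P Q) (coproduct_rels K P Q) (Gen n d (Inl x))"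

definition coproduct_inr ::
  "('k, 'm) ring_scheme \<Rightarrow> ('k, 'a) operad \<Rightarrow> ('k, 'b) operad
    \<Rightarrow> nat \<Rightarrow> int \<Rightarrow> 'b \<Rightarrow> ('k, 'a + 'b) expr set" where
  "coproduct_inr K P Q n d y =
     pres_class K (coproduct_gens P Q) (coproduct_rels K P Q) (Gen n d (Inr y))"

definition coproduct_map ::
  "('k, 'c) operad \<Rightarrow> ('a \<Rightarrow> 'c) \<Rightarrow> ('b \<Rightarrow> 'c) \<Rightarrow> ('k, 'a + 'b) expr set \<Rightarrow> 'c" where
  "coproduct_map T f g = induced_map T (\<lambda>n d. case_sum f g)"


section \<open>Adjoining a curvature element\<close>

text \<open>The operad \<open>[\<kappa>]\<close>, with \<open>\<kappa>\<close> of arity 0 and degree \<open>-1\<close>.\<close>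

definition kappa_gens :: "nat \<Rightarrow> int \<Rightarrow> unit set" where
  "kappa_gens n d = (if n = 0 \<and> d = -1 then {()} else {})"

definition kappa_operad ::
  "('k, 'm) ring_scheme \<Rightarrow> ('k, ('k, unit) expr set) operad" where
  "kappa_operad K = presented_operad K kappa_gens {}"

definition kappa_elem :: "('k, 'm) ring_scheme \<Rightarrow> ('k, unit) expr set" where
  "kappa_elem K = pres_class K kappa_gens {} (Gen 0 (-1) ())"

text \<open>
  \<open>weight_space K P S k w n d\<close> is the span, in arity \<open>n\<close> and degree \<open>d\<close>, of the expressions in
  the elements of \<open>S\<close> and the element \<open>k\<close> (of arity 0 and degree \<open>-1\<close>) in which \<open>k\<close> appears
  exactly \<open>w\<close> times.
\<close>

inductive weight_homogeneous ::
  "('k, 'm) ring_scheme \<Rightarrow> ('k, 'a) operad \<Rightarrow> (nat \<Rightarrow> int \<Rightarrow> 'a set) \<Rightarrow> 'a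
    \<Rightarrow> nat \<Rightarrow> nat \<Rightarrow> int \<Rightarrow> 'a \<Rightarrow> bool"
  for K and P and S and k where
  base: "x \<in> S n d \<Longrightarrow> weight_homogeneous K P S k 0 n d x"
| kappa: "weight_homogeneous K P S k 1 0 (-1) k"
| zero: "weight_homogeneous K P S k w n d \<zero>\<^bsub>Sp P n d\<^esub>"
| add: "\<lbrakk>weight_homogeneous K P S k w n d x; weight_homogeneous K P S k w n d y\<rbrakk>
    \<Longrightarrow> weight_homogeneous K P S k w n d (x \<oplus>\<^bsub>Sp P n d\<^esub> y)"
| smult: "\<lbrakk>c \<in> carrier K; weight_homogeneous K P S k w n d x\<rbrakk>
    \<Longrightarrow> weight_homogeneous K P S k w n d (c \<odot>\<^bsub>Sp P n d\<^esub> x)"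
| pcomp: "\<lbrakk>weight_homogeneous K P S k v n d x; weight_homogeneous K P S k w m e y; 1 \<le> i; i \<le> n\<rbrakk>
    \<Longrightarrow> weight_homogeneous K P S k (v + w) (n + m - 1) (d + e) (pcomp P i x y)"
| act: "\<lbrakk>weight_homogeneous K P S k w n d x; \<sigma> permutes {1..n}\<rbrakk>
    \<Longrightarrow> weight_homogeneous K P S k w n d (act P \<sigma> x)"

definition weight_space ::
  "('k, 'm) ring_scheme \<Rightarrow> ('k, 'a) operad \<Rightarrow> (nat \<Rightarrow> int \<Rightarrow> 'a set) \<Rightarrow> 'a
    \<Rightarrow> nat \<Rightarrow> nat \<Rightarrow> int \<Rightarrow> 'a set" where
  "weight_space K P S k w n d = {x. weight_homogeneous K P S k w n d x}"


section \<open>Curved operads\<close>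

record ('k, 'a) curv =
  op :: "('k, 'a) operad"
  diff :: "'a \<Rightarrow> 'a"
  curvature :: 'a
  base :: "nat \<Rightarrow> int \<Rightarrow> 'a set"

definition base_operad :: "('k, 'a) curv \<Rightarrow> ('k, 'a) operad" where
  "base_operad Q = restrict_operad (op Q) (base Q)"

text \<open>The operad \<open>Q\<^sub>0 \<or> [\<kappa>]\<close> and the natural map from it to \<open>Q\<close>.\<close>

definition base_kappa ::
  "('k, 'm) ring_scheme \<Rightarrow> ('k, 'a) curv \<Rightarrow> ('k, ('k, 'a + ('k, unit) expr set) expr set) operad" where
  "base_kappa K Q = coproduct K (base_operad Q) (kappa_operad K)"

definition natural_map :: "('k, 'a) curv \<Rightarrow> ('k, 'a + ('k, unit) expr set) expr set \<Rightarrow> 'a" where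
  "natural_map Q =
     coproduct_map (op Q) (\<lambda>x. x) (induced_map (op Q) (\<lambda>n d u. curvature Q))"

text \<open>
  The weight grading of \<open>Q\<close>, transported from the one of \<open>Q\<^sub>0 \<or> [\<kappa>]\<close> along the natural map.
\<close>

definition curv_weight ::
  "('k, 'm) ring_scheme \<Rightarrow> ('k, 'a) curv \<Rightarrow> nat \<Rightarrow> nat \<Rightarrow> int \<Rightarrow> 'a set" where
  "curv_weight K Q w n d = natural_map Q `
     weight_space K (base_kappa K Q)
       (\<lambda>m e. coproduct_inl K (base_operad Q) (kappa_operad K) m e ` base Q m e)
       (coproduct_inr K (base_operad Q) (kappa_operad K) 0 (-1) (kappa_elem K)) w n d"

definition weight_component ::
  "('k, 'm) ring_scheme \<Rightarrow> ('k, 'a) curv \<Rightarrow> nat \<Rightarrow> nat \<Rightarrow> int \<Rightarrow> 'a \<Rightarrow> 'a" where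
  "weight_component K Q w n d x =
     (THE y. \<exists>f. (\<forall>v. f v \<in> curv_weight K Q v n d) \<and>
                 finite {v. f v \<noteq> \<zero>\<^bsub>Sp (op Q) n d\<^esub>} \<and>
                 x = (\<Oplus>\<^bsub>Sp (op Q) n d\<^esub>v\<in>{v. f v \<noteq> \<zero>\<^bsub>Sp (op Q) n d\<^esub>}. f v) \<and>
                 y = f w)"

text \<open>
  The part \<open>d\<^sub>i\<close> of the differential, which raises the weight by the integer \<open>i\<close>, on elements of
  arity \<open>n\<close> and degree \<open>d\<close>.
\<close>

definition diff_part ::
  "('k, 'm) ring_scheme \<Rightarrow> ('k, 'a) curv \<Rightarrow> int \<Rightarrow> nat \<Rightarrow> int \<Rightarrow> 'a \<Rightarrow> 'a" where
  "diff_part K Q i n d x =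
     (\<Oplus>\<^bsub>Sp (op Q) n (d - 1)\<^esub>j\<in>{j. 0 \<le> int j + i \<and> weight_component K Q j n d x \<noteq> \<zero>\<^bsub>Sp (op Q) n d\<^esub>}.
        weight_component K Q (nat (int j + i)) n (d - 1) (diff Q (weight_component K Q j n d x)))"

definition curv_object :: "('k, 'm) ring_scheme \<Rightarrow> ('k, 'a) curv \<Rightarrow> bool" where
  "curv_object K Q \<longleftrightarrow>
     dg_operad K (op Q) (diff Q) \<and>
     suboperad K (op Q) (base Q) \<and>
     curvature Q \<in> carrier (Sp (op Q) 0 (-1)) - base Q 0 (-1) \<and>
     natural_map Q \<in> operad_iso K (base_kappa K Q) (op Q) \<and>
     (\<forall>i. i \<notin> {0, 1} \<longrightarrow> (\<forall>n d. \<forall>x \<in> carrier (Sp (op Q) n d).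
        diff_part K Q i n d x = \<zero>\<^bsub>Sp (op Q) n (d - 1)\<^esub>)) \<and>
     diff_part K Q 1 0 (-1) (curvature Q) = \<zero>\<^bsub>Sp (op Q) 0 (-2)\<^esub>"

text \<open>
  Morphisms are taken to be extensional functions, so that two morphisms with the same values on
  all operations are equal.
\<close>

definition curv_hom ::
  "('k, 'm) ring_scheme \<Rightarrow> ('k, 'a) curv \<Rightarrow> ('k, 'b) curv \<Rightarrow> ('a \<Rightarrow> 'b) set" where
  "curv_hom K Q Q' = {\<Phi>.
     \<Phi> \<in> extensional (\<Union>n d. carrier (Sp (op Q) n d)) \<and>
     \<Phi> \<in> operad_hom K (op Q) (op Q') \<and>
     (\<forall>n d. \<forall>x \<in> carrier (Sp (op Q) n d). \<Phi> (diff Q x) = diff Q' (\<Phi> x)) \<and>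
     \<Phi> (curvature Q) = curvature Q' \<and>
     (\<forall>n d. \<Phi> ` base Q n d \<subseteq> base Q' n d)}"


section \<open>The curved L-infinity operad\<close>

definition cL_gens :: "nat \<Rightarrow> int \<Rightarrow> unit set" where
  "cL_gens n d = (if d = -1 then {()} else {})"

definition cL_rels :: "(('k, unit) expr \<times> ('k, unit) expr) set" where
  "cL_rels = {(Act \<sigma> (Gen n (-1) ()), Gen n (-1) ()) | n \<sigma>. \<sigma> permutes {1..n}}"

definition cL_operad :: "('k, 'm) ring_scheme \<Rightarrow> ('k, ('k, unit) expr set) operad" where
  "cL_operad K = presented_operad K cL_gens cL_rels"

definition ell :: "('k, 'm) ring_scheme \<Rightarrow> nat \<Rightarrow> ('k, unit) expr set" where
  "ell K n = pres_class K cL_gens cL_rels (Gen n (-1) ())"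

text \<open>
  The slots \<open>1..q\<close> of \<open>pcomp 1 (ell (p + 1)) (ell q)\<close> are those of \<open>ell q\<close>, and the slot \<open>j\<close>
  of an operation acted upon by \<open>\<sigma>\<close> receives the input \<open>i\<close> with \<open>\<sigma> i = j\<close>; so the elements of
  \<open>unshuffles p q\<close> correspond to the subsets \<open>I = {i. \<sigma> i \<in> {1..q}}\<close> of \<open>{1..p + q}\<close>.
\<close>

definition unshuffles :: "nat \<Rightarrow> nat \<Rightarrow> (nat \<Rightarrow> nat) set" where
  "unshuffles p q = {\<sigma>. \<sigma> permutes {1..p + q} \<and>
     strict_mono_on {1..q} (inv_into UNIV \<sigma>) \<and> strict_mono_on {q + 1..q + p} (inv_into UNIV \<sigma>)}"

definition cL_diff_ell :: "('k, 'm) ring_scheme \<Rightarrow> nat \<Rightarrow> ('k, unit) expr set" where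
  "cL_diff_ell K n =
     (let M = Sp (cL_operad K) n (-2)
      in \<ominus>\<^bsub>M\<^esub> finsum M
           (\<lambda>(p, q). \<Oplus>\<^bsub>M\<^esub>\<sigma>\<in>unshuffles p q.
              act (cL_operad K) \<sigma> (pcomp (cL_operad K) 1 (ell K (p + 1)) (ell K q)))
           {(p, q). p + q = n})"

definition cL_diff :: "('k, 'm) ring_scheme \<Rightarrow> ('k, unit) expr set \<Rightarrow> ('k, unit) expr set" where
  "cL_diff K X =
     the_elem (deriv_expr K (cL_operad K) (\<lambda>n d u. ell K n) (\<lambda>n d u. cL_diff_ell K n) ` X)"

definition cL_base :: "('k, 'm) ring_scheme \<Rightarrow> nat \<Rightarrow> int \<Rightarrow> ('k, unit) expr set set" where
  "cL_base K = generated_suboperad K (cL_operad K)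
     (\<lambda>n d. if n > 0 \<and> d = -1 then {ell K n} else {})"

definition cL_infinity :: "('k, 'm) ring_scheme \<Rightarrow> ('k, ('k, unit) expr set) curv" where
  "cL_infinity K =
     \<lparr>op = cL_operad K, diff = cL_diff K, curvature = ell K 0, base = cL_base K\<rparr>"

end

theory Submission
  imports Defs
begin

text \<open>
  Let \<open>Q\<close> be an object. In weight 1, the differential of a candidate image \<open>l\<^sub>n\<close> of \<open>\<l>\<^sub>n\<close> must be
  \<open>- l\<^bsub>n+1\<^esub> \<circ>\<^sub>1 \<kappa>\<close>. As \<open>Q\<close> is freely generated by \<open>\<kappa>\<close> over \<open>Q\<^sub>0\<close>, each element of weight 1, arity \<open>n\<close>
  and degree -2 is \<open>z \<circ>\<^sub>1 \<kappa>\<close> for a unique \<open>z\<close> in \<open>Q\<^sub>0\<close>; uniqueness is seen from the derivation which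
  unplugs one \<open>\<kappa>\<close>. So \<open>l\<^sub>0 = \<kappa>\<close> determines all \<open>l\<^sub>n\<close>, which gives the uniqueness of morphisms.

  Conversely define \<open>l\<^sub>n\<close> by this recursion. Equivariance of \<open>d\<close> makes \<open>l\<^bsub>n+1\<^esub>\<close> invariant under
  permutations of the inputs other than the first one. The weight 2 part of \<open>d\<^sup>2 = 0\<close> is
  \<open>(l\<^bsub>n+2\<^esub> \<circ>\<^sub>1 \<kappa>) \<circ>\<^sub>1 \<kappa> = 0\<close>; since \<open>\<kappa>\<close> is odd, this is what invariance under the transposition of
  the first two inputs requires. The defect \<open>r\<^sub>n\<close> of the formula for \<open>d l\<^sub>n\<close> lies in \<open>Q\<^sub>0\<close>, and by
  \<open>d\<^sup>2 = 0\<close> it satisfies \<open>r\<^bsub>n+1\<^esub> \<circ>\<^sub>1 \<kappa> = 0\<close> once the formula holds for smaller \<open>n\<close>, so it vanishes.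

  That the weight spaces are independent follows from the automorphism \<open>\<kappa> \<mapsto> 2 \<kappa>\<close>, which acts on weight
  \<open>w\<close> by \<open>2\<^sup>w\<close>; this uses characteristic zero.
\<close>

text \<open>The congruence yields equalities; that classes differ, or that plugging in
  \<open>\<kappa>\<close> is injective, is seen only through maps out of the quotient. So each such
  map (evaluation, rescaling, unplugging, the differential) is defined on expressions and checked
  against the rules of the congruence. All derivations are instances of one construction, with
  values in an infinitesimal bimodule. As operads have no unit here, unplugging
  \<open>\<kappa>\<close> from itself has no operation as its value; the bimodule carries an extra
  scalar for this.

  That the differential of the source squares to zero is not obtained by cancelling sums over trees
  with three vertices. Appending one more symmetric input is a derivation that commutes with the
  differential and sends each generator to the next, so one computation in arity 0 suffices. The
  target also avoids these sums: the identity known in the source is carried over and compared term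
  by term with \<open>d (d x) = 0\<close>.\<close>

section \<open>Block permutations of the inputs of a composite\<close>

lemma finite_inj_on_permutes:
  assumes "finite S" "f ` S \<subseteq> S" "inj_on f S" "\<And>x. x \<notin> S \<Longrightarrow> f x = x"
  shows "f permutes S"
  using assms by (intro bij_imp_permutes) (auto simp: bij_betw_def endo_inj_surj)

lemma permutes_ge1:
  fixes n :: nat
  assumes "\<sigma> permutes {1..n}"
  shows "1 \<le> \<sigma> k \<longleftrightarrow> 1 \<le> k" "\<sigma> k \<le> n \<longleftrightarrow> k \<le> n" "\<sigma> 0 = 0"
  using permutes_in_image[OF assms, of k] permutes_not_in[OF assms, of k] permutes_not_in[OF assms, of 0]
  by (auto simp: not_le)

text \<open>The inverse is the block permutation formed with the inverse of \<open>\<tau>\<close>.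
  On a finite set that is mapped into itself, a left inverse is enough.\<close>

lemma block_inner_permutes:
  assumes "\<tau> permutes {1..m}" "1 \<le> i" "i \<le> n"
  shows "block_inner i m \<tau> permutes {1..n + m - 1}"
proof (rule finite_inj_on_permutes)
  note in_im = permutes_in_image[OF assms(1)]
  show "block_inner i m \<tau> ` {1..n + m - 1} \<subseteq> {1..n + m - 1}"
  proof
    fix x assume "x \<in> block_inner i m \<tau> ` {1..n + m - 1}"
    then obtain k where k: "k \<in> {1..n + m - 1}" "x = block_inner i m \<tau> k" by auto
    then show "x \<in> {1..n + m - 1}"
    proof (cases "i \<le> k \<and> k < i + m")
      case True
      define v where "v = \<tau> (k + 1 - i)"
      have "1 \<le> v" "v \<le> m" using in_im[of "k + 1 - i"] True unfolding v_def by auto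
      moreover have "x = v + i - 1" using True k by (simp add: block_inner_def v_def)
      ultimately show ?thesis using assms(2,3) by auto
    qed (use k in \<open>auto simp: block_inner_def\<close>)
  qed
  have "block_inner i m (inv_into UNIV \<tau>) (block_inner i m \<tau> k) = k" for k
  proof (cases "i \<le> k \<and> k < i + m")
    case True
    then have *: "1 \<le> \<tau> (k + 1 - i)" "\<tau> (k + 1 - i) \<le> m" using in_im[of "k + 1 - i"] by auto
    have "\<tau> (k + 1 - i) + i - 1 + 1 - i = \<tau> (k + 1 - i)" using * by linarith
    moreover have "inv_into UNIV \<tau> (\<tau> (k + 1 - i)) = k + 1 - i" using permutes_inverses(2)[OF assms(1)] .
    moreover have "block_inner i m \<tau> k = \<tau> (k + 1 - i) + i - 1" using True by (simp add: block_inner_def)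
    moreover have "i \<le> \<tau> (k + 1 - i) + i - 1" "\<tau> (k + 1 - i) + i - 1 < i + m" using * assms(2) by linarith+
    ultimately show ?thesis using True by (simp add: block_inner_def)
  qed (auto simp: block_inner_def)
  then show "inj_on (block_inner i m \<tau>) {1..n + m - 1}" by (rule inj_on_inverseI)
qed (use assms in \<open>auto simp: block_inner_def\<close>)

text \<open>An index outside the block is renumbered as an input of \<open>\<sigma>\<close>, and its
  image is renumbered again to make room for the moved block. The block and its complement have
  disjoint images. All of this includes \<open>m = 0\<close>, where the slot \<open>i\<close>
  disappears.\<close>

lemma block_outer_permutes:
  assumes "\<sigma> permutes {1..n}" "1 \<le> i" "i \<le> n"
  shows "block_outer i m \<sigma> permutes {1..n + m - 1}"
proof (rule finite_inj_on_permutes)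
  note p = permutes_ge1[OF assms(1)]
  note inj = permutes_inj[OF assms(1), THEN injD]
  have i: "1 \<le> \<sigma> i" "\<sigma> i \<le> n" using assms p by auto
  show "block_outer i m \<sigma> ` {1..n + m - 1} \<subseteq> {1..n + m - 1}"
  proof
    fix x assume "x \<in> block_outer i m \<sigma> ` {1..n + m - 1}"
    then obtain k where k: "k \<in> {1..n + m - 1}" "x = block_outer i m \<sigma> k" by auto
    let ?k' = "if k < i then k else k + 1 - m"
    show "x \<in> {1..n + m - 1}"
    proof (cases "i \<le> k \<and> k < i + m")
      case True then show ?thesis using k i by (auto simp: block_outer_def)
    next
      case False
      then have "?k' \<noteq> i" "1 \<le> ?k'" "?k' \<le> n" using k assms by auto
      then have "\<sigma> ?k' \<noteq> \<sigma> i" "1 \<le> \<sigma> ?k'" "\<sigma> ?k' \<le> n" using inj p(1,2) by blast+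
      moreover have "x = (if \<sigma> ?k' < \<sigma> i then \<sigma> ?k' else \<sigma> ?k' + m - 1)"
        using False k by (auto simp: block_outer_def Let_def)
      moreover define v where "v = \<sigma> ?k'"
      ultimately show ?thesis using i by (cases "v < \<sigma> i") auto
    qed
  qed
  show "inj_on (block_outer i m \<sigma>) {1..n + m - 1}"
  proof (rule inj_onI)
    fix x y assume *: "block_outer i m \<sigma> x = block_outer i m \<sigma> y"
      "x \<in> {1..n + m - 1}" "y \<in> {1..n + m - 1}"
    \<comment> \<open>Off the block \<open>?k\<close> never takes the value \<open>i\<close>: it
      stays below \<open>i\<close> before the block and is at least \<open>i + 1\<close> after it,
      also when \<open>m = 0\<close>.\<close>
    let ?k = "\<lambda>k. if k < i then k else k + 1 - m"
    have ne: "\<sigma> (?k k) \<noteq> \<sigma> i" if "\<not> (i \<le> k \<and> k < i + m)" for k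
      using inj[of "?k k" i] that by (auto split: if_splits)
    have e: "?k x = ?k y" if "\<sigma> (?k x) = \<sigma> (?k y)" using inj that by blast
    show "x = y"
    proof (cases "i \<le> x \<and> x < i + m"; cases "i \<le> y \<and> y < i + m")
      assume "\<not> (i \<le> x \<and> x < i + m)" "\<not> (i \<le> y \<and> y < i + m)"
      then have b: "block_outer i m \<sigma> k = (if \<sigma> (?k k) < \<sigma> i then \<sigma> (?k k) else \<sigma> (?k k) + m - 1)"
        if "k = x \<or> k = y" for k
        using that by (auto simp: block_outer_def Let_def)
      have "\<sigma> (?k x) \<noteq> \<sigma> i" "\<sigma> (?k y) \<noteq> \<sigma> i"
        using ne \<open>\<not> (i \<le> x \<and> x < i + m)\<close> \<open>\<not> (i \<le> y \<and> y < i + m)\<close> by blast+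
      moreover have "(if \<sigma> (?k x) < \<sigma> i then \<sigma> (?k x) else \<sigma> (?k x) + m - 1) =
          (if \<sigma> (?k y) < \<sigma> i then \<sigma> (?k y) else \<sigma> (?k y) + m - 1)"
        using *(1) b[of x] b[of y] by argo
      \<comment> \<open>Replacing the slot \<open>w\<close> by \<open>m\<close> slots is injective
        on the other slots; with \<open>m = 0\<close> it closes the gap at \<open>w\<close>.\<close>
      moreover have "u = v" if "u \<noteq> w" "v \<noteq> w" "1 \<le> w"
        "(if u < w then u else u + m - 1) = (if v < w then v else v + m - 1)" for u v w :: nat
        using that by (auto split: if_splits)
      ultimately have "\<sigma> (?k x) = \<sigma> (?k y)" using i(1) by metis
      then have "?k x = ?k y" by (rule e)
      then show ?thesis using \<open>\<not> (i \<le> x \<and> x < i + m)\<close> \<open>\<not> (i \<le> y \<and> y < i + m)\<close> assms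
        by (auto split: if_splits)
    next
      assume a: "(i \<le> x \<and> x < i + m)" "\<not> (i \<le> y \<and> y < i + m)"
      then have "block_outer i m \<sigma> x = \<sigma> i + (x - i)" by (auto simp: block_outer_def)
      moreover have "block_outer i m \<sigma> y = (if \<sigma> (?k y) < \<sigma> i then \<sigma> (?k y) else \<sigma> (?k y) + m - 1)"
        using a by (auto simp: block_outer_def Let_def)
      ultimately show ?thesis using ne[of y] a * by (auto split: if_splits)
    next
      assume a: "(i \<le> y \<and> y < i + m)" "\<not> (i \<le> x \<and> x < i + m)"
      then have "block_outer i m \<sigma> y = \<sigma> i + (y - i)" by (auto simp: block_outer_def)
      moreover have "block_outer i m \<sigma> x = (if \<sigma> (?k x) < \<sigma> i then \<sigma> (?k x) else \<sigma> (?k x) + m - 1)"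
        using a by (auto simp: block_outer_def Let_def)
      ultimately show ?thesis using ne[of x] a * by (auto split: if_splits)
    qed (use * in \<open>auto simp: block_outer_def\<close>)
  qed
  fix x assume x: "x \<notin> {1..n + m - 1}"
  show "block_outer i m \<sigma> x = x"
  proof (cases "x = 0")
    case False
    then have "\<not> x < i + m" "x + 1 - m > n" using x assms by auto
    then have "\<sigma> (x + 1 - m) = x + 1 - m" using permutes_not_in[OF assms(1)] by auto
    then show ?thesis using \<open>\<not> x < i + m\<close> \<open>x + 1 - m > n\<close> i by (auto simp: block_outer_def Let_def)
  next
    case True
    have "0 < \<sigma> i" "0 < i" using assms(2) i(1) by linarith+
    then show ?thesis using True p(3) by (simp add: block_outer_def)
  qed
qed simp

section \<open>Presented operads\<close>

lemma (in cring) sign_of_closed [simp, intro]: "sign_of R k \<in> carrier R"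
  by (simp add: sign_of_def)

lemma (in cring) sign_of_add: "sign_of R (a + b) = sign_of R a \<otimes> sign_of R b"
  by (auto simp: sign_of_def l_minus r_minus)

text \<open>The hypotheses of the rules are just strong enough to keep expressions well-formed with
  equal arity and degree. Only the rules for the action need an argument: block permutations and
  composites of permutations must permute the right set of inputs.\<close>

lemma pres_cong_wf:
  assumes "cring K" "(s, t) \<in> pres_cong K G R"
  shows "wf_expr K G s \<and> wf_expr K G t \<and> arity s = arity t \<and> degree s = degree t"
  using assms(2)
proof (induction rule: pres_cong.induct)
  case (Comp_Act_right i s \<tau> t)
  then show ?case using block_inner_permutes[of \<tau> "arity t" i "arity s"] by auto
next
  case (Comp_Act_left i \<sigma> s t)
  then show ?case using block_outer_permutes[of \<sigma> "arity s" i "arity t"] permutes_ge1(1,2)[of \<sigma> "arity s" i] by auto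
next
  case (Act_Act \<tau> \<sigma> t)
  then show ?case by (auto intro: permutes_compose)
qed (use assms(1) in \<open>auto simp: cring.sign_of_closed permutes_id cring.cring_simprules\<close>)

locale presentation = field K for K :: "('k, 'm) ring_scheme" (structure) +
  fixes G :: "nat \<Rightarrow> int \<Rightarrow> 'g set" and R :: "(('k, 'g) expr \<times> ('k, 'g) expr) set"
begin

abbreviation "cls \<equiv> pres_class K G R"
abbreviation "wfe \<equiv> wf_expr K G"
abbreviation "PP \<equiv> presented_operad K G R"

lemma cong_wf: "(s, t) \<in> pres_cong K G R \<Longrightarrow> wfe s \<and> wfe t \<and> arity s = arity t \<and> degree s = degree t"
  using pres_cong_wf is_cring by blast

lemma mem_cls: "t \<in> cls s \<longleftrightarrow> (s, t) \<in> pres_cong K G R"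
  by (simp add: pres_class_def)

lemma cls_eq: "(s, t) \<in> pres_cong K G R \<Longrightarrow> cls s = cls t"
  unfolding pres_class_def by (blast intro: pres_cong.sym pres_cong.trans)

lemma cls_eq_iff: "wfe s \<Longrightarrow> cls s = cls t \<longleftrightarrow> (s, t) \<in> pres_cong K G R"
  by (metis cls_eq mem_cls pres_cong.refl pres_cong.sym)

lemma carrier_presented:
  "carrier (Sp PP n d) = cls ` {t. wfe t \<and> arity t = n \<and> degree t = d}"
proof -
  have "pres_cong K G R `` {t} = cls t" for t by (simp add: pres_class_def)
  then show ?thesis by (auto simp: presented_operad_def quotient_def)
qed

lemma carrier_presentedE:
  assumes "X \<in> carrier (Sp PP n d)"
  obtains t where "X = cls t" "wfe t" "arity t = n" "degree t = d"
  using assms by (auto simp: carrier_presented)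

lemma cls_closed: "wfe t \<Longrightarrow> arity t = n \<Longrightarrow> degree t = d \<Longrightarrow> cls t \<in> carrier (Sp PP n d)"
  by (auto simp: carrier_presented)

text \<open>The operations on classes are unions over representatives; an operation that respects
  the congruence may be computed on any one of them.\<close>

lemma UN_cls:
  assumes "wfe s" "\<And>t. (s, t) \<in> pres_cong K G R \<Longrightarrow> F t = F s"
  shows "(\<Union>t \<in> cls s. F t) = F s"
proof -
  have "s \<in> cls s" using assms(1) by (simp add: pres_cong.refl mem_cls)
  moreover have "F t = F s" if "t \<in> cls s" for t using that assms(2) by (simp add: mem_cls)
  ultimately show ?thesis by blast
qed

lemma zero_presented: "\<zero>\<^bsub>Sp PP n d\<^esub> = cls (Zero n d)"
  by (simp add: presented_operad_def)

lemma add_presented: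
  assumes "wfe (Add s t)" shows "cls s \<oplus>\<^bsub>Sp PP n d\<^esub> cls t = cls (Add s t)"
proof -
  have "(\<Union>a\<in>cls s. \<Union>b\<in>cls t. cls (Add a b)) = (\<Union>b\<in>cls t. cls (Add s b))"
    by (rule UN_cls) (use assms cong_wf in \<open>auto simp: mem_cls intro!: SUP_cong cls_eq pres_cong.cong_Add intro: pres_cong.sym pres_cong.refl\<close>)
  also have "\<dots> = cls (Add s t)"
    by (rule UN_cls) (use assms cong_wf in \<open>auto simp: mem_cls intro!: cls_eq pres_cong.cong_Add intro: pres_cong.sym pres_cong.refl\<close>)
  finally show ?thesis by (simp add: presented_operad_def)
qed

lemma smult_presented:
  assumes "wfe (Smult c t)" shows "c \<odot>\<^bsub>Sp PP n d\<^esub> cls t = cls (Smult c t)"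
proof -
  have "(\<Union>b\<in>cls t. cls (Smult c b)) = cls (Smult c t)"
    by (rule UN_cls) (use assms cong_wf in \<open>auto simp: mem_cls intro!: cls_eq pres_cong.cong_Smult intro: pres_cong.sym pres_cong.refl\<close>)
  then show ?thesis by (simp add: presented_operad_def)
qed

lemma pcomp_presented:
  assumes "wfe (Comp i s t)" shows "pcomp PP i (cls s) (cls t) = cls (Comp i s t)"
proof -
  have "(\<Union>a\<in>cls s. \<Union>b\<in>cls t. cls (Comp i a b)) = (\<Union>b\<in>cls t. cls (Comp i s b))"
    by (rule UN_cls) (use assms cong_wf in \<open>auto simp: mem_cls intro!: SUP_cong cls_eq pres_cong.cong_Comp intro: pres_cong.sym pres_cong.refl\<close>)
  also have "\<dots> = cls (Comp i s t)"
    by (rule UN_cls) (use assms cong_wf in \<open>auto simp: mem_cls intro!: cls_eq pres_cong.cong_Comp intro: pres_cong.sym pres_cong.refl\<close>)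
  finally show ?thesis by (simp add: presented_operad_def)
qed

lemma act_presented:
  assumes "wfe (Act \<sigma> t)" shows "act PP \<sigma> (cls t) = cls (Act \<sigma> t)"
proof -
  have "(\<Union>b\<in>cls t. cls (Act \<sigma> b)) = cls (Act \<sigma> t)"
    by (rule UN_cls) (use assms cong_wf in \<open>auto simp: mem_cls intro!: cls_eq pres_cong.cong_Act intro: pres_cong.sym pres_cong.refl\<close>)
  then show ?thesis by (simp add: presented_operad_def)
qed

lemmas presented_simps = zero_presented add_presented smult_presented pcomp_presented act_presented

lemma module_presented: "module K (Sp PP n d)"
proof (rule module.intro)
  have minus: "\<ominus> \<one> \<in> carrier K" by simp
  show "abelian_group (Sp PP n d)"
  proof (rule abelian_groupI)
    fix X Y assume "X \<in> carrier (Sp PP n d)" "Y \<in> carrier (Sp PP n d)"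
    then show "X \<oplus>\<^bsub>Sp PP n d\<^esub> Y \<in> carrier (Sp PP n d)" "X \<oplus>\<^bsub>Sp PP n d\<^esub> Y = Y \<oplus>\<^bsub>Sp PP n d\<^esub> X"
      by (auto elim!: carrier_presentedE simp: add_presented intro!: cls_closed cls_eq pres_cong.Add_comm del: equalityI)
  next
    fix X Y Z assume "X \<in> carrier (Sp PP n d)" "Y \<in> carrier (Sp PP n d)" "Z \<in> carrier (Sp PP n d)"
    then show "X \<oplus>\<^bsub>Sp PP n d\<^esub> Y \<oplus>\<^bsub>Sp PP n d\<^esub> Z = X \<oplus>\<^bsub>Sp PP n d\<^esub> (Y \<oplus>\<^bsub>Sp PP n d\<^esub> Z)"
      by (auto elim!: carrier_presentedE simp: add_presented intro!: cls_closed cls_eq pres_cong.Add_assoc del: equalityI)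
  next
    fix X assume X: "X \<in> carrier (Sp PP n d)"
    then obtain t where t: "X = cls t" "wfe t" "arity t = n" "degree t = d" by (rule carrier_presentedE)
    show "\<zero>\<^bsub>Sp PP n d\<^esub> \<oplus>\<^bsub>Sp PP n d\<^esub> X = X"
      using t pres_cong.Add_Zero[of K G t R] by (auto simp: presented_simps intro: cls_eq del: equalityI)
    show "\<exists>Y\<in>carrier (Sp PP n d). Y \<oplus>\<^bsub>Sp PP n d\<^esub> X = \<zero>\<^bsub>Sp PP n d\<^esub>"
      using t pres_cong.Add_inverse[of K G t R] minus
      by (intro bexI[of _ "cls (Smult (\<ominus> \<one>) t)"] cls_closed) (auto simp: presented_simps intro: cls_eq del: equalityI)
  qed (auto simp: zero_presented intro!: cls_closed)
  show "module_axioms K (Sp PP n d)"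
    by unfold_locales
      (auto elim!: carrier_presentedE simp: presented_simps
        intro!: cls_closed cls_eq pres_cong.Smult_add_scalar pres_cong.Smult_Add pres_cong.Smult_Smult pres_cong.Smult_one del: equalityI)
qed (rule is_cring)

text \<open>Each axiom is a rule of the congruence, read off on representatives. For the
  equivariance axioms, the block permutations also have to be known to be admissible, so that the
  right-hand side is a well-formed expression.\<close>

lemma presented_graded_operad: "graded_operad K PP"
proof (intro graded_operad.intro graded_operad_axioms.intro)
  show "field K" by (rule field_axioms)
  show "module K (Sp PP n d)" for n d by (rule module_presented)
next
  fix x y z n d m e l f i j
  assume a: "x \<in> carrier (Sp PP n d)" "y \<in> carrier (Sp PP m e)" "z \<in> carrier (Sp PP l f)"
    "1 \<le> i" "i \<le> n" "1 \<le> j" "j \<le> m"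
  obtain r s t where e: "x = cls r" "y = cls s" "z = cls t" "wfe r" "wfe s" "wfe t"
    "arity r = n" "arity s = m" using a(1-3) by (metis carrier_presentedE)
  have wf: "wfe (Comp i r s)" "wfe (Comp j s t)" "wfe (Comp (i + j - 1) (Comp i r s) t)" "wfe (Comp i r (Comp j s t))"
    using e a(4-7) by auto
  show "pcomp PP (i + j - 1) (pcomp PP i x y) z = pcomp PP i x (pcomp PP j y z)"
    unfolding e(1-3) pcomp_presented[OF wf(1)] pcomp_presented[OF wf(2)] pcomp_presented[OF wf(3)]
      pcomp_presented[OF wf(4)]
    by (intro cls_eq pres_cong.Comp_sequential wf)
next
  fix x y z n d m e l f i k
  assume a: "x \<in> carrier (Sp PP n d)" "y \<in> carrier (Sp PP m e)" "z \<in> carrier (Sp PP l f)"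
    "1 \<le> i" "i < k" "k \<le> n"
  obtain r s t where e: "x = cls r" "y = cls s" "z = cls t" "wfe r" "wfe s" "wfe t"
    "arity r = n" "arity s = m" "degree s = e" "degree t = f" using a(1-3) by (metis carrier_presentedE)
  have wf: "wfe (Comp i r s)" "wfe (Comp k r t)" "wfe (Comp (k + m - 1) (Comp i r s) t)"
    "wfe (Comp i (Comp k r t) s)" "wfe (Smult (sign_of K (e * f)) (Comp i (Comp k r t) s))"
    using e a(4-6) by auto
  show "pcomp PP (k + m - 1) (pcomp PP i x y) z =
      sign_of K (e * f) \<odot>\<^bsub>Sp PP (n + m + l - 2) (d + e + f)\<^esub> pcomp PP i (pcomp PP k x z) y"
    using pres_cong.Comp_parallel[of K G i r s k t R, OF wf(1,2) a(5)]
    unfolding e(1-3) pcomp_presented[OF wf(1)] pcomp_presented[OF wf(2)] pcomp_presented[OF wf(3)]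
      pcomp_presented[OF wf(4)] smult_presented[OF wf(5)] e(8-10)
    by (rule cls_eq)
next
  fix x y n d m e i \<tau>
  assume a: "x \<in> carrier (Sp PP n d)" "y \<in> carrier (Sp PP m e)" "1 \<le> i" "i \<le> n" "\<tau> permutes {1..m}"
  then show "pcomp PP i x (act PP \<tau> y) = act PP (block_inner i m \<tau>) (pcomp PP i x y)"
    using block_inner_permutes[OF a(5,3,4)] pres_cong.Comp_Act_right[of K G i _ \<tau>]
    by (auto elim!: carrier_presentedE simp: presented_simps intro!: cls_eq del: equalityI)
next
  fix x y n d m e i \<sigma>
  assume a: "x \<in> carrier (Sp PP n d)" "y \<in> carrier (Sp PP m e)" "1 \<le> i" "i \<le> n" "\<sigma> permutes {1..n}"
  then show "pcomp PP i (act PP \<sigma> x) y = act PP (block_outer i m \<sigma>) (pcomp PP (\<sigma> i) x y)"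
    using block_outer_permutes[OF a(5,3,4), of m] pres_cong.Comp_Act_left[of K G i \<sigma>] permutes_ge1(1,2)[OF a(5), of i]
    by (auto elim!: carrier_presentedE simp: presented_simps intro!: cls_eq del: equalityI)
qed (auto elim!: carrier_presentedE simp: presented_simps permutes_id permutes_compose
    intro!: cls_closed cls_eq pres_cong.Comp_Add_left pres_cong.Comp_Add_right
      pres_cong.Comp_Smult_left pres_cong.Comp_Smult_right pres_cong.Act_Add pres_cong.Act_Smult
      pres_cong.Act_id pres_cong.Act_Act del: equalityI)

end

declare One_nat_def [simp del]

section \<open>Additive maps and computation in a graded operad\<close>

text \<open>Composition in either argument, the action, homomorphisms and derivations are all
  additive maps between spaces of fixed arity and degree, so zero, negatives and finite sums are
  treated once for all of them.\<close>

lemma additive_map: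
  assumes "abelian_group A" "abelian_group B"
    and closed: "\<And>x. x \<in> carrier A \<Longrightarrow> f x \<in> carrier B"
    and add: "\<And>x y. x \<in> carrier A \<Longrightarrow> y \<in> carrier A \<Longrightarrow> f (x \<oplus>\<^bsub>A\<^esub> y) = f x \<oplus>\<^bsub>B\<^esub> f y"
  shows additive_zero: "f \<zero>\<^bsub>A\<^esub> = \<zero>\<^bsub>B\<^esub>"
    and additive_minus: "x \<in> carrier A \<Longrightarrow> f (\<ominus>\<^bsub>A\<^esub> x) = \<ominus>\<^bsub>B\<^esub> f x"
    and additive_finsum: "g \<in> S \<rightarrow> carrier A \<Longrightarrow> f (finsum A g S) = finsum B (\<lambda>s. f (g s)) S"
proof -
  interpret A: abelian_group A by fact
  interpret B: abelian_group B by fact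
  have "f \<zero>\<^bsub>A\<^esub> \<oplus>\<^bsub>B\<^esub> f \<zero>\<^bsub>A\<^esub> = f \<zero>\<^bsub>A\<^esub> \<oplus>\<^bsub>B\<^esub> \<zero>\<^bsub>B\<^esub>"
    using add[of "\<zero>\<^bsub>A\<^esub>" "\<zero>\<^bsub>A\<^esub>"] closed by simp
  then show zero: "f \<zero>\<^bsub>A\<^esub> = \<zero>\<^bsub>B\<^esub>"
    using closed[of "\<zero>\<^bsub>A\<^esub>"] B.r_neg1[of "f \<zero>\<^bsub>A\<^esub>" "f \<zero>\<^bsub>A\<^esub>"] B.l_neg by simp
  show "f (\<ominus>\<^bsub>A\<^esub> x) = \<ominus>\<^bsub>B\<^esub> f x" if x: "x \<in> carrier A"
  proof -
    have "f (\<ominus>\<^bsub>A\<^esub> x) \<oplus>\<^bsub>B\<^esub> f x = \<zero>\<^bsub>B\<^esub>" using add[of "\<ominus>\<^bsub>A\<^esub> x" x] x zero by (simp add: A.l_neg)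
    then show ?thesis using x closed B.minus_equality by simp
  qed
  show "f (finsum A g S) = finsum B (\<lambda>s. f (g s)) S" if "g \<in> S \<rightarrow> carrier A"
  proof (cases "finite S")
    case True
    then show ?thesis using that
      by (induction S rule: finite_induct) (auto simp: zero add closed A.finsum_closed Pi_iff)
  \<comment> \<open>Over an infinite index set both sums are zero by convention.\<close>
  qed (simp add: A.finsum_infinite B.finsum_infinite zero)
qed

context graded_operad
begin

lemmas Sp_abelian_group = module.axioms(2)[OF module_Sp]

lemma Sp_abelian_monoid: "abelian_monoid (Sp P n d)"
  by (rule abelian_group.axioms(1)[OF Sp_abelian_group])

lemmas Sp_closed [simp, intro] =
  abelian_monoid.zero_closed[OF Sp_abelian_monoid]
  abelian_monoid.a_closed[OF Sp_abelian_monoid]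
  abelian_group.a_inv_closed[OF Sp_abelian_group]
  module.smult_closed[OF module_Sp]

lemmas Sp_zero [simp] =
  abelian_monoid.l_zero[OF Sp_abelian_monoid]
  abelian_monoid.r_zero[OF Sp_abelian_monoid]
  module.smult_r_null[OF module_Sp]
  module.smult_l_null[OF module_Sp]
  module.smult_one[OF module_Sp]
  abelian_group.minus_minus[OF Sp_abelian_group]

lemmas Sp_a_ac =
  abelian_monoid.a_assoc[OF Sp_abelian_monoid]
  abelian_monoid.a_comm[OF Sp_abelian_monoid]
  abelian_monoid.a_lcomm[OF Sp_abelian_monoid]

lemmas Sp_r_distr = module.smult_r_distr[OF module_Sp]
lemmas Sp_l_distr = module.smult_l_distr[OF module_Sp]
lemmas Sp_smult_smult = module.smult_assoc1[OF module_Sp]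

lemma pcomp_in:
  assumes "x \<in> carrier (Sp P n d)" "y \<in> carrier (Sp P m e)" "1 \<le> i" "i \<le> n" "N = n + m - 1" "D = d + e"
  shows "pcomp P i x y \<in> carrier (Sp P N D)"
  using pcomp_closed assms by blast

lemma pcomp_linear_left:
  assumes "y \<in> carrier (Sp P m e)" "1 \<le> i" "i \<le> n" "N = n + m - 1" "D = d + e" "x \<in> carrier (Sp P n d)"
  shows "x' \<in> carrier (Sp P n d) \<Longrightarrow> pcomp P i (x \<oplus>\<^bsub>Sp P n d\<^esub> x') y = pcomp P i x y \<oplus>\<^bsub>Sp P N D\<^esub> pcomp P i x' y"
    "c \<in> carrier K \<Longrightarrow> pcomp P i (c \<odot>\<^bsub>Sp P n d\<^esub> x) y = c \<odot>\<^bsub>Sp P N D\<^esub> pcomp P i x y"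
    "pcomp P i (\<ominus>\<^bsub>Sp P n d\<^esub> x) y = \<ominus>\<^bsub>Sp P N D\<^esub> pcomp P i x y"
  using pcomp_add_left pcomp_smult_left assms
    additive_minus[OF Sp_abelian_group[of n d] Sp_abelian_group[of N D], of "\<lambda>x. pcomp P i x y"] pcomp_closed
  by auto

lemma pcomp_zero_left:
  assumes "y \<in> carrier (Sp P m e)" "1 \<le> i" "i \<le> n" "N = n + m - 1" "D = d + e"
  shows "pcomp P i \<zero>\<^bsub>Sp P n d\<^esub> y = \<zero>\<^bsub>Sp P N D\<^esub>"
  using additive_zero[OF Sp_abelian_group[of n d] Sp_abelian_group[of N D], of "\<lambda>x. pcomp P i x y"]
    pcomp_closed pcomp_add_left assms by auto

lemma pcomp_linear_right:
  assumes "x \<in> carrier (Sp P n d)" "1 \<le> i" "i \<le> n" "N = n + m - 1" "D = d + e" "y \<in> carrier (Sp P m e)"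
  shows "y' \<in> carrier (Sp P m e) \<Longrightarrow> pcomp P i x (y \<oplus>\<^bsub>Sp P m e\<^esub> y') = pcomp P i x y \<oplus>\<^bsub>Sp P N D\<^esub> pcomp P i x y'"
    "c \<in> carrier K \<Longrightarrow> pcomp P i x (c \<odot>\<^bsub>Sp P m e\<^esub> y) = c \<odot>\<^bsub>Sp P N D\<^esub> pcomp P i x y"
    "pcomp P i x (\<ominus>\<^bsub>Sp P m e\<^esub> y) = \<ominus>\<^bsub>Sp P N D\<^esub> pcomp P i x y"
  using pcomp_add_right pcomp_smult_right assms
    additive_minus[OF Sp_abelian_group[of m e] Sp_abelian_group[of N D], of "\<lambda>y. pcomp P i x y"] pcomp_closed
  by auto

lemma pcomp_zero_right:
  assumes "x \<in> carrier (Sp P n d)" "1 \<le> i" "i \<le> n" "N = n + m - 1" "D = d + e"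
  shows "pcomp P i x \<zero>\<^bsub>Sp P m e\<^esub> = \<zero>\<^bsub>Sp P N D\<^esub>"
  using additive_zero[OF Sp_abelian_group[of m e] Sp_abelian_group[of N D], of "\<lambda>y. pcomp P i x y"]
    pcomp_closed pcomp_add_right assms by auto

lemma act_zero: "\<sigma> permutes {1..n} \<Longrightarrow> act P \<sigma> \<zero>\<^bsub>Sp P n d\<^esub> = \<zero>\<^bsub>Sp P n d\<^esub>"
  using additive_zero[OF Sp_abelian_group[of n d] Sp_abelian_group[of n d], of "act P \<sigma>"]
    act_closed act_add by auto

lemma act_minus:
  assumes "\<sigma> permutes {1..n}" "x \<in> carrier (Sp P n d)"
  shows "act P \<sigma> (\<ominus>\<^bsub>Sp P n d\<^esub> x) = \<ominus>\<^bsub>Sp P n d\<^esub> act P \<sigma> x"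
  by (rule additive_minus[OF Sp_abelian_group Sp_abelian_group])
    (use assms act_closed act_add in auto)

lemma act_finsum:
  assumes "\<sigma> permutes {1..n}" "g \<in> S \<rightarrow> carrier (Sp P n d)"
  shows "act P \<sigma> (finsum (Sp P n d) g S) = finsum (Sp P n d) (\<lambda>s. act P \<sigma> (g s)) S"
  by (rule additive_finsum[OF Sp_abelian_group Sp_abelian_group])
    (use assms act_closed act_add in auto)

lemma pcomp_parallel':
  assumes "x \<in> carrier (Sp P n d)" "y \<in> carrier (Sp P m e)" "z \<in> carrier (Sp P l f)"
    "1 \<le> i" "i < k" "k \<le> n" "N = n + m + l - 2" "D = d + e + f" "k' = k + m - 1"
  shows "pcomp P k' (pcomp P i x y) z = sign_of K (e * f) \<odot>\<^bsub>Sp P N D\<^esub> pcomp P i (pcomp P k x z) y"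
  using assms pcomp_parallel by blast

lemma pcomp_sequential':
  assumes "x \<in> carrier (Sp P n d)" "y \<in> carrier (Sp P m e)" "z \<in> carrier (Sp P l f)"
    "1 \<le> i" "i \<le> n" "1 \<le> j" "j \<le> m" "k = i + j - 1"
  shows "pcomp P k (pcomp P i x y) z = pcomp P i x (pcomp P j y z)"
  using assms pcomp_sequential by blast

end

section \<open>Homomorphisms and suboperads\<close>

text \<open>Spaces of different arity or degree may share values of the type \<open>'a\<close>,
  whereas the inclusions into a coproduct label an element with its arity and degree. They are
  therefore families of maps and not a single function as in \<open>operad_hom\<close>.\<close>

definition graded_hom ::
  "('k, 'm) ring_scheme \<Rightarrow> ('k, 'a) operad \<Rightarrow> ('k, 'b) operad \<Rightarrow> (nat \<Rightarrow> int \<Rightarrow> 'a \<Rightarrow> 'b) \<Rightarrow> bool" where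
  "graded_hom K P Q f \<longleftrightarrow>
     (\<forall>n d. \<forall>x \<in> carrier (Sp P n d). f n d x \<in> carrier (Sp Q n d)) \<and>
     (\<forall>n d. \<forall>x \<in> carrier (Sp P n d). \<forall>y \<in> carrier (Sp P n d).
        f n d (x \<oplus>\<^bsub>Sp P n d\<^esub> y) = f n d x \<oplus>\<^bsub>Sp Q n d\<^esub> f n d y) \<and>
     (\<forall>n d. \<forall>c \<in> carrier K. \<forall>x \<in> carrier (Sp P n d).
        f n d (c \<odot>\<^bsub>Sp P n d\<^esub> x) = c \<odot>\<^bsub>Sp Q n d\<^esub> f n d x) \<and>
     (\<forall>n d m e. \<forall>x \<in> carrier (Sp P n d). \<forall>y \<in> carrier (Sp P m e). \<forall>i \<in> {1..n}.
        f (n + m - 1) (d + e) (pcomp P i x y) = pcomp Q i (f n d x) (f m e y)) \<and>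
     (\<forall>n d \<sigma>. \<forall>x \<in> carrier (Sp P n d). \<sigma> permutes {1..n} \<longrightarrow> f n d (act P \<sigma> x) = act Q \<sigma> (f n d x))"

lemma operad_hom_iff: "f \<in> operad_hom K P Q \<longleftrightarrow> graded_hom K P Q (\<lambda>n d. f)"
  by (simp add: operad_hom_def graded_hom_def)

lemma graded_homD:
  assumes "graded_hom K P Q f"
  shows "x \<in> carrier (Sp P n d) \<Longrightarrow> f n d x \<in> carrier (Sp Q n d)"
    and "x \<in> carrier (Sp P n d) \<Longrightarrow> y \<in> carrier (Sp P n d) \<Longrightarrow> f n d (x \<oplus>\<^bsub>Sp P n d\<^esub> y) = f n d x \<oplus>\<^bsub>Sp Q n d\<^esub> f n d y"
    and "c \<in> carrier K \<Longrightarrow> x \<in> carrier (Sp P n d) \<Longrightarrow> f n d (c \<odot>\<^bsub>Sp P n d\<^esub> x) = c \<odot>\<^bsub>Sp Q n d\<^esub> f n d x"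
    and "x \<in> carrier (Sp P n d) \<Longrightarrow> y \<in> carrier (Sp P m e) \<Longrightarrow> 1 \<le> i \<Longrightarrow> i \<le> n \<Longrightarrow>
        f (n + m - 1) (d + e) (pcomp P i x y) = pcomp Q i (f n d x) (f m e y)"
    and "x \<in> carrier (Sp P n d) \<Longrightarrow> \<sigma> permutes {1..n} \<Longrightarrow> f n d (act P \<sigma> x) = act Q \<sigma> (f n d x)"
  using assms unfolding graded_hom_def by auto

lemma operad_homD:
  assumes "f \<in> operad_hom K P Q"
  shows "x \<in> carrier (Sp P n d) \<Longrightarrow> f x \<in> carrier (Sp Q n d)"
    and "x \<in> carrier (Sp P n d) \<Longrightarrow> y \<in> carrier (Sp P n d) \<Longrightarrow> f (x \<oplus>\<^bsub>Sp P n d\<^esub> y) = f x \<oplus>\<^bsub>Sp Q n d\<^esub> f y"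
    and "c \<in> carrier K \<Longrightarrow> x \<in> carrier (Sp P n d) \<Longrightarrow> f (c \<odot>\<^bsub>Sp P n d\<^esub> x) = c \<odot>\<^bsub>Sp Q n d\<^esub> f x"
    and "x \<in> carrier (Sp P n d) \<Longrightarrow> y \<in> carrier (Sp P m e) \<Longrightarrow> 1 \<le> i \<Longrightarrow> i \<le> n \<Longrightarrow>
        f (pcomp P i x y) = pcomp Q i (f x) (f y)"
    and "x \<in> carrier (Sp P n d) \<Longrightarrow> \<sigma> permutes {1..n} \<Longrightarrow> f (act P \<sigma> x) = act Q \<sigma> (f x)"
  using assms unfolding operad_hom_def by auto

lemma graded_hom_zero:
  assumes "graded_operad K P" "graded_operad K Q" "graded_hom K P Q f"
  shows "f n d \<zero>\<^bsub>Sp P n d\<^esub> = \<zero>\<^bsub>Sp Q n d\<^esub>"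
  by (rule additive_zero[OF graded_operad.Sp_abelian_group[OF assms(1)] graded_operad.Sp_abelian_group[OF assms(2)]])
    (auto intro: graded_homD[OF assms(3)])

lemma graded_hom_minus:
  assumes "graded_operad K P" "graded_operad K Q" "graded_hom K P Q f" "x \<in> carrier (Sp P n d)"
  shows "f n d (\<ominus>\<^bsub>Sp P n d\<^esub> x) = \<ominus>\<^bsub>Sp Q n d\<^esub> f n d x"
  by (rule additive_minus[OF graded_operad.Sp_abelian_group[OF assms(1)] graded_operad.Sp_abelian_group[OF assms(2)]])
    (auto intro: graded_homD[OF assms(3)] assms(4))

lemma graded_hom_finsum:
  assumes "graded_operad K P" "graded_operad K Q" "graded_hom K P Q f" "g \<in> S \<rightarrow> carrier (Sp P n d)"
  shows "f n d (finsum (Sp P n d) g S) = finsum (Sp Q n d) (\<lambda>s. f n d (g s)) S"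
  by (rule additive_finsum[OF graded_operad.Sp_abelian_group[OF assms(1)] graded_operad.Sp_abelian_group[OF assms(2)]])
    (auto intro: graded_homD[OF assms(3)] simp: assms(4))

lemma graded_hom_comp:
  assumes "graded_hom K P Q f" "graded_hom K Q R g"
  shows "graded_hom K P R (\<lambda>n d x. g n d (f n d x))"
  unfolding graded_hom_def using graded_homD[OF assms(1)] graded_homD[OF assms(2)] by simp

lemma (in graded_operad) suboperadD:
  assumes "suboperad K P H"
  shows "H n d \<subseteq> carrier (Sp P n d)"
    and "\<zero>\<^bsub>Sp P n d\<^esub> \<in> H n d"
    and "x \<in> H n d \<Longrightarrow> y \<in> H n d \<Longrightarrow> x \<oplus>\<^bsub>Sp P n d\<^esub> y \<in> H n d"
    and "c \<in> carrier K \<Longrightarrow> x \<in> H n d \<Longrightarrow> c \<odot>\<^bsub>Sp P n d\<^esub> x \<in> H n d"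
    and "x \<in> H n d \<Longrightarrow> \<ominus>\<^bsub>Sp P n d\<^esub> x \<in> H n d"
    and "\<lbrakk>x \<in> H n d; y \<in> H m e; 1 \<le> i; i \<le> n; N = n + m - 1; D = d + e\<rbrakk> \<Longrightarrow> pcomp P i x y \<in> H N D"
    and "x \<in> H n d \<Longrightarrow> \<sigma> permutes {1..n} \<Longrightarrow> act P \<sigma> x \<in> H n d"
proof -
  have H: "submodule (H n d) K (Sp P n d)" using assms by (simp add: suboperad_def)
  interpret M: module K "Sp P n d" by (rule module_Sp)
  interpret S: subgroup "H n d" "add_monoid (Sp P n d)" by (rule submodule.axioms(1)[OF H])
  show "\<zero>\<^bsub>Sp P n d\<^esub> \<in> H n d" using S.one_closed by simp
  note E = M.submoduleE[OF H]
  show "H n d \<subseteq> carrier (Sp P n d)" by (rule E)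
  show "x \<in> H n d \<Longrightarrow> y \<in> H n d \<Longrightarrow> x \<oplus>\<^bsub>Sp P n d\<^esub> y \<in> H n d" by (rule E)
  show "c \<in> carrier K \<Longrightarrow> x \<in> H n d \<Longrightarrow> c \<odot>\<^bsub>Sp P n d\<^esub> x \<in> H n d" by (rule E)
  show "x \<in> H n d \<Longrightarrow> \<ominus>\<^bsub>Sp P n d\<^esub> x \<in> H n d" by (rule E)
qed (use assms in \<open>auto simp: suboperad_def\<close>)

lemma (in graded_operad) suboperadI:
  assumes sub: "\<And>n d. H n d \<subseteq> carrier (Sp P n d)"
    and zero: "\<And>n d. \<zero>\<^bsub>Sp P n d\<^esub> \<in> H n d"
    and add: "\<And>n d x y. x \<in> H n d \<Longrightarrow> y \<in> H n d \<Longrightarrow> x \<oplus>\<^bsub>Sp P n d\<^esub> y \<in> H n d"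
    and smult: "\<And>n d c x. c \<in> carrier K \<Longrightarrow> x \<in> H n d \<Longrightarrow> c \<odot>\<^bsub>Sp P n d\<^esub> x \<in> H n d"
    and "\<And>n d m e i x y. \<lbrakk>x \<in> H n d; y \<in> H m e; 1 \<le> i; i \<le> n\<rbrakk> \<Longrightarrow> pcomp P i x y \<in> H (n + m - 1) (d + e)"
    and "\<And>n d \<sigma> x. x \<in> H n d \<Longrightarrow> \<sigma> permutes {1..n} \<Longrightarrow> act P \<sigma> x \<in> H n d"
  shows "suboperad K P H"
  unfolding suboperad_def
proof (intro conjI allI)
  fix n d
  interpret M: module K "Sp P n d" by (rule module_Sp)
  show "submodule (H n d) K (Sp P n d)"
  proof (rule M.submoduleI)
    fix a assume a: "a \<in> H n d"
    then have "\<ominus>\<^bsub>Sp P n d\<^esub> a = (\<ominus> \<one>) \<odot>\<^bsub>Sp P n d\<^esub> a"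
      using M.smult_l_minus[of \<one> a] sub by (auto simp: subset_iff)
    then show "\<ominus>\<^bsub>Sp P n d\<^esub> a \<in> H n d" using smult[of "\<ominus> \<one>"] a by simp
  qed (use sub zero add smult in auto)
qed (use assms(5,6) in auto)

text \<open>This is the induction principle behind most later proofs: a property that is stable
  under all operations cuts out a suboperad, and it holds everywhere once it holds on
  generators.\<close>

lemma (in graded_operad) eval_in_suboperad:
  assumes H: "suboperad K P H" and \<rho>: "\<And>n d g. g \<in> G n d \<Longrightarrow> \<rho> n d g \<in> H n d" and "wf_expr K G t"
  shows "eval_expr P \<rho> t \<in> H (arity t) (degree t)"
  using assms(3) by (induction t) (auto simp: \<rho> intro: suboperadD(2-7)[OF H])

lemma (in graded_operad) suboperad_carrier: "suboperad K P (\<lambda>n d. carrier (Sp P n d))"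
  by (rule suboperadI) (auto simp: pcomp_closed act_closed)

section \<open>The universal property of a presented operad\<close>

locale presentation_eval = presentation K G R + T: graded_operad K T
  for K :: "('k, 'm) ring_scheme" (structure) and G :: "nat \<Rightarrow> int \<Rightarrow> 'g set"
    and R :: "(('k, 'g) expr \<times> ('k, 'g) expr) set" and T :: "('k, 'a) operad" +
  fixes \<rho> :: "nat \<Rightarrow> int \<Rightarrow> 'g \<Rightarrow> 'a"
  assumes \<rho>_closed: "g \<in> G n d \<Longrightarrow> \<rho> n d g \<in> carrier (Sp T n d)"
    and \<rho>_rel: "\<lbrakk>(s, t) \<in> R; wfe s; wfe t; arity s = arity t; degree s = degree t\<rbrakk>
      \<Longrightarrow> eval_expr T \<rho> s = eval_expr T \<rho> t"
begin

abbreviation "ev \<equiv> eval_expr T \<rho>"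

lemma ev_closed: "wfe t \<Longrightarrow> ev t \<in> carrier (Sp T (arity t) (degree t))"
  using T.eval_in_suboperad[OF T.suboperad_carrier, of G \<rho>] \<rho>_closed by blast

lemma ev_in: "wfe t \<Longrightarrow> arity t = n \<Longrightarrow> degree t = d \<Longrightarrow> ev t \<in> carrier (Sp T n d)"
  using ev_closed by blast

text \<open>Apart from \<open>rel\<close>, which is the hypothesis on \<open>\<rho>\<close>, every
  rule is either formal or an axiom of operads and hence valid for values in
  \<open>T\<close>.\<close>

lemma ev_cong: "(s, t) \<in> pres_cong K G R \<Longrightarrow> ev s = ev t"
proof (induction rule: pres_cong.induct)
  case (cong_Add s s' t t')
  then show ?case using cong_wf by simp
next
  case (cong_Smult t t' c)
  then show ?case using cong_wf by simp
next
  case (Add_assoc r s t)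
  then show ?case using ev_in[of r "arity s" "degree s"] ev_in[of t "arity s" "degree s"] ev_closed[of s]
    by (simp add: T.Sp_a_ac)
next
  case (Add_comm s t)
  then show ?case using ev_in[of s "arity t" "degree t"] ev_closed[of t] by (simp add: T.Sp_a_ac)
next
  case (Add_inverse t)
  have "\<ominus> \<one> \<odot>\<^bsub>Sp T (arity t) (degree t)\<^esub> ev t = \<ominus>\<^bsub>Sp T (arity t) (degree t)\<^esub> ev t"
    using module.smult_l_minus[OF T.module_Sp, of \<one>] ev_closed[OF Add_inverse] T.Sp_zero(5) by simp
  then show ?case
    using ev_closed[OF Add_inverse] abelian_group.l_neg[OF T.Sp_abelian_group] by simp
next
  case (Smult_add_scalar a b t)
  then show ?case using ev_closed[of t] by (simp add: T.Sp_l_distr)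
next
  case (Smult_Add a s t)
  then show ?case using ev_in[of s "arity t" "degree t"] ev_closed[of t] by (simp add: T.Sp_r_distr)
next
  case (Smult_Smult a b t)
  then show ?case using ev_closed[of t] by (simp add: T.Sp_smult_smult)
next
  case (Comp_sequential i r s j t)
  then show ?case using ev_closed[of r] ev_closed[of s] ev_closed[of t]
    by (auto intro!: T.pcomp_sequential)
next
  case (Comp_parallel i r s k t)
  then show ?case using ev_closed[of r] ev_closed[of s] ev_closed[of t]
    by (auto intro!: T.pcomp_parallel')
next
  case (Comp_Act_right i s \<tau> t)
  then show ?case using ev_closed[of t] ev_closed[of s] by (auto intro!: T.pcomp_act_right)
next
  case (Comp_Act_left i \<sigma> s t)
  then show ?case using ev_closed[of t] ev_closed[of s] by (auto intro!: T.pcomp_act_left)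
next
  case (Act_Add \<sigma> s t)
  then show ?case using ev_closed[of s] ev_in[of t "arity s" "degree s"] T.act_add[of "ev s" "arity s" "degree s"] by auto
next
  case (Act_id t)
  then show ?case using ev_closed[of t] by (simp add: T.act_id)
next
  case (Act_Act \<tau> \<sigma> t)
  then show ?case using ev_closed[of t] by (simp add: T.act_act)
qed (simp_all add: \<rho>_rel ev_closed T.pcomp_add_left T.pcomp_add_right T.pcomp_smult_left T.pcomp_smult_right
    T.act_smult ev_in)

text \<open>Congruent expressions have the same value, so the image of a class is a singleton and
  \<open>the_elem\<close> picks out the value of any representative.\<close>

lemma induced_cls: "wfe t \<Longrightarrow> induced_map T \<rho> (cls t) = ev t"
proof -
  assume "wfe t"
  then have "ev ` cls t = {ev t}"
    using ev_cong pres_cong.refl by (fastforce simp: mem_cls)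
  then show ?thesis by (simp add: induced_map_def)
qed

lemma induced_hom: "induced_map T \<rho> \<in> operad_hom K PP T"
  unfolding operad_hom_def
  by (auto elim!: carrier_presentedE simp: presented_simps induced_cls ev_in)

end

lemma eval_expr_cong:
  assumes "wf_expr K G t" "\<And>n d g. g \<in> G n d \<Longrightarrow> \<rho> n d g = \<rho>' n d g"
  shows "eval_expr P \<rho> t = eval_expr P \<rho>' t"
  using assms(1) by (induction t) (auto simp: assms(2))

section \<open>Derivations into infinitesimal bimodules\<close>

text \<open>These are the axioms under which \<open>P\<close> plus \<open>M\<close>, with composites
  of two elements of \<open>M\<close> set to zero, is again an operad; derivations into
  \<open>M\<close> are the sections of its projection to \<open>P\<close>. The space
  \<open>M n d\<close> receives the values on operations of arity \<open>n\<close> and degree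
  \<open>d\<close>: a shift of degree is part of the choice of \<open>M\<close>, and the Koszul
  signs are part of the two actions. These signs depend on arities and degrees, which elements do
  not carry, so the actions take them as arguments.\<close>

locale inf_bimodule = graded_operad K P for K :: "('k, 'm) ring_scheme" (structure) and P :: "('k, 'a) operad" +
  fixes M :: "nat \<Rightarrow> int \<Rightarrow> ('k, 'b) module"
    and lact :: "nat \<Rightarrow> int \<Rightarrow> nat \<Rightarrow> int \<Rightarrow> nat \<Rightarrow> 'a \<Rightarrow> 'b \<Rightarrow> 'b"
    and ract :: "nat \<Rightarrow> int \<Rightarrow> nat \<Rightarrow> int \<Rightarrow> nat \<Rightarrow> 'b \<Rightarrow> 'a \<Rightarrow> 'b"
    and mact :: "(nat \<Rightarrow> nat) \<Rightarrow> 'b \<Rightarrow> 'b"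
  assumes module_M: "module K (M n d)"
    and lact_closed: "\<lbrakk>x \<in> carrier (Sp P n d); u \<in> carrier (M m e); 1 \<le> i; i \<le> n\<rbrakk>
        \<Longrightarrow> lact n d m e i x u \<in> carrier (M (n + m - 1) (d + e))"
    and lact_add_left: "\<lbrakk>x \<in> carrier (Sp P n d); x' \<in> carrier (Sp P n d); u \<in> carrier (M m e); 1 \<le> i; i \<le> n\<rbrakk>
        \<Longrightarrow> lact n d m e i (x \<oplus>\<^bsub>Sp P n d\<^esub> x') u = lact n d m e i x u \<oplus>\<^bsub>M (n + m - 1) (d + e)\<^esub> lact n d m e i x' u"
    and lact_add_right: "\<lbrakk>x \<in> carrier (Sp P n d); u \<in> carrier (M m e); u' \<in> carrier (M m e); 1 \<le> i; i \<le> n\<rbrakk>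
        \<Longrightarrow> lact n d m e i x (u \<oplus>\<^bsub>M m e\<^esub> u') = lact n d m e i x u \<oplus>\<^bsub>M (n + m - 1) (d + e)\<^esub> lact n d m e i x u'"
    and lact_smult_left: "\<lbrakk>c \<in> carrier K; x \<in> carrier (Sp P n d); u \<in> carrier (M m e); 1 \<le> i; i \<le> n\<rbrakk>
        \<Longrightarrow> lact n d m e i (c \<odot>\<^bsub>Sp P n d\<^esub> x) u = c \<odot>\<^bsub>M (n + m - 1) (d + e)\<^esub> lact n d m e i x u"
    and lact_smult_right: "\<lbrakk>c \<in> carrier K; x \<in> carrier (Sp P n d); u \<in> carrier (M m e); 1 \<le> i; i \<le> n\<rbrakk>
        \<Longrightarrow> lact n d m e i x (c \<odot>\<^bsub>M m e\<^esub> u) = c \<odot>\<^bsub>M (n + m - 1) (d + e)\<^esub> lact n d m e i x u"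
    and ract_closed: "\<lbrakk>u \<in> carrier (M n d); y \<in> carrier (Sp P m e); 1 \<le> i; i \<le> n\<rbrakk>
        \<Longrightarrow> ract n d m e i u y \<in> carrier (M (n + m - 1) (d + e))"
    and ract_add_left: "\<lbrakk>u \<in> carrier (M n d); u' \<in> carrier (M n d); y \<in> carrier (Sp P m e); 1 \<le> i; i \<le> n\<rbrakk>
        \<Longrightarrow> ract n d m e i (u \<oplus>\<^bsub>M n d\<^esub> u') y = ract n d m e i u y \<oplus>\<^bsub>M (n + m - 1) (d + e)\<^esub> ract n d m e i u' y"
    and ract_add_right: "\<lbrakk>u \<in> carrier (M n d); y \<in> carrier (Sp P m e); y' \<in> carrier (Sp P m e); 1 \<le> i; i \<le> n\<rbrakk>
        \<Longrightarrow> ract n d m e i u (y \<oplus>\<^bsub>Sp P m e\<^esub> y') = ract n d m e i u y \<oplus>\<^bsub>M (n + m - 1) (d + e)\<^esub> ract n d m e i u y'"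
    and ract_smult_left: "\<lbrakk>c \<in> carrier K; u \<in> carrier (M n d); y \<in> carrier (Sp P m e); 1 \<le> i; i \<le> n\<rbrakk>
        \<Longrightarrow> ract n d m e i (c \<odot>\<^bsub>M n d\<^esub> u) y = c \<odot>\<^bsub>M (n + m - 1) (d + e)\<^esub> ract n d m e i u y"
    and ract_smult_right: "\<lbrakk>c \<in> carrier K; u \<in> carrier (M n d); y \<in> carrier (Sp P m e); 1 \<le> i; i \<le> n\<rbrakk>
        \<Longrightarrow> ract n d m e i u (c \<odot>\<^bsub>Sp P m e\<^esub> y) = c \<odot>\<^bsub>M (n + m - 1) (d + e)\<^esub> ract n d m e i u y"
    and mact_closed: "\<lbrakk>u \<in> carrier (M n d); \<sigma> permutes {1..n}\<rbrakk> \<Longrightarrow> mact \<sigma> u \<in> carrier (M n d)"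
    and mact_add: "\<lbrakk>u \<in> carrier (M n d); u' \<in> carrier (M n d); \<sigma> permutes {1..n}\<rbrakk>
        \<Longrightarrow> mact \<sigma> (u \<oplus>\<^bsub>M n d\<^esub> u') = mact \<sigma> u \<oplus>\<^bsub>M n d\<^esub> mact \<sigma> u'"
    and mact_smult: "\<lbrakk>c \<in> carrier K; u \<in> carrier (M n d); \<sigma> permutes {1..n}\<rbrakk>
        \<Longrightarrow> mact \<sigma> (c \<odot>\<^bsub>M n d\<^esub> u) = c \<odot>\<^bsub>M n d\<^esub> mact \<sigma> u"
    and mact_id: "u \<in> carrier (M n d) \<Longrightarrow> mact id u = u"
    and mact_mact: "\<lbrakk>u \<in> carrier (M n d); \<sigma> permutes {1..n}; \<tau> permutes {1..n}\<rbrakk>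
        \<Longrightarrow> mact \<tau> (mact \<sigma> u) = mact (\<sigma> \<circ> \<tau>) u"
    and ract_ract_seq: "\<lbrakk>u \<in> carrier (M n d); y \<in> carrier (Sp P m e); z \<in> carrier (Sp P l f);
        1 \<le> i; i \<le> n; 1 \<le> j; j \<le> m\<rbrakk>
        \<Longrightarrow> ract (n + m - 1) (d + e) l f (i + j - 1) (ract n d m e i u y) z
          = ract n d (m + l - 1) (e + f) i u (pcomp P j y z)"
    and ract_lact_seq: "\<lbrakk>x \<in> carrier (Sp P n d); u \<in> carrier (M m e); z \<in> carrier (Sp P l f);
        1 \<le> i; i \<le> n; 1 \<le> j; j \<le> m\<rbrakk>
        \<Longrightarrow> ract (n + m - 1) (d + e) l f (i + j - 1) (lact n d m e i x u) z
          = lact n d (m + l - 1) (e + f) i x (ract m e l f j u z)"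
    and lact_lact_seq: "\<lbrakk>x \<in> carrier (Sp P n d); y \<in> carrier (Sp P m e); u \<in> carrier (M l f);
        1 \<le> i; i \<le> n; 1 \<le> j; j \<le> m\<rbrakk>
        \<Longrightarrow> lact (n + m - 1) (d + e) l f (i + j - 1) (pcomp P i x y) u
          = lact n d (m + l - 1) (e + f) i x (lact m e l f j y u)"
    and ract_ract_par: "\<lbrakk>u \<in> carrier (M n d); y \<in> carrier (Sp P m e); z \<in> carrier (Sp P l f);
        1 \<le> i; i < k; k \<le> n\<rbrakk>
        \<Longrightarrow> ract (n + m - 1) (d + e) l f (k + m - 1) (ract n d m e i u y) z
          = sign_of K (e * f) \<odot>\<^bsub>M (n + m + l - 2) (d + e + f)\<^esub>
              ract (n + l - 1) (d + f) m e i (ract n d l f k u z) y"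
    and ract_lact_par: "\<lbrakk>x \<in> carrier (Sp P n d); u \<in> carrier (M m e); z \<in> carrier (Sp P l f);
        1 \<le> i; i < k; k \<le> n\<rbrakk>
        \<Longrightarrow> ract (n + m - 1) (d + e) l f (k + m - 1) (lact n d m e i x u) z
          = sign_of K (e * f) \<odot>\<^bsub>M (n + m + l - 2) (d + e + f)\<^esub>
              lact (n + l - 1) (d + f) m e i (pcomp P k x z) u"
    and lact_ract_par: "\<lbrakk>x \<in> carrier (Sp P n d); y \<in> carrier (Sp P m e); u \<in> carrier (M l f);
        1 \<le> i; i < k; k \<le> n\<rbrakk>
        \<Longrightarrow> lact (n + m - 1) (d + e) l f (k + m - 1) (pcomp P i x y) u
          = sign_of K (e * f) \<odot>\<^bsub>M (n + m + l - 2) (d + e + f)\<^esub>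
              ract (n + l - 1) (d + f) m e i (lact n d l f k x u) y"
    and lact_act_right: "\<lbrakk>x \<in> carrier (Sp P n d); u \<in> carrier (M m e); 1 \<le> i; i \<le> n; \<tau> permutes {1..m}\<rbrakk>
        \<Longrightarrow> lact n d m e i x (mact \<tau> u) = mact (block_inner i m \<tau>) (lact n d m e i x u)"
    and ract_act_right: "\<lbrakk>u \<in> carrier (M n d); y \<in> carrier (Sp P m e); 1 \<le> i; i \<le> n; \<tau> permutes {1..m}\<rbrakk>
        \<Longrightarrow> ract n d m e i u (act P \<tau> y) = mact (block_inner i m \<tau>) (ract n d m e i u y)"
    and lact_act_left: "\<lbrakk>x \<in> carrier (Sp P n d); u \<in> carrier (M m e); 1 \<le> i; i \<le> n; \<sigma> permutes {1..n}\<rbrakk>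
        \<Longrightarrow> lact n d m e i (act P \<sigma> x) u = mact (block_outer i m \<sigma>) (lact n d m e (\<sigma> i) x u)"
    and ract_act_left: "\<lbrakk>u \<in> carrier (M n d); y \<in> carrier (Sp P m e); 1 \<le> i; i \<le> n; \<sigma> permutes {1..n}\<rbrakk>
        \<Longrightarrow> ract n d m e i (mact \<sigma> u) y = mact (block_outer i m \<sigma>) (ract n d m e (\<sigma> i) u y)"
begin

lemmas M_abelian_group = module.axioms(2)[OF module_M]

lemma M_abelian_monoid: "abelian_monoid (M n d)"
  by (rule abelian_group.axioms(1)[OF M_abelian_group])

lemmas M_closed [simp, intro] =
  abelian_monoid.zero_closed[OF M_abelian_monoid]
  abelian_monoid.a_closed[OF M_abelian_monoid]
  abelian_group.a_inv_closed[OF M_abelian_group]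
  module.smult_closed[OF module_M]

lemmas M_zero [simp] =
  abelian_monoid.l_zero[OF M_abelian_monoid]
  abelian_monoid.r_zero[OF M_abelian_monoid]
  module.smult_r_null[OF module_M]
  module.smult_l_null[OF module_M]
  module.smult_one[OF module_M]

lemmas M_a_ac =
  abelian_monoid.a_assoc[OF M_abelian_monoid]
  abelian_monoid.a_comm[OF M_abelian_monoid]
  abelian_monoid.a_lcomm[OF M_abelian_monoid]

lemmas M_r_distr = module.smult_r_distr[OF module_M]
lemmas M_l_distr = module.smult_l_distr[OF module_M]
lemmas M_smult_smult = module.smult_assoc1[OF module_M]

lemma lact_zero_right:
  assumes "x \<in> carrier (Sp P n d)" "1 \<le> i" "i \<le> n"
  shows "lact n d m e i x \<zero>\<^bsub>M m e\<^esub> = \<zero>\<^bsub>M (n + m - 1) (d + e)\<^esub>"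
  by (rule additive_zero[OF M_abelian_group M_abelian_group])
    (use assms lact_closed lact_add_right in auto)

lemma ract_zero_left:
  assumes "y \<in> carrier (Sp P m e)" "1 \<le> i" "i \<le> n"
  shows "ract n d m e i \<zero>\<^bsub>M n d\<^esub> y = \<zero>\<^bsub>M (n + m - 1) (d + e)\<^esub>"
  by (rule additive_zero[OF M_abelian_group M_abelian_group])
    (use assms ract_closed ract_add_left in auto)

end

primrec derivation_expr ::
  "(nat \<Rightarrow> int \<Rightarrow> ('k, 'b) module) \<Rightarrow> (nat \<Rightarrow> int \<Rightarrow> nat \<Rightarrow> int \<Rightarrow> nat \<Rightarrow> 'a \<Rightarrow> 'b \<Rightarrow> 'b)
    \<Rightarrow> (nat \<Rightarrow> int \<Rightarrow> nat \<Rightarrow> int \<Rightarrow> nat \<Rightarrow> 'b \<Rightarrow> 'a \<Rightarrow> 'b) \<Rightarrow> ((nat \<Rightarrow> nat) \<Rightarrow> 'b \<Rightarrow> 'b)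
    \<Rightarrow> ('k, 'a) operad \<Rightarrow> (nat \<Rightarrow> int \<Rightarrow> 'g \<Rightarrow> 'a) \<Rightarrow> (nat \<Rightarrow> int \<Rightarrow> 'g \<Rightarrow> 'b) \<Rightarrow> ('k, 'g) expr \<Rightarrow> 'b" where
  "derivation_expr M la ra ma P \<rho> \<delta> (Gen n d g) = \<delta> n d g"
| "derivation_expr M la ra ma P \<rho> \<delta> (Zero n d) = \<zero>\<^bsub>M n d\<^esub>"
| "derivation_expr M la ra ma P \<rho> \<delta> (Add s t) =
     derivation_expr M la ra ma P \<rho> \<delta> s \<oplus>\<^bsub>M (arity s) (degree s)\<^esub> derivation_expr M la ra ma P \<rho> \<delta> t"
| "derivation_expr M la ra ma P \<rho> \<delta> (Smult c t) =
     c \<odot>\<^bsub>M (arity t) (degree t)\<^esub> derivation_expr M la ra ma P \<rho> \<delta> t"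
| "derivation_expr M la ra ma P \<rho> \<delta> (Comp i s t) =
     ra (arity s) (degree s) (arity t) (degree t) i (derivation_expr M la ra ma P \<rho> \<delta> s) (eval_expr P \<rho> t)
     \<oplus>\<^bsub>M (arity s + arity t - 1) (degree s + degree t)\<^esub>
     la (arity s) (degree s) (arity t) (degree t) i (eval_expr P \<rho> s) (derivation_expr M la ra ma P \<rho> \<delta> t)"
| "derivation_expr M la ra ma P \<rho> \<delta> (Act \<sigma> t) = ma \<sigma> (derivation_expr M la ra ma P \<rho> \<delta> t)"

locale presentation_derivation = presentation_eval K G R T \<rho> + M: inf_bimodule K T M lact ract mact
  for K :: "('k, 'm) ring_scheme" (structure) and G :: "nat \<Rightarrow> int \<Rightarrow> 'g set"
    and R :: "(('k, 'g) expr \<times> ('k, 'g) expr) set" and T :: "('k, 'a) operad" and \<rho>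
    and M :: "nat \<Rightarrow> int \<Rightarrow> ('k, 'b) module" and lact ract mact +
  fixes \<delta> :: "nat \<Rightarrow> int \<Rightarrow> 'g \<Rightarrow> 'b"
  assumes \<delta>_closed: "g \<in> G n d \<Longrightarrow> \<delta> n d g \<in> carrier (M n d)"
    and \<delta>_rel: "\<lbrakk>(s, t) \<in> R; wfe s; wfe t; arity s = arity t; degree s = degree t\<rbrakk>
      \<Longrightarrow> derivation_expr M lact ract mact T \<rho> \<delta> s = derivation_expr M lact ract mact T \<rho> \<delta> t"
begin

abbreviation "der \<equiv> derivation_expr M lact ract mact T \<rho> \<delta>"

lemma der_closed: "wfe t \<Longrightarrow> der t \<in> carrier (M (arity t) (degree t))"
  by (induction t) (auto simp: \<delta>_closed M.mact_closed M.lact_closed M.ract_closed ev_closed)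

lemma der_in: "wfe t \<Longrightarrow> arity t = n \<Longrightarrow> degree t = d \<Longrightarrow> der t \<in> carrier (M n d)"
  using der_closed by blast

text \<open>By the Leibniz rule, each operad axiom splits into terms in which the derivation hits
  one of its operations, and each term is an instance of a bimodule axiom.\<close>

lemma der_cong: "(s, t) \<in> pres_cong K G R \<Longrightarrow> der s = der t"
proof (induction rule: pres_cong.induct)
  case (cong_Add s s' t t')
  then show ?case using cong_wf by simp
next
  case (cong_Smult t t' c)
  then show ?case using cong_wf by simp
next
  case (cong_Comp s s' t t' i)
  then show ?case using cong_wf[of s s'] cong_wf[of t t'] ev_cong by simp
next
  case (Add_assoc r s t)
  then show ?case using der_in[of r "arity s" "degree s"] der_in[of t "arity s" "degree s"] der_closed[of s]
    by (simp add: M.M_a_ac)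
next
  case (Add_comm s t)
  then show ?case using der_in[of s "arity t" "degree t"] der_closed[of t] by (simp add: M.M_a_ac)
next
  case (Add_inverse t)
  have "\<ominus> \<one> \<odot>\<^bsub>M (arity t) (degree t)\<^esub> der t = \<ominus>\<^bsub>M (arity t) (degree t)\<^esub> der t"
    using module.smult_l_minus[OF M.module_M, of \<one>] der_closed[OF Add_inverse] M.M_zero(5) by simp
  then show ?case
    using der_closed[OF Add_inverse] abelian_group.l_neg[OF M.M_abelian_group] by simp
next
  case (Smult_add_scalar a b t)
  then show ?case using der_closed[of t] by (simp add: M.M_l_distr)
next
  case (Smult_Add a s t)
  then show ?case using der_in[of s "arity t" "degree t"] der_closed[of t] by (simp add: M.M_r_distr)
next
  case (Smult_Smult a b t)
  then show ?case using der_closed[of t] by (simp add: M.M_smult_smult)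
next
  case (Comp_Add_left i s s' t)
  note c = ev_closed[of s] ev_closed[of s'] ev_closed[of t] der_closed[of s] der_closed[of s'] der_closed[of t]
  show ?case using Comp_Add_left c
    by (simp add: M.ract_add_left M.lact_add_left M.M_a_ac M.lact_closed M.ract_closed)
next
  case (Comp_Add_right i s t t')
  note c = ev_closed[of s] ev_closed[of t'] ev_closed[of t] der_closed[of s] der_closed[of t'] der_closed[of t]
  show ?case using Comp_Add_right c
    by (simp add: M.ract_add_right M.lact_add_right M.M_a_ac M.lact_closed M.ract_closed)
next
  case (Comp_Smult_left i c s t)
  note c = ev_closed[of s] ev_closed[of t] der_closed[of s] der_closed[of t]
  show ?case using Comp_Smult_left c
    by (simp add: M.ract_smult_left M.lact_smult_left M.M_r_distr M.lact_closed M.ract_closed)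
next
  case (Comp_Smult_right i s c t)
  note c = ev_closed[of s] ev_closed[of t] der_closed[of s] der_closed[of t]
  show ?case using Comp_Smult_right c
    by (simp add: M.ract_smult_right M.lact_smult_right M.M_r_distr M.lact_closed M.ract_closed)
next
  case (Comp_sequential i r s j t)
  note c = ev_closed[of r] ev_closed[of s] ev_closed[of t] der_closed[of r] der_closed[of s] der_closed[of t]
  let ?n = "arity r" and ?d = "degree r" and ?m = "arity s" and ?e = "degree s" and ?l = "arity t" and ?f = "degree t"
  have i: "1 \<le> i" "i \<le> ?n" "1 \<le> j" "j \<le> ?m" "wfe r" "wfe s" "wfe t" using Comp_sequential by auto
  note cs = c(1)[OF i(5)] c(2)[OF i(6)] c(3)[OF i(7)] c(4)[OF i(5)] c(5)[OF i(6)] c(6)[OF i(7)]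
  have k: "1 \<le> i + j - 1" "i + j - 1 \<le> ?n + ?m - 1" using i by auto
  let ?M = "M (?n + ?m - 1 + ?l - 1) (?d + ?e + ?f)"
  have M: "M (?n + (?m + ?l - 1) - 1) (?d + (?e + ?f)) = ?M" using i by (simp add: algebra_simps)
  note cl = M.ract_closed[OF cs(4,2) i(1,2)] M.lact_closed[OF cs(1,5) i(1,2)]
    M.ract_closed[OF cs(5,3) i(3,4)] M.lact_closed[OF cs(2,6) i(3,4)]
  \<comment> \<open>There are three Leibniz terms, where the derivation hits \<open>r\<close>,
    \<open>s\<close> and \<open>t\<close>; each has its own sequential axiom.\<close>
  have "der (Comp (i + j - 1) (Comp i r s) t) =
     ract (?n + ?m - 1) (?d + ?e) ?l ?f (i + j - 1) (ract ?n ?d ?m ?e i (der r) (ev s)) (ev t) \<oplus>\<^bsub>?M\<^esub>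
     ract (?n + ?m - 1) (?d + ?e) ?l ?f (i + j - 1) (lact ?n ?d ?m ?e i (ev r) (der s)) (ev t) \<oplus>\<^bsub>?M\<^esub>
     lact (?n + ?m - 1) (?d + ?e) ?l ?f (i + j - 1) (pcomp T i (ev r) (ev s)) (der t)"
    using M.ract_add_left[OF cl(1,2) cs(3) k] by simp
  also have "\<dots> = ract ?n ?d (?m + ?l - 1) (?e + ?f) i (der r) (pcomp T j (ev s) (ev t)) \<oplus>\<^bsub>?M\<^esub>
     (lact ?n ?d (?m + ?l - 1) (?e + ?f) i (ev r) (ract ?m ?e ?l ?f j (der s) (ev t)) \<oplus>\<^bsub>?M\<^esub>
      lact ?n ?d (?m + ?l - 1) (?e + ?f) i (ev r) (lact ?m ?e ?l ?f j (ev s) (der t)))"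
    unfolding M.ract_ract_seq[OF cs(4,2,3) i(1-4)] M.ract_lact_seq[OF cs(1,5,3) i(1-4)]
      M.lact_lact_seq[OF cs(1,2,6) i(1-4)] M[symmetric]
    by (intro abelian_monoid.a_assoc[OF M.M_abelian_monoid] M.ract_closed M.lact_closed
        T.pcomp_closed cs cl i)
  also have "\<dots> = der (Comp i r (Comp j s t))"
    using M.lact_add_right[OF cs(1) cl(3,4) i(1,2)] M by simp
  finally show ?case .
next
  case (Comp_parallel i r s k t)
  note c = ev_closed[of r] ev_closed[of s] ev_closed[of t] der_closed[of r] der_closed[of s] der_closed[of t]
  let ?n = "arity r" and ?d = "degree r" and ?m = "arity s" and ?e = "degree s" and ?l = "arity t" and ?f = "degree t"
  have i: "1 \<le> i" "i < k" "k \<le> ?n" "1 \<le> k" "i \<le> ?n" "wfe r" "wfe s" "wfe t" using Comp_parallel by auto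
  note cs = c(1)[OF i(6)] c(2)[OF i(7)] c(3)[OF i(8)] c(4)[OF i(6)] c(5)[OF i(7)] c(6)[OF i(8)]
  have k: "1 \<le> k + ?m - 1" "k + ?m - 1 \<le> ?n + ?m - 1" using i by auto
  have k': "i \<le> ?n + ?l - 1" using i by auto
  let ?M = "M (?n + ?m + ?l - 2) (?d + ?e + ?f)"
  have M: "M (?n + ?m - 1 + ?l - 1) (?d + ?e + ?f) = ?M" using i by (auto intro!: arg_cong2[where f = M])
  have M': "M (?n + ?l - 1 + ?m - 1) (?d + ?f + ?e) = ?M" using i by (auto intro!: arg_cong2[where f = M])
  note cl = M.ract_closed[OF cs(4,2) i(1,5)] M.lact_closed[OF cs(1,5) i(1,5)]
    M.ract_closed[OF cs(4,3) i(4,3)] M.lact_closed[OF cs(1,6) i(4,3)]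
  let ?s = "sign_of K (?e * ?f)"
  \<comment> \<open>The terms in which the derivation hits \<open>r\<close>, \<open>s\<close> and
    \<open>t\<close>. After the exchange \<open>t\<close> is composed before \<open>s\<close>, so
    they come in the order \<open>A\<close>, \<open>C\<close>, \<open>B\<close>.\<close>
  define A B C where
    "A = ract (?n + ?l - 1) (?d + ?f) ?m ?e i (ract ?n ?d ?l ?f k (der r) (ev t)) (ev s)"
    "B = lact (?n + ?l - 1) (?d + ?f) ?m ?e i (pcomp T k (ev r) (ev t)) (der s)"
    "C = ract (?n + ?l - 1) (?d + ?f) ?m ?e i (lact ?n ?d ?l ?f k (ev r) (der t)) (ev s)"
  have ABC: "A \<in> carrier ?M" "B \<in> carrier ?M" "C \<in> carrier ?M"
    unfolding A_B_C_def M'[symmetric]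
    by (intro M.ract_closed M.lact_closed T.pcomp_closed cs cl i k')+
  have "der (Comp (k + ?m - 1) (Comp i r s) t) =
     ract (?n + ?m - 1) (?d + ?e) ?l ?f (k + ?m - 1) (ract ?n ?d ?m ?e i (der r) (ev s)) (ev t) \<oplus>\<^bsub>?M\<^esub>
     ract (?n + ?m - 1) (?d + ?e) ?l ?f (k + ?m - 1) (lact ?n ?d ?m ?e i (ev r) (der s)) (ev t) \<oplus>\<^bsub>?M\<^esub>
     lact (?n + ?m - 1) (?d + ?e) ?l ?f (k + ?m - 1) (pcomp T i (ev r) (ev s)) (der t)"
    using M.ract_add_left[OF cl(1,2) cs(3) k] M by simp
  also have "\<dots> = ?s \<odot>\<^bsub>?M\<^esub> A \<oplus>\<^bsub>?M\<^esub> ?s \<odot>\<^bsub>?M\<^esub> B \<oplus>\<^bsub>?M\<^esub> ?s \<odot>\<^bsub>?M\<^esub> C"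
    unfolding A_B_C_def M.ract_ract_par[OF cs(4,2,3) i(1-3)] M.ract_lact_par[OF cs(1,5,3) i(1-3)]
      M.lact_ract_par[OF cs(1,2,6) i(1-3)] ..
  also have "\<dots> = ?s \<odot>\<^bsub>?M\<^esub> (A \<oplus>\<^bsub>?M\<^esub> C \<oplus>\<^bsub>?M\<^esub> B)"
    using ABC by (simp add: M.M_r_distr M.M_a_ac)
  also have "\<dots> = der (Smult ?s (Comp i (Comp k r t) s))"
    using M.ract_add_left[OF cl(3,4) cs(2) i(1) k'] M' 
    by (simp add: A_B_C_def)
  finally show ?case .
next
  case (Comp_Act_right i s \<tau> t)
  have p: "block_inner i (arity t) \<tau> permutes {1..arity s + arity t - 1}"
    by (rule block_inner_permutes) (use Comp_Act_right in auto)
  show ?case using ev_closed[of t] ev_closed[of s] der_closed[of t] der_closed[of s] p Comp_Act_right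
    by (simp add: M.lact_act_right M.ract_act_right M.mact_add M.lact_closed M.ract_closed)
next
  case (Comp_Act_left i \<sigma> s t)
  have p: "block_outer i (arity t) \<sigma> permutes {1..arity s + arity t - 1}"
    by (rule block_outer_permutes) (use Comp_Act_left in auto)
  have "1 \<le> \<sigma> i" "\<sigma> i \<le> arity s" using permutes_ge1[of \<sigma> "arity s"] Comp_Act_left by auto
  then show ?case using ev_closed[of t] ev_closed[of s] der_closed[of t] der_closed[of s] p Comp_Act_left
    by (simp add: M.lact_act_left M.ract_act_left M.mact_add M.lact_closed M.ract_closed)
next
  case (Act_Add \<sigma> s t)
  then show ?case using der_closed[of s] der_in[of t "arity s" "degree s"] M.mact_add[of "der s" "arity s" "degree s"] by auto
next
  case (Act_id t)
  then show ?case using der_closed[of t] by (simp add: M.mact_id)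
next
  case (Act_Act \<tau> \<sigma> t)
  then show ?case using der_closed[of t] by (simp add: M.mact_mact)
qed (simp_all add: \<delta>_rel der_in M.mact_smult)

definition induced_der :: "('k, 'g) expr set \<Rightarrow> 'b" where
  "induced_der X = the_elem (der ` X)"

lemma induced_der_cls: "wfe t \<Longrightarrow> induced_der (cls t) = der t"
proof -
  assume "wfe t"
  then have "der ` cls t = {der t}"
    using der_cong pres_cong.refl by (fastforce simp: mem_cls)
  then show ?thesis by (simp add: induced_der_def)
qed

end

section \<open>The bimodule of derivations of degree -1\<close>

lemma sign_of_cong: "(even a \<longleftrightarrow> even b) \<Longrightarrow> sign_of K a = sign_of K b"
  by (simp add: sign_of_def)

context graded_operad
begin

lemma sign_smult_smult:
  "x \<in> carrier (Sp P n d) \<Longrightarrow>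
    sign_of K a \<odot>\<^bsub>Sp P n d\<^esub> (sign_of K b \<odot>\<^bsub>Sp P n d\<^esub> x) = sign_of K (a + b) \<odot>\<^bsub>Sp P n d\<^esub> x"
  by (simp add: Sp_smult_smult sign_of_add)

lemma smult_commute:
  "\<lbrakk>a \<in> carrier K; b \<in> carrier K; x \<in> carrier (Sp P n d)\<rbrakk> \<Longrightarrow>
    a \<odot>\<^bsub>Sp P n d\<^esub> (b \<odot>\<^bsub>Sp P n d\<^esub> x) = b \<odot>\<^bsub>Sp P n d\<^esub> (a \<odot>\<^bsub>Sp P n d\<^esub> x)"
  by (simp add: Sp_smult_smult[symmetric] m_comm)

text \<open>The sign is the one for an operator of degree -1 passing \<open>x\<close>; with it,
  derivations into this bimodule are exactly those of \<open>deriv_expr\<close>.\<close>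

definition shift_lact :: "nat \<Rightarrow> int \<Rightarrow> nat \<Rightarrow> int \<Rightarrow> nat \<Rightarrow> 'a \<Rightarrow> 'a \<Rightarrow> 'a" where
  "shift_lact n d m e i x u = sign_of K d \<odot>\<^bsub>Sp P (n + m - 1) (d + e - 1)\<^esub> pcomp P i x u"

text \<open>An element \<open>u\<close> filed under degree \<open>e\<close> has actual degree
  \<open>e - 1\<close> as an operation. The parallel axioms of the operad thus produce signs in
  \<open>e - 1\<close>, and the factor in \<open>shift_lact\<close> turns them into the signs in
  \<open>e\<close> which the bimodule axioms ask for.\<close>

lemma shift_bimodule:
  "inf_bimodule K P (\<lambda>n d. Sp P n (d - 1)) shift_lact (\<lambda>n d m e i. pcomp P i) (act P)"
proof (intro inf_bimodule.intro graded_operad_axioms inf_bimodule_axioms.intro)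
  show "module K (Sp P n (d - 1))" for n d by (rule module_Sp)
next
  fix x u n d m e i
  assume a: "x \<in> carrier (Sp P n d)" "u \<in> carrier (Sp P m (e - 1))" "1 \<le> i" "i \<le> n"
  have c: "pcomp P i x u \<in> carrier (Sp P (n + m - 1) (d + e - 1))"
    by (rule pcomp_in[OF a]) auto
  then show "shift_lact n d m e i x u \<in> carrier (Sp P (n + m - 1) (d + e - 1))"
    by (simp add: shift_lact_def)
  note l = pcomp_linear_left[where N = "n + m - 1" and D = "d + e - 1" and d = d, OF a(2-4) HOL.refl]
  note r = pcomp_linear_right[where N = "n + m - 1" and D = "d + e - 1" and e = "e - 1" and m = m, OF a(1,3,4) HOL.refl]
  show "shift_lact n d m e i (x \<oplus>\<^bsub>Sp P n d\<^esub> x') u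
      = shift_lact n d m e i x u \<oplus>\<^bsub>Sp P (n + m - 1) (d + e - 1)\<^esub> shift_lact n d m e i x' u"
    if "x' \<in> carrier (Sp P n d)" for x'
    using l(1)[OF _ a(1) that] that a pcomp_in[OF that a(2-4), of "n + m - 1" "d + e - 1"] c
    by (simp add: shift_lact_def Sp_r_distr)
  show "shift_lact n d m e i x (u \<oplus>\<^bsub>Sp P m (e - 1)\<^esub> u')
      = shift_lact n d m e i x u \<oplus>\<^bsub>Sp P (n + m - 1) (d + e - 1)\<^esub> shift_lact n d m e i x u'"
    if "u' \<in> carrier (Sp P m (e - 1))" for u'
    using r(1)[OF _ a(2) that] that a pcomp_in[OF a(1) that a(3,4), of "n + m - 1" "d + e - 1"] c
    by (simp add: shift_lact_def Sp_r_distr)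
  show "shift_lact n d m e i (k \<odot>\<^bsub>Sp P n d\<^esub> x) u = k \<odot>\<^bsub>Sp P (n + m - 1) (d + e - 1)\<^esub> shift_lact n d m e i x u"
    if "k \<in> carrier K" for k
    using l(2)[OF _ a(1) that] that a c
    by (simp add: shift_lact_def) (rule smult_commute; simp)
  show "shift_lact n d m e i x (k \<odot>\<^bsub>Sp P m (e - 1)\<^esub> u) = k \<odot>\<^bsub>Sp P (n + m - 1) (d + e - 1)\<^esub> shift_lact n d m e i x u"
    if "k \<in> carrier K" for k
    using r(2)[OF _ a(2) that] that a c
    by (simp add: shift_lact_def) (rule smult_commute; simp)
  show "shift_lact n d m e i x (act P \<tau> u) = act P (block_inner i m \<tau>) (shift_lact n d m e i x u)"
    if "\<tau> permutes {1..m}" for \<tau>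
    using pcomp_act_right[OF a that] act_smult[OF _ c block_inner_permutes[OF that a(3,4)]] by (simp add: shift_lact_def)
  show "shift_lact n d m e i (act P \<sigma> x) u = act P (block_outer i m \<sigma>) (shift_lact n d m e (\<sigma> i) x u)"
    if "\<sigma> permutes {1..n}" for \<sigma>
  proof -
    have "pcomp P (\<sigma> i) x u \<in> carrier (Sp P (n + m - 1) (d + e - 1))"
      by (rule pcomp_in[OF a(1,2)]) (use permutes_ge1[OF that] a in auto)
    then show ?thesis
      using pcomp_act_left[OF a that] act_smult[OF _ _ block_outer_permutes[OF that a(3,4)]] by (simp add: shift_lact_def)
  qed
next
  fix u y n d m e i
  assume a: "u \<in> carrier (Sp P n (d - 1))" "y \<in> carrier (Sp P m e)" "1 \<le> i" "i \<le> n"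
  show c: "pcomp P i u y \<in> carrier (Sp P (n + m - 1) (d + e - 1))"
    by (rule pcomp_in[OF a]) auto
  note l = pcomp_linear_left[where N = "n + m - 1" and D = "d + e - 1" and d = "d - 1", OF a(2-4) HOL.refl]
  note r = pcomp_linear_right[where N = "n + m - 1" and D = "d + e - 1" and e = e and m = m, OF a(1,3,4) HOL.refl]
  show "pcomp P i (u \<oplus>\<^bsub>Sp P n (d - 1)\<^esub> u') y = pcomp P i u y \<oplus>\<^bsub>Sp P (n + m - 1) (d + e - 1)\<^esub> pcomp P i u' y"
    if "u' \<in> carrier (Sp P n (d - 1))" for u' using l(1) a that by simp
  show "pcomp P i u (y \<oplus>\<^bsub>Sp P m e\<^esub> y') = pcomp P i u y \<oplus>\<^bsub>Sp P (n + m - 1) (d + e - 1)\<^esub> pcomp P i u y'"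
    if "y' \<in> carrier (Sp P m e)" for y' using r(1) a that by simp
  show "pcomp P i (k \<odot>\<^bsub>Sp P n (d - 1)\<^esub> u) y = k \<odot>\<^bsub>Sp P (n + m - 1) (d + e - 1)\<^esub> pcomp P i u y"
    if "k \<in> carrier K" for k using l(2) a that by simp
  show "pcomp P i u (k \<odot>\<^bsub>Sp P m e\<^esub> y) = k \<odot>\<^bsub>Sp P (n + m - 1) (d + e - 1)\<^esub> pcomp P i u y"
    if "k \<in> carrier K" for k using r(2) a that by simp
  show "pcomp P i u (act P \<tau> y) = act P (block_inner i m \<tau>) (pcomp P i u y)"
    if "\<tau> permutes {1..m}" for \<tau> by (rule pcomp_act_right[OF a that])
  show "pcomp P i (act P \<sigma> u) y = act P (block_outer i m \<sigma>) (pcomp P (\<sigma> i) u y)"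
    if "\<sigma> permutes {1..n}" for \<sigma> by (rule pcomp_act_left[OF a that])
next
  fix u y z n d m e l f i j
  assume a: "u \<in> carrier (Sp P n (d - 1))" "y \<in> carrier (Sp P m e)" "z \<in> carrier (Sp P l f)"
    "1 \<le> i" "i \<le> n" "1 \<le> j" "j \<le> m"
  then show "pcomp P (i + j - 1) (pcomp P i u y) z = pcomp P i u (pcomp P j y z)" by (rule pcomp_sequential)
next
  fix x u z n d m e l f i j
  assume a: "x \<in> carrier (Sp P n d)" "u \<in> carrier (Sp P m (e - 1))" "z \<in> carrier (Sp P l f)"
    "1 \<le> i" "i \<le> n" "1 \<le> j" "j \<le> m"
  have "pcomp P i x u \<in> carrier (Sp P (n + m - 1) (d + e - 1))" by (rule pcomp_in[OF a(1,2,4,5)]) auto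
  then have "pcomp P (i + j - 1) (sign_of K d \<odot>\<^bsub>Sp P (n + m - 1) (d + e - 1)\<^esub> pcomp P i x u) z =
     sign_of K d \<odot>\<^bsub>Sp P (n + (m + l - 1) - 1) (d + (e + f) - 1)\<^esub> pcomp P (i + j - 1) (pcomp P i x u) z"
    by (intro pcomp_linear_left(2)[OF a(3)]) (use a in auto)
  then show "pcomp P (i + j - 1) (shift_lact n d m e i x u) z = shift_lact n d (m + l - 1) (e + f) i x (pcomp P j u z)"
    using pcomp_sequential[OF a] by (simp add: shift_lact_def)
next
  fix x y u n d m e l f i j
  assume a: "x \<in> carrier (Sp P n d)" "y \<in> carrier (Sp P m e)" "u \<in> carrier (Sp P l (f - 1))"
    "1 \<le> i" "i \<le> n" "1 \<le> j" "j \<le> m"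
  have c: "pcomp P j y u \<in> carrier (Sp P (m + l - 1) (e + f - 1))" by (rule pcomp_in[OF a(2,3,6,7)]) auto
  have c': "pcomp P i x (pcomp P j y u) \<in> carrier (Sp P (n + (m + l - 1) - 1) (d + (e + f) - 1))"
    by (rule pcomp_in[OF a(1) c a(4,5)]) auto
  have "pcomp P i x (sign_of K e \<odot>\<^bsub>Sp P (m + l - 1) (e + f - 1)\<^esub> pcomp P j y u) =
     sign_of K e \<odot>\<^bsub>Sp P (n + (m + l - 1) - 1) (d + (e + f) - 1)\<^esub> pcomp P i x (pcomp P j y u)"
    using c by (intro pcomp_linear_right(2)[OF a(1)]) (use a in auto)
  moreover have "n + m - 1 + l - 1 = n + (m + l - 1) - 1" using a by auto
  ultimately show "shift_lact (n + m - 1) (d + e) l f (i + j - 1) (pcomp P i x y) u =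
      shift_lact n d (m + l - 1) (e + f) i x (shift_lact m e l f j y u)"
    using pcomp_sequential[OF a] c' by (simp add: shift_lact_def sign_smult_smult add.assoc)
next
  fix u y z n d m e l f i k
  assume a: "u \<in> carrier (Sp P n (d - 1))" "y \<in> carrier (Sp P m e)" "z \<in> carrier (Sp P l f)"
    "1 \<le> i" "i < k" "k \<le> n"
  then show "pcomp P (k + m - 1) (pcomp P i u y) z =
    sign_of K (e * f) \<odot>\<^bsub>Sp P (n + m + l - 2) (d + e + f - 1)\<^esub> pcomp P i (pcomp P k u z) y"
    by (rule pcomp_parallel') auto
next
  fix x u z n d m e l f i k
  assume a: "x \<in> carrier (Sp P n d)" "u \<in> carrier (Sp P m (e - 1))" "z \<in> carrier (Sp P l f)"
    "1 \<le> i" "i < k" "k \<le> n"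
  have i: "i \<le> n" "1 \<le> k" using a by auto
  have c: "pcomp P i x u \<in> carrier (Sp P (n + m - 1) (d + e - 1))" by (rule pcomp_in[OF a(1,2,4) i(1)]) auto
  have "pcomp P k x z \<in> carrier (Sp P (n + l - 1) (d + f))" by (rule pcomp_in[OF a(1,3) i(2) a(6)]) auto
  then have c': "pcomp P i (pcomp P k x z) u \<in> carrier (Sp P (n + m + l - 2) (d + e + f - 1))"
    by (rule pcomp_in[OF _ a(2,4)]) (use a in auto)
  have "pcomp P (k + m - 1) (sign_of K d \<odot>\<^bsub>Sp P (n + m - 1) (d + e - 1)\<^esub> pcomp P i x u) z =
     sign_of K d \<odot>\<^bsub>Sp P (n + m + l - 2) (d + e + f - 1)\<^esub> pcomp P (k + m - 1) (pcomp P i x u) z"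
    using c by (intro pcomp_linear_left(2)[OF a(3)]) (use a in auto)
  also have "pcomp P (k + m - 1) (pcomp P i x u) z =
     sign_of K ((e - 1) * f) \<odot>\<^bsub>Sp P (n + m + l - 2) (d + e + f - 1)\<^esub> pcomp P i (pcomp P k x z) u"
    by (rule pcomp_parallel'[OF a]) auto
  \<comment> \<open>The exponents \<open>d + (e - 1) * f\<close> and \<open>e * f + (d + f)\<close>
    have the same parity; \<open>d + f\<close> is the degree of the composite that \<open>u\<close>
    is now plugged into.\<close>
  also have "sign_of K d \<odot>\<^bsub>Sp P (n + m + l - 2) (d + e + f - 1)\<^esub> \<dots> =
     sign_of K (e * f) \<odot>\<^bsub>Sp P (n + m + l - 2) (d + e + f - 1)\<^esub>
     (sign_of K (d + f) \<odot>\<^bsub>Sp P (n + m + l - 2) (d + e + f - 1)\<^esub> pcomp P i (pcomp P k x z) u)"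
    using c' sign_of_cong[where K = K and a = "d + (e - 1) * f" and b = "e * f + (d + f)"] by (cases "even d"; cases "even e"; cases "even f") (simp_all add: sign_smult_smult)
  finally have 1: "pcomp P (k + m - 1) (sign_of K d \<odot>\<^bsub>Sp P (n + m - 1) (d + e - 1)\<^esub> pcomp P i x u) z =
     sign_of K (e * f) \<odot>\<^bsub>Sp P (n + m + l - 2) (d + e + f - 1)\<^esub>
     (sign_of K (d + f) \<odot>\<^bsub>Sp P (n + m + l - 2) (d + e + f - 1)\<^esub> pcomp P i (pcomp P k x z) u)" .
  show "pcomp P (k + m - 1) (shift_lact n d m e i x u) z =
    sign_of K (e * f) \<odot>\<^bsub>Sp P (n + m + l - 2) (d + e + f - 1)\<^esub> shift_lact (n + l - 1) (d + f) m e i (pcomp P k x z) u"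
  proof -
    have 2: "n + l - 1 + m - 1 = n + m + l - 2" "d + f + e - 1 = d + e + f - 1" using i a by auto
    show ?thesis unfolding shift_lact_def 1 2 ..
  qed
next
  fix x y u n d m e l f i k
  assume a: "x \<in> carrier (Sp P n d)" "y \<in> carrier (Sp P m e)" "u \<in> carrier (Sp P l (f - 1))"
    "1 \<le> i" "i < k" "k \<le> n"
  have i: "i \<le> n" "1 \<le> k" using a by auto
  have c: "pcomp P k x u \<in> carrier (Sp P (n + l - 1) (d + f - 1))" by (rule pcomp_in[OF a(1,3) i(2) a(6)]) auto
  then have c': "pcomp P i (pcomp P k x u) y \<in> carrier (Sp P (n + m + l - 2) (d + e + f - 1))"
    by (rule pcomp_in[OF _ a(2,4)]) (use a in auto)
  have 1: "pcomp P i (sign_of K d \<odot>\<^bsub>Sp P (n + l - 1) (d + f - 1)\<^esub> pcomp P k x u) y =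
     sign_of K d \<odot>\<^bsub>Sp P (n + m + l - 2) (d + e + f - 1)\<^esub> pcomp P i (pcomp P k x u) y"
    using c by (intro pcomp_linear_left(2)[OF a(2)]) (use a in auto)
  have 2: "pcomp P (k + m - 1) (pcomp P i x y) u =
     sign_of K (e * (f - 1)) \<odot>\<^bsub>Sp P (n + m + l - 2) (d + e + f - 1)\<^esub> pcomp P i (pcomp P k x u) y"
    by (rule pcomp_parallel'[OF a]) auto
  \<comment> \<open>The exponents \<open>d + e + e * (f - 1)\<close> and \<open>e * f + d\<close>
    have the same parity.\<close>
  have 3: "sign_of K (d + e) \<odot>\<^bsub>Sp P (n + m + l - 2) (d + e + f - 1)\<^esub>
      (sign_of K (e * (f - 1)) \<odot>\<^bsub>Sp P (n + m + l - 2) (d + e + f - 1)\<^esub> pcomp P i (pcomp P k x u) y) =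
     sign_of K (e * f) \<odot>\<^bsub>Sp P (n + m + l - 2) (d + e + f - 1)\<^esub>
      (sign_of K d \<odot>\<^bsub>Sp P (n + m + l - 2) (d + e + f - 1)\<^esub> pcomp P i (pcomp P k x u) y)"
    using c' sign_of_cong[where K = K and a = "d + e + e * (f - 1)" and b = "e * f + d"] by (cases "even d"; cases "even e"; cases "even f") (simp_all add: sign_smult_smult)
  have 4: "n + m - 1 + l - 1 = n + m + l - 2" using i a by auto
  show "shift_lact (n + m - 1) (d + e) l f (k + m - 1) (pcomp P i x y) u =
    sign_of K (e * f) \<odot>\<^bsub>Sp P (n + m + l - 2) (d + e + f - 1)\<^esub> pcomp P i (shift_lact n d l f k x u) y"
    unfolding shift_lact_def 4 2 3 1 ..
qed (auto simp: act_closed act_add act_smult act_id act_act)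

end

section \<open>Marking an input\<close>

text \<open>
  \<open>gam i\<close> moves the \<open>i\<close>-th slot to the front, and \<open>up \<sigma>\<close> acts by \<open>\<sigma>\<close> on all inputs but the
  first one.
\<close>

definition gam :: "nat \<Rightarrow> nat \<Rightarrow> nat" where
  "gam i k = (if k = 1 then i else if 2 \<le> k \<and> k \<le> i then k - 1 else k)"

definition up :: "(nat \<Rightarrow> nat) \<Rightarrow> nat \<Rightarrow> nat" where
  "up \<sigma> k = (if k \<le> 1 then k else \<sigma> (k - 1) + 1)"

lemma gam_1 [simp]: "gam 1 = id"
  by (auto simp: gam_def fun_eq_iff)

lemma gam_permutes: "1 \<le> i \<Longrightarrow> i \<le> n \<Longrightarrow> gam i permutes {1..n}"
  by (rule finite_inj_on_permutes) (auto simp: gam_def inj_on_def split: if_splits)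

lemma up_permutes:
  assumes "\<sigma> permutes {1..n}" shows "up \<sigma> permutes {1..n + 1}"
proof (rule finite_inj_on_permutes)
  note p = permutes_ge1[OF assms]
  show "up \<sigma> ` {1..n + 1} \<subseteq> {1..n + 1}" using p by (auto simp: up_def)
  show "inj_on (up \<sigma>) {1..n + 1}"
  proof (rule inj_onI)
    fix x y assume "x \<in> {1..n + 1}" "y \<in> {1..n + 1}" "up \<sigma> x = up \<sigma> y"
    moreover have "\<not> x \<le> 1 \<Longrightarrow> 1 \<le> \<sigma> (x - 1)" "\<not> y \<le> 1 \<Longrightarrow> 1 \<le> \<sigma> (y - 1)"
      using p(1)[of "x - 1"] p(1)[of "y - 1"] by auto
    ultimately show "x = y"
      using inj_eq[OF permutes_inj[OF assms], of "x - 1" "y - 1"]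
      by (cases "x \<le> 1"; cases "y \<le> 1") (auto simp: up_def)
  qed
  fix x assume "x \<notin> {1..n + 1}"
  then have "x = 0 \<or> 1 < x \<and> x - 1 \<notin> {1..n}" by auto
  then show "up \<sigma> x = x"
    using permutes_not_in[OF assms, of "x - 1"] by (auto simp: up_def)
qed simp

lemma up_id [simp]: "up id = id"
  by (auto simp: up_def fun_eq_iff)

lemma up_comp:
  assumes "\<tau> permutes {1..n}" shows "up (\<sigma> \<circ> \<tau>) = up \<sigma> \<circ> up \<tau>"
proof
  fix k show "up (\<sigma> \<circ> \<tau>) k = (up \<sigma> \<circ> up \<tau>) k"
    using permutes_ge1(1)[OF assms, of "k - 1"] by (auto simp: up_def)
qed

lemma block_outer_1 [simp]: "1 \<le> i \<Longrightarrow> block_outer i 1 \<sigma> = \<sigma>"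
proof
  fix k assume "1 \<le> i"
  then show "block_outer i 1 \<sigma> k = \<sigma> k"
    by (cases k i rule: linorder_cases) (auto simp: block_outer_def Let_def)
qed

text \<open>Only the first \<open>i\<close> slots are touched by \<open>gam i\<close>, so composing
  at a later slot \<open>p\<close> leaves it as it is.\<close>

lemma block_outer_gam: "1 \<le> i \<Longrightarrow> i < p \<Longrightarrow> block_outer p m (gam i) = gam i"
  by (auto simp: block_outer_def gam_def fun_eq_iff Let_def)

text \<open>Plugging an operation of arity 0 into the slot moved to the front amounts to plugging it
  into the original slot: the remaining inputs keep their order.\<close>

lemma block_outer_gam_0: "1 \<le> i \<Longrightarrow> block_outer 1 0 (gam i) = id"
  by (auto simp: block_outer_def gam_def fun_eq_iff Let_def)

text \<open>The earlier slot \<open>i\<close> is in position \<open>i + 1\<close> after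
  \<open>k\<close> has moved to the front; filling it with \<open>m\<close> inputs pushes the
  original position of the moved slot to \<open>k + m - 1\<close>.\<close>

lemma block_outer_gam_shift:
  "1 \<le> i \<Longrightarrow> i < k \<Longrightarrow> block_outer (i + 1) m (gam k) = gam (k + m - 1)"
  by (auto simp: block_outer_def gam_def fun_eq_iff Let_def)

text \<open>A slot of the inner operation travels to the front in two stages, to the start of its
  block and from there to the front of the composite.\<close>

lemma block_inner_gam:
  "1 \<le> i \<Longrightarrow> 1 \<le> j \<Longrightarrow> j \<le> m \<Longrightarrow> block_inner i m (gam j) \<circ> gam i = gam (i + j - 1)"
  by (auto simp: block_inner_def gam_def fun_eq_iff)

text \<open>The block of an operation with an additional first input is longer by one, and
  \<open>gam i\<close> takes this first slot out of it; \<open>\<tau>\<close> permutes what is left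
  of the block.\<close>

lemma block_inner_up:
  assumes "1 \<le> i" "\<tau> permutes {1..m}"
  shows "block_inner i (m + 1) (up \<tau>) \<circ> gam i = gam i \<circ> up (block_inner i m \<tau>)"
proof
  fix k
  have "1 \<le> \<tau> (k - i)" if "i < k" using that permutes_ge1(1)[OF assms(2), of "k - i"] by auto
  then show "(block_inner i (m + 1) (up \<tau>) \<circ> gam i) k = (gam i \<circ> up (block_inner i m \<tau>)) k"
    using assms(1) by (cases "i < k"; cases "k < i + m + 1") (auto simp: block_inner_def gam_def up_def)
qed

lemma up_block_inner: "1 \<le> i \<Longrightarrow> up (block_inner i m \<tau>) = block_inner (i + 1) m \<tau>"
  by (auto simp: block_inner_def up_def fun_eq_iff)

lemma up_block_outer:
  assumes "1 \<le> i" "\<sigma> permutes {1..n}"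
  shows "block_outer (i + 1) m (up \<sigma>) = up (block_outer i m \<sigma>)"
proof
  fix k
  have i: "1 \<le> \<sigma> i" using assms permutes_ge1(1) by auto
  note k = permutes_ge1(1)[OF assms(2), of "k - 1"] permutes_ge1(1)[OF assms(2), of "k - m"]
  consider "k = 0" | "k = 1" | "2 \<le> k" "k < i + 1" | "i + 1 \<le> k" "k < i + 1 + m" | "2 \<le> k" "i + 1 + m \<le> k" by linarith
  then show "block_outer (i + 1) m (up \<sigma>) k = up (block_outer i m \<sigma>) k"
  proof cases
    case 5
    then have "k - 1 + 1 - m = k - m" "k + 1 - m - 1 = k - m" "\<not> k + 1 - m \<le> 1"
      "\<not> k - 1 < i + m" "\<not> k - 1 < i" "\<not> k < i + 1 + m" using assms(1) by auto
    then show ?thesis using 5 k assms(1) i by (simp add: block_outer_def up_def Let_def)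
  qed (use k i assms(1) in \<open>auto simp: block_outer_def up_def Let_def\<close>)
qed

lemma block_outer_up:
  assumes "1 \<le> i" "\<sigma> permutes {1..n}"
  shows "block_outer i (m + 1) \<sigma> \<circ> gam i = gam (\<sigma> i) \<circ> up (block_outer i m \<sigma>)"
proof
  fix k
  have i: "1 \<le> \<sigma> i" using assms permutes_ge1(1) by auto
  have inj: "\<sigma> a = \<sigma> b \<longleftrightarrow> a = b" for a b using inj_eq[OF permutes_inj[OF assms(2)]] .
  note ge = permutes_ge1(1)[OF assms(2)]
  \<comment> \<open>The cases are a non-input, the additional input, and the inputs before, inside
    and after the block.\<close>
  consider "k = 0" | "k = 1" | "2 \<le> k" "k \<le> i" | "2 \<le> k" "i + 1 \<le> k" "k < i + 1 + m" | "2 \<le> k" "i + 1 + m \<le> k" by linarith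
  then show "(block_outer i (m + 1) \<sigma> \<circ> gam i) k = (gam (\<sigma> i) \<circ> up (block_outer i m \<sigma>)) k"
  proof cases
    case 1
    have "\<sigma> 0 = 0" by (rule permutes_ge1(3)[OF assms(2)])
    then show ?thesis using 1 assms(1) i by (simp add: block_outer_def up_def gam_def Let_def)
  next
    case 2 then show ?thesis using assms(1) by (simp add: block_outer_def up_def gam_def Let_def)
  next
    case 3
    then have "\<sigma> (k - 1) \<noteq> \<sigma> i" "1 \<le> \<sigma> (k - 1)" using inj ge[of "k - 1"] by auto
    moreover define s where "s = \<sigma> (k - 1)"
    moreover have "gam i k = k - 1" using 3 by (simp add: gam_def)
    ultimately show ?thesis using 3 i assms(1)
      by (cases "s < \<sigma> i") (auto simp: block_outer_def up_def gam_def Let_def)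
  next
    case 4
    then have "gam i k = k" using assms(1) by (simp add: gam_def)
    then show ?thesis using 4 assms(1) i by (auto simp: block_outer_def up_def gam_def Let_def)
  next
    case 5
    then have "\<sigma> (k - m) \<noteq> \<sigma> i" "1 \<le> \<sigma> (k - m)" using inj ge[of "k - m"] by auto
    moreover define s where "s = \<sigma> (k - m)"
    moreover have "gam i k = k" "k + 1 - (m + 1) = k - m" "k - 1 + 1 - m = k - m" using 5 assms(1) by (auto simp: gam_def)
    ultimately show ?thesis using 5 i assms(1)
      by (cases "s < \<sigma> i") (auto simp: block_outer_def up_def gam_def Let_def)
  qed
qed

section \<open>The bimodule of operations with a marked first input\<close>

context graded_operad
begin

text \<open>
  An element \<open>(y, c)\<close> of \<open>marked r n d\<close> is an operation with an additional first input, to be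
  filled by an element of arity 0 and degree \<open>-r\<close>, plus \<open>c\<close> times this element itself, which is
  needed because operads have no unit.
\<close>

definition marked :: "int \<Rightarrow> nat \<Rightarrow> int \<Rightarrow> ('k, 'a \<times> 'k) module" where
  "marked r n d =
    \<lparr>carrier = {(y, c). y \<in> carrier (Sp P (n + 1) (d + r)) \<and> c \<in> carrier K \<and> (c \<noteq> \<zero> \<longrightarrow> n = 0 \<and> d = - r)},
     monoid.mult = undefined, one = undefined,
     zero = (\<zero>\<^bsub>Sp P (n + 1) (d + r)\<^esub>, \<zero>),
     add = \<lambda>(y, c) (y', c'). (y \<oplus>\<^bsub>Sp P (n + 1) (d + r)\<^esub> y', c \<oplus> c'),
     smult = \<lambda>a (y, c). (a \<odot>\<^bsub>Sp P (n + 1) (d + r)\<^esub> y, a \<otimes> c)\<rparr>"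

text \<open>The marked input of \<open>u\<close> ends up in slot \<open>i\<close> of the composite
  and is brought to the front by \<open>gam i\<close>. The second summand is the contribution of the
  scalar: plugging the marked element itself into slot \<open>i\<close> of \<open>x\<close> turns
  this slot into the marked input. The resulting scalar is zero because a composite is never the
  bare element.\<close>

definition mark_lact :: "int \<Rightarrow> nat \<Rightarrow> int \<Rightarrow> nat \<Rightarrow> int \<Rightarrow> nat \<Rightarrow> 'a \<Rightarrow> 'a \<times> 'k \<Rightarrow> 'a \<times> 'k" where
  "mark_lact r n d m e i x u =
     (act P (gam i) (pcomp P i x (fst u)) \<oplus>\<^bsub>Sp P (n + m) (d + e + r)\<^esub>
      (if m = 0 \<and> e = - r then snd u \<odot>\<^bsub>Sp P n d\<^esub> act P (gam i) x else \<zero>\<^bsub>Sp P (n + m) (d + e + r)\<^esub>), \<zero>)"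

text \<open>The sign is that of the parallel axiom for exchanging \<open>x\<close> with the element
  of degree \<open>-r\<close> which is to fill the first input. The scalar of \<open>u\<close> does
  not appear: it vanishes as soon as \<open>u\<close> has an input for \<open>x\<close>.\<close>

definition mark_ract :: "int \<Rightarrow> nat \<Rightarrow> int \<Rightarrow> nat \<Rightarrow> int \<Rightarrow> nat \<Rightarrow> 'a \<times> 'k \<Rightarrow> 'a \<Rightarrow> 'a \<times> 'k" where
  "mark_ract r n d m e i u x = (sign_of K (r * e) \<odot>\<^bsub>Sp P (n + m) (d + e + r)\<^esub> pcomp P (i + 1) (fst u) x, \<zero>)"

definition mark_act :: "(nat \<Rightarrow> nat) \<Rightarrow> 'a \<times> 'k \<Rightarrow> 'a \<times> 'k" where
  "mark_act \<sigma> u = (act P (up \<sigma>) (fst u), snd u)"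

lemma marked_simps [simp]:
  "(y, c) \<in> carrier (marked r n d) \<longleftrightarrow>
     y \<in> carrier (Sp P (n + 1) (d + r)) \<and> c \<in> carrier K \<and> (c \<noteq> \<zero> \<longrightarrow> n = 0 \<and> d = - r)"
  "\<zero>\<^bsub>marked r n d\<^esub> = (\<zero>\<^bsub>Sp P (n + 1) (d + r)\<^esub>, \<zero>)"
  "(y, c) \<oplus>\<^bsub>marked r n d\<^esub> (y', c') = (y \<oplus>\<^bsub>Sp P (n + 1) (d + r)\<^esub> y', c \<oplus> c')"
  "a \<odot>\<^bsub>marked r n d\<^esub> (y, c) = (a \<odot>\<^bsub>Sp P (n + 1) (d + r)\<^esub> y, a \<otimes> c)"
  by (simp_all add: marked_def)

lemma marked_cases:
  assumes "u \<in> carrier (marked r n d)"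
  obtains y c where "u = (y, c)" "y \<in> carrier (Sp P (n + 1) (d + r))" "c \<in> carrier K"
    "c \<noteq> \<zero> \<Longrightarrow> n = 0 \<and> d = - r"
  using assms by (cases u) auto

lemma module_marked: "module K (marked r n d)"
proof (rule module.intro)
  show "abelian_group (marked r n d)"
  proof (rule abelian_groupI)
    fix u assume "u \<in> carrier (marked r n d)"
    then obtain y c where u: "u = (y, c)" "y \<in> carrier (Sp P (n + 1) (d + r))" "c \<in> carrier K"
      "c \<noteq> \<zero> \<Longrightarrow> n = 0 \<and> d = - r" by (rule marked_cases) blast
    then show "\<exists>v\<in>carrier (marked r n d). v \<oplus>\<^bsub>marked r n d\<^esub> u = \<zero>\<^bsub>marked r n d\<^esub>"
      using abelian_group.l_neg[OF Sp_abelian_group u(2)] l_neg[OF u(3)]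
      by (intro bexI[of _ "(\<ominus>\<^bsub>Sp P (n + 1) (d + r)\<^esub> y, \<ominus> c)"]) auto
  qed (auto elim!: marked_cases simp: Sp_a_ac a_ac)
  show "module_axioms K (marked r n d)"
    by unfold_locales (auto elim!: marked_cases simp: Sp_l_distr Sp_r_distr Sp_smult_smult l_distr r_distr m_assoc)
qed (rule is_cring)

text \<open>With the marked input regarded as an ordinary one, each axiom is an operad axiom
  followed by keeping track, through the identities for \<open>gam\<close> and \<open>up\<close>, of
  where this input goes. The scalars need separate cases: they can be non-zero only in arity 0 and
  degree \<open>-r\<close>, and only the left action uses them.\<close>

lemma marked_bimodule:
  "inf_bimodule K P (marked r) (mark_lact r) (mark_ract r) mark_act"
proof (intro inf_bimodule.intro graded_operad_axioms inf_bimodule_axioms.intro)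
  show "module K (marked r n d)" for n d by (rule module_marked)
next
  fix x u n d m e i
  assume a: "x \<in> carrier (Sp P n d)" "u \<in> carrier (marked r m e)" "1 \<le> i" "i \<le> n"
  obtain y c where u: "u = (y, c)" "y \<in> carrier (Sp P (m + 1) (e + r))" "c \<in> carrier K"
    "c \<noteq> \<zero> \<Longrightarrow> m = 0 \<and> e = - r" using a(2) by (rule marked_cases) blast
  define S where "S = Sp P (n + m) (d + e + r)"
  have S: "Sp P (n + m - 1 + 1) (d + e + r) = S" using a by (simp add: S_def)
  \<comment> \<open>The case in which \<open>u\<close> may have a non-zero scalar; composing with
    such a \<open>u\<close> changes the type of \<open>x\<close> as little as filling a slot and
    marking it again.\<close>
  define b where "b \<longleftrightarrow> m = 0 \<and> e = - r"
  have S0: "b \<Longrightarrow> Sp P n d = S" by (simp add: S_def b_def)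
  have ml: "mark_lact r n d m e i' x' u' = (act P (gam i') (pcomp P i' x' (fst u')) \<oplus>\<^bsub>S\<^esub>
      (if b then snd u' \<odot>\<^bsub>Sp P n d\<^esub> act P (gam i') x' else \<zero>\<^bsub>S\<^esub>), \<zero>)" for i' x' u'
    by (simp add: mark_lact_def S_def b_def)
  have gp: "gam i permutes {1..n + m}" "gam i permutes {1..n}" using a by (auto intro!: gam_permutes)
  have p: "pcomp P i x' y' \<in> carrier S" if "x' \<in> carrier (Sp P n d)" "y' \<in> carrier (Sp P (m + 1) (e + r))" for x' y'
    unfolding S_def by (rule pcomp_in[OF that a(3,4)]) auto
  have A: "v \<in> carrier S \<Longrightarrow> act P (gam i) v \<in> carrier S" for v unfolding S_def using act_closed gp by blast
  have c: "act P (gam i) (pcomp P i x' y') \<in> carrier S" if "x' \<in> carrier (Sp P n d)" "y' \<in> carrier (Sp P (m + 1) (e + r))" for x' y'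
    using A p that by blast
  have c2: "x' \<in> carrier (Sp P n d) \<Longrightarrow> act P (gam i) x' \<in> carrier (Sp P n d)" for x'
    using act_closed gp by blast
  note S_ac = Sp_a_ac[where n = "n + m" and d = "d + e + r", folded S_def] Sp_r_distr[where n = "n + m" and d = "d + e + r", folded S_def]
    Sp_l_distr[where n = "n + m" and d = "d + e + r", folded S_def]
  note S_cl = Sp_closed[where n = "n + m" and d = "d + e + r", folded S_def] Sp_zero[where n = "n + m" and d = "d + e + r", folded S_def]
  show "mark_lact r n d m e i x u \<in> carrier (marked r (n + m - 1) (d + e))"
    using c[OF a(1) u(2)] c2[OF a(1)] S0 u by (auto simp: ml S S_cl)
  note l = pcomp_linear_left[where N = "n + m" and D = "d + e + r" and n = n and d = d, OF u(2) a(3,4), folded S_def]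
  note rr = pcomp_linear_right[where N = "n + m" and D = "d + e + r" and e = "e + r" and m = "m + 1", OF a(1,3,4), folded S_def]
  note ga = act_add[where n = "n + m" and d = "d + e + r", OF _ _ gp(1), folded S_def]
    act_smult[where n = "n + m" and d = "d + e + r", OF _ _ gp(1), folded S_def]
  note ga' = act_add[where n = n and d = d, OF _ _ gp(2)] act_smult[where n = n and d = d, OF _ _ gp(2)]
  show "mark_lact r n d m e i (x \<oplus>\<^bsub>Sp P n d\<^esub> x') u
      = mark_lact r n d m e i x u \<oplus>\<^bsub>marked r (n + m - 1) (d + e)\<^esub> mark_lact r n d m e i x' u"
    if "x' \<in> carrier (Sp P n d)" for x'
    using l(1)[OF _ _ a(1) that] ga(1)[OF p[OF a(1) u(2)] p[OF that u(2)]] ga'(1)[OF a(1) that] c[OF a(1) u(2)] c[OF that u(2)]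
      c2[OF a(1)] c2[OF that] u(1,3) S0
    by (cases b) (simp_all add: ml S S_ac S_cl)
  show "mark_lact r n d m e i x (u \<oplus>\<^bsub>marked r m e\<^esub> u')
      = mark_lact r n d m e i x u \<oplus>\<^bsub>marked r (n + m - 1) (d + e)\<^esub> mark_lact r n d m e i x u'"
    if u': "u' \<in> carrier (marked r m e)" for u'
  proof -
    obtain y' c' where u': "u' = (y', c')" "y' \<in> carrier (Sp P (m + 1) (e + r))" "c' \<in> carrier K"
      using u' by (rule marked_cases) blast
    then show ?thesis
      using rr(1)[OF _ _ u(2) u'(2)] ga(1)[OF p[OF a(1) u(2)] p[OF a(1) u'(2)]] c[OF a(1) u(2)] c[OF a(1) u'(2)]
        c2[OF a(1)] u(1,3) S0
      by (cases b) (simp_all add: ml S S_ac S_cl)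
  qed
  have comm: "\<lbrakk>a \<in> carrier K; b \<in> carrier K; v \<in> carrier S\<rbrakk> \<Longrightarrow> a \<odot>\<^bsub>S\<^esub> (b \<odot>\<^bsub>S\<^esub> v) = b \<odot>\<^bsub>S\<^esub> (a \<odot>\<^bsub>S\<^esub> v)" for a b v
    unfolding S_def by (rule smult_commute)
  show "mark_lact r n d m e i (k \<odot>\<^bsub>Sp P n d\<^esub> x) u = k \<odot>\<^bsub>marked r (n + m - 1) (d + e)\<^esub> mark_lact r n d m e i x u"
    if k: "k \<in> carrier K" for k
    using l(2)[OF _ _ a(1) k] ga(2)[OF k p[OF a(1) u(2)]] ga'(2)[OF k a(1)] c[OF a(1) u(2)]
      c2[OF a(1)] u(1,3) S0 k comm[OF k u(3)]
    by (cases b) (simp_all add: ml S S_ac S_cl)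
  show "mark_lact r n d m e i x (k \<odot>\<^bsub>marked r m e\<^esub> u) = k \<odot>\<^bsub>marked r (n + m - 1) (d + e)\<^esub> mark_lact r n d m e i x u"
    if k: "k \<in> carrier K" for k
    using rr(2)[OF _ _ u(2) k] ga(2)[OF k p[OF a(1) u(2)]] c[OF a(1) u(2)]
      c2[OF a(1)] u(1,3) S0 k Sp_smult_smult[OF k u(3) c2[OF a(1)]]
    by (cases b) (simp_all add: ml S S_ac S_cl)
  show "mark_lact r n d m e i x (mark_act \<tau> u) = mark_act (block_inner i m \<tau>) (mark_lact r n d m e i x u)"
    if \<tau>: "\<tau> permutes {1..m}" for \<tau>
  proof -
    have bp: "block_inner i (m + 1) (up \<tau>) permutes {1..n + m}"
      using block_inner_permutes[OF up_permutes[OF \<tau>] a(3,4)] by simp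
    have b': "up (block_inner i m \<tau>) permutes {1..n + m}"
      using up_permutes[OF block_inner_permutes[OF \<tau> a(3,4)]] a by simp
    have "act P (gam i) (pcomp P i x (act P (up \<tau>) y)) = act P (gam i) (act P (block_inner i (m + 1) (up \<tau>)) (pcomp P i x y))"
      using pcomp_act_right[OF a(1) u(2) a(3,4) up_permutes[OF \<tau>]] by simp
    also have "\<dots> = act P (block_inner i (m + 1) (up \<tau>) \<circ> gam i) (pcomp P i x y)"
      using act_act[OF p[OF a(1) u(2), unfolded S_def] bp gp(1)] .
    also have "\<dots> = act P (up (block_inner i m \<tau>)) (act P (gam i) (pcomp P i x y))"
      using act_act[OF p[OF a(1) u(2), unfolded S_def] gp(1) b'] block_inner_up[OF a(3) \<tau>] by simp
    finally have 1: "act P (gam i) (pcomp P i x (act P (up \<tau>) y)) = act P (up (block_inner i m \<tau>)) (act P (gam i) (pcomp P i x y))" .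
    have bid: "act P (up (block_inner i m \<tau>)) v = v" if "b" "v \<in> carrier (Sp P n d)" for v
    proof -
      have "block_inner i m \<tau> = id" using that by (auto simp: block_inner_def fun_eq_iff b_def)
      then show ?thesis using that act_id by simp
    qed
    have "act P (up (block_inner i m \<tau>)) (v \<oplus>\<^bsub>S\<^esub> w) = act P (up (block_inner i m \<tau>)) v \<oplus>\<^bsub>S\<^esub> act P (up (block_inner i m \<tau>)) w"
      if "v \<in> carrier S" "w \<in> carrier S" for v w
      using act_add[OF that[unfolded S_def] b'] unfolding S_def .
    moreover have "act P (up (block_inner i m \<tau>)) \<zero>\<^bsub>S\<^esub> = \<zero>\<^bsub>S\<^esub>" unfolding S_def by (rule act_zero[OF b'])
    moreover have "v \<in> carrier S \<Longrightarrow> act P (up (block_inner i m \<tau>)) v \<in> carrier S" for v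
      unfolding S_def by (rule act_closed[OF _ b'])
    ultimately show ?thesis
      using 1 u(1,3) S0 c[OF a(1) u(2)] c2[OF a(1)] bid
      by (cases b) (simp_all add: ml mark_act_def S_cl)
  qed
  show "mark_lact r n d m e i (act P \<sigma> x) u = mark_act (block_outer i m \<sigma>) (mark_lact r n d m e (\<sigma> i) x u)"
    if \<sigma>: "\<sigma> permutes {1..n}" for \<sigma>
  proof -
    have si: "1 \<le> \<sigma> i" "\<sigma> i \<le> n" using permutes_ge1[OF \<sigma>] a by auto
    have bp: "block_outer i (m + 1) \<sigma> permutes {1..n + m}"
      using block_outer_permutes[OF \<sigma> a(3,4), of "m + 1"] by simp
    have b': "up (block_outer i m \<sigma>) permutes {1..n + m}"
      using up_permutes[OF block_outer_permutes[OF \<sigma> a(3,4)]] a by simp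
    have sp: "pcomp P (\<sigma> i) x y \<in> carrier S" unfolding S_def by (rule pcomp_in[OF a(1) u(2) si]) auto
    have gs: "gam (\<sigma> i) permutes {1..n + m}" "gam (\<sigma> i) permutes {1..n}" using si by (auto intro!: gam_permutes)
    have "act P (gam i) (pcomp P i (act P \<sigma> x) y) = act P (gam i) (act P (block_outer i (m + 1) \<sigma>) (pcomp P (\<sigma> i) x y))"
      using pcomp_act_left[OF a(1) u(2) a(3,4) \<sigma>] by simp
    also have "\<dots> = act P (block_outer i (m + 1) \<sigma> \<circ> gam i) (pcomp P (\<sigma> i) x y)"
      using act_act[OF sp[unfolded S_def] bp gp(1)] .
    also have "\<dots> = act P (up (block_outer i m \<sigma>)) (act P (gam (\<sigma> i)) (pcomp P (\<sigma> i) x y))"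
      using act_act[OF sp[unfolded S_def] gs(1) b'] block_outer_up[OF a(3) \<sigma>] by simp
    finally have 1: "act P (gam i) (pcomp P i (act P \<sigma> x) y) = act P (up (block_outer i m \<sigma>)) (act P (gam (\<sigma> i)) (pcomp P (\<sigma> i) x y))" .
    have 2: "act P (gam i) (act P \<sigma> x) = act P (up (block_outer i m \<sigma>)) (act P (gam (\<sigma> i)) x)" if "b"
    proof -
      have m: "m = 0" using that by (simp add: b_def)
      have "act P (gam i) (act P \<sigma> x) = act P (\<sigma> \<circ> gam i) x" using act_act[OF a(1) \<sigma> gp(2)] .
      also have "\<sigma> \<circ> gam i = gam (\<sigma> i) \<circ> up (block_outer i m \<sigma>)"
        using block_outer_up[OF a(3) \<sigma>, of 0] m a(3) by simp
      also have "act P \<dots> x = act P (up (block_outer i m \<sigma>)) (act P (gam (\<sigma> i)) x)"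
        using act_act[OF a(1) gs(2), of "up (block_outer i m \<sigma>)"] b' m by simp
      finally show ?thesis .
    qed
    have gsx: "act P (gam (\<sigma> i)) x \<in> carrier (Sp P n d)" "act P (gam (\<sigma> i)) (pcomp P (\<sigma> i) x y) \<in> carrier S"
      using act_closed[OF a(1) gs(2)] act_closed[OF sp[unfolded S_def] gs(1)] by (auto simp: S_def)
    have "act P (up (block_outer i m \<sigma>)) (v \<oplus>\<^bsub>S\<^esub> w) = act P (up (block_outer i m \<sigma>)) v \<oplus>\<^bsub>S\<^esub> act P (up (block_outer i m \<sigma>)) w"
      if "v \<in> carrier S" "w \<in> carrier S" for v w
      using act_add[OF that[unfolded S_def] b'] unfolding S_def .
    moreover have "act P (up (block_outer i m \<sigma>)) (k \<odot>\<^bsub>S\<^esub> v) = k \<odot>\<^bsub>S\<^esub> act P (up (block_outer i m \<sigma>)) v"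
      if "v \<in> carrier S" "k \<in> carrier K" for v k
      using act_smult[OF that(2) that(1)[unfolded S_def] b'] unfolding S_def .
    moreover have "act P (up (block_outer i m \<sigma>)) \<zero>\<^bsub>S\<^esub> = \<zero>\<^bsub>S\<^esub>" unfolding S_def by (rule act_zero[OF b'])
    moreover have "v \<in> carrier S \<Longrightarrow> act P (up (block_outer i m \<sigma>)) v \<in> carrier S" for v
      unfolding S_def by (rule act_closed[OF _ b'])
    ultimately show ?thesis
      using 1 2 u(1,3) S0 gsx
      by (cases b) (simp_all add: ml mark_act_def S_cl)
  qed
next
  fix u x n d m e i
  assume a: "u \<in> carrier (marked r n d)" "x \<in> carrier (Sp P m e)" "1 \<le> i" "i \<le> n"
  \<comment> \<open>The slot \<open>i\<close> exists, so the arity is positive and the scalar of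
    \<open>u\<close> vanishes.\<close>
  have n: "n \<noteq> 0" using a by auto
  obtain y where u: "u = (y, \<zero>)" "y \<in> carrier (Sp P (n + 1) (d + r))"
    using a(1) n by (auto elim: marked_cases)
  define S where "S = Sp P (n + m) (d + e + r)"
  have S: "Sp P (n + m - 1 + 1) (d + e + r) = S" using n by (simp add: S_def)
  have i: "1 \<le> i + 1" "i + 1 \<le> n + 1" using a by auto
  have p: "pcomp P (i + 1) y' x' \<in> carrier S" if "y' \<in> carrier (Sp P (n + 1) (d + r))" "x' \<in> carrier (Sp P m e)" for x' y'
    unfolding S_def by (rule pcomp_in[OF that i]) auto
  note S_ac = Sp_r_distr[where n = "n + m" and d = "d + e + r", folded S_def]
  have comm: "\<lbrakk>a \<in> carrier K; b \<in> carrier K; v \<in> carrier S\<rbrakk> \<Longrightarrow> a \<odot>\<^bsub>S\<^esub> (b \<odot>\<^bsub>S\<^esub> v) = b \<odot>\<^bsub>S\<^esub> (a \<odot>\<^bsub>S\<^esub> v)" for a b v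
    unfolding S_def by (rule smult_commute)
  have cl: "k \<in> carrier K \<Longrightarrow> v \<in> carrier S \<Longrightarrow> k \<odot>\<^bsub>S\<^esub> v \<in> carrier S" for k v unfolding S_def by simp
  show "mark_ract r n d m e i u x \<in> carrier (marked r (n + m - 1) (d + e))"
    using p[OF u(2) a(2)] u cl by (simp add: mark_ract_def S S_def[symmetric])
  note l = pcomp_linear_left[where N = "n + m" and D = "d + e + r" and n = "n + 1" and d = "d + r", OF a(2) i, folded S_def]
  note rr = pcomp_linear_right[where N = "n + m" and D = "d + e + r" and e = e and m = m, OF u(2) i, folded S_def]
  show "mark_ract r n d m e i (u \<oplus>\<^bsub>marked r n d\<^esub> u') x
      = mark_ract r n d m e i u x \<oplus>\<^bsub>marked r (n + m - 1) (d + e)\<^esub> mark_ract r n d m e i u' x"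
    if u': "u' \<in> carrier (marked r n d)" for u'
  proof -
    obtain y' where u': "u' = (y', \<zero>)" "y' \<in> carrier (Sp P (n + 1) (d + r))"
      using u' n by (auto elim: marked_cases)
    show ?thesis using l(1)[OF _ _ u(2) u'(2)] p[OF u(2) a(2)] p[OF u'(2) a(2)] u(1) u'(1)
      by (simp add: mark_ract_def S S_def[symmetric] S_ac)
  qed
  show "mark_ract r n d m e i u (x \<oplus>\<^bsub>Sp P m e\<^esub> x')
      = mark_ract r n d m e i u x \<oplus>\<^bsub>marked r (n + m - 1) (d + e)\<^esub> mark_ract r n d m e i u x'"
    if "x' \<in> carrier (Sp P m e)" for x'
    using rr(1)[OF _ _ a(2) that] p[OF u(2) a(2)] p[OF u(2) that] u(1)
    by (simp add: mark_ract_def S S_def[symmetric] S_ac)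
  show "mark_ract r n d m e i (k \<odot>\<^bsub>marked r n d\<^esub> u) x = k \<odot>\<^bsub>marked r (n + m - 1) (d + e)\<^esub> mark_ract r n d m e i u x"
    if k: "k \<in> carrier K" for k
    using l(2)[OF _ _ u(2) k] p[OF u(2) a(2)] u(1) k comm[OF _ k]
    by (simp add: mark_ract_def S S_def[symmetric])
  show "mark_ract r n d m e i u (k \<odot>\<^bsub>Sp P m e\<^esub> x) = k \<odot>\<^bsub>marked r (n + m - 1) (d + e)\<^esub> mark_ract r n d m e i u x"
    if k: "k \<in> carrier K" for k
    using rr(2)[OF _ _ a(2) k] p[OF u(2) a(2)] u(1) k comm[OF _ k]
    by (simp add: mark_ract_def S S_def[symmetric])
  show "mark_ract r n d m e i u (act P \<tau> x) = mark_act (block_inner i m \<tau>) (mark_ract r n d m e i u x)"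
    if \<tau>: "\<tau> permutes {1..m}" for \<tau>
  proof -
    have b: "block_inner (i + 1) m \<tau> permutes {1..n + m}"
      using block_inner_permutes[OF \<tau> i] by simp
    show ?thesis
      using pcomp_act_right[OF u(2) a(2) i \<tau>] act_smult[OF _ p[OF u(2) a(2), unfolded S_def] b] u(1)
      by (simp add: mark_ract_def mark_act_def up_block_inner[OF a(3)])
  qed
  show "mark_ract r n d m e i (mark_act \<sigma> u) x = mark_act (block_outer i m \<sigma>) (mark_ract r n d m e (\<sigma> i) u x)"
    if \<sigma>: "\<sigma> permutes {1..n}" for \<sigma>
  proof -
    have si: "1 \<le> \<sigma> i" "\<sigma> i \<le> n" using permutes_ge1[OF \<sigma>] a by auto
    have b: "block_outer (i + 1) m (up \<sigma>) permutes {1..n + m}"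
      using block_outer_permutes[OF up_permutes[OF \<sigma>] i] by simp
    have "up \<sigma> (i + 1) = \<sigma> i + 1" using a(3) by (simp add: up_def)
    moreover have "pcomp P (\<sigma> i + 1) y x \<in> carrier (Sp P (n + m) (d + e + r))"
      by (rule pcomp_in[OF u(2) a(2)]) (use si in auto)
    ultimately show ?thesis
      using pcomp_act_left[OF u(2) a(2) i up_permutes[OF \<sigma>]] act_smult[OF _ _ b] u(1)
      by (simp add: mark_ract_def mark_act_def up_block_outer[OF a(3) \<sigma>])
  qed
next
  fix u x z n d m e l f i j
  assume a: "u \<in> carrier (marked r n d)" "x \<in> carrier (Sp P m e)" "z \<in> carrier (Sp P l f)"
    "1 \<le> i" "i \<le> n" "1 \<le> j" "j \<le> m"
  have n: "n \<noteq> 0" using a by auto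
  obtain y where u: "u = (y, \<zero>)" "y \<in> carrier (Sp P (n + 1) (d + r))"
    using a(1) n by (auto elim: marked_cases)
  define S where "S = Sp P (n + m + l - 1) (d + e + f + r)"
  have S: "Sp P (n + m - 1 + l) (d + e + f + r) = S" "Sp P (n + (m + l - 1)) (d + (e + f) + r) = S"
    using a by (auto simp: S_def algebra_simps intro!: arg_cong2[where f = "Sp P"])
  have 1: "pcomp P (i + 1) y x \<in> carrier (Sp P (n + m) (d + e + r))"
    by (rule pcomp_in[OF u(2) a(2)]) (use a in auto)
  have xz: "pcomp P j x z \<in> carrier (Sp P (m + l - 1) (e + f))" by (rule pcomp_in[OF a(2,3,6,7)]) auto
  have 2: "pcomp P (i + 1) y (pcomp P j x z) \<in> carrier S"
    unfolding S_def by (rule pcomp_in[OF u(2) xz]) (use a in auto)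
  have "pcomp P (i + j - 1 + 1) (sign_of K (r * e) \<odot>\<^bsub>Sp P (n + m) (d + e + r)\<^esub> pcomp P (i + 1) y x) z =
    sign_of K (r * e) \<odot>\<^bsub>S\<^esub> pcomp P (i + j - 1 + 1) (pcomp P (i + 1) y x) z"
    unfolding S_def by (rule pcomp_linear_left(2)[OF a(3) _ _ _ _ 1]) (use a in auto)
  also have "pcomp P (i + j - 1 + 1) (pcomp P (i + 1) y x) z = pcomp P (i + 1) y (pcomp P j x z)"
    by (rule pcomp_sequential'[OF u(2) a(2,3)]) (use a in auto)
  finally show "mark_ract r (n + m - 1) (d + e) l f (i + j - 1) (mark_ract r n d m e i u x) z =
    mark_ract r n d (m + l - 1) (e + f) i u (pcomp P j x z)"
    using 2 S u(1) sign_smult_smult[of _ "n + m + l - 1" "d + e + f + r", folded S_def] n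
    by (simp add: mark_ract_def algebra_simps)
next
  fix x u z n d m e l f i j
  assume a: "x \<in> carrier (Sp P n d)" "u \<in> carrier (marked r m e)" "z \<in> carrier (Sp P l f)"
    "1 \<le> i" "i \<le> n" "1 \<le> j" "j \<le> m"
  have m: "m \<noteq> 0" using a by auto
  obtain y where u: "u = (y, \<zero>)" "y \<in> carrier (Sp P (m + 1) (e + r))"
    using a(2) m by (auto elim: marked_cases)
  define S where "S = Sp P (n + m + l - 1) (d + e + f + r)"
  have S: "Sp P (n + m - 1 + l) (d + e + f + r) = S" "Sp P (n + (m + l - 1)) (d + (e + f) + r) = S"
    using a by (auto simp: S_def algebra_simps intro!: arg_cong2[where f = "Sp P"])
  have j: "1 \<le> j + 1" "j + 1 \<le> m + 1" using a by auto
  have xy: "pcomp P i x y \<in> carrier (Sp P (n + m) (d + e + r))" by (rule pcomp_in[OF a(1) u(2) a(4,5)]) auto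
  have yz: "pcomp P (j + 1) y z \<in> carrier (Sp P (m + l) (e + f + r))" by (rule pcomp_in[OF u(2) a(3) j]) auto
  have xyz: "pcomp P i x (pcomp P (j + 1) y z) \<in> carrier S"
    unfolding S_def by (rule pcomp_in[OF a(1) yz a(4,5)]) (use a in auto)
  have g: "gam i permutes {1..n + m}" "gam i permutes {1..n + m + l - 1}" using a by (auto intro!: gam_permutes)
  have gxy: "act P (gam i) (pcomp P i x y) \<in> carrier (Sp P (n + m) (d + e + r))" by (rule act_closed[OF xy g(1)])
  have gi: "gam i (i + j) = i + j" using a by (simp add: gam_def)
  have "pcomp P (i + j) (act P (gam i) (pcomp P i x y)) z =
      act P (block_outer (i + j) l (gam i)) (pcomp P (gam i (i + j)) (pcomp P i x y) z)"
    by (rule pcomp_act_left[OF xy a(3) _ _ g(1)]) (use a in auto)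
  also have "\<dots> = act P (gam i) (pcomp P i x (pcomp P (j + 1) y z))"
    using block_outer_gam[of i "i + j" l] a gi pcomp_sequential'[OF a(1) u(2) a(3-5) j, of "i + j"] by simp
  finally have 1: "pcomp P (i + j) (act P (gam i) (pcomp P i x y)) z = act P (gam i) (pcomp P i x (pcomp P (j + 1) y z))" .
  have 2: "pcomp P i x (sign_of K (r * f) \<odot>\<^bsub>Sp P (m + l) (e + f + r)\<^esub> pcomp P (j + 1) y z) =
    sign_of K (r * f) \<odot>\<^bsub>S\<^esub> pcomp P i x (pcomp P (j + 1) y z)"
    unfolding S_def by (rule pcomp_linear_right(2)[OF a(1,4,5) _ _ yz]) (use a in auto)
  have 3: "act P (gam i) (sign_of K (r * f) \<odot>\<^bsub>S\<^esub> pcomp P i x (pcomp P (j + 1) y z)) =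
    sign_of K (r * f) \<odot>\<^bsub>S\<^esub> act P (gam i) (pcomp P i x (pcomp P (j + 1) y z))"
    unfolding S_def by (rule act_smult[OF _ xyz[unfolded S_def] g(2)]) simp
  have 4: "act P (gam i) (pcomp P i x (pcomp P (j + 1) y z)) \<in> carrier S"
    unfolding S_def by (rule act_closed[OF xyz[unfolded S_def] g(2)])
  have "i + j - 1 + 1 = i + j" using a by simp
  moreover have "v \<in> carrier S \<Longrightarrow> k \<in> carrier K \<Longrightarrow> k \<odot>\<^bsub>S\<^esub> v \<oplus>\<^bsub>S\<^esub> \<zero>\<^bsub>S\<^esub> = k \<odot>\<^bsub>S\<^esub> v" for v k unfolding S_def by simp
  moreover have "\<not> (m + l - 1 = 0 \<and> e + f = - r \<and> m = 0)" using m by simp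
  moreover have "\<zero> \<odot>\<^bsub>Sp P n d\<^esub> act P (gam i) x = \<zero>\<^bsub>S\<^esub>" if "m + l - 1 = 0" "e + f = - r"
  proof -
    have "S = Sp P n d" unfolding S_def using m that by (intro arg_cong2[where f = "Sp P"]) auto
    then show ?thesis using act_closed[OF a(1) gam_permutes[OF a(4,5)]] by simp
  qed
  ultimately show "mark_ract r (n + m - 1) (d + e) l f (i + j - 1) (mark_lact r n d m e i x u) z =
    mark_lact r n d (m + l - 1) (e + f) i x (mark_ract r m e l f j u z)"
    using 1 2 3 4 S u(1) gxy m
    by (simp add: mark_ract_def mark_lact_def)
next
  fix x y u n d m e l f i j
  assume a: "x \<in> carrier (Sp P n d)" "y \<in> carrier (Sp P m e)" "u \<in> carrier (marked r l f)"
    "1 \<le> i" "i \<le> n" "1 \<le> j" "j \<le> m"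
  obtain w c where u: "u = (w, c)" "w \<in> carrier (Sp P (l + 1) (f + r))" "c \<in> carrier K"
    "c \<noteq> \<zero> \<Longrightarrow> l = 0 \<and> f = - r" using a(3) by (rule marked_cases) blast
  define S where "S = Sp P (n + m + l - 1) (d + e + f + r)"
  have S: "Sp P (n + m - 1 + l) (d + e + f + r) = S" "Sp P (n + (m + l - 1)) (d + (e + f) + r) = S"
    using a by (auto simp: S_def algebra_simps intro!: arg_cong2[where f = "Sp P"])
  have xy: "pcomp P i x y \<in> carrier (Sp P (n + m - 1) (d + e))" by (rule pcomp_in[OF a(1,2,4,5)]) auto
  have yw: "pcomp P j y w \<in> carrier (Sp P (m + l) (e + f + r))" by (rule pcomp_in[OF a(2) u(2) a(6,7)]) auto
  have gj: "gam j permutes {1..m + l}" "gam j permutes {1..m}" using a by (auto intro!: gam_permutes)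
  have gyw: "act P (gam j) (pcomp P j y w) \<in> carrier (Sp P (m + l) (e + f + r))" by (rule act_closed[OF yw gj(1)])
  have gi: "gam i permutes {1..n + m + l - 1}" "gam i permutes {1..n + m - 1}" using a by (auto intro!: gam_permutes)
  have gij: "gam (i + j - 1) permutes {1..n + m + l - 1}" "gam (i + j - 1) permutes {1..n + m - 1}"
    using a by (auto intro!: gam_permutes)
  have bp: "block_inner i (m + l) (gam j) permutes {1..n + m + l - 1}" "block_inner i m (gam j) permutes {1..n + m - 1}"
    using block_inner_permutes[OF gj(1) a(4,5)] block_inner_permutes[OF gj(2) a(4,5)] by (simp_all add: add.assoc)
  have xyw: "pcomp P i x (pcomp P j y w) \<in> carrier S"
    unfolding S_def by (rule pcomp_in[OF a(1) yw a(4,5)]) (use a in auto)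
  have "act P (gam i) (pcomp P i x (act P (gam j) (pcomp P j y w))) =
    act P (gam i) (act P (block_inner i (m + l) (gam j)) (pcomp P i x (pcomp P j y w)))"
    using pcomp_act_right[OF a(1) yw a(4,5) gj(1)] by simp
  also have "\<dots> = act P (gam (i + j - 1)) (pcomp P i x (pcomp P j y w))"
    using act_act[OF xyw[unfolded S_def] bp(1) gi(1)] block_inner_gam[OF a(4,6), of "m + l"] a by simp
  also have "\<dots> = act P (gam (i + j - 1)) (pcomp P (i + j - 1) (pcomp P i x y) w)"
    using pcomp_sequential[OF a(1,2) u(2) a(4-7)] by simp
  finally have 1: "act P (gam i) (pcomp P i x (act P (gam j) (pcomp P j y w))) =
    act P (gam (i + j - 1)) (pcomp P (i + j - 1) (pcomp P i x y) w)" .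
  have cl1: "act P (gam (i + j - 1)) (pcomp P (i + j - 1) (pcomp P i x y) w) \<in> carrier S"
    using act_closed[OF xyw[unfolded S_def] gij(1)] pcomp_sequential[OF a(1,2) u(2) a(4-7)] by (simp add: S_def)
  show "mark_lact r (n + m - 1) (d + e) l f (i + j - 1) (pcomp P i x y) u =
    mark_lact r n d (m + l - 1) (e + f) i x (mark_lact r m e l f j y u)"
  proof (cases "l = 0 \<and> f = - r")
    case True
    have gy: "act P (gam j) y \<in> carrier (Sp P m e)" by (rule act_closed[OF a(2) gj(2)])
    have S': "S = Sp P (n + m - 1) (d + e)" using True by (simp add: S_def)
    have yw': "pcomp P j y w \<in> carrier (Sp P m e)" using yw True by simp
    have gyw': "act P (gam j) (pcomp P j y w) \<in> carrier (Sp P m e)" using gyw True by simp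
    have "pcomp P i x (act P (gam j) (pcomp P j y w) \<oplus>\<^bsub>Sp P m e\<^esub> c \<odot>\<^bsub>Sp P m e\<^esub> act P (gam j) y) =
      pcomp P i x (act P (gam j) (pcomp P j y w)) \<oplus>\<^bsub>S\<^esub> c \<odot>\<^bsub>S\<^esub> pcomp P i x (act P (gam j) y)"
      using pcomp_add_right[OF a(1) gyw', of "c \<odot>\<^bsub>Sp P m e\<^esub> act P (gam j) y" i] gy u(3) a
        pcomp_smult_right[OF u(3) a(1) gy a(4,5)] by (simp add: S')
    moreover have "act P (gam i) (pcomp P i x (act P (gam j) (pcomp P j y w)) \<oplus>\<^bsub>S\<^esub> c \<odot>\<^bsub>S\<^esub> pcomp P i x (act P (gam j) y)) =
      act P (gam i) (pcomp P i x (act P (gam j) (pcomp P j y w))) \<oplus>\<^bsub>S\<^esub> c \<odot>\<^bsub>S\<^esub> act P (gam i) (pcomp P i x (act P (gam j) y))"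
      using pcomp_closed[OF a(1) gyw' a(4,5)] pcomp_closed[OF a(1) gy a(4,5)] u(3)
      by (simp add: S' act_add[OF _ _ gi(2)] act_smult[OF _ _ gi(2)])
    moreover have "act P (gam i) (pcomp P i x (act P (gam j) y)) = act P (gam (i + j - 1)) (pcomp P i x y)"
      using pcomp_act_right[OF a(1,2,4,5) gj(2)] act_act[OF xy bp(2) gi(2)] block_inner_gam[OF a(4,6,7)] by simp
    moreover have "\<zero> \<odot>\<^bsub>Sp P n d\<^esub> act P (gam i) x = \<zero>\<^bsub>Sp P n d\<^esub>"
      using act_closed[OF a(1) gam_permutes[OF a(4,5)]] by simp
    moreover have "m \<noteq> 0" using a by simp
    moreover have "m + l - 1 = 0 \<and> e + f = - r \<Longrightarrow> S = Sp P n d" using True a unfolding S_def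
      by (intro arg_cong2[where f = "Sp P"]) auto
    moreover have "act P (gam (i + j - 1)) (pcomp P (i + j - 1) (pcomp P i x y) w) \<oplus>\<^bsub>S\<^esub> c \<odot>\<^bsub>S\<^esub> act P (gam (i + j - 1)) (pcomp P i x y)
        \<in> carrier S"
      using cl1 u(3) act_closed[OF xy gij(2)] by (simp add: S')
    ultimately show ?thesis
      using 1 True u(1) S S'
      by (simp add: mark_lact_def) (auto simp: S')
  next
    case False
    then have c: "c = \<zero>" using u(4) by blast
    have "\<zero> \<odot>\<^bsub>Sp P n d\<^esub> act P (gam i) x = \<zero>\<^bsub>Sp P n d\<^esub>"
      using act_closed[OF a(1) gam_permutes[OF a(4,5)]] by simp
    moreover have "m + l - 1 = 0 \<and> e + f = - r \<Longrightarrow> S = Sp P n d" using a unfolding S_def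
      by (intro arg_cong2[where f = "Sp P"]) auto
    moreover have "v \<in> carrier S \<Longrightarrow> v \<oplus>\<^bsub>S\<^esub> \<zero>\<^bsub>S\<^esub> = v" for v unfolding S_def by simp
    ultimately show ?thesis
      using 1 False u(1) S cl1 gyw c
      by (auto simp add: mark_lact_def)
  qed
next
  fix u x z n d m e l f i k
  assume a: "u \<in> carrier (marked r n d)" "x \<in> carrier (Sp P m e)" "z \<in> carrier (Sp P l f)"
    "1 \<le> i" "i < k" "k \<le> n"
  have n: "n \<noteq> 0" using a by auto
  obtain y where u: "u = (y, \<zero>)" "y \<in> carrier (Sp P (n + 1) (d + r))"
    using a(1) n by (auto elim: marked_cases)
  define S where "S = Sp P (n + m + l - 1) (d + e + f + r)"
  have S: "Sp P (n + m - 1 + l) (d + e + f + r) = S" "Sp P (n + l - 1 + m) (d + f + e + r) = S"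
    "Sp P (n + m + l - 2 + 1) (d + e + f + r) = S"
    using a by (auto simp: S_def algebra_simps intro!: arg_cong2[where f = "Sp P"])
  have 1: "pcomp P (i + 1) y x \<in> carrier (Sp P (n + m) (d + e + r))"
    by (rule pcomp_in[OF u(2) a(2)]) (use a in auto)
  have 2: "pcomp P (k + 1) y z \<in> carrier (Sp P (n + l) (d + f + r))"
    by (rule pcomp_in[OF u(2) a(3)]) (use a in auto)
  have 3: "pcomp P (i + 1) (pcomp P (k + 1) y z) x \<in> carrier S"
    unfolding S_def by (rule pcomp_in[OF 2 a(2)]) (use a in auto)
  have 4: "pcomp P (k + m - 1 + 1) (sign_of K (r * e) \<odot>\<^bsub>Sp P (n + m) (d + e + r)\<^esub> pcomp P (i + 1) y x) z =
    sign_of K (r * e) \<odot>\<^bsub>S\<^esub> pcomp P (k + m - 1 + 1) (pcomp P (i + 1) y x) z"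
    unfolding S_def by (rule pcomp_linear_left(2)[OF a(3) _ _ _ _ 1]) (use a in auto)
  have 5: "pcomp P (i + 1) (sign_of K (r * f) \<odot>\<^bsub>Sp P (n + l) (d + f + r)\<^esub> pcomp P (k + 1) y z) x =
    sign_of K (r * f) \<odot>\<^bsub>S\<^esub> pcomp P (i + 1) (pcomp P (k + 1) y z) x"
    unfolding S_def by (rule pcomp_linear_left(2)[OF a(2) _ _ _ _ 2]) (use a in auto)
  have 6: "pcomp P (k + m - 1 + 1) (pcomp P (i + 1) y x) z =
    sign_of K (e * f) \<odot>\<^bsub>S\<^esub> pcomp P (i + 1) (pcomp P (k + 1) y z) x"
    unfolding S_def by (rule pcomp_parallel'[OF u(2) a(2,3)]) (use a in auto)
  have 7: "n + m - 1 + 1 = n + m" "n + l - 1 + 1 = n + l" using n by auto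
  show "mark_ract r (n + m - 1) (d + e) l f (k + m - 1) (mark_ract r n d m e i u x) z =
    sign_of K (e * f) \<odot>\<^bsub>marked r (n + m + l - 2) (d + e + f)\<^esub>
      mark_ract r (n + l - 1) (d + f) m e i (mark_ract r n d l f k u z) x"
    using 3 4 5 6 7 S u(1) sign_smult_smult[of _ "n + m + l - 1" "d + e + f + r", folded S_def]
    by (simp add: mark_ract_def algebra_simps)
next
  fix x u z n d m e l f i k
  assume a: "x \<in> carrier (Sp P n d)" "u \<in> carrier (marked r m e)" "z \<in> carrier (Sp P l f)"
    "1 \<le> i" "i < k" "k \<le> n"
  have i: "i \<le> n" "1 \<le> k" using a by auto
  obtain y c where u: "u = (y, c)" "y \<in> carrier (Sp P (m + 1) (e + r))" "c \<in> carrier K"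
    "c \<noteq> \<zero> \<Longrightarrow> m = 0 \<and> e = - r" using a(2) by (rule marked_cases) blast
  define S where "S = Sp P (n + m + l - 1) (d + e + f + r)"
  have S: "Sp P (n + m - 1 + l) (d + e + f + r) = S" "Sp P (n + l - 1 + m) (d + f + e + r) = S"
    "Sp P (n + m + l - 2 + 1) (d + e + f + r) = S"
    using a by (auto simp: S_def algebra_simps intro!: arg_cong2[where f = "Sp P"])
  note SS = sign_smult_smult[of _ "n + m + l - 1" "d + e + f + r", folded S_def]
  have xy: "pcomp P i x y \<in> carrier (Sp P (n + m) (d + e + r))" by (rule pcomp_in[OF a(1) u(2) a(4) i(1)]) auto
  have xz: "pcomp P k x z \<in> carrier (Sp P (n + l - 1) (d + f))" by (rule pcomp_in[OF a(1,3) i(2) a(6)]) auto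
  have xzy: "pcomp P i (pcomp P k x z) y \<in> carrier S"
    unfolding S_def by (rule pcomp_in[OF xz u(2) a(4)]) (use a in auto)
  have g: "gam i permutes {1..n + m}" "gam i permutes {1..n}" "gam i permutes {1..n + m + l - 1}" "gam i permutes {1..n + l - 1}"
    using a by (auto intro!: gam_permutes)
  have gxy: "act P (gam i) (pcomp P i x y) \<in> carrier (Sp P (n + m) (d + e + r))" by (rule act_closed[OF xy g(1)])
  have gx: "act P (gam i) x \<in> carrier (Sp P n d)" by (rule act_closed[OF a(1) g(2)])
  have gk: "gam i (k + m) = k + m" "gam i k = k" using a by (auto simp: gam_def)
  have ik: "i < k + m" using a by simp
  have "pcomp P (k + m) (act P (gam i) (pcomp P i x y)) z =
      act P (block_outer (k + m) l (gam i)) (pcomp P (gam i (k + m)) (pcomp P i x y) z)"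
    by (rule pcomp_act_left[OF xy a(3) _ _ g(1)]) (use a in auto)
  also have "\<dots> = act P (gam i) (sign_of K ((e + r) * f) \<odot>\<^bsub>S\<^esub> pcomp P i (pcomp P k x z) y)"
    unfolding block_outer_gam[OF a(4) ik] gk S_def
    by (subst pcomp_parallel'[OF a(1) u(2) a(3-6)]) (use a in auto)
  also have "\<dots> = sign_of K ((e + r) * f) \<odot>\<^bsub>S\<^esub> act P (gam i) (pcomp P i (pcomp P k x z) y)"
    unfolding S_def by (rule act_smult[OF _ xzy[unfolded S_def] g(3)]) simp
  finally have 1: "pcomp P (k + m) (act P (gam i) (pcomp P i x y)) z =
    sign_of K ((e + r) * f) \<odot>\<^bsub>S\<^esub> act P (gam i) (pcomp P i (pcomp P k x z) y)" .
  have gxzy: "act P (gam i) (pcomp P i (pcomp P k x z) y) \<in> carrier S"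
    unfolding S_def by (rule act_closed[OF xzy[unfolded S_def] g(3)])
  have k1: "k + m - 1 + 1 = k + m" using i by simp
  \<comment> \<open>The parallel axiom sees the degree \<open>e + r\<close> of the operation with
    its marked input, and \<open>mark_ract\<close> contributes \<open>r * f\<close>; the two
    occurrences of \<open>r * f\<close> cancel.\<close>
  have sg: "sign_of K (r * f + (e + r) * f) = sign_of K (e * f)"
    by (rule sign_of_cong) (cases "even r"; cases "even e"; cases "even f"; simp)
  show "mark_ract r (n + m - 1) (d + e) l f (k + m - 1) (mark_lact r n d m e i x u) z =
    sign_of K (e * f) \<odot>\<^bsub>marked r (n + m + l - 2) (d + e + f)\<^esub>
      mark_lact r (n + l - 1) (d + f) m e i (pcomp P k x z) u"
  proof (cases "m = 0 \<and> e = - r")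
    case True
    have S': "S = Sp P (n + l - 1) (d + f)" using True by (simp add: S_def)
    have gxy': "act P (gam i) (pcomp P i x y) \<in> carrier (Sp P n d)" using gxy True by simp
    have "pcomp P k (act P (gam i) x) z = act P (gam i) (pcomp P k x z)"
      using pcomp_act_left[OF a(1,3) i(2) a(6) g(2)] block_outer_gam[OF a(4,5)] gk by simp
    then have "pcomp P k (act P (gam i) (pcomp P i x y) \<oplus>\<^bsub>Sp P n d\<^esub> c \<odot>\<^bsub>Sp P n d\<^esub> act P (gam i) x) z =
      pcomp P k (act P (gam i) (pcomp P i x y)) z \<oplus>\<^bsub>S\<^esub> c \<odot>\<^bsub>S\<^esub> act P (gam i) (pcomp P k x z)"
      using pcomp_add_left[OF gxy' _ a(3) i(2) a(6), of "c \<odot>\<^bsub>Sp P n d\<^esub> act P (gam i) x"]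
        pcomp_smult_left[OF u(3) gx a(3) i(2) a(6)] u(3) gx by (simp add: S')
    moreover have gxz: "act P (gam i) (pcomp P k x z) \<in> carrier S" unfolding S' by (rule act_closed[OF xz g(4)])
    \<comment> \<open>The scalar term gets its sign from \<open>mark_ract\<close> alone; as
      \<open>e = - r\<close> here, it is the sign for \<open>e * f\<close>.\<close>
    moreover have "sign_of K (r * f) \<odot>\<^bsub>S\<^esub> (c \<odot>\<^bsub>S\<^esub> v) = sign_of K (e * f) \<odot>\<^bsub>S\<^esub> (c \<odot>\<^bsub>S\<^esub> v)" for v
      using True by (simp add: sign_of_def)
    moreover have "k' \<in> carrier K \<Longrightarrow> v \<in> carrier S \<Longrightarrow> w \<in> carrier S \<Longrightarrow> k' \<odot>\<^bsub>S\<^esub> (v \<oplus>\<^bsub>S\<^esub> w) = k' \<odot>\<^bsub>S\<^esub> v \<oplus>\<^bsub>S\<^esub> k' \<odot>\<^bsub>S\<^esub> w"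
      "k' \<in> carrier K \<Longrightarrow> v \<in> carrier S \<Longrightarrow> k' \<odot>\<^bsub>S\<^esub> v \<in> carrier S" for k' v w
      unfolding S_def by (auto simp: Sp_r_distr)
    moreover have "sign_of K (r * f) \<odot>\<^bsub>S\<^esub> (sign_of K ((e + r) * f) \<odot>\<^bsub>S\<^esub> act P (gam i) (pcomp P i (pcomp P k x z) y)) =
      sign_of K (e * f) \<odot>\<^bsub>S\<^esub> act P (gam i) (pcomp P i (pcomp P k x z) y)"
      using SS[OF gxzy] sg by simp
    ultimately show ?thesis
      using True 1 u(1,3) k1 S gxzy
      by (simp add: mark_ract_def mark_lact_def)
  next
    case False
    have "k' \<in> carrier K \<Longrightarrow> v \<in> carrier S \<Longrightarrow> k' \<odot>\<^bsub>S\<^esub> (v \<oplus>\<^bsub>S\<^esub> \<zero>\<^bsub>S\<^esub>) = k' \<odot>\<^bsub>S\<^esub> v" for k' v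
      unfolding S_def by simp
    then show ?thesis
      using False 1 u(1,3) k1 S gxzy gxy SS[OF gxzy, of "r * f" "(e + r) * f"] sg
      by (auto simp add: mark_ract_def mark_lact_def)
  qed
next
  fix x y u n d m e l f i k
  assume a: "x \<in> carrier (Sp P n d)" "y \<in> carrier (Sp P m e)" "u \<in> carrier (marked r l f)"
    "1 \<le> i" "i < k" "k \<le> n"
  have i: "i \<le> n" "1 \<le> k" using a by auto
  obtain w c where u: "u = (w, c)" "w \<in> carrier (Sp P (l + 1) (f + r))" "c \<in> carrier K"
    "c \<noteq> \<zero> \<Longrightarrow> l = 0 \<and> f = - r" using a(3) by (rule marked_cases) blast
  define S where "S = Sp P (n + m + l - 1) (d + e + f + r)"
  have S: "Sp P (n + m - 1 + l) (d + e + f + r) = S" "Sp P (n + l - 1 + m) (d + f + e + r) = S"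
    "Sp P (n + m + l - 2 + 1) (d + e + f + r) = S"
    using a by (auto simp: S_def algebra_simps intro!: arg_cong2[where f = "Sp P"])
  note SS = sign_smult_smult[of _ "n + m + l - 1" "d + e + f + r", folded S_def]
  have xy: "pcomp P i x y \<in> carrier (Sp P (n + m - 1) (d + e))" by (rule pcomp_in[OF a(1,2,4) i(1)]) auto
  have xw: "pcomp P k x w \<in> carrier (Sp P (n + l) (d + f + r))" by (rule pcomp_in[OF a(1) u(2) i(2) a(6)]) auto
  have xwy: "pcomp P i (pcomp P k x w) y \<in> carrier S"
    unfolding S_def by (rule pcomp_in[OF xw a(2) a(4)]) (use a in auto)
  have gk: "gam k permutes {1..n + l}" "gam k permutes {1..n}" using a by (auto intro!: gam_permutes)
  have gkm: "gam (k + m - 1) permutes {1..n + m + l - 1}" "gam (k + m - 1) permutes {1..n + m - 1}"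
    using a by (auto intro!: gam_permutes)
  have gxw: "act P (gam k) (pcomp P k x w) \<in> carrier (Sp P (n + l) (d + f + r))" by (rule act_closed[OF xw gk(1)])
  have gx: "act P (gam k) x \<in> carrier (Sp P n d)" by (rule act_closed[OF a(1) gk(2)])
  have gki: "gam k (i + 1) = i" using a by (auto simp: gam_def)
  have "pcomp P (i + 1) (act P (gam k) (pcomp P k x w)) y =
      act P (block_outer (i + 1) m (gam k)) (pcomp P (gam k (i + 1)) (pcomp P k x w) y)"
    by (rule pcomp_act_left[OF xw a(2) _ _ gk(1)]) (use a in auto)
  then have 1: "pcomp P (i + 1) (act P (gam k) (pcomp P k x w)) y = act P (gam (k + m - 1)) (pcomp P i (pcomp P k x w) y)"
    unfolding block_outer_gam_shift[OF a(4,5)] gki .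
  have "pcomp P (k + m - 1) (pcomp P i x y) w = sign_of K (e * (f + r)) \<odot>\<^bsub>S\<^esub> pcomp P i (pcomp P k x w) y"
    unfolding S_def by (rule pcomp_parallel'[OF a(1,2) u(2) a(4-6)]) (use a in auto)
  moreover have "act P (gam (k + m - 1)) (sign_of K (e * (f + r)) \<odot>\<^bsub>S\<^esub> pcomp P i (pcomp P k x w) y) =
    sign_of K (e * (f + r)) \<odot>\<^bsub>S\<^esub> act P (gam (k + m - 1)) (pcomp P i (pcomp P k x w) y)"
    unfolding S_def by (rule act_smult[OF _ xwy[unfolded S_def] gkm(1)]) simp
  ultimately have 2: "act P (gam (k + m - 1)) (pcomp P (k + m - 1) (pcomp P i x y) w) =
    sign_of K (e * (f + r)) \<odot>\<^bsub>S\<^esub> act P (gam (k + m - 1)) (pcomp P i (pcomp P k x w) y)" by simp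
  have gxwy: "act P (gam (k + m - 1)) (pcomp P i (pcomp P k x w) y) \<in> carrier S"
    unfolding S_def by (rule act_closed[OF xwy[unfolded S_def] gkm(1)])
  have sg: "sign_of K (e * f + r * e) = sign_of K (e * (f + r))"
    by (rule sign_of_cong) (cases "even r"; cases "even e"; cases "even f"; simp)
  have n1: "n + l - 1 + 1 = n + l" using i a(4) by linarith
  show "mark_lact r (n + m - 1) (d + e) l f (k + m - 1) (pcomp P i x y) u =
    sign_of K (e * f) \<odot>\<^bsub>marked r (n + m + l - 2) (d + e + f)\<^esub>
      mark_ract r (n + l - 1) (d + f) m e i (mark_lact r n d l f k x u) y"
  proof (cases "l = 0 \<and> f = - r")
    case True
    have S': "S = Sp P (n + m - 1) (d + e)" using True by (simp add: S_def)
    have gxw': "act P (gam k) (pcomp P k x w) \<in> carrier (Sp P n d)" using gxw True by simp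
    have i1: "1 \<le> i + 1" "i + 1 \<le> n" using a by auto
    have "pcomp P (i + 1) (act P (gam k) x) y = act P (gam (k + m - 1)) (pcomp P i x y)"
      using pcomp_act_left[OF a(1,2) i1 gk(2)] block_outer_gam_shift[OF a(4,5)] gki by simp
    then have "pcomp P (i + 1) (act P (gam k) (pcomp P k x w) \<oplus>\<^bsub>Sp P n d\<^esub> c \<odot>\<^bsub>Sp P n d\<^esub> act P (gam k) x) y =
      pcomp P (i + 1) (act P (gam k) (pcomp P k x w)) y \<oplus>\<^bsub>S\<^esub> c \<odot>\<^bsub>S\<^esub> act P (gam (k + m - 1)) (pcomp P i x y)"
      using pcomp_add_left[OF gxw' _ a(2) i1, of "c \<odot>\<^bsub>Sp P n d\<^esub> act P (gam k) x"]
        pcomp_smult_left[OF u(3) gx a(2) i1] u(3) gx by (simp add: S')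
    moreover have gxz: "act P (gam (k + m - 1)) (pcomp P i x y) \<in> carrier S" unfolding S' by (rule act_closed[OF xy gkm(2)])
    moreover have "k' \<in> carrier K \<Longrightarrow> v \<in> carrier S \<Longrightarrow> v' \<in> carrier S \<Longrightarrow> k' \<odot>\<^bsub>S\<^esub> (v \<oplus>\<^bsub>S\<^esub> v') = k' \<odot>\<^bsub>S\<^esub> v \<oplus>\<^bsub>S\<^esub> k' \<odot>\<^bsub>S\<^esub> v'"
      "k' \<in> carrier K \<Longrightarrow> v \<in> carrier S \<Longrightarrow> k' \<odot>\<^bsub>S\<^esub> v \<in> carrier S" for k' v v'
      unfolding S_def by (auto simp: Sp_r_distr)
    moreover have "sign_of K (e * f) \<odot>\<^bsub>S\<^esub> (sign_of K (r * e) \<odot>\<^bsub>S\<^esub> v) = sign_of K (e * (f + r)) \<odot>\<^bsub>S\<^esub> v" if "v \<in> carrier S" for v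
      using SS[OF that] sg by simp
    \<comment> \<open>Here \<open>f = - r\<close>, so the signs of the axiom and of
      \<open>mark_ract\<close> cancel on the scalar term.\<close>
    moreover have "sign_of K (e * (f + r)) = \<one>" using True by (simp add: sign_of_def)
    moreover have "v \<in> carrier S \<Longrightarrow> \<one> \<odot>\<^bsub>S\<^esub> v = v" for v unfolding S_def by simp
    ultimately show ?thesis
      using True 1 2 u(1,3) n1 S gxwy
      by (simp add: mark_ract_def mark_lact_def)
  next
    case False
    have "v \<in> carrier S \<Longrightarrow> k' \<in> carrier K \<Longrightarrow> k' \<odot>\<^bsub>S\<^esub> v \<oplus>\<^bsub>S\<^esub> \<zero>\<^bsub>S\<^esub> = k' \<odot>\<^bsub>S\<^esub> v" for v k'
      unfolding S_def by simp
    then show ?thesis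
      using False 1 2 u(1,3) n1 S gxwy gxw SS[OF gxwy, of "e * f" "r * e"] sg
      by (auto simp add: mark_ract_def mark_lact_def)
  qed
next
  fix u n d \<sigma> assume a: "u \<in> carrier (marked r n d)" "\<sigma> permutes {1..n}"
  note s = up_permutes[OF a(2)]
  obtain y c where u: "u = (y, c)" "y \<in> carrier (Sp P (n + 1) (d + r))" "c \<in> carrier K"
    "c \<noteq> \<zero> \<Longrightarrow> n = 0 \<and> d = - r" using a(1) by (rule marked_cases) blast
  show "mark_act \<sigma> u \<in> carrier (marked r n d)"
    using u act_closed[OF u(2) s] by (auto simp: mark_act_def)
  show "mark_act \<sigma> (u \<oplus>\<^bsub>marked r n d\<^esub> u') = mark_act \<sigma> u \<oplus>\<^bsub>marked r n d\<^esub> mark_act \<sigma> u'"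
    if "u' \<in> carrier (marked r n d)" for u'
    using that u act_add[OF u(2) _ s] by (auto simp: mark_act_def elim!: marked_cases)
  show "mark_act \<sigma> (k \<odot>\<^bsub>marked r n d\<^esub> u) = k \<odot>\<^bsub>marked r n d\<^esub> mark_act \<sigma> u" if "k \<in> carrier K" for k
    using that u act_smult[OF _ u(2) s] by (auto simp: mark_act_def)
  show "mark_act \<tau> (mark_act \<sigma> u) = mark_act (\<sigma> \<circ> \<tau>) u" if "\<tau> permutes {1..n}" for \<tau>
    using u act_act[OF u(2) s up_permutes[OF that]] up_comp[OF that] by (simp add: mark_act_def)
next
  show "mark_act id u = u" if "u \<in> carrier (marked r n d)" for u n d
    using that by (auto simp: mark_act_def act_id elim!: marked_cases)
qed

end

section \<open>Coproducts and the free presentation of a curved operad\<close>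

lemma hom_eval:
  assumes "graded_operad K P" "graded_operad K T" "graded_hom K P T f"
    and \<rho>: "\<And>n d g. g \<in> G n d \<Longrightarrow> \<rho> n d g \<in> carrier (Sp P n d)" and "wf_expr K G t"
  shows "f (arity t) (degree t) (eval_expr P \<rho> t) = eval_expr T (\<lambda>n d g. f n d (\<rho> n d g)) t"
proof -
  interpret P: graded_operad K P by fact
  have cl: "wf_expr K G t \<Longrightarrow> eval_expr P \<rho> t \<in> carrier (Sp P (arity t) (degree t))" for t
    by (rule P.eval_in_suboperad[OF P.suboperad_carrier \<rho>])
  note h = graded_homD[OF assms(3)]
  show ?thesis using assms(5)
  proof (induction t)
    case (Zero n d)
    then show ?case using graded_hom_zero[OF assms(1-3), of n d] by simp
  next
    case (Add s t)
    then have "wf_expr K G s" "wf_expr K G t" "arity t = arity s" "degree t = degree s" by auto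
    then show ?case using Add.IH h(2)[OF cl[of s], of "eval_expr P \<rho> t"] cl[of t] by simp
  next
    case (Smult c t)
    then show ?case using h(3)[OF _ cl[of t], of c] by simp
  next
    case (Comp i s t)
    then show ?case using h(4)[OF cl[of s] cl[of t], of i] by simp
  next
    case (Act \<sigma> t)
    then show ?case using h(5)[OF cl[of t], of \<sigma>] by simp
  qed simp
qed

lemma (in presentation) eval_presented: "wfe t \<Longrightarrow> eval_expr PP (\<lambda>n d g. cls (Gen n d g)) t = cls t"
  by (induction t) (simp_all add: presented_simps)

text \<open>The structure relations say precisely that labelling elements as generators is a
  homomorphism. Closure of \<open>P\<close> is assumed directly instead of
  \<open>graded_operad\<close>, so that \<open>restrict_operad\<close> is covered, whose closure
  comes from \<open>suboperad\<close>.\<close>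

lemma (in presentation) gen_hom:
  assumes R: "structure_relations K P h \<subseteq> R"
    and G: "\<And>n d x. x \<in> carrier (Sp P n d) \<Longrightarrow> h x \<in> G n d"
    and add: "\<And>n d x y. x \<in> carrier (Sp P n d) \<Longrightarrow> y \<in> carrier (Sp P n d) \<Longrightarrow> x \<oplus>\<^bsub>Sp P n d\<^esub> y \<in> carrier (Sp P n d)"
    and smult: "\<And>n d c x. c \<in> carrier K \<Longrightarrow> x \<in> carrier (Sp P n d) \<Longrightarrow> c \<odot>\<^bsub>Sp P n d\<^esub> x \<in> carrier (Sp P n d)"
    and comp: "\<And>n d m e i x y. x \<in> carrier (Sp P n d) \<Longrightarrow> y \<in> carrier (Sp P m e) \<Longrightarrow> i \<in> {1..n} \<Longrightarrow>
      pcomp P i x y \<in> carrier (Sp P (n + m - 1) (d + e))"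
    and act: "\<And>n d \<sigma> x. x \<in> carrier (Sp P n d) \<Longrightarrow> \<sigma> permutes {1..n} \<Longrightarrow> act P \<sigma> x \<in> carrier (Sp P n d)"
  shows "graded_hom K P PP (\<lambda>n d x. cls (Gen n d (h x)))"
  unfolding graded_hom_def
proof (intro conjI allI ballI impI)
  have wf: "x \<in> carrier (Sp P n d) \<Longrightarrow> wfe (Gen n d (h x))" for x n d by (simp add: G)
  have cl: "cls s = cls t" if "(s, t) \<in> structure_relations K P h" "wfe s" "wfe t"
    "arity s = arity t" "degree s = degree t" for s t
    using that R by (intro cls_eq pres_cong.rel) auto
  fix n d x assume x: "x \<in> carrier (Sp P n d)"
  show "cls (Gen n d (h x)) \<in> carrier (Sp PP n d)"
    by (rule cls_closed) (use wf[OF x] in auto)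
  show "cls (Gen n d (h (x \<oplus>\<^bsub>Sp P n d\<^esub> y))) = cls (Gen n d (h x)) \<oplus>\<^bsub>Sp PP n d\<^esub> cls (Gen n d (h y))"
    if y: "y \<in> carrier (Sp P n d)" for y
  proof -
    have w: "wfe (Add (Gen n d (h x)) (Gen n d (h y)))" using wf[OF x] wf[OF y] by simp
    have "(Add (Gen n d (h x)) (Gen n d (h y)), Gen n d (h (x \<oplus>\<^bsub>Sp P n d\<^esub> y))) \<in> structure_relations K P h"
      unfolding structure_relations_def using x y by blast
    from cl[OF this w wf[OF add[OF x y]]] show ?thesis
      by (simp add: add_presented[OF w])
  qed
  show "cls (Gen n d (h (c \<odot>\<^bsub>Sp P n d\<^esub> x))) = c \<odot>\<^bsub>Sp PP n d\<^esub> cls (Gen n d (h x))"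
    if c: "c \<in> carrier K" for c
  proof -
    have w: "wfe (Smult c (Gen n d (h x)))" using wf[OF x] c by simp
    have "(Smult c (Gen n d (h x)), Gen n d (h (c \<odot>\<^bsub>Sp P n d\<^esub> x))) \<in> structure_relations K P h"
      unfolding structure_relations_def using x c by blast
    from cl[OF this w wf[OF smult[OF c x]]] show ?thesis
      by (simp add: smult_presented[OF w])
  qed
  show "cls (Gen n d (h (act P \<sigma> x))) = act PP \<sigma> (cls (Gen n d (h x)))"
    if \<sigma>: "\<sigma> permutes {1..n}" for \<sigma>
  proof -
    have w: "wfe (Act \<sigma> (Gen n d (h x)))" using wf[OF x] \<sigma> by simp
    have "(Act \<sigma> (Gen n d (h x)), Gen n d (h (act P \<sigma> x))) \<in> structure_relations K P h"
      unfolding structure_relations_def using x \<sigma> by blast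
    from cl[OF this w wf[OF act[OF x \<sigma>]]] show ?thesis
      by (simp add: act_presented[OF w])
  qed
  show "cls (Gen (n + m - 1) (d + e) (h (pcomp P i x y))) = pcomp PP i (cls (Gen n d (h x))) (cls (Gen m e (h y)))"
    if y: "y \<in> carrier (Sp P m e)" and i: "i \<in> {1..n}" for m e y i
  proof -
    have w: "wfe (Comp i (Gen n d (h x)) (Gen m e (h y)))" using wf[OF x] wf[OF y] i by simp
    have "(Comp i (Gen n d (h x)) (Gen m e (h y)), Gen (n + m - 1) (d + e) (h (pcomp P i x y))) \<in> structure_relations K P h"
      unfolding structure_relations_def using x y i by blast
    from cl[OF this w wf[OF comp[OF x y i]]] show ?thesis
      by (simp add: pcomp_presented[OF w])
  qed
qed

lemma structure_relations_eval:
  assumes "graded_hom K P T f" "(s, t) \<in> structure_relations K P h"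
    and "\<And>n d x. x \<in> carrier (Sp P n d) \<Longrightarrow> \<rho> n d (h x) = f n d x"
    and "\<And>n d x y. x \<in> carrier (Sp P n d) \<Longrightarrow> y \<in> carrier (Sp P n d) \<Longrightarrow> x \<oplus>\<^bsub>Sp P n d\<^esub> y \<in> carrier (Sp P n d)"
    and "\<And>n d c x. c \<in> carrier K \<Longrightarrow> x \<in> carrier (Sp P n d) \<Longrightarrow> c \<odot>\<^bsub>Sp P n d\<^esub> x \<in> carrier (Sp P n d)"
    and "\<And>n d m e i x y. x \<in> carrier (Sp P n d) \<Longrightarrow> y \<in> carrier (Sp P m e) \<Longrightarrow> i \<in> {1..n} \<Longrightarrow>
      pcomp P i x y \<in> carrier (Sp P (n + m - 1) (d + e))"
    and "\<And>n d \<sigma> x. x \<in> carrier (Sp P n d) \<Longrightarrow> \<sigma> permutes {1..n} \<Longrightarrow> act P \<sigma> x \<in> carrier (Sp P n d)"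
  shows "eval_expr T \<rho> s = eval_expr T \<rho> t"
  using assms(2) graded_homD[OF assms(1)] assms(3-7)
  unfolding structure_relations_def by (auto simp: assms(3))

lemma restrict_operad_simps [simp]:
  "carrier (Sp (restrict_operad P H) n d) = H n d"
  "add (Sp (restrict_operad P H) n d) = add (Sp P n d)"
  "smult (Sp (restrict_operad P H) n d) = smult (Sp P n d)"
  "pcomp (restrict_operad P H) = pcomp P"
  "act (restrict_operad P H) = act P"
  by (simp_all add: restrict_operad_def)

text \<open>Half of the universal property of the coproduct: a pair of homomorphisms respects the
  structure relations of both factors. The first factor is a restriction because it will be the base
  of an object.\<close>

lemma coproduct_eval:
  assumes "graded_operad K T" "graded_hom K (restrict_operad P H) T f" "suboperad K P H"
    and "graded_hom K Q T g" "graded_operad K P" "graded_operad K Q"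
  shows "presentation_eval K (coproduct_gens (restrict_operad P H) Q) (coproduct_rels K (restrict_operad P H) Q) T
    (\<lambda>n d. case_sum (f n d) (g n d))"
proof -
  interpret T: graded_operad K T by fact
  interpret P: graded_operad K P by fact
  interpret Q: graded_operad K Q by fact
  show ?thesis
  proof unfold_locales
    show "x \<in> coproduct_gens (restrict_operad P H) Q n d \<Longrightarrow> case_sum (f n d) (g n d) x \<in> carrier (Sp T n d)" for n d x
      using graded_homD(1)[OF assms(2)] graded_homD(1)[OF assms(4)] by (auto simp: coproduct_gens_def)
    show "eval_expr T (\<lambda>n d. case_sum (f n d) (g n d)) s = eval_expr T (\<lambda>n d. case_sum (f n d) (g n d)) t"
      if "(s, t) \<in> coproduct_rels K (restrict_operad P H) Q" for s t
    proof (cases "(s, t) \<in> structure_relations K (restrict_operad P H) Inl")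
      case True
      show ?thesis by (rule structure_relations_eval[OF assms(2) True])
        (auto intro: P.suboperadD[OF assms(3)])
    next
      case False
      then have "(s, t) \<in> structure_relations K Q Inr" using that by (simp add: coproduct_rels_def)
      then show ?thesis by (rule structure_relations_eval[OF assms(4)])
        (auto intro: Q.pcomp_closed Q.act_closed)
    qed
  qed
qed

lemma (in field) kappa_graded_operad: "graded_operad R (kappa_operad R)"
proof -
  interpret presentation R kappa_gens "{}" ..
  show ?thesis unfolding kappa_operad_def by (rule presented_graded_operad)
qed

lemma (in graded_operad) kappa_eval:
  assumes "k \<in> carrier (Sp P 0 (-1))"
  shows "presentation_eval K kappa_gens {} P (\<lambda>n d u. k)"
  by unfold_locales (use assms in \<open>auto simp: kappa_gens_def split: if_splits\<close>)

lemma (in graded_operad) kappa_hom: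
  assumes "k \<in> carrier (Sp P 0 (-1))"
  shows "graded_hom K (kappa_operad K) P (\<lambda>n d. induced_map P (\<lambda>n d u. k))"
    and "induced_map P (\<lambda>n d u. k) (kappa_elem K) = k"
proof -
  interpret presentation_eval K kappa_gens "{}" P "\<lambda>n d u. k" by (rule kappa_eval[OF assms])
  show "graded_hom K (kappa_operad K) P (\<lambda>n d. induced_map P (\<lambda>n d u. k))"
    using induced_hom unfolding kappa_operad_def operad_hom_iff .
  show "induced_map P (\<lambda>n d u. k) (kappa_elem K) = k"
    using induced_cls[of "Gen 0 (-1) ()"] by (simp add: kappa_elem_def kappa_gens_def)
qed

lemma (in graded_operad) restrict_hom:
  assumes "suboperad K P H" shows "graded_hom K (restrict_operad P H) P (\<lambda>n d x. x)"
  unfolding graded_hom_def using suboperadD(1)[OF assms] by auto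

section \<open>Presentation of an object by its base and one generator\<close>

text \<open>The coproduct has every element of the operad generated by \<open>\<kappa>\<close> as a
  generator. Replacing them by a single generator means that a homomorphism or a derivation is
  determined by its values on the base and one further value.\<close>

definition curv_gens :: "('k, 'a) curv \<Rightarrow> nat \<Rightarrow> int \<Rightarrow> ('a + unit) set" where
  "curv_gens Q n d = base Q n d <+> kappa_gens n d"

definition curv_rels :: "('k, 'm) ring_scheme \<Rightarrow> ('k, 'a) curv \<Rightarrow> (('k, 'a + unit) expr \<times> ('k, 'a + unit) expr) set" where
  "curv_rels K Q = structure_relations K (base_operad Q) Inl"

text \<open>The conditions on an object that do not mention the differential. They are kept apart
  because the curved L-infinity operad needs its weight grading before the conditions on its
  differential can be verified.\<close>

locale curved_grading = graded_operad K "op Q" for K :: "('k, 'm) ring_scheme" (structure) and Q :: "('k, 'a) curv" +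
  assumes base_sub: "suboperad K (op Q) (base Q)"
    and curvature_closed: "curvature Q \<in> carrier (Sp (op Q) 0 (-1))"
    and natural_iso: "natural_map Q \<in> operad_iso K (base_kappa K Q) (op Q)"
begin

abbreviation "P \<equiv> op Q"
abbreviation "\<kappa> \<equiv> curvature Q"
abbreviation "B \<equiv> base Q"

lemmas baseD = suboperadD[OF base_sub]

lemma base_closed: "x \<in> B n d \<Longrightarrow> x \<in> carrier (Sp P n d)"
  using baseD(1) by blast

lemma presentation_evalI:
  assumes "graded_operad K T" "graded_hom K (base_operad Q) T f" "k \<in> carrier (Sp T 0 (-1))"
  shows "presentation_eval K (curv_gens Q) (curv_rels K Q) T (\<lambda>n d. case_sum (f n d) (\<lambda>u. k))"
proof -
  interpret T: graded_operad K T by fact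
  show ?thesis
  proof unfold_locales
    show "x \<in> curv_gens Q n d \<Longrightarrow> case_sum (f n d) (\<lambda>u. k) x \<in> carrier (Sp T n d)" for n d x
      using graded_homD(1)[OF assms(2)] assms(3)
      by (auto simp: curv_gens_def kappa_gens_def base_operad_def split: if_splits)
    show "eval_expr T (\<lambda>n d. case_sum (f n d) (\<lambda>u. k)) s = eval_expr T (\<lambda>n d. case_sum (f n d) (\<lambda>u. k)) t"
      if "(s, t) \<in> curv_rels K Q" for s t
      using that unfolding curv_rels_def
      by (rule structure_relations_eval[OF assms(2)]) (auto simp: base_operad_def intro: baseD)
  qed
qed

sublocale F: presentation_eval K "curv_gens Q" "curv_rels K Q" "op Q" "\<lambda>n d. case_sum (\<lambda>x. x) (\<lambda>u. curvature Q)"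
  using presentation_evalI[OF graded_operad_axioms restrict_hom[OF base_sub, folded base_operad_def] curvature_closed] .

lemma natural_eval:
  "presentation_eval K (coproduct_gens (base_operad Q) (kappa_operad K)) (coproduct_rels K (base_operad Q) (kappa_operad K))
    P (\<lambda>n d. case_sum (\<lambda>x. x) (induced_map P (\<lambda>n d u. \<kappa>)))"
  using coproduct_eval[OF graded_operad_axioms restrict_hom[OF base_sub] base_sub kappa_hom(1)[OF curvature_closed]
      graded_operad_axioms kappa_graded_operad]
  unfolding base_operad_def .

lemma base_kappa_operad: "graded_operad K (base_kappa K Q)"
proof -
  interpret C: presentation K "coproduct_gens (base_operad Q) (kappa_operad K)" "coproduct_rels K (base_operad Q) (kappa_operad K)" ..
  show ?thesis unfolding base_kappa_def coproduct_def by (rule C.presented_graded_operad)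
qed

lemma F_Gen_hom: "graded_hom K (base_operad Q) F.PP (\<lambda>n d x. F.cls (Gen n d (Inl x)))"
  by (rule F.gen_hom) (auto simp: curv_rels_def curv_gens_def base_operad_def intro: baseD)

text \<open>This is how injectivity of the natural map is used. An expression is first evaluated in
  the coproduct, by \<open>\<rho>\<close>. From there the natural map leads to its value in
  \<open>P\<close>, and the map given by the universal property of the coproduct leads to its class
  in the small presentation. Equal values in \<open>P\<close> therefore come from one element of the
  coproduct, hence from one class.\<close>

lemma eval_eq_imp_cong:
  assumes wf: "wf_expr K (curv_gens Q) s" "wf_expr K (curv_gens Q) t" "arity s = arity t" "degree s = degree t"
    and eq: "F.ev s = F.ev t"
  shows "(s, t) \<in> pres_cong K (curv_gens Q) (curv_rels K Q)"
proof -
  let ?G = "coproduct_gens (base_operad Q) (kappa_operad K)" and ?R = "coproduct_rels K (base_operad Q) (kappa_operad K)"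
  let ?C = "base_kappa K Q"
  interpret C: graded_operad K ?C by (rule base_kappa_operad)
  interpret N: presentation_eval K ?G ?R P "\<lambda>n d. case_sum (\<lambda>x. x) (induced_map P (\<lambda>n d u. \<kappa>))"
    by (rule natural_eval)
  have C: "?C = N.PP" by (simp add: base_kappa_def coproduct_def)
  interpret FP: graded_operad K F.PP by (rule F.presented_graded_operad)
  have k: "F.cls (Gen 0 (-1) (Inr ())) \<in> carrier (Sp F.PP 0 (-1))"
    by (rule F.cls_closed) (auto simp: curv_gens_def kappa_gens_def)
  interpret S: presentation_eval K ?G ?R F.PP "\<lambda>n d. case_sum (\<lambda>x. F.cls (Gen n d (Inl x)))
      (induced_map F.PP (\<lambda>n d u. F.cls (Gen 0 (-1) (Inr ()))))"
    using coproduct_eval[OF FP.graded_operad_axioms _ base_sub FP.kappa_hom(1)[OF k] graded_operad_axioms kappa_graded_operad]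
      F_Gen_hom unfolding base_operad_def .
  define \<rho> where "\<rho> n d = case_sum (coproduct_inl K (base_operad Q) (kappa_operad K) n d)
    (\<lambda>u :: unit. coproduct_inr K (base_operad Q) (kappa_operad K) n d (kappa_elem K))" for n d
  have kwf: "kappa_elem K \<in> carrier (Sp (kappa_operad K) 0 (-1))"
  proof -
    interpret presentation K kappa_gens "{}" ..
    show ?thesis unfolding kappa_elem_def kappa_operad_def by (rule cls_closed) (auto simp: kappa_gens_def)
  qed
  have wfl: "x \<in> B n d \<Longrightarrow> wf_expr K ?G (Gen n d (Inl x))" for x n d
    by (auto simp: coproduct_gens_def base_operad_def)
  have wfr: "wf_expr K ?G (Gen 0 (-1) (Inr (kappa_elem K)))" using kwf by (auto simp: coproduct_gens_def)
  have \<rho>: "\<rho> n d g \<in> carrier (Sp ?C n d)" if "g \<in> curv_gens Q n d" for n d g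
    using that wfl wfr unfolding C \<rho>_def
    by (auto simp: curv_gens_def kappa_gens_def coproduct_inl_def coproduct_inr_def split: if_splits intro!: N.cls_closed)
  let ?\<nu> = "natural_map Q" and ?\<psi> = "induced_map F.PP (\<lambda>n d. case_sum (\<lambda>x. F.cls (Gen n d (Inl x)))
      (induced_map F.PP (\<lambda>n d u. F.cls (Gen 0 (-1) (Inr ())))))"
  have \<nu>: "?\<nu> = induced_map P (\<lambda>n d. case_sum (\<lambda>x. x) (induced_map P (\<lambda>n d u. \<kappa>)))"
    by (simp add: natural_map_def coproduct_map_def)
  have \<nu>hom: "graded_hom K ?C P (\<lambda>n d. ?\<nu>)" using N.induced_hom unfolding C \<nu> operad_hom_iff .
  have \<psi>hom: "graded_hom K ?C F.PP (\<lambda>n d. ?\<psi>)" using S.induced_hom unfolding C operad_hom_iff .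
  have ev\<nu>: "?\<nu> (eval_expr ?C \<rho> t) = F.ev t" if t: "wf_expr K (curv_gens Q) t" for t
  proof -
    have "?\<nu> (eval_expr ?C \<rho> t) = eval_expr P (\<lambda>n d g. ?\<nu> (\<rho> n d g)) t"
      using hom_eval[OF C.graded_operad_axioms graded_operad_axioms \<nu>hom \<rho> t] by simp
    also have "\<dots> = F.ev t"
      by (rule eval_expr_cong[OF t])
        (use N.induced_cls[OF wfl] N.induced_cls[OF wfr] kappa_hom(2)[OF curvature_closed] in
          \<open>auto simp: curv_gens_def kappa_gens_def \<rho>_def \<nu> coproduct_inl_def coproduct_inr_def split: if_splits\<close>)
    finally show ?thesis .
  qed
  have ev\<psi>: "?\<psi> (eval_expr ?C \<rho> t) = F.cls t" if t: "wf_expr K (curv_gens Q) t" for t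
  proof -
    have "?\<psi> (eval_expr ?C \<rho> t) = eval_expr F.PP (\<lambda>n d g. ?\<psi> (\<rho> n d g)) t"
      using hom_eval[OF C.graded_operad_axioms FP.graded_operad_axioms \<psi>hom \<rho> t] by simp
    also have "\<dots> = eval_expr F.PP (\<lambda>n d g. F.cls (Gen n d g)) t"
      by (rule eval_expr_cong[OF t])
        (use S.induced_cls[OF wfl] S.induced_cls[OF wfr] FP.kappa_hom(2)[OF k] in
          \<open>auto simp: curv_gens_def kappa_gens_def \<rho>_def coproduct_inl_def coproduct_inr_def split: if_splits\<close>)
    finally show ?thesis using F.eval_presented[OF t] by simp
  qed
  have "bij_betw ?\<nu> (carrier (Sp ?C (arity t) (degree t))) (carrier (Sp P (arity t) (degree t)))"
    using natural_iso by (simp add: operad_iso_def)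
  then have "inj_on ?\<nu> (carrier (Sp ?C (arity t) (degree t)))" by (rule bij_betw_imp_inj_on)
  moreover have "eval_expr ?C \<rho> s \<in> carrier (Sp ?C (arity t) (degree t))" "eval_expr ?C \<rho> t \<in> carrier (Sp ?C (arity t) (degree t))"
    using C.eval_in_suboperad[OF C.suboperad_carrier, of "curv_gens Q" \<rho>] \<rho> wf by (metis (no_types, lifting))+
  ultimately have "eval_expr ?C \<rho> s = eval_expr ?C \<rho> t"
    using eq ev\<nu>[OF wf(1)] ev\<nu>[OF wf(2)] by (metis inj_onD)
  then have "F.cls s = F.cls t" using ev\<psi>[OF wf(1)] ev\<psi>[OF wf(2)] by metis
  then show ?thesis using F.cls_eq_iff[OF wf(1)] by blast
qed

text \<open>Surjectivity of the natural map makes each operation the value of an expression in the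
  generators of the coproduct, so it is enough that these lie in \<open>H\<close>.\<close>

lemma generated:
  assumes H: "suboperad K P H" and "\<And>n d. B n d \<subseteq> H n d" "\<kappa> \<in> H 0 (-1)" and x: "x \<in> carrier (Sp P n d)"
  shows "x \<in> H n d"
proof -
  let ?G = "coproduct_gens (base_operad Q) (kappa_operad K)" and ?R = "coproduct_rels K (base_operad Q) (kappa_operad K)"
  interpret N: presentation_eval K ?G ?R P "\<lambda>n d. case_sum (\<lambda>x. x) (induced_map P (\<lambda>n d u. \<kappa>))"
    by (rule natural_eval)
  interpret k: presentation_eval K kappa_gens "{}" P "\<lambda>n d u. \<kappa>" by (rule kappa_eval[OF curvature_closed])
  have "bij_betw (natural_map Q) (carrier (Sp (base_kappa K Q) n d)) (carrier (Sp P n d))"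
    using natural_iso by (simp add: operad_iso_def)
  then have "x \<in> natural_map Q ` carrier (Sp (base_kappa K Q) n d)"
    using x bij_betw_imp_surj_on by fast
  then obtain X where X: "X \<in> carrier (Sp (base_kappa K Q) n d)" "x = natural_map Q X" by blast
  have "X \<in> carrier (Sp N.PP n d)" using X(1) unfolding base_kappa_def coproduct_def .
  then obtain t where t: "X = N.cls t" "wf_expr K ?G t" "arity t = n" "degree t = d"
    by (rule N.carrier_presentedE)
  have "N.ev t \<in> H (arity t) (degree t)"
  proof (rule eval_in_suboperad[OF H _ t(2)])
    fix n d g assume g: "g \<in> ?G n d"
    show "case_sum (\<lambda>x. x) (induced_map P (\<lambda>n d u. \<kappa>)) g \<in> H n d"
    proof (cases g)
      case (Inl x)
      then show ?thesis using g assms(2) by (auto simp: coproduct_gens_def base_operad_def)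
    next
      \<comment> \<open>A generator of this kind is itself the class of an expression in
        \<open>\<kappa>\<close>, which calls for a second evaluation.\<close>
      case (Inr Y)
      then have "Y \<in> carrier (Sp k.PP n d)" using g by (auto simp: coproduct_gens_def kappa_operad_def)
      then obtain s where s: "Y = k.cls s" "wf_expr K kappa_gens s" "arity s = n" "degree s = d"
        by (rule k.carrier_presentedE)
      have "k.ev s \<in> H (arity s) (degree s)"
        by (rule eval_in_suboperad[OF H _ s(2)]) (use assms(3) in \<open>auto simp: kappa_gens_def split: if_splits\<close>)
      then show ?thesis using Inr s k.induced_cls by simp
    qed
  qed
  then show ?thesis using X(2) t N.induced_cls[OF t(2)] by (simp add: natural_map_def coproduct_map_def)
qed

lemma ev_surj:
  assumes "x \<in> carrier (Sp P n d)"
  shows "\<exists>t. wf_expr K (curv_gens Q) t \<and> arity t = n \<and> degree t = d \<and> F.ev t = x"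
proof -
  let ?w = "wf_expr K (curv_gens Q)"
  define H where "H n d = {F.ev t | t. ?w t \<and> arity t = n \<and> degree t = d}" for n d
  have HI: "F.ev t \<in> H n d" if "?w t" "arity t = n" "degree t = d" for t n d
    using that by (auto simp: H_def)
  have HE: "\<exists>t. x = F.ev t \<and> ?w t \<and> arity t = n \<and> degree t = d" if "x \<in> H n d" for x n d
    using that by (auto simp: H_def)
  have "suboperad K P H"
  proof (rule suboperadI)
    show "H n d \<subseteq> carrier (Sp P n d)" for n d using F.ev_in by (auto simp: H_def)
    show "\<zero>\<^bsub>Sp P n d\<^esub> \<in> H n d" for n d using HI[of "Zero n d"] by simp
    fix n d x assume "x \<in> H n d"
    then obtain s where s: "x = F.ev s" "?w s" "arity s = n" "degree s = d" using HE by blast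
    show "x \<oplus>\<^bsub>Sp P n d\<^esub> y \<in> H n d" if y: "y \<in> H n d" for y
    proof -
      obtain t where "y = F.ev t" "?w t" "arity t = n" "degree t = d" using HE[OF y] by blast
      then show ?thesis using HI[of "Add s t" n d] s by simp
    qed
    show "c \<odot>\<^bsub>Sp P n d\<^esub> x \<in> H n d" if "c \<in> carrier K" for c
      using HI[of "Smult c s" n d] that s by simp
    show "pcomp P i x y \<in> H (n + m - 1) (d + e)" if y: "y \<in> H m e" and "1 \<le> i" "i \<le> n" for y m e i
    proof -
      obtain t where "y = F.ev t" "?w t" "arity t = m" "degree t = e" using HE[OF y] by blast
      then show ?thesis using HI[of "Comp i s t"] s that by simp
    qed
    show "act P \<sigma> x \<in> H n d" if "\<sigma> permutes {1..n}" for \<sigma>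
      using HI[of "Act \<sigma> s" n d] that s by simp
  qed
  moreover have "B n d \<subseteq> H n d" for n d
  proof
    fix x assume "x \<in> B n d"
    then show "x \<in> H n d" using HI[of "Gen n d (Inl x)" n d] by (auto simp: curv_gens_def)
  qed
  moreover have "\<kappa> \<in> H 0 (-1)"
    using HI[of "Gen 0 (-1) (Inr ())" 0 "-1"] by (auto simp: curv_gens_def kappa_gens_def)
  ultimately have "x \<in> H n d" using generated assms by blast
  then show ?thesis by (auto simp: H_def)
qed

definition rep :: "nat \<Rightarrow> int \<Rightarrow> 'a \<Rightarrow> ('k, 'a + unit) expr" where
  "rep n d x = (SOME t. wf_expr K (curv_gens Q) t \<and> arity t = n \<and> degree t = d \<and> F.ev t = x)"

lemma rep:
  assumes "x \<in> carrier (Sp P n d)"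
  shows "wf_expr K (curv_gens Q) (rep n d x)" "arity (rep n d x) = n" "degree (rep n d x) = d" "F.ev (rep n d x) = x"
  using someI_ex[OF ev_surj[OF assms]] unfolding rep_def by auto

text \<open>The chosen expression matters only up to congruence. Hence any map on expressions which
  respects the congruence descends to \<open>P\<close> by way of \<open>rep\<close>; homomorphisms
  and the unplugging derivation arise in this manner.\<close>

lemma rep_cong:
  assumes "wf_expr K (curv_gens Q) t" "arity t = n" "degree t = d"
  shows "(rep n d (F.ev t), t) \<in> pres_cong K (curv_gens Q) (curv_rels K Q)"
  using rep[OF F.ev_in[OF assms]] assms by (intro eval_eq_imp_cong) auto

lemma rep_ops:
  assumes "x \<in> carrier (Sp P n d)"
  shows "y \<in> carrier (Sp P n d) \<Longrightarrow>
      (rep n d (x \<oplus>\<^bsub>Sp P n d\<^esub> y), Add (rep n d x) (rep n d y)) \<in> pres_cong K (curv_gens Q) (curv_rels K Q)"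
    and "c \<in> carrier K \<Longrightarrow> (rep n d (c \<odot>\<^bsub>Sp P n d\<^esub> x), Smult c (rep n d x)) \<in> pres_cong K (curv_gens Q) (curv_rels K Q)"
    and "\<lbrakk>y \<in> carrier (Sp P m e); 1 \<le> i; i \<le> n; N = n + m - 1; D = d + e\<rbrakk> \<Longrightarrow>
      (rep N D (pcomp P i x y), Comp i (rep n d x) (rep m e y)) \<in> pres_cong K (curv_gens Q) (curv_rels K Q)"
    and "\<sigma> permutes {1..n} \<Longrightarrow> (rep n d (act P \<sigma> x), Act \<sigma> (rep n d x)) \<in> pres_cong K (curv_gens Q) (curv_rels K Q)"
proof -
  note x = rep[OF assms]
  show "y \<in> carrier (Sp P n d) \<Longrightarrow>
      (rep n d (x \<oplus>\<^bsub>Sp P n d\<^esub> y), Add (rep n d x) (rep n d y)) \<in> pres_cong K (curv_gens Q) (curv_rels K Q)"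
    using rep_cong[of "Add (rep n d x) (rep n d y)" n d] x rep[of y n d] by simp
  show "c \<in> carrier K \<Longrightarrow> (rep n d (c \<odot>\<^bsub>Sp P n d\<^esub> x), Smult c (rep n d x)) \<in> pres_cong K (curv_gens Q) (curv_rels K Q)"
    using rep_cong[of "Smult c (rep n d x)" n d] x by simp
  show "\<lbrakk>y \<in> carrier (Sp P m e); 1 \<le> i; i \<le> n; N = n + m - 1; D = d + e\<rbrakk> \<Longrightarrow>
      (rep N D (pcomp P i x y), Comp i (rep n d x) (rep m e y)) \<in> pres_cong K (curv_gens Q) (curv_rels K Q)"
    using rep_cong[of "Comp i (rep n d x) (rep m e y)"] x rep[of y m e] by simp
  show "\<sigma> permutes {1..n} \<Longrightarrow> (rep n d (act P \<sigma> x), Act \<sigma> (rep n d x)) \<in> pres_cong K (curv_gens Q) (curv_rels K Q)"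
    using rep_cong[of "Act \<sigma> (rep n d x)" n d] x by simp
qed

end

section \<open>The weight grading\<close>

context curved_grading
begin

abbreviation weight :: "nat \<Rightarrow> nat \<Rightarrow> int \<Rightarrow> 'a \<Rightarrow> bool" where
  "weight \<equiv> weight_homogeneous K P B \<kappa>"

lemma weight_closed: "weight w n d x \<Longrightarrow> x \<in> carrier (Sp P n d)"
  by (induction rule: weight_homogeneous.induct)
    (auto simp: curvature_closed pcomp_closed act_closed intro: base_closed)

lemma natural_hom: "natural_map Q \<in> operad_hom K (base_kappa K Q) P"
  using natural_iso by (simp add: operad_iso_def)

lemma natural_coproduct:
  shows natural_inl: "x \<in> B n d \<Longrightarrow> coproduct_inl K (base_operad Q) (kappa_operad K) n d x \<in> carrier (Sp (base_kappa K Q) n d) \<and>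
      natural_map Q (coproduct_inl K (base_operad Q) (kappa_operad K) n d x) = x"
    and natural_inr: "coproduct_inr K (base_operad Q) (kappa_operad K) 0 (-1) (kappa_elem K) \<in> carrier (Sp (base_kappa K Q) 0 (-1)) \<and>
      natural_map Q (coproduct_inr K (base_operad Q) (kappa_operad K) 0 (-1) (kappa_elem K)) = \<kappa>"
proof -
  let ?G = "coproduct_gens (base_operad Q) (kappa_operad K)" and ?R = "coproduct_rels K (base_operad Q) (kappa_operad K)"
  interpret N: presentation_eval K ?G ?R P "\<lambda>n d. case_sum (\<lambda>x. x) (induced_map P (\<lambda>n d u. \<kappa>))"
    by (rule natural_eval)
  have C: "base_kappa K Q = N.PP" by (simp add: base_kappa_def coproduct_def)
  have \<nu>: "natural_map Q = induced_map P (\<lambda>n d. case_sum (\<lambda>x. x) (induced_map P (\<lambda>n d u. \<kappa>)))"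
    by (simp add: natural_map_def coproduct_map_def)
  show "coproduct_inl K (base_operad Q) (kappa_operad K) n d x \<in> carrier (Sp (base_kappa K Q) n d) \<and>
      natural_map Q (coproduct_inl K (base_operad Q) (kappa_operad K) n d x) = x" if "x \<in> B n d"
  proof -
    have "wf_expr K ?G (Gen n d (Inl x))" using that by (auto simp: coproduct_gens_def base_operad_def)
    then show ?thesis using N.induced_cls[of "Gen n d (Inl x)"] N.cls_closed[of "Gen n d (Inl x)"]
      by (simp add: C \<nu> coproduct_inl_def)
  qed
  have "kappa_elem K \<in> carrier (Sp (kappa_operad K) 0 (-1))"
  proof -
    interpret presentation K kappa_gens "{}" ..
    show ?thesis unfolding kappa_elem_def kappa_operad_def by (rule cls_closed) (auto simp: kappa_gens_def)
  qed
  then have "wf_expr K ?G (Gen 0 (-1) (Inr (kappa_elem K)))" by (auto simp: coproduct_gens_def)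
  then show "coproduct_inr K (base_operad Q) (kappa_operad K) 0 (-1) (kappa_elem K) \<in> carrier (Sp (base_kappa K Q) 0 (-1)) \<and>
      natural_map Q (coproduct_inr K (base_operad Q) (kappa_operad K) 0 (-1) (kappa_elem K)) = \<kappa>"
    using N.induced_cls[of "Gen 0 (-1) (Inr (kappa_elem K))"] N.cls_closed[of "Gen 0 (-1) (Inr (kappa_elem K))"]
      kappa_hom(2)[OF curvature_closed]
    by (simp add: C \<nu> coproduct_inr_def)
qed

text \<open>The natural map is a homomorphism that matches the generators with the base and
  \<open>\<kappa>\<close>, so expressions with a given number of \<open>\<kappa>\<close> correspond.
  From here on weights are taken inside \<open>P\<close>, without the coproduct.\<close>

lemma curv_weight_eq: "curv_weight K Q w n d = {x. weight w n d x}"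
proof -
  let ?C = "base_kappa K Q" and ?\<nu> = "natural_map Q"
  let ?S = "\<lambda>m e. coproduct_inl K (base_operad Q) (kappa_operad K) m e ` base Q m e"
  let ?k = "coproduct_inr K (base_operad Q) (kappa_operad K) 0 (-1) (kappa_elem K)"
  interpret C: graded_operad K ?C by (rule base_kappa_operad)
  note h = operad_homD[OF natural_hom]
  have nz: "?\<nu> \<zero>\<^bsub>Sp ?C n d\<^esub> = \<zero>\<^bsub>Sp P n d\<^esub>" for n d
    using graded_hom_zero[OF C.graded_operad_axioms graded_operad_axioms] natural_hom unfolding operad_hom_iff by blast
  have 1: "X \<in> carrier (Sp ?C n d) \<and> weight w n d (?\<nu> X)" if "weight_homogeneous K ?C ?S ?k w n d X" for w n d X
    using that
    by (induction rule: weight_homogeneous.induct)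
      (auto simp: natural_inl natural_inr h nz C.pcomp_closed C.act_closed intro: weight_homogeneous.intros)
  have 2: "\<exists>X. weight_homogeneous K ?C ?S ?k w n d X \<and> ?\<nu> X = x" if "weight w n d x" for w n d x
    using that
  proof (induction rule: weight_homogeneous.induct)
    case (base x n d)
    then show ?case using natural_inl by (intro exI[of _ "coproduct_inl K (base_operad Q) (kappa_operad K) n d x"])
        (auto intro: weight_homogeneous.base)
  next
    case kappa
    show ?case using natural_inr by (auto intro: weight_homogeneous.kappa)
  next
    case (zero w n d)
    show ?case using nz by (auto intro: weight_homogeneous.zero)
  next
    case (add w n d x y)
    then obtain X Y where "weight_homogeneous K ?C ?S ?k w n d X" "?\<nu> X = x" "weight_homogeneous K ?C ?S ?k w n d Y" "?\<nu> Y = y" by auto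
    then show ?case using 1 h(2) by (intro exI[of _ "X \<oplus>\<^bsub>Sp ?C n d\<^esub> Y"]) (auto intro: weight_homogeneous.add)
  next
    case (smult c w n d x)
    then obtain X where "weight_homogeneous K ?C ?S ?k w n d X" "?\<nu> X = x" by auto
    then show ?case using 1 h(3) smult(1) by (intro exI[of _ "c \<odot>\<^bsub>Sp ?C n d\<^esub> X"]) (auto intro: weight_homogeneous.smult)
  next
    case (pcomp v n d x w m e y i)
    then obtain X Y where "weight_homogeneous K ?C ?S ?k v n d X" "?\<nu> X = x" "weight_homogeneous K ?C ?S ?k w m e Y" "?\<nu> Y = y" by auto
    then show ?case using 1 h(4)[of X n d Y m e i] pcomp by (intro exI[of _ "pcomp ?C i X Y"]) (auto intro: weight_homogeneous.pcomp)
  next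
    case (act w n d x \<sigma>)
    then obtain X where "weight_homogeneous K ?C ?S ?k w n d X" "?\<nu> X = x" by auto
    then show ?case using 1 h(5)[of X n d \<sigma>] act by (intro exI[of _ "act ?C \<sigma> X"]) (auto intro: weight_homogeneous.act)
  qed
  show ?thesis
  proof (intro equalityI subsetI)
    fix x assume "x \<in> curv_weight K Q w n d"
    then show "x \<in> {x. weight w n d x}" using 1 by (auto simp: curv_weight_def weight_space_def)
  next
    fix x assume "x \<in> {x. weight w n d x}"
    then show "x \<in> curv_weight K Q w n d" using 2[of w n d x] by (auto simp: curv_weight_def weight_space_def)
  qed
qed

text \<open>The universal property of the object as a coproduct of its base and the operad on
  \<open>\<kappa>\<close>, transported along the natural isomorphism.\<close>

lemma hom_extension:
  assumes "graded_operad K T" "graded_hom K (base_operad Q) T f" "k \<in> carrier (Sp T 0 (-1))"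
  defines "g \<equiv> \<lambda>n d x. eval_expr T (\<lambda>n d. case_sum (f n d) (\<lambda>u. k)) (rep n d x)"
  shows "graded_hom K P T g" and "x \<in> B n d \<Longrightarrow> g n d x = f n d x" and "g 0 (-1) \<kappa> = k"
proof -
  interpret E: presentation_eval K "curv_gens Q" "curv_rels K Q" T "\<lambda>n d. case_sum (f n d) (\<lambda>u. k)"
    by (rule presentation_evalI[OF assms(1-3)])
  show "graded_hom K P T g"
    unfolding graded_hom_def
  proof (intro conjI allI ballI impI)
    fix n d x assume x: "x \<in> carrier (Sp P n d)"
    note r = rep[OF x]
    show "g n d x \<in> carrier (Sp T n d)" using E.ev_in[OF r(1-3)] by (simp add: g_def)
    show "g n d (x \<oplus>\<^bsub>Sp P n d\<^esub> y) = g n d x \<oplus>\<^bsub>Sp T n d\<^esub> g n d y" if "y \<in> carrier (Sp P n d)" for y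
      using E.ev_cong[OF rep_ops(1)[OF x that]] r by (simp add: g_def)
    show "g n d (c \<odot>\<^bsub>Sp P n d\<^esub> x) = c \<odot>\<^bsub>Sp T n d\<^esub> g n d x" if "c \<in> carrier K" for c
      using E.ev_cong[OF rep_ops(2)[OF x that]] r by (simp add: g_def)
    show "g (n + m - 1) (d + e) (pcomp P i x y) = pcomp T i (g n d x) (g m e y)"
      if "y \<in> carrier (Sp P m e)" "i \<in> {1..n}" for m e y i
      using E.ev_cong[OF rep_ops(3)[OF x that(1) _ _ HOL.refl HOL.refl, of i]] that by (simp add: g_def)
    show "g n d (act P \<sigma> x) = act T \<sigma> (g n d x)" if "\<sigma> permutes {1..n}" for \<sigma>
      using E.ev_cong[OF rep_ops(4)[OF x that]] by (simp add: g_def)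
  qed
  show "x \<in> B n d \<Longrightarrow> g n d x = f n d x"
    using E.ev_cong[OF rep_cong[of "Gen n d (Inl x)" n d]] by (auto simp: g_def curv_gens_def)
  show "g 0 (-1) \<kappa> = k"
    using E.ev_cong[OF rep_cong[of "Gen 0 (-1) (Inr ())" 0 "-1"]] by (auto simp: g_def curv_gens_def kappa_gens_def)
qed

definition scale :: "'k \<Rightarrow> nat \<Rightarrow> int \<Rightarrow> 'a \<Rightarrow> 'a" where
  "scale a n d x = eval_expr P (\<lambda>n d. case_sum (\<lambda>x. x) (\<lambda>u. a \<odot>\<^bsub>Sp P 0 (-1)\<^esub> \<kappa>)) (rep n d x)"

lemma scale_hom:
  assumes "a \<in> carrier K" shows "graded_hom K P P (scale a)"
    and "x \<in> B n d \<Longrightarrow> scale a n d x = x" and "scale a 0 (-1) \<kappa> = a \<odot>\<^bsub>Sp P 0 (-1)\<^esub> \<kappa>"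
proof -
  have k: "a \<odot>\<^bsub>Sp P 0 (-1)\<^esub> \<kappa> \<in> carrier (Sp P 0 (-1))" using assms curvature_closed by simp
  note h = hom_extension[OF graded_operad_axioms restrict_hom[OF base_sub, folded base_operad_def] k]
  show "graded_hom K P P (scale a)" unfolding scale_def[abs_def] by (rule h(1))
  show "x \<in> B n d \<Longrightarrow> scale a n d x = x" unfolding scale_def by (rule h(2))
  show "scale a 0 (-1) \<kappa> = a \<odot>\<^bsub>Sp P 0 (-1)\<^esub> \<kappa>" unfolding scale_def by (rule h(3))
qed

lemma scale_weight:
  assumes a: "a \<in> carrier K" and "weight w n d x"
  shows "scale a n d x = (a [^] w) \<odot>\<^bsub>Sp P n d\<^esub> x"
  using assms(2)
proof (induction rule: weight_homogeneous.induct)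
  case (base x n d)
  then show ?case using scale_hom(2)[OF a] base_closed by simp
next
  case kappa
  then show ?case using scale_hom(3)[OF a] a by (simp add: One_nat_def)
next
  case (zero w n d)
  show ?case using graded_hom_zero[OF graded_operad_axioms graded_operad_axioms scale_hom(1)[OF a]] a by simp
next
  case (add w n d x y)
  then show ?case using graded_homD(2)[OF scale_hom(1)[OF a]] weight_closed a by (simp add: Sp_r_distr)
next
  case (smult c w n d x)
  then show ?case using graded_homD(3)[OF scale_hom(1)[OF a], of c x n d] weight_closed a by (simp add: smult_commute)
next
  case (pcomp v n d x w m e y i)
  note c = weight_closed[OF pcomp(1)] weight_closed[OF pcomp(2)] pcomp_closed[OF weight_closed[OF pcomp(1)] weight_closed[OF pcomp(2)] pcomp(3,4)]
  let ?M = "Sp P (n + m - 1) (d + e)"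
  have "scale a (n + m - 1) (d + e) (pcomp P i x y) = pcomp P i ((a [^] v) \<odot>\<^bsub>Sp P n d\<^esub> x) ((a [^] w) \<odot>\<^bsub>Sp P m e\<^esub> y)"
    using graded_homD(4)[OF scale_hom(1)[OF a] c(1,2) pcomp(3,4)] pcomp.IH by simp
  also have "\<dots> = (a [^] v) \<odot>\<^bsub>?M\<^esub> pcomp P i x ((a [^] w) \<odot>\<^bsub>Sp P m e\<^esub> y)"
    by (rule pcomp_smult_left) (use a c pcomp in auto)
  also have "pcomp P i x ((a [^] w) \<odot>\<^bsub>Sp P m e\<^esub> y) = (a [^] w) \<odot>\<^bsub>?M\<^esub> pcomp P i x y"
    by (rule pcomp_smult_right) (use a c pcomp in auto)
  finally show ?case using c(3) a by (simp add: Sp_smult_smult nat_pow_mult[symmetric])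
next
  case (act w n d x \<sigma>)
  note c = weight_closed[OF act(1)]
  show ?case using graded_homD(5)[OF scale_hom(1)[OF a] c act(2)] act.IH act_smult[OF _ c act(2)] a by simp
qed

lemma weight_submodule:
  assumes "weight w n d x"
  shows "weight w n d y \<Longrightarrow> weight w n d (x \<oplus>\<^bsub>Sp P n d\<^esub> y)"
    and "c \<in> carrier K \<Longrightarrow> weight w n d (c \<odot>\<^bsub>Sp P n d\<^esub> x)"
    and "weight w n d (\<ominus>\<^bsub>Sp P n d\<^esub> x)"
proof -
  show "weight w n d y \<Longrightarrow> weight w n d (x \<oplus>\<^bsub>Sp P n d\<^esub> y)" "c \<in> carrier K \<Longrightarrow> weight w n d (c \<odot>\<^bsub>Sp P n d\<^esub> x)"
    using assms by (auto intro: weight_homogeneous.add weight_homogeneous.smult)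
  have "\<ominus>\<^bsub>Sp P n d\<^esub> x = (\<ominus> \<one>) \<odot>\<^bsub>Sp P n d\<^esub> x"
    using module.smult_l_minus[OF module_Sp, of \<one> x] weight_closed[OF assms] by simp
  then show "weight w n d (\<ominus>\<^bsub>Sp P n d\<^esub> x)" using assms by (auto intro: weight_homogeneous.smult)
qed

section \<open>Elements of weight 0 and 1\<close>

text \<open>Elements of the two stated forms are closed under the operations: the single
  \<open>\<kappa>\<close> can always be moved into the first slot by the exchange of compositions
  and by \<open>gam\<close>, leaving an operation of the base around it. Both weights are treated in
  one induction, since a composite of weight 1 has a factor of weight 0.\<close>

lemma weight_0_1:
  assumes "weight w n d x"
  shows weight_0: "w = 0 \<Longrightarrow> x \<in> B n d"
    and weight_1: "w = 1 \<Longrightarrow> \<exists>z c. z \<in> B (n + 1) (d + 1) \<and> c \<in> carrier K \<and>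
      x = pcomp P 1 z \<kappa> \<oplus>\<^bsub>Sp P n d\<^esub> (if n = 0 \<and> d = - 1 then c \<odot>\<^bsub>Sp P n d\<^esub> \<kappa> else \<zero>\<^bsub>Sp P n d\<^esub>)"
proof -
  let ?E = "\<lambda>n d x. \<exists>z c. z \<in> B (n + 1) (d + 1) \<and> c \<in> carrier K \<and>
      x = pcomp P 1 z \<kappa> \<oplus>\<^bsub>Sp P n d\<^esub> (if n = 0 \<and> d = - 1 then c \<odot>\<^bsub>Sp P n d\<^esub> \<kappa> else \<zero>\<^bsub>Sp P n d\<^esub>)"
  have zk: "pcomp P 1 z \<kappa> \<in> carrier (Sp P n d)" if "z \<in> B (n + 1) (d + 1)" for z n d
    by (rule pcomp_in[OF base_closed[OF that] curvature_closed]) auto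
  have EI: "?E n d (pcomp P 1 z \<kappa>)" if "z \<in> B (n + 1) (d + 1)" for z n d
    using zk[OF that] curvature_closed that by (intro exI[of _ z] exI[of _ \<zero>]) auto
  have Ek: "\<exists>z. z \<in> B (n + 1) (d + 1) \<and> x = pcomp P 1 z \<kappa>" if "?E n d x" "\<not> (n = 0 \<and> d = -1)" for n d x
    using that zk by force
  have "(w = 0 \<longrightarrow> x \<in> B n d) \<and> (w = 1 \<longrightarrow> ?E n d x)"
    using assms
  proof (induction rule: weight_homogeneous.induct)
    case kappa
    \<comment> \<open>Without a unit, \<open>\<kappa>\<close> need not result from plugging; it is
      the case \<open>z = 0\<close> and \<open>c = 1\<close>.\<close>
    show ?case using curvature_closed baseD(2)
      by (auto intro!: exI[of _ "\<zero>\<^bsub>Sp P 1 0\<^esub>"] exI[of _ \<one>] simp: pcomp_zero_left[OF curvature_closed])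
  next
    case (zero w n d)
    show ?case using baseD(2) EI[of "\<zero>\<^bsub>Sp P (n + 1) (d + 1)\<^esub>" n d] pcomp_zero_left[OF curvature_closed, of 1 "n + 1" n d "d + 1"]
      by simp
  next
    case (add w n d x y)
    have "?E n d (x \<oplus>\<^bsub>Sp P n d\<^esub> y)" if "w = 1"
    proof -
      obtain z c where z: "z \<in> B (n + 1) (d + 1)" "c \<in> carrier K"
        "x = pcomp P 1 z \<kappa> \<oplus>\<^bsub>Sp P n d\<^esub> (if n = 0 \<and> d = - 1 then c \<odot>\<^bsub>Sp P n d\<^esub> \<kappa> else \<zero>\<^bsub>Sp P n d\<^esub>)"
        using add \<open>w = 1\<close> by blast
      obtain z' c' where z': "z' \<in> B (n + 1) (d + 1)" "c' \<in> carrier K"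
        "y = pcomp P 1 z' \<kappa> \<oplus>\<^bsub>Sp P n d\<^esub> (if n = 0 \<and> d = - 1 then c' \<odot>\<^bsub>Sp P n d\<^esub> \<kappa> else \<zero>\<^bsub>Sp P n d\<^esub>)"
        using add \<open>w = 1\<close> by blast
      have "pcomp P 1 (z \<oplus>\<^bsub>Sp P (n + 1) (d + 1)\<^esub> z') \<kappa> = pcomp P 1 z \<kappa> \<oplus>\<^bsub>Sp P n d\<^esub> pcomp P 1 z' \<kappa>"
        by (rule pcomp_linear_left(1)[OF curvature_closed]) (use z(1) z'(1) base_closed in auto)
      then show ?thesis using z z' zk[OF z(1)] zk[OF z'(1)] curvature_closed baseD(3)[OF z(1) z'(1)]
        by (intro exI[of _ "z \<oplus>\<^bsub>Sp P (n + 1) (d + 1)\<^esub> z'"] exI[of _ "c \<oplus> c'"])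
          (auto simp: Sp_l_distr Sp_a_ac)
    qed
    then show ?case using add baseD(3) by auto
  next
    case (smult k w n d x)
    have "?E n d (k \<odot>\<^bsub>Sp P n d\<^esub> x)" if "w = 1"
    proof -
      obtain z c where z: "z \<in> B (n + 1) (d + 1)" "c \<in> carrier K"
        "x = pcomp P 1 z \<kappa> \<oplus>\<^bsub>Sp P n d\<^esub> (if n = 0 \<and> d = - 1 then c \<odot>\<^bsub>Sp P n d\<^esub> \<kappa> else \<zero>\<^bsub>Sp P n d\<^esub>)"
        using smult \<open>w = 1\<close> by blast
      have "pcomp P 1 (k \<odot>\<^bsub>Sp P (n + 1) (d + 1)\<^esub> z) \<kappa> = k \<odot>\<^bsub>Sp P n d\<^esub> pcomp P 1 z \<kappa>"
        by (rule pcomp_linear_left(2)[OF curvature_closed]) (use z(1) base_closed smult in auto)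
      then show ?thesis using z zk[OF z(1)] curvature_closed baseD(4)[OF smult(1) z(1)] smult(1)
        by (intro exI[of _ "k \<odot>\<^bsub>Sp P (n + 1) (d + 1)\<^esub> z"] exI[of _ "k \<otimes> c"])
          (auto simp: Sp_r_distr Sp_smult_smult)
    qed
    then show ?case using smult baseD(4) by auto
  next
    case (pcomp v n d x w m e y i)
    note c = weight_closed[OF pcomp(1)] weight_closed[OF pcomp(2)]
    have "?E (n + m - 1) (d + e) (pcomp P i x y)" if vw: "v = 1" "w = 0"
    proof -
      have y: "y \<in> B m e" using pcomp vw by blast
      have "?E n d x" using pcomp.IH(1) vw(1) by blast
      \<comment> \<open>The slot \<open>i\<close> exists, so \<open>x\<close> has positive arity and
        contains no bare multiple of \<open>\<kappa>\<close>.\<close>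
      moreover have "\<not> (n = 0 \<and> d = -1)" using pcomp by auto
      ultimately obtain z where z: "z \<in> B (n + 1) (d + 1)" "x = pcomp P 1 z \<kappa>" using Ek by blast
      have zy: "pcomp P (i + 1) z y \<in> B (n + m - 1 + 1) (d + e + 1)"
        by (rule baseD(6)[OF z(1) y]) (use pcomp in auto)
      \<comment> \<open>The exchange lets \<open>y\<close> enter \<open>z\<close> ahead of
        \<open>\<kappa>\<close>. Its slot is \<open>i + 1\<close> because slot 1 is still open, and
        its sign is absorbed into the base operation.\<close>
      have "pcomp P i (pcomp P 1 z \<kappa>) y = sign_of K (- 1 * e) \<odot>\<^bsub>Sp P (n + m - 1) (d + e)\<^esub> pcomp P 1 (pcomp P (i + 1) z y) \<kappa>"
        by (rule pcomp_parallel'[OF base_closed[OF z(1)] curvature_closed c(2)]) (use pcomp in auto)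
      also have "\<dots> = pcomp P 1 (sign_of K (- 1 * e) \<odot>\<^bsub>Sp P (n + m - 1 + 1) (d + e + 1)\<^esub> pcomp P (i + 1) z y) \<kappa>"
        by (rule pcomp_linear_left(2)[OF curvature_closed, symmetric]) (use base_closed[OF zy] pcomp in auto)
      finally show ?thesis using EI[OF baseD(4)[OF _ zy, of "sign_of K (- 1 * e)"]] z(2) by simp
    qed
    moreover have "?E (n + m - 1) (d + e) (pcomp P i x y)" if vw: "v = 0" "w = 1"
    proof -
      have x: "x \<in> B n d" using pcomp vw by blast
      note i = pcomp(3,4)
      obtain z b where z: "z \<in> B (m + 1) (e + 1)" "b \<in> carrier K"
        "y = pcomp P 1 z \<kappa> \<oplus>\<^bsub>Sp P m e\<^esub> (if m = 0 \<and> e = - 1 then b \<odot>\<^bsub>Sp P m e\<^esub> \<kappa> else \<zero>\<^bsub>Sp P m e\<^esub>)"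
        using pcomp.IH(2) vw(2) by blast
      have nm: "n + (m + 1) - 1 = n + m - 1 + 1" using i by auto
      have g: "gam i permutes {1..n}" "gam i permutes {1..n + m - 1 + 1}"
        using i by (auto intro!: gam_permutes)
      \<comment> \<open>Any slot may be replaced by the first one after moving it there; no
        permutation of the remaining inputs is left over.\<close>
      have gk: "pcomp P i v \<kappa> = pcomp P 1 (act P (gam i) v) \<kappa>" if "v \<in> carrier (Sp P n' d')" "i \<le> n'" for v n' d'
      proof -
        have gp: "gam i permutes {1..n'}" using i that by (auto intro!: gam_permutes)
        have "pcomp P 1 (act P (gam i) v) \<kappa> = act P (block_outer 1 0 (gam i)) (pcomp P (gam i 1) v \<kappa>)"
          by (rule pcomp_act_left[OF that(1) curvature_closed _ _ gp]) (use that i in auto)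
        moreover have "gam i 1 = i" by (simp add: gam_def)
        moreover have "pcomp P i v \<kappa> \<in> carrier (Sp P (n' - 1) (d' - 1))"
          by (rule pcomp_in[OF that(1) curvature_closed]) (use that i in auto)
        ultimately show ?thesis using block_outer_gam_0[OF i(1)] by (simp add: act_id)
      qed
      have xz: "pcomp P i x z \<in> B (n + m - 1 + 1) (d + e + 1)"
        by (rule baseD(6)[OF x z(1)]) (use i in auto)
      have "pcomp P i x (pcomp P 1 z \<kappa>) = pcomp P (i + 1 - 1) (pcomp P i x z) \<kappa>"
        by (rule pcomp_sequential[OF c(1) base_closed[OF z(1)] curvature_closed i, symmetric]) auto
      also have "\<dots> = pcomp P 1 (act P (gam i) (pcomp P i x z)) \<kappa>"
        using gk[OF base_closed[OF xz]] i by simp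
      finally have 1: "pcomp P i x (pcomp P 1 z \<kappa>) = pcomp P 1 (act P (gam i) (pcomp P i x z)) \<kappa>" .
      note gxz = baseD(7)[OF xz g(2)]
      have zk': "pcomp P 1 z \<kappa> \<in> carrier (Sp P m e)" by (rule zk[OF z(1)])
      show ?thesis
      proof (cases "m = 0 \<and> e = - 1")
        case True
        have gx: "act P (gam i) x \<in> B (n + m - 1 + 1) (d + e + 1)" using baseD(7)[OF x g(1)] True i by simp
        have "pcomp P i x y = pcomp P i x (pcomp P 1 z \<kappa>) \<oplus>\<^bsub>Sp P (n + m - 1) (d + e)\<^esub> pcomp P i x (b \<odot>\<^bsub>Sp P m e\<^esub> \<kappa>)"
          unfolding z(3) using True z(2) zk' curvature_closed by (subst pcomp_add_right[OF c(1) _ _ i]) auto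
        also have "pcomp P i x (b \<odot>\<^bsub>Sp P m e\<^esub> \<kappa>) = b \<odot>\<^bsub>Sp P (n + m - 1) (d + e)\<^esub> pcomp P i x \<kappa>"
          using pcomp_smult_right[OF z(2) c(1), of \<kappa> m e i] True curvature_closed i by simp
        also have "pcomp P i x \<kappa> = pcomp P 1 (act P (gam i) x) \<kappa>" using gk[OF c(1) i(2)] .
        also have "b \<odot>\<^bsub>Sp P (n + m - 1) (d + e)\<^esub> pcomp P 1 (act P (gam i) x) \<kappa> =
            pcomp P 1 (b \<odot>\<^bsub>Sp P (n + m - 1 + 1) (d + e + 1)\<^esub> act P (gam i) x) \<kappa>"
          by (rule pcomp_linear_left(2)[OF curvature_closed, symmetric]) (use base_closed[OF gx] z(2) i in auto)
        also have "pcomp P i x (pcomp P 1 z \<kappa>) \<oplus>\<^bsub>Sp P (n + m - 1) (d + e)\<^esub> \<dots> =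
          pcomp P 1 (act P (gam i) (pcomp P i x z) \<oplus>\<^bsub>Sp P (n + m - 1 + 1) (d + e + 1)\<^esub>
              b \<odot>\<^bsub>Sp P (n + m - 1 + 1) (d + e + 1)\<^esub> act P (gam i) x) \<kappa>"
          unfolding 1 by (rule pcomp_linear_left(1)[OF curvature_closed, symmetric])
            (use base_closed[OF gx] base_closed[OF gxz] z(2) i in auto)
        finally show ?thesis using EI[OF baseD(3)[OF gxz baseD(4)[OF z(2) gx]]] by simp
      next
        case False
        then have "y = pcomp P 1 z \<kappa>" using z(3) zk' by auto
        then show ?thesis using 1 EI[OF gxz] by simp
      qed
    qed
    moreover have "v + w = 1 \<Longrightarrow> (v = 1 \<and> w = 0) \<or> (v = 0 \<and> w = 1)" by auto
    ultimately have E: "v + w = 1 \<Longrightarrow> ?E (n + m - 1) (d + e) (pcomp P i x y)" by blast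
    have "v + w = 0 \<Longrightarrow> pcomp P i x y \<in> B (n + m - 1) (d + e)"
      using pcomp baseD(6)[of x n d y m e i "n + m - 1" "d + e"] by simp
    then show ?case using E by blast
  next
    case (act w n d x \<sigma>)
    have "?E n d (act P \<sigma> x)" if "w = 1"
    \<comment> \<open>In arity 0 only the identity acts. In positive arity there is no bare multiple
      of \<open>\<kappa>\<close>, and \<open>\<sigma>\<close> passes to \<open>z\<close> as
      \<open>up \<sigma>\<close>, which fixes the slot of \<open>\<kappa>\<close>.\<close>
    proof (cases "n = 0")
      case True
      then show ?thesis using act that weight_closed[OF act(1)] act_id by simp
    next
      case False
      then obtain z where z: "z \<in> B (n + 1) (d + 1)" "x = pcomp P 1 z \<kappa>" using Ek[of n d x] act \<open>w = 1\<close> by blast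
      note up = up_permutes[OF act(2)]
      have bo: "block_outer 1 0 (up \<sigma>) = \<sigma>"
      proof
        fix k show "block_outer 1 0 (up \<sigma>) k = \<sigma> k"
          using permutes_ge1(1)[OF act(2), of k] permutes_ge1(3)[OF act(2)]
          by (cases "k = 0") (auto simp: block_outer_def up_def Let_def)
      qed
      have "pcomp P 1 (act P (up \<sigma>) z) \<kappa> = act P (block_outer 1 0 (up \<sigma>)) (pcomp P (up \<sigma> 1) z \<kappa>)"
        by (rule pcomp_act_left[OF base_closed[OF z(1)] curvature_closed _ _ up]) auto
      then have "act P \<sigma> x = pcomp P 1 (act P (up \<sigma>) z) \<kappa>" using z(2) bo by (simp add: up_def)
      then show ?thesis using EI[OF baseD(7)[OF z(1) up]] by simp
    qed
    then show ?case using act baseD(7) by auto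
  qed simp
  then show "w = 0 \<Longrightarrow> x \<in> B n d" "w = 1 \<Longrightarrow> ?E n d x" by blast+
qed

lemma weight_0_iff: "weight 0 n d x \<longleftrightarrow> x \<in> B n d"
  using weight_0 by (auto intro: weight_homogeneous.base)

lemma weight_1_plug:
  assumes "weight 1 n d x" "\<not> (n = 0 \<and> d = -1)"
  obtains z where "z \<in> B (n + 1) (d + 1)" "x = pcomp P 1 z \<kappa>"
proof -
  obtain z where z: "z \<in> B (n + 1) (d + 1)" "x = pcomp P 1 z \<kappa> \<oplus>\<^bsub>Sp P n d\<^esub> \<zero>\<^bsub>Sp P n d\<^esub>"
    using weight_1[OF assms(1) HOL.refl] assms(2) by auto
  moreover have "pcomp P 1 z \<kappa> \<in> carrier (Sp P n d)"
    by (rule pcomp_in[OF base_closed[OF z(1)] curvature_closed]) auto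
  ultimately show thesis using that by simp
qed

lemma plug_weight_1:
  assumes "z \<in> B (n + 1) (d + 1)" shows "weight 1 n d (pcomp P 1 z \<kappa>)"
  using weight_homogeneous.pcomp[of K P B \<kappa> 0 "n + 1" "d + 1" z 1 0 "-1" \<kappa> 1]
    assms weight_homogeneous.kappa[of K P B \<kappa>] by (simp add: weight_0_iff)

end

section \<open>Independence of the weight spaces\<close>

locale curved_grading_char_0 = curved_grading K Q
  for K :: "('k, 'm) ring_scheme" (structure) and Q :: "('k, 'a) curv" +
  assumes char_0: "m > (0::nat) \<Longrightarrow> [m] \<cdot> \<one> \<noteq> \<zero>"
begin

lemma power_2_inj:
  assumes "u \<noteq> v" shows "([(2::nat)] \<cdot> \<one>) [^] u \<noteq> ([(2::nat)] \<cdot> \<one>) [^] (v :: nat)"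
proof -
  have mult: "[(m * n)] \<cdot> \<one> = [m] \<cdot> \<one> \<otimes> [n] \<cdot> \<one>" for m n :: nat
    using add_pow_ldistr[of \<one> "[n] \<cdot> \<one>" m] add.nat_pow_pow[of \<one> n m] add.nat_pow_pow[of \<one> m n]
    by (simp add: mult.commute)
  have pow: "([(2::nat)] \<cdot> \<one>) [^] u = [(2 ^ u :: nat)] \<cdot> \<one>" for u :: nat
    by (induction u) (simp_all add: mult mult.commute[of 2], simp add: One_nat_def)
  have inj: "m = n" if "[m] \<cdot> \<one> = [n] \<cdot> \<one>" for m n :: nat
  proof (rule ccontr)
    have lt: False if "m < n" "[m] \<cdot> \<one> = [n] \<cdot> \<one>" for m n :: nat
    proof -
      have "[m] \<cdot> \<one> \<oplus> [(n - m)] \<cdot> \<one> = [m] \<cdot> \<one> \<oplus> \<zero>"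
        using add.nat_pow_mult[of \<one> m "n - m"] that by simp
      then have "[(n - m)] \<cdot> \<one> = \<zero>" using r_neg1[of "[m] \<cdot> \<one>" "[(n - m)] \<cdot> \<one>"] by (simp add: l_neg)
      then show False using char_0[of "n - m"] that by simp
    qed
    assume "m \<noteq> n" then show False using lt[of m n] lt[of n m] that by (cases m n rule: linorder_cases) auto
  qed
  show ?thesis using inj[of "2 ^ u" "2 ^ v"] assms unfolding pow by auto
qed

text \<open>Rescaling \<open>\<kappa>\<close> by 2 multiplies the summand of weight \<open>v\<close>
  by 2^v. Subtracting 2^u times the original relation removes the summand of weight
  \<open>u\<close>; by induction the others vanish, since their coefficients 2^v - 2^u are non-zero
  in characteristic zero.\<close>

lemma weight_independent:
  assumes "finite A" "\<And>v. v \<in> A \<Longrightarrow> weight v n d (f v)" "finsum (Sp P n d) f A = \<zero>\<^bsub>Sp P n d\<^esub>" "v \<in> A"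
  shows "f v = \<zero>\<^bsub>Sp P n d\<^esub>"
  using assms
proof (induction A arbitrary: f v rule: finite_induct)
  case (insert u A)
  interpret M: module K "Sp P n d" by (rule module_Sp)
  let ?M = "Sp P n d"
  let ?a = "[(2::nat)] \<cdot> \<one>"
  have f: "weight v n d (f v)" if "v \<in> insert u A" for v using insert.prems(1) that .
  have fc: "f v \<in> carrier ?M" if "v \<in> insert u A" for v using weight_closed[OF f[OF that]] .
  have fA: "f \<in> A \<rightarrow> carrier ?M" and fu: "f u \<in> carrier ?M" using fc by auto
  have sum: "f u \<oplus>\<^bsub>?M\<^esub> finsum ?M f A = \<zero>\<^bsub>?M\<^esub>"
    using M.finsum_insert[OF insert.hyps fA fu] insert.prems(2) by simp
  have a: "?a \<in> carrier K" by simp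
  have "finsum ?M (\<lambda>v. scale ?a n d (f v)) (insert u A) = \<zero>\<^bsub>?M\<^esub>"
    using graded_hom_finsum[OF graded_operad_axioms graded_operad_axioms scale_hom(1)[OF a], of f "insert u A" n d]
      graded_hom_zero[OF graded_operad_axioms graded_operad_axioms scale_hom(1)[OF a], of n d] insert.prems(2) fc
    by (simp add: Pi_def)
  also have "finsum ?M (\<lambda>v. scale ?a n d (f v)) (insert u A) = finsum ?M (\<lambda>v. (?a [^] v) \<odot>\<^bsub>?M\<^esub> f v) (insert u A)"
    by (rule M.finsum_cong') (use scale_weight[OF a f] fc in auto)
  also have "\<dots> = (?a [^] u) \<odot>\<^bsub>?M\<^esub> f u \<oplus>\<^bsub>?M\<^esub> finsum ?M (\<lambda>v. (?a [^] v) \<odot>\<^bsub>?M\<^esub> f v) A"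
    using fc insert.hyps by (intro M.finsum_insert) auto
  finally have 1: "(?a [^] u) \<odot>\<^bsub>?M\<^esub> f u \<oplus>\<^bsub>?M\<^esub> finsum ?M (\<lambda>v. (?a [^] v) \<odot>\<^bsub>?M\<^esub> f v) A = \<zero>\<^bsub>?M\<^esub>" .
  have "(\<ominus> (?a [^] u)) \<odot>\<^bsub>?M\<^esub> finsum ?M f A = finsum ?M (\<lambda>v. (\<ominus> (?a [^] u)) \<odot>\<^bsub>?M\<^esub> f v) A"
    by (rule additive_finsum[OF Sp_abelian_group Sp_abelian_group _ _ fA]) (auto simp: Sp_r_distr)
  moreover have "(\<ominus> (?a [^] u)) \<odot>\<^bsub>?M\<^esub> (f u \<oplus>\<^bsub>?M\<^esub> finsum ?M f A) = \<zero>\<^bsub>?M\<^esub>"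
    using sum by simp
  ultimately have 2: "(\<ominus> (?a [^] u)) \<odot>\<^bsub>?M\<^esub> f u \<oplus>\<^bsub>?M\<^esub> finsum ?M (\<lambda>v. (\<ominus> (?a [^] u)) \<odot>\<^bsub>?M\<^esub> f v) A = \<zero>\<^bsub>?M\<^esub>"
    using fu M.finsum_closed[OF fA] by (simp add: Sp_r_distr)
  let ?c = "\<lambda>v. ?a [^] v \<oplus> (\<ominus> (?a [^] u))"
  have "finsum ?M (\<lambda>v. ?c v \<odot>\<^bsub>?M\<^esub> f v) A = finsum ?M (\<lambda>v. (?a [^] v) \<odot>\<^bsub>?M\<^esub> f v \<oplus>\<^bsub>?M\<^esub> (\<ominus> (?a [^] u)) \<odot>\<^bsub>?M\<^esub> f v) A"
    by (rule M.finsum_cong') (use fc in \<open>auto simp: Sp_l_distr\<close>)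
  also have "\<dots> = finsum ?M (\<lambda>v. (?a [^] v) \<odot>\<^bsub>?M\<^esub> f v) A \<oplus>\<^bsub>?M\<^esub> finsum ?M (\<lambda>v. (\<ominus> (?a [^] u)) \<odot>\<^bsub>?M\<^esub> f v) A"
    by (rule M.finsum_addf) (use fc in auto)
  also have "\<dots> = \<zero>\<^bsub>?M\<^esub>"
  proof -
    define X Y x y where xy: "X = finsum ?M (\<lambda>v. (?a [^] v) \<odot>\<^bsub>?M\<^esub> f v) A"
      "Y = finsum ?M (\<lambda>v. (\<ominus> (?a [^] u)) \<odot>\<^bsub>?M\<^esub> f v) A" "x = (?a [^] u) \<odot>\<^bsub>?M\<^esub> f u" "y = (\<ominus> (?a [^] u)) \<odot>\<^bsub>?M\<^esub> f u"
    have c: "X \<in> carrier ?M" "Y \<in> carrier ?M" "x \<in> carrier ?M" "y \<in> carrier ?M"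
      unfolding xy using fc fu by (auto intro!: M.finsum_closed)
    have "x \<oplus>\<^bsub>?M\<^esub> y = \<zero>\<^bsub>?M\<^esub>" unfolding xy using fu by (simp add: Sp_l_distr[symmetric] r_neg)
    then have "X \<oplus>\<^bsub>?M\<^esub> Y = (x \<oplus>\<^bsub>?M\<^esub> X) \<oplus>\<^bsub>?M\<^esub> (y \<oplus>\<^bsub>?M\<^esub> Y)"
      using c by (simp add: Sp_a_ac)
    then show ?thesis using 1 2 unfolding xy by simp
  qed
  finally have sum0: "finsum ?M (\<lambda>v. ?c v \<odot>\<^bsub>?M\<^esub> f v) A = \<zero>\<^bsub>?M\<^esub>" .
  have w: "weight v n d (?c v \<odot>\<^bsub>?M\<^esub> f v)" if "v \<in> A" for v
    by (rule weight_homogeneous.smult) (use f that in auto)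
  have cz: "?c v \<odot>\<^bsub>?M\<^esub> f v = \<zero>\<^bsub>?M\<^esub>" if "v \<in> A" for v
    by (rule insert.IH[OF w sum0 that])
  have fz: "f v = \<zero>\<^bsub>?M\<^esub>" if v: "v \<in> A" for v
  proof -
    have "v \<noteq> u" using v insert.hyps by auto
    then have c0: "?c v \<noteq> \<zero>" using power_2_inj[of v u] by (metis a minus_equality minus_minus nat_pow_closed r_neg a_inv_closed)
    then have "?c v \<in> Units K" using field_Units by simp
    then obtain b where b: "b \<in> carrier K" "b \<otimes> ?c v = \<one>" by (metis Units_closed Units_l_inv_ex)
    have "f v = (b \<otimes> ?c v) \<odot>\<^bsub>?M\<^esub> f v" using b(2) fc v by simp
    also have "\<dots> = b \<odot>\<^bsub>?M\<^esub> (?c v \<odot>\<^bsub>?M\<^esub> f v)" using b(1) fc v by (intro Sp_smult_smult) auto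
    also have "\<dots> = \<zero>\<^bsub>?M\<^esub>" using cz[OF v] b(1) by simp
    finally show ?thesis .
  qed
  then have "finsum ?M f A = finsum ?M (\<lambda>v. \<zero>\<^bsub>?M\<^esub>) A" by (intro M.finsum_cong') auto
  also have "\<dots> = \<zero>\<^bsub>?M\<^esub>" by (rule M.finsum_zero)
  finally have "f u = \<zero>\<^bsub>?M\<^esub>" using sum fu by simp
  then show ?case using fz insert.prems(3) by blast
qed simp

end

context graded_operad
begin

lemma minus_cancel:
  assumes "x \<in> carrier (Sp P n d)" "y \<in> carrier (Sp P n d)"
    "x \<oplus>\<^bsub>Sp P n d\<^esub> \<ominus>\<^bsub>Sp P n d\<^esub> y = \<zero>\<^bsub>Sp P n d\<^esub>"
  shows "x = y"
proof -
  interpret M: module K "Sp P n d" by (rule module_Sp)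
  have "x = (x \<oplus>\<^bsub>Sp P n d\<^esub> \<ominus>\<^bsub>Sp P n d\<^esub> y) \<oplus>\<^bsub>Sp P n d\<^esub> y"
    using assms(1,2) by (simp add: M.a_assoc M.l_neg)
  then show ?thesis using assms by simp
qed

lemma finsum_support:
  assumes "finite A" "\<And>v. f v \<in> carrier (Sp P n d)" "\<And>v. v \<notin> A \<Longrightarrow> f v = \<zero>\<^bsub>Sp P n d\<^esub>"
  shows "finsum (Sp P n d) f {v. f v \<noteq> \<zero>\<^bsub>Sp P n d\<^esub>} = finsum (Sp P n d) f A"
proof -
  interpret M: module K "Sp P n d" by (rule module_Sp)
  show ?thesis
    by (rule M.add.finprod_mono_neutral_cong_left) (use assms in auto)
qed

lemma finsum_neutral:
  assumes "\<And>v. v \<in> A \<Longrightarrow> f v = \<zero>\<^bsub>Sp P n d\<^esub>"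
  shows "finsum (Sp P n d) f A = \<zero>\<^bsub>Sp P n d\<^esub>"
proof -
  interpret M: module K "Sp P n d" by (rule module_Sp)
  have "finsum (Sp P n d) f A = finsum (Sp P n d) (\<lambda>v. \<zero>\<^bsub>Sp P n d\<^esub>) A"
    using assms by (intro M.finsum_cong') auto
  then show ?thesis by (simp add: M.finsum_zero)
qed

lemma finsum_minus:
  assumes "f \<in> A \<rightarrow> carrier (Sp P n d)"
  shows "\<ominus>\<^bsub>Sp P n d\<^esub> (finsum (Sp P n d) f A) = finsum (Sp P n d) (\<lambda>v. \<ominus>\<^bsub>Sp P n d\<^esub> f v) A"
  by (rule additive_finsum[OF Sp_abelian_group Sp_abelian_group _ _ assms])
    (auto simp: abelian_group.minus_add[OF Sp_abelian_group])

end

section \<open>Decomposition into weight components\<close>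

context curved_grading_char_0
begin

text \<open>This is the condition inside the description that defines
  \<open>weight_component\<close>. A decomposition is a function on all weights, so that uniqueness
  becomes an equality of functions.\<close>

definition decomposed :: "nat \<Rightarrow> int \<Rightarrow> 'a \<Rightarrow> (nat \<Rightarrow> 'a) \<Rightarrow> bool" where
  "decomposed n d x f \<longleftrightarrow> (\<forall>v. weight v n d (f v)) \<and> finite {v. f v \<noteq> \<zero>\<^bsub>Sp P n d\<^esub>} \<and>
     x = finsum (Sp P n d) f {v. f v \<noteq> \<zero>\<^bsub>Sp P n d\<^esub>}"

lemma decomposedI:
  assumes "finite A" "\<And>v. weight v n d (f v)" "\<And>v. v \<notin> A \<Longrightarrow> f v = \<zero>\<^bsub>Sp P n d\<^esub>" "x = finsum (Sp P n d) f A"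
  shows "decomposed n d x f"
proof -
  have "{v. f v \<noteq> \<zero>\<^bsub>Sp P n d\<^esub>} \<subseteq> A" using assms(3) by auto
  then show ?thesis using finsum_support[OF assms(1) weight_closed[OF assms(2)] assms(3)] assms finite_subset
    by (auto simp: decomposed_def)
qed

lemma decomposed_unique:
  assumes f: "decomposed n d x f" and g: "decomposed n d x g"
  shows "f = g"
proof
  fix w
  interpret M: module K "Sp P n d" by (rule module_Sp)
  let ?M = "Sp P n d"
  let ?A = "{v. f v \<noteq> \<zero>\<^bsub>?M\<^esub>} \<union> {v. g v \<noteq> \<zero>\<^bsub>?M\<^esub>}"
  have wf: "weight v n d (f v)" "weight v n d (g v)" for v using f g by (auto simp: decomposed_def)
  have fc: "f v \<in> carrier ?M" "g v \<in> carrier ?M" for v using wf weight_closed by blast+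
  have fin: "finite ?A" using f g by (auto simp: decomposed_def)
  have "finsum ?M f ?A = x" "finsum ?M g ?A = x"
    using finsum_support[OF fin fc(1)] finsum_support[OF fin fc(2)] f g by (auto simp: decomposed_def)
  moreover have "finsum ?M (\<lambda>v. f v \<oplus>\<^bsub>?M\<^esub> \<ominus>\<^bsub>?M\<^esub> g v) ?A = finsum ?M f ?A \<oplus>\<^bsub>?M\<^esub> finsum ?M (\<lambda>v. \<ominus>\<^bsub>?M\<^esub> g v) ?A"
    by (rule M.finsum_addf) (use fc in auto)
  moreover have "finsum ?M (\<lambda>v. \<ominus>\<^bsub>?M\<^esub> g v) ?A = \<ominus>\<^bsub>?M\<^esub> finsum ?M g ?A"
    by (rule finsum_minus[symmetric]) (use fc in auto)
  moreover have "finsum ?M g ?A \<in> carrier ?M" using fc by (intro M.finsum_closed) auto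
  ultimately have sum: "finsum ?M (\<lambda>v. f v \<oplus>\<^bsub>?M\<^esub> \<ominus>\<^bsub>?M\<^esub> g v) ?A = \<zero>\<^bsub>?M\<^esub>" by (simp add: M.r_neg)
  have "f w \<oplus>\<^bsub>?M\<^esub> \<ominus>\<^bsub>?M\<^esub> g w = \<zero>\<^bsub>?M\<^esub>"
  proof (cases "w \<in> ?A")
    case True
    show ?thesis
      by (rule weight_independent[OF fin _ sum True]) (rule weight_submodule(1)[OF wf(1) weight_submodule(3)[OF wf(2)]])
  next
    case False
    then show ?thesis by simp
  qed
  then show "f w = g w" by (rule minus_cancel[OF fc])
qed

lemma weight_component_eq:
  assumes "decomposed n d x f"
  shows "weight_component K Q w n d x = f w"
proof -
  have eq: "(\<exists>f. (\<forall>v. f v \<in> curv_weight K Q v n d) \<and> finite {v. f v \<noteq> \<zero>\<^bsub>Sp P n d\<^esub>} \<and>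
      x = finsum (Sp P n d) f {v. f v \<noteq> \<zero>\<^bsub>Sp P n d\<^esub>} \<and> y = f w) \<longleftrightarrow> (\<exists>f. decomposed n d x f \<and> y = f w)" for y
    by (auto simp: decomposed_def curv_weight_eq)
  show ?thesis unfolding weight_component_def eq
    using assms decomposed_unique by (intro the_equality) blast+
qed

text \<open>Sums of homogeneous elements form a suboperad, by bilinearity of composition and
  additivity of weights, and this suboperad contains the base and \<open>\<kappa>\<close>.\<close>

lemma ex_decomposed:
  assumes "x \<in> carrier (Sp P n d)"
  shows "\<exists>f. decomposed n d x f"
proof -
  define H where "H n d = {x. \<exists>f A. finite A \<and> (\<forall>v. weight v n d (f v)) \<and>
    (\<forall>v. v \<notin> A \<longrightarrow> f v = \<zero>\<^bsub>Sp P n d\<^esub>) \<and> x = finsum (Sp P n d) f A}" for n d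
  have single: "x \<in> H n d" if "weight w n d x" for w n d x
  proof -
    interpret M: module K "Sp P n d" by (rule module_Sp)
    have "finsum (Sp P n d) (\<lambda>v. if w = v then x else \<zero>\<^bsub>Sp P n d\<^esub>) {w} = x"
      using M.finsum_singleton[of w "{w}" "\<lambda>_. x"] weight_closed[OF that] by simp
    then show ?thesis unfolding H_def using that weight_homogeneous.zero
      by (intro CollectI exI[of _ "\<lambda>v. if w = v then x else \<zero>\<^bsub>Sp P n d\<^esub>"] exI[of _ "{w}"]) auto
  qed
  have Hc: "H n d \<subseteq> carrier (Sp P n d)" for n d
  proof -
    interpret M: module K "Sp P n d" by (rule module_Sp)
    show ?thesis unfolding H_def using weight_closed by (blast intro: M.finsum_closed)
  qed
  have zero: "\<zero>\<^bsub>Sp P n d\<^esub> \<in> H n d" for n d by (rule single[OF weight_homogeneous.zero])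
  have add: "x \<oplus>\<^bsub>Sp P n d\<^esub> y \<in> H n d" if "x \<in> H n d" "y \<in> H n d" for x y n d
  proof -
    interpret M: module K "Sp P n d" by (rule module_Sp)
    obtain f A where f: "finite A" "\<And>v. weight v n d (f v)" "\<And>v. v \<notin> A \<Longrightarrow> f v = \<zero>\<^bsub>Sp P n d\<^esub>"
      "x = finsum (Sp P n d) f A" using \<open>x \<in> H n d\<close> by (auto simp: H_def)
    obtain g B' where g: "finite B'" "\<And>v. weight v n d (g v)" "\<And>v. v \<notin> B' \<Longrightarrow> g v = \<zero>\<^bsub>Sp P n d\<^esub>"
      "y = finsum (Sp P n d) g B'" using \<open>y \<in> H n d\<close> by (auto simp: H_def)
    note fc = weight_closed[OF f(2)] weight_closed[OF g(2)]
    have "x = finsum (Sp P n d) f (A \<union> B')" "y = finsum (Sp P n d) g (A \<union> B')"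
      unfolding f(4) g(4)
      using finsum_support[OF f(1) fc(1) f(3)] finsum_support[OF g(1) fc(2) g(3)]
        finsum_support[of "A \<union> B'" f n d] finsum_support[of "A \<union> B'" g n d] f g fc by auto
    then have "x \<oplus>\<^bsub>Sp P n d\<^esub> y = finsum (Sp P n d) (\<lambda>v. f v \<oplus>\<^bsub>Sp P n d\<^esub> g v) (A \<union> B')"
      using fc by (simp add: M.finsum_addf Pi_def)
    then show ?thesis unfolding H_def using f g weight_submodule(1)[OF f(2) g(2)]
      by (intro CollectI exI[of _ "\<lambda>v. f v \<oplus>\<^bsub>Sp P n d\<^esub> g v"] exI[of _ "A \<union> B'"]) auto
  qed
  have sum: "finsum (Sp P n d) F A \<in> H n d" if "\<And>v. v \<in> A \<Longrightarrow> F v \<in> H n d" "finite A" for F n d and A :: "nat set"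
  proof -
    interpret M: module K "Sp P n d" by (rule module_Sp)
    show ?thesis using that(2,1) Hc
    proof (induction A rule: finite_induct)
      case (insert u A)
      then have "F \<in> A \<rightarrow> carrier (Sp P n d)" "F u \<in> carrier (Sp P n d)" by (auto simp: subset_iff)
      then show ?case using insert add by (simp add: M.finsum_insert)
    qed (use zero in simp)
  qed
  have H: "suboperad K P H"
  proof (rule suboperadI[OF Hc zero add])
    fix n d x assume x: "x \<in> H n d"
    interpret M: module K "Sp P n d" by (rule module_Sp)
    obtain f A where f: "finite A" "\<And>v. weight v n d (f v)" "x = finsum (Sp P n d) f A" using x by (auto simp: H_def)
    note fc = weight_closed[OF f(2)]
    have fP: "f \<in> A \<rightarrow> carrier (Sp P n d)" using fc by auto
    show "c \<odot>\<^bsub>Sp P n d\<^esub> x \<in> H n d" if "c \<in> carrier K" for c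
    proof -
      have "c \<odot>\<^bsub>Sp P n d\<^esub> x = finsum (Sp P n d) (\<lambda>v. c \<odot>\<^bsub>Sp P n d\<^esub> f v) A"
        unfolding f(3) by (rule additive_finsum[OF Sp_abelian_group Sp_abelian_group _ _ fP]) (use that in \<open>auto simp: Sp_r_distr\<close>)
      moreover have "c \<odot>\<^bsub>Sp P n d\<^esub> f v \<in> H n d" for v by (rule single[OF weight_submodule(2)[OF f(2) that]])
      ultimately show ?thesis using sum f(1) by simp
    qed
    show "act P \<sigma> x \<in> H n d" if "\<sigma> permutes {1..n}" for \<sigma>
    proof -
      have "act P \<sigma> x = finsum (Sp P n d) (\<lambda>v. act P \<sigma> (f v)) A" unfolding f(3) by (rule act_finsum[OF that fP])
      moreover have "act P \<sigma> (f v) \<in> H n d" for v by (rule single[OF weight_homogeneous.act[OF f(2) that]])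
      ultimately show ?thesis using sum f(1) by simp
    qed
    show "pcomp P i x y \<in> H (n + m - 1) (d + e)" if y: "y \<in> H m e" and i: "1 \<le> i" "i \<le> n" for y m e i
    proof -
      obtain g B' where g: "finite B'" "\<And>v. weight v m e (g v)" "y = finsum (Sp P m e) g B'" using y by (auto simp: H_def)
      note gc = weight_closed[OF g(2)]
      have gP: "g \<in> B' \<rightarrow> carrier (Sp P m e)" using gc by auto
      have yc: "y \<in> carrier (Sp P m e)" using y Hc by auto
      have fy: "pcomp P i (f u) y \<in> H (n + m - 1) (d + e)" for u
      proof -
        have "pcomp P i (f u) y = finsum (Sp P (n + m - 1) (d + e)) (\<lambda>v. pcomp P i (f u) (g v)) B'"
          unfolding g(3) by (rule additive_finsum[OF Sp_abelian_group Sp_abelian_group _ _ gP])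
            (auto intro: pcomp_closed[OF fc _ i] pcomp_add_right[OF fc _ _ i])
        moreover have "pcomp P i (f u) (g v) \<in> H (n + m - 1) (d + e)" for v
          by (rule single[OF weight_homogeneous.pcomp[OF f(2) g(2) i]])
        ultimately show ?thesis using sum g(1) by simp
      qed
      have "pcomp P i x y = finsum (Sp P (n + m - 1) (d + e)) (\<lambda>u. pcomp P i (f u) y) A"
        unfolding f(3) by (rule additive_finsum[OF Sp_abelian_group Sp_abelian_group _ _ fP])
          (auto intro: pcomp_closed[OF _ yc i] pcomp_add_left[OF _ _ yc i])
      then show ?thesis using sum f(1) fy by simp
    qed
  qed
  have "x \<in> H n d"
  proof (rule generated[OF H _ _ assms])
    show "B n d \<subseteq> H n d" for n d using single[OF weight_homogeneous.base] by auto
    show "\<kappa> \<in> H 0 (-1)" by (rule single[OF weight_homogeneous.kappa])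
  qed
  then obtain f A where "finite A" "\<And>v. weight v n d (f v)" "\<And>v. v \<notin> A \<Longrightarrow> f v = \<zero>\<^bsub>Sp P n d\<^esub>" "x = finsum (Sp P n d) f A"
    by (auto simp: H_def)
  then have "decomposed n d x f" by (rule decomposedI)
  then show ?thesis by (intro exI[of _ f])
qed

lemma decomposed_pair:
  assumes "weight v n d x" "weight u n d y" "v \<noteq> u"
  shows "decomposed n d (x \<oplus>\<^bsub>Sp P n d\<^esub> y) (\<lambda>w. if w = v then x else if w = u then y else \<zero>\<^bsub>Sp P n d\<^esub>)"
proof -
  interpret M: module K "Sp P n d" by (rule module_Sp)
  let ?f = "\<lambda>w. if w = v then x else if w = u then y else \<zero>\<^bsub>Sp P n d\<^esub>"
  note c = weight_closed[OF assms(1)] weight_closed[OF assms(2)]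
  have "finsum (Sp P n d) ?f {v, u} = x \<oplus>\<^bsub>Sp P n d\<^esub> y"
    using c assms(3) by (simp add: M.finsum_insert Pi_def)
  then show ?thesis using assms weight_homogeneous.zero by (intro decomposedI[of "{v, u}"]) auto
qed

lemma weight_component_pair:
  assumes "weight v n d x" "weight u n d y" "v \<noteq> u"
  shows "weight_component K Q w n d (x \<oplus>\<^bsub>Sp P n d\<^esub> y) = (if w = v then x else if w = u then y else \<zero>\<^bsub>Sp P n d\<^esub>)"
  using weight_component_eq[OF decomposed_pair[OF assms]] .

lemma weight_component_weight:
  assumes "weight v n d x"
  shows "weight_component K Q w n d x = (if w = v then x else \<zero>\<^bsub>Sp P n d\<^esub>)"
  using weight_component_pair[OF assms weight_homogeneous.zero, of "v + 1" w] weight_closed[OF assms] by auto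

lemma decompose_01:
  assumes "x \<in> carrier (Sp P n d)" "\<And>v. v \<ge> 2 \<Longrightarrow> weight_component K Q v n d x = \<zero>\<^bsub>Sp P n d\<^esub>"
  obtains y z where "weight 0 n d y" "weight 1 n d z" "x = y \<oplus>\<^bsub>Sp P n d\<^esub> z"
    "weight_component K Q 0 n d x = y" "weight_component K Q 1 n d x = z"
proof -
  interpret M: module K "Sp P n d" by (rule module_Sp)
  obtain f where f: "decomposed n d x f" using ex_decomposed[OF assms(1)] by blast
  then have w: "weight v n d (f v)" for v by (simp add: decomposed_def)
  note c = weight_closed[OF w]
  have "f v = \<zero>\<^bsub>Sp P n d\<^esub>" if "v \<notin> {0, 1}" for v
    using assms(2)[of v] weight_component_eq[OF f, of v] that by (cases "v \<ge> 2") auto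
  then have "x = finsum (Sp P n d) f {0, 1}"
    using f finsum_support[of "{0,1}" f n d] c by (simp add: decomposed_def)
  also have "\<dots> = f 0 \<oplus>\<^bsub>Sp P n d\<^esub> f 1" using c by (simp add: M.finsum_insert Pi_def)
  finally show thesis using that[of "f 0" "f 1"] w weight_component_eq[OF f] by blast
qed

end

section \<open>Unplugging the curvature\<close>

lemma (in curved_grading) unplug_derivation:
  "presentation_derivation K (curv_gens Q) (curv_rels K Q) P (\<lambda>n d. case_sum (\<lambda>x. x) (\<lambda>u. \<kappa>))
    (marked 1) (mark_lact 1) (mark_ract 1) mark_act
    (\<lambda>n d. case_sum (\<lambda>x. \<zero>\<^bsub>marked 1 n d\<^esub>) (\<lambda>u. (\<zero>\<^bsub>Sp P 1 0\<^esub>, \<one>)))"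
proof -
  interpret M: inf_bimodule K P "marked 1" "mark_lact 1" "mark_ract 1" mark_act by (rule marked_bimodule)
  let ?der = "derivation_expr (marked 1) (mark_lact 1) (mark_ract 1) mark_act P (\<lambda>n d. case_sum (\<lambda>x. x) (\<lambda>u. \<kappa>))
    (\<lambda>n d. case_sum (\<lambda>x. \<zero>\<^bsub>marked 1 n d\<^esub>) (\<lambda>u. (\<zero>\<^bsub>Sp P 1 0\<^esub>, \<one>)))"
  show ?thesis
  proof unfold_locales
    show "case_sum (\<lambda>x. \<zero>\<^bsub>marked 1 n d\<^esub>) (\<lambda>u. (\<zero>\<^bsub>Sp P 1 0\<^esub>, \<one>)) g \<in> carrier (marked 1 n d)"
      if "g \<in> curv_gens Q n d" for g n d
      using that by (auto simp: curv_gens_def kappa_gens_def split: if_splits)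
    have mact0: "mark_act \<sigma> \<zero>\<^bsub>marked 1 n d\<^esub> = \<zero>\<^bsub>marked 1 n d\<^esub>" if "\<sigma> permutes {1..n}" for \<sigma> n d
      using act_zero[OF up_permutes[OF that]] by (simp add: mark_act_def)
    fix s t assume st: "(s, t) \<in> curv_rels K Q"
    note l0 = M.lact_zero_right[simplified marked_simps(2)]
    consider n d x y where "s = Add (Gen n d (Inl x)) (Gen n d (Inl y))" "t = Gen n d (Inl (x \<oplus>\<^bsub>Sp P n d\<^esub> y))"
      | n d c x where "s = Smult c (Gen n d (Inl x))" "t = Gen n d (Inl (c \<odot>\<^bsub>Sp P n d\<^esub> x))" "c \<in> carrier K"
      | n d m e i x y where "s = Comp i (Gen n d (Inl x)) (Gen m e (Inl y))" "t = Gen (n + m - 1) (d + e) (Inl (pcomp P i x y))"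
        "x \<in> B n d" "y \<in> B m e" "1 \<le> i" "i \<le> n"
      | n d \<sigma> x where "s = Act \<sigma> (Gen n d (Inl x))" "t = Gen n d (Inl (act P \<sigma> x))" "\<sigma> permutes {1..n}"
      using st unfolding curv_rels_def structure_relations_def base_operad_def restrict_operad_simps by fastforce
    then show "?der s = ?der t"
    proof cases
      case 3
      have "mark_ract 1 n d m e i \<zero>\<^bsub>marked 1 n d\<^esub> y = \<zero>\<^bsub>marked 1 (n + m - 1) (d + e)\<^esub>"
        "mark_lact 1 n d m e i x \<zero>\<^bsub>marked 1 m e\<^esub> = \<zero>\<^bsub>marked 1 (n + m - 1) (d + e)\<^esub>"
        using M.ract_zero_left[OF base_closed[OF 3(4)] 3(5,6)] M.lact_zero_right[OF base_closed[OF 3(3)] 3(5,6)] .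
      then show ?thesis using 3 M.M_zero(1)[OF M.M_closed(1)]
        by (simp del: marked_simps)
    next
      case 4
      then show ?thesis using mact0 by (simp del: marked_simps)
    qed (simp_all del: marked_simps)
  qed
qed

context curved_grading
begin

sublocale U: presentation_derivation K "curv_gens Q" "curv_rels K Q" P "\<lambda>n d. case_sum (\<lambda>x. x) (\<lambda>u. curvature Q)"
    "marked 1" "mark_lact 1" "mark_ract 1" mark_act
    "\<lambda>n d. case_sum (\<lambda>x. \<zero>\<^bsub>marked 1 n d\<^esub>) (\<lambda>u. (\<zero>\<^bsub>Sp P 1 0\<^esub>, \<one>))"
  by (rule unplug_derivation)

definition unplug :: "nat \<Rightarrow> int \<Rightarrow> 'a \<Rightarrow> 'a \<times> 'k" where
  "unplug n d x = U.der (rep n d x)"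

lemma unplug_base: "x \<in> B n d \<Longrightarrow> unplug n d x = \<zero>\<^bsub>marked 1 n d\<^esub>"
  using U.der_cong[OF rep_cong[of "Gen n d (Inl x)" n d]] by (auto simp: unplug_def curv_gens_def)

lemma unplug_curvature: "unplug 0 (-1) \<kappa> = (\<zero>\<^bsub>Sp P 1 0\<^esub>, \<one>)"
  using U.der_cong[OF rep_cong[of "Gen 0 (-1) (Inr ())" 0 "-1"]] by (auto simp: unplug_def curv_gens_def kappa_gens_def)

lemma unplug_zero: "unplug n d \<zero>\<^bsub>Sp P n d\<^esub> = \<zero>\<^bsub>marked 1 n d\<^esub>"
  by (rule unplug_base[OF baseD(2)])

lemma unplug_pcomp:
  assumes "x \<in> carrier (Sp P n d)" "y \<in> carrier (Sp P m e)" "1 \<le> i" "i \<le> n" "N = n + m - 1" "D = d + e"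
  shows "unplug N D (pcomp P i x y) =
    mark_ract 1 n d m e i (unplug n d x) y \<oplus>\<^bsub>marked 1 N D\<^esub> mark_lact 1 n d m e i x (unplug m e y)"
  using U.der_cong[OF rep_ops(3)[OF assms]] rep[OF assms(1)] rep[OF assms(2)] assms(5,6)
  by (simp add: unplug_def)

text \<open>In the Leibniz rule the term with the derivation of \<open>z\<close> vanishes as
  \<open>z\<close> is in the base. The other term plugs the bare element into the first slot, which
  just marks this slot and returns \<open>z\<close>. Thus unplugging is a left inverse of
  plugging.\<close>

lemma unplug_plug:
  assumes "z \<in> B (n + 1) (d + 1)"
  shows "unplug n d (pcomp P 1 z \<kappa>) = (z, \<zero>)"
proof -
  note z = base_closed[OF assms]
  have "mark_ract 1 (n + 1) (d + 1) 0 (-1) 1 \<zero>\<^bsub>marked 1 (n + 1) (d + 1)\<^esub> \<kappa> = \<zero>\<^bsub>marked 1 n d\<^esub>"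
    using U.M.ract_zero_left[OF curvature_closed, of 1 "n + 1" "d + 1"] by (simp del: marked_simps)
  moreover have "mark_lact 1 (n + 1) (d + 1) 0 (-1) 1 z (\<zero>\<^bsub>Sp P 1 0\<^esub>, \<one>) = (z, \<zero>)"
    using pcomp_zero_right[OF z, of 1 "n + 1" 1 "d + 1" 0] z by (simp add: mark_lact_def act_id[where d = "d + 1"] act_id[where d = "d - 1"] act_id[OF Sp_closed(1)])
  moreover have "unplug n d (pcomp P 1 z \<kappa>) =
    mark_ract 1 (n + 1) (d + 1) 0 (-1) 1 (unplug (n + 1) (d + 1) z) \<kappa> \<oplus>\<^bsub>marked 1 n d\<^esub>
    mark_lact 1 (n + 1) (d + 1) 0 (-1) 1 z (unplug 0 (-1) \<kappa>)"
    by (rule unplug_pcomp[OF z curvature_closed]) auto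
  ultimately show ?thesis using z unfolding unplug_base[OF assms] unplug_curvature by simp
qed

lemma plug_inj:
  assumes "z \<in> B (n + 1) (d + 1)" "z' \<in> B (n + 1) (d + 1)" "pcomp P 1 z \<kappa> = pcomp P 1 z' \<kappa>"
  shows "z = z'"
proof -
  have "(z, \<zero>) = (z', \<zero>)"
    unfolding unplug_plug[OF assms(1), symmetric] unplug_plug[OF assms(2), symmetric] assms(3) ..
  then show ?thesis by simp
qed

text \<open>Unplugging one of two copies of \<open>\<kappa>\<close> leaves the other in slot 1 or in
  slot 2, and the two results have opposite signs because \<open>\<kappa>\<close> is odd. If the
  twofold plugging is zero, plugging into slot 1 and into slot 2 thus agree, and injectivity of
  plugging gives invariance under the exchange of the slots.\<close>

lemma plug_plug_symmetric:
  assumes x: "x \<in> B (n + 2) d" and eq: "pcomp P 1 (pcomp P 1 x \<kappa>) \<kappa> = \<zero>\<^bsub>Sp P n (d - 2)\<^esub>"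
  shows "act P (gam 2) x = x"
proof -
  have x': "x \<in> B (n + 1 + 1) (d - 1 + 1)" using x by (simp add: add.assoc one_add_one[symmetric] del: one_add_one)
  note xc = base_closed[OF x]
  let ?y = "pcomp P 1 x \<kappa>"
  have y: "?y \<in> carrier (Sp P (n + 1) (d - 1))" by (rule pcomp_in[OF xc curvature_closed]) auto
  have x2: "pcomp P 2 x \<kappa> \<in> carrier (Sp P (n + 1) (d - 1))" by (rule pcomp_in[OF xc curvature_closed]) auto
  have "\<zero>\<^bsub>marked 1 n (d - 2)\<^esub> = unplug n (d - 2) (pcomp P 1 ?y \<kappa>)"
    unfolding eq unplug_zero ..
  also have "\<dots> = mark_ract 1 (n + 1) (d - 1) 0 (-1) 1 (unplug (n + 1) (d - 1) ?y) \<kappa> \<oplus>\<^bsub>marked 1 n (d - 2)\<^esub>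
    mark_lact 1 (n + 1) (d - 1) 0 (-1) 1 ?y (unplug 0 (-1) \<kappa>)"
    by (rule unplug_pcomp[OF y curvature_closed]) auto
  also have "\<dots> = mark_ract 1 (n + 1) (d - 1) 0 (-1) 1 (x, \<zero>) \<kappa> \<oplus>\<^bsub>marked 1 n (d - 2)\<^esub>
    mark_lact 1 (n + 1) (d - 1) 0 (-1) 1 ?y (\<zero>\<^bsub>Sp P 1 0\<^esub>, \<one>)"
    using unplug_plug[OF x'] unplug_curvature by simp
  also have "mark_lact 1 (n + 1) (d - 1) 0 (-1) 1 ?y (\<zero>\<^bsub>Sp P 1 0\<^esub>, \<one>) = (?y, \<zero>)"
    using pcomp_zero_right[OF y, of 1 "n + 1" 1 "d - 1" 0] y by (simp add: mark_lact_def act_id[where d = "d + 1"] act_id[where d = "d - 1"] act_id[OF Sp_closed(1)])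
  \<comment> \<open>The slot is 2 since slot 1 is now the marked one, and the sign is that of
    \<open>1 * (-1)\<close>.\<close>
  also have "mark_ract 1 (n + 1) (d - 1) 0 (-1) 1 (x, \<zero>) \<kappa> = (\<ominus>\<^bsub>Sp P (n + 1) (d - 1)\<^esub> pcomp P 2 x \<kappa>, \<zero>)"
    using module.smult_l_minus[OF module_Sp one_closed x2] x2 by (simp add: mark_ract_def sign_of_def)
  finally have "\<ominus>\<^bsub>Sp P (n + 1) (d - 1)\<^esub> pcomp P 2 x \<kappa> \<oplus>\<^bsub>Sp P (n + 1) (d - 1)\<^esub> ?y = \<zero>\<^bsub>Sp P (n + 1) (d - 1)\<^esub>"
    by simp
  then have "?y = pcomp P 2 x \<kappa>"
    using minus_cancel[OF y x2] y x2 by (simp add: Sp_a_ac)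
  moreover have "pcomp P 1 (act P (gam 2) x) \<kappa> = pcomp P 2 x \<kappa>"
  proof -
    have g: "gam 2 permutes {1..n + 2}" by (rule gam_permutes) auto
    have "pcomp P 1 (act P (gam 2) x) \<kappa> = act P (block_outer 1 0 (gam 2)) (pcomp P (gam 2 1) x \<kappa>)"
      by (rule pcomp_act_left[OF xc curvature_closed _ _ g]) auto
    then show ?thesis using block_outer_gam_0[of 2] x2 by (simp add: gam_def act_id)
  qed
  moreover have "act P (gam 2) x \<in> B (n + 1 + 1) (d - 1 + 1)"
  proof -
    have "gam 2 permutes {1..n + 1 + 1}" by (rule gam_permutes) auto
    then show ?thesis using baseD(7)[OF x'] by blast
  qed
  ultimately show ?thesis using plug_inj[OF _ x'] by metis
qed

end

section \<open>Sums over unshuffles\<close>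

text \<open>At the first point where the functions differ, the smaller of the two values would be
  missing from the image of the other function.\<close>

lemma strict_mono_on_unique:
  fixes f g :: "nat \<Rightarrow> nat"
  assumes "strict_mono_on S f" "strict_mono_on S g" "f ` S = g ` S" "x \<in> S"
  shows "f x = g x"
  using assms(4)
proof (induction x rule: less_induct)
  case (less x)
  have *: False if h: "strict_mono_on S f" "strict_mono_on S g" "f ` S = g ` S" "f x < g x"
    "\<And>y. y < x \<Longrightarrow> y \<in> S \<Longrightarrow> f y = g y" for f g :: "nat \<Rightarrow> nat"
  proof -
    have "f x \<in> g ` S" using h(3) less.prems by blast
    then obtain y where y: "y \<in> S" "f x = g y" by blast
    show False
    proof (cases "y < x")
      case True
      then show False using strict_mono_onD[OF h(1) y(1) less.prems] h(5)[OF True y(1)] y(2) by simp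
    next
      case False
      then have "y = x \<or> x < y" by auto
      then have "y = x \<or> g x < g y" using strict_mono_onD[OF h(2) less.prems y(1)] by blast
      then show False using y(2) h(4) by auto
    qed
  qed
  show ?case
    using *[of f g] *[of g f] assms(1-3) less.IH by (metis linorder_neqE_nat)
qed

text \<open>The offset \<open>c\<close> is there for the second block of slots of an unshuffle,
  which starts at \<open>q + 1\<close>.\<close>

lemma ex_strict_mono_enum:
  fixes I :: "nat set"
  assumes "finite I"
  shows "\<exists>a. strict_mono_on {c + 1..c + card I} a \<and> a ` {c + 1..c + card I} = I"
proof -
  let ?l = "sorted_list_of_set I"
  have l: "sorted_wrt (<) ?l" "set ?l = I" "length ?l = card I"
    using assms by auto
  let ?a = "\<lambda>k. ?l ! (k - c - 1)"
  have "strict_mono_on {c + 1..c + card I} ?a"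
    by (rule strict_mono_onI) (use sorted_wrt_nth_less[OF l(1)] l(3) in auto)
  moreover have "?a ` {c + 1..c + card I} = I"
  proof (intro equalityI subsetI)
    fix x assume "x \<in> ?a ` {c + 1..c + card I}"
    then obtain k where "k \<in> {c + 1..c + card I}" "x = ?l ! (k - c - 1)" by auto
    moreover from this have "k - c - 1 < length ?l" using l(3) by auto
    ultimately show "x \<in> I" using l(2) nth_mem by blast
  next
    fix x assume "x \<in> I"
    then obtain j where "j < length ?l" "?l ! j = x" using l(2) by (metis in_set_conv_nth)
    then show "x \<in> ?a ` {c + 1..c + card I}" using l(3) by (intro image_eqI[of _ _ "c + 1 + j"]) auto
  qed
  ultimately show ?thesis by (intro exI conjI)
qed

text \<open>The inverse of an unshuffle is monotone on each block, so it is determined by the image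
  of the first block; the image of the second is the complement.\<close>

lemma unshuffles_bij:
  assumes "q \<le> n"
  shows "bij_betw (\<lambda>\<sigma>. inv_into UNIV \<sigma> ` {1..q}) (unshuffles (n - q) q) {I. I \<subseteq> {1..n} \<and> card I = q}"
proof -
  have nq: "n - q + q = n" "q + (n - q) = n" using assms by auto
  have un: "{1..n} = {1..q} \<union> {q + 1..n}" using assms by auto
  show ?thesis unfolding bij_betw_def
  proof
    show "inj_on (\<lambda>\<sigma>. inv_into UNIV \<sigma> ` {1..q}) (unshuffles (n - q) q)"
    proof (rule inj_onI)
      fix \<sigma> \<tau> assume s: "\<sigma> \<in> unshuffles (n - q) q" "\<tau> \<in> unshuffles (n - q) q"
        and eq: "inv_into UNIV \<sigma> ` {1..q} = inv_into UNIV \<tau> ` {1..q}"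
      have p: "\<sigma> permutes {1..n}" "\<tau> permutes {1..n}" using s nq by (auto simp: unshuffles_def)
      note pi = permutes_inv[OF p(1)] permutes_inv[OF p(2)]
      have c: "inv_into UNIV \<rho> ` {q + 1..n} = {1..n} - inv_into UNIV \<rho> ` {1..q}" if "\<rho> permutes {1..n}" for \<rho>
      proof -
        have "{1..n} = inv_into UNIV \<rho> ` {1..q} \<union> inv_into UNIV \<rho> ` {q + 1..n}"
          using permutes_image[OF permutes_inv[OF that]] unfolding un image_Un by simp
        moreover have "inv_into UNIV \<rho> ` {1..q} \<inter> inv_into UNIV \<rho> ` {q + 1..n} = {}"
          unfolding image_Int[OF permutes_inj[OF permutes_inv[OF that]], symmetric] by simp
        ultimately show ?thesis by blast
      qed
      have h1: "inv_into UNIV \<sigma> k = inv_into UNIV \<tau> k" if "k \<in> {1..q}" for k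
        by (rule strict_mono_on_unique[OF _ _ eq that]) (use s in \<open>auto simp: unshuffles_def\<close>)
      have h2: "inv_into UNIV \<sigma> k = inv_into UNIV \<tau> k" if "k \<in> {q + 1..n}" for k
        by (rule strict_mono_on_unique[OF _ _ _ that]) (use s c[OF p(1)] c[OF p(2)] eq nq in \<open>auto simp: unshuffles_def\<close>)
      have "inv_into UNIV \<sigma> k = inv_into UNIV \<tau> k" for k
      proof (cases "k \<in> {1..n}")
        case True
        then have "k \<in> {1..q} \<or> k \<in> {q + 1..n}" using un by blast
        then show ?thesis using h1 h2 by blast
      next
        case False
        show ?thesis using permutes_not_in[OF pi(1) False] permutes_not_in[OF pi(2) False] by simp
      qed
      then have "inv_into UNIV (inv_into UNIV \<sigma>) = inv_into UNIV (inv_into UNIV \<tau>)" by presburger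
      then show "\<sigma> = \<tau>" unfolding permutes_inv_inv[OF p(1)] permutes_inv_inv[OF p(2)] .
    qed
    show "(\<lambda>\<sigma>. inv_into UNIV \<sigma> ` {1..q}) ` unshuffles (n - q) q = {I. I \<subseteq> {1..n} \<and> card I = q}"
    proof (intro equalityI subsetI)
      fix I assume "I \<in> (\<lambda>\<sigma>. inv_into UNIV \<sigma> ` {1..q}) ` unshuffles (n - q) q"
      then obtain \<sigma> where s: "\<sigma> permutes {1..n}" "I = inv_into UNIV \<sigma> ` {1..q}"
        using nq by (auto simp: unshuffles_def)
      note pi = permutes_inv[OF s(1)]
      have "I \<subseteq> {1..n}" using s(2) un permutes_image[OF pi] by blast
      moreover have "card I = q" unfolding s(2)
        using card_image[OF inj_on_subset[OF permutes_inj[OF pi]], of "{1..q}"] by simp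
      ultimately show "I \<in> {I. I \<subseteq> {1..n} \<and> card I = q}" by simp
    next
      fix I assume "I \<in> {I. I \<subseteq> {1..n} \<and> card I = q}"
      then have I: "I \<subseteq> {1..n}" "card I = q" by auto
      have fI: "finite I" using I(1) finite_subset by blast
      have cJ: "card ({1..n} - I) = n - q" using card_Diff_subset[OF fI I(1)] I(2) by simp
      obtain a where a: "strict_mono_on {1..q} a" "a ` {1..q} = I"
        using ex_strict_mono_enum[OF fI, of 0] I(2) by auto
      obtain b where b: "strict_mono_on {q + 1..n} b" "b ` {q + 1..n} = {1..n} - I"
        using ex_strict_mono_enum[of "{1..n} - I" q] cJ nq by auto
      \<comment> \<open>The inverse of the wanted unshuffle: it lists \<open>I\<close> in increasing
        order and then the complement of \<open>I\<close>.\<close>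
      define \<tau> where "\<tau> k = (if k \<in> {1..q} then a k else if k \<in> {q + 1..n} then b k else k)" for k
      have im: "\<tau> ` {1..q} = I" "\<tau> ` {q + 1..n} = {1..n} - I"
        using a(2) b(2) by (auto simp: \<tau>_def image_iff)
      have "\<tau> ` {1..n} = {1..n}" unfolding un image_Un im using I(1) un by auto
      then have t: "\<tau> permutes {1..n}"
        by (intro bij_imp_permutes) (use assms in \<open>auto simp: bij_betw_def eq_card_imp_inj_on \<tau>_def\<close>)
      have m: "strict_mono_on {1..q} \<tau>" "strict_mono_on {q + 1..n} \<tau>"
        using a(1) b(1) by (auto simp: \<tau>_def strict_mono_on_def)
      have inv: "inv_into UNIV (inv_into UNIV \<tau>) = \<tau>" by (rule permutes_inv_inv[OF t])
      have "inv_into UNIV \<tau> \<in> unshuffles (n - q) q"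
        using permutes_inv[OF t] m nq by (simp add: unshuffles_def inv)
      then show "I \<in> (\<lambda>\<sigma>. inv_into UNIV \<sigma> ` {1..q}) ` unshuffles (n - q) q"
        using im(1) inv by (intro image_eqI[of _ _ "inv_into UNIV \<tau>"]) auto
    qed
  qed
qed

text \<open>The formula for the differential makes sense for any such family. It is needed twice,
  for the generators of the curved L-infinity operad and for their images in an object.\<close>

locale symmetric_family = graded_operad K P for K :: "('k, 'm) ring_scheme" (structure) and P :: "('k, 'a) operad" +
  fixes l :: "nat \<Rightarrow> 'a"
  assumes l_closed: "l n \<in> carrier (Sp P n (-1))"
    and l_sym: "\<sigma> permutes {1..n} \<Longrightarrow> act P \<sigma> (l n) = l n"
begin

definition tree :: "nat \<Rightarrow> nat \<Rightarrow> 'a" where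
  "tree p q = pcomp P 1 (l (p + 1)) (l q)"

text \<open>
  \<open>bterm n I\<close> is \<open>tree p q\<close> with the inputs in \<open>I\<close> fed into its inner operation; by symmetry of
  the family any \<open>\<sigma>\<close> which moves \<open>I\<close> to the front gives the same result. Indexing by
  subsets instead of unshuffles makes the sum visibly invariant under all permutations.
\<close>

definition bterm :: "nat \<Rightarrow> nat set \<Rightarrow> 'a" where
  "bterm n I = act P (SOME \<sigma>. \<sigma> permutes {1..n} \<and> \<sigma> ` I = {1..card I}) (tree (n - card I) (card I))"

definition dl :: "nat \<Rightarrow> 'a" where
  "dl n = \<ominus>\<^bsub>Sp P n (-2)\<^esub> finsum (Sp P n (-2)) (bterm n) (Pow {1..n})"

lemma tree_closed: "n = p + q \<Longrightarrow> tree p q \<in> carrier (Sp P n (-2))"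
  unfolding tree_def by (rule pcomp_in[OF l_closed l_closed]) auto

text \<open>A permutation that preserves the first \<open>q\<close> inputs factors into a
  permutation of the inner inputs and one of the outer slots which fixes the slot of the inner
  operation; symmetry of the family absorbs both.\<close>

lemma tree_sym:
  assumes "\<rho> permutes {1..p + q}" "\<rho> ` {1..q} = {1..q}"
  shows "act P \<rho> (tree p q) = tree p q"
proof -
  have in1: "\<rho> k \<in> {1..q} \<longleftrightarrow> k \<in> {1..q}" for k
    using assms(2) permutes_inj[OF assms(1)] by (metis inj_image_mem_iff)
  have in2: "\<rho> k \<in> {1..p + q} \<longleftrightarrow> k \<in> {1..p + q}" for k by (rule permutes_in_image[OF assms(1)])
  have inj: "\<rho> x = \<rho> y \<longleftrightarrow> x = y" for x y using inj_eq[OF permutes_inj[OF assms(1)]] .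
  define \<tau> where "\<tau> k = (if k \<in> {1..q} then \<rho> k else k)" for k
  \<comment> \<open>The slot \<open>k\<close> of the outer operation with \<open>k \<ge> 2\<close>
    is the input \<open>k + q - 1\<close> of the tree, since slot 1 has been replaced by
    \<open>q\<close> inputs.\<close>
  define \<tau>' where "\<tau>' k = (if 2 \<le> k \<and> k \<le> p + 1 then \<rho> (k + q - 1) + 1 - q else k)" for k
  have t: "\<tau> permutes {1..q}"
  proof (rule finite_inj_on_permutes)
    show "\<tau> ` {1..q} \<subseteq> {1..q}" using assms(2) by (auto simp: \<tau>_def)
    show "inj_on \<tau> {1..q}" using inj by (auto simp: \<tau>_def inj_on_def)
  qed (auto simp: \<tau>_def)
  have big: "q + 1 \<le> \<rho> (k + q - 1)" "\<rho> (k + q - 1) \<le> p + q" if "2 \<le> k" "k \<le> p + 1" for k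
    using in1[of "k + q - 1"] in2[of "k + q - 1"] that by auto
  have t': "\<tau>' permutes {1..p + 1}"
  proof (rule finite_inj_on_permutes)
    show "\<tau>' ` {1..p + 1} \<subseteq> {1..p + 1}"
    proof
      fix x assume "x \<in> \<tau>' ` {1..p + 1}"
      then obtain k where k: "1 \<le> k" "k \<le> p + 1" "x = \<tau>' k" by auto
      then show "x \<in> {1..p + 1}" using big[of k] by (cases "2 \<le> k") (auto simp: \<tau>'_def)
    qed
    show "inj_on \<tau>' {1..p + 1}"
    proof (rule inj_onI)
      fix x y assume *: "x \<in> {1..p + 1}" "y \<in> {1..p + 1}" "\<tau>' x = \<tau>' y"
      define u v where "u = \<rho> (x + q - 1)" and "v = \<rho> (y + q - 1)"
      have uv: "u = v \<longleftrightarrow> x + q - 1 = y + q - 1" unfolding u_def v_def by (rule inj)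
      show "x = y" using * big[of x, folded u_def] big[of y, folded v_def] uv
        by (cases "2 \<le> x"; cases "2 \<le> y") (auto simp: \<tau>'_def u_def[symmetric] v_def[symmetric])
    qed
  qed (auto simp: \<tau>'_def)
  have dec: "\<rho> = block_outer 1 q \<tau>' \<circ> block_inner 1 q \<tau>"
  proof
    fix k
    consider "k = 0" | "k \<in> {1..q}" | "q + 1 \<le> k" "k \<le> p + q" | "p + q < k" by force
    then show "\<rho> k = (block_outer 1 q \<tau>' \<circ> block_inner 1 q \<tau>) k"
    proof cases
      case 1
      then show ?thesis using in2[of 0] permutes_not_in[OF assms(1), of 0]
        by (auto simp: block_outer_def block_inner_def \<tau>'_def Let_def)
    next
      case 2
      then show ?thesis using in1[of k] by (auto simp: block_outer_def block_inner_def \<tau>'_def \<tau>_def Let_def)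
    next
      case 3
      define w where "w = \<rho> k"
      have w: "q + 1 \<le> w" "w \<le> p + q" using big[of "k + 1 - q"] 3 by (auto simp: w_def)
      have "\<tau>' (k + 1 - q) = w + 1 - q" using 3 by (auto simp: \<tau>'_def w_def)
      then show ?thesis using 3 w unfolding w_def[symmetric]
        by (auto simp: block_outer_def block_inner_def Let_def) (auto simp: \<tau>'_def)
    next
      case 4
      then have "\<rho> k = k" using permutes_not_in[OF assms(1)] by auto
      moreover have "\<tau>' (k + 1 - q) = k + 1 - q" "\<tau>' 1 = 1" using 4 by (auto simp: \<tau>'_def)
      ultimately show ?thesis using 4 by (auto simp: block_outer_def block_inner_def Let_def)
    qed
  qed
  have b: "block_outer 1 q \<tau>' permutes {1..p + q}" "block_inner 1 q \<tau> permutes {1..p + q}"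
    using block_outer_permutes[OF t', of 1 q] block_inner_permutes[OF t, of 1 "p + 1"] by (simp_all add: add.commute)
  have o: "act P (block_outer 1 q \<tau>') (tree p q) = tree p q"
    using pcomp_act_left[OF l_closed[of "p + 1"] l_closed[of q] _ _ t', of 1] l_sym[OF t']
    by (simp add: tree_def \<tau>'_def)
  have i: "act P (block_inner 1 q \<tau>) (tree p q) = tree p q"
    using pcomp_act_right[OF l_closed[of "p + 1"] l_closed[of q] _ _ t, of 1] l_sym[OF t]
    by (simp add: tree_def)
  show ?thesis unfolding dec
    using act_act[OF tree_closed[OF HOL.refl] b, symmetric] o i by simp
qed

text \<open>Two arrangements of \<open>I\<close> at the front differ by a permutation that preserves
  \<open>{1..q}\<close>, and such a permutation fixes the tree.\<close>

lemma bterm_eq: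
  assumes "\<sigma> permutes {1..n}" "\<sigma> ` I = {1..q}" "n = p + q"
  shows "bterm n I = act P \<sigma> (tree p q)"
proof -
  have inj: "inj \<sigma>" by (rule permutes_inj[OF assms(1)])
  have q: "card I = q" using card_image[OF inj_on_subset[OF inj subset_UNIV], of I] assms(2) by simp
  define \<tau> where "\<tau> = (SOME \<sigma>. \<sigma> permutes {1..n} \<and> \<sigma> ` I = {1..card I})"
  have \<tau>: "\<tau> permutes {1..n}" "\<tau> ` I = {1..q}"
    using someI[of "\<lambda>\<sigma>. \<sigma> permutes {1..n} \<and> \<sigma> ` I = {1..card I}" \<sigma>] assms q unfolding \<tau>_def by auto
  define \<rho> where "\<rho> = \<tau> \<circ> inv_into UNIV \<sigma>"
  have pi: "inv_into UNIV \<sigma> permutes {1..n}" by (rule permutes_inv[OF assms(1)])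
  have \<rho>: "\<rho> permutes {1..n}" unfolding \<rho>_def by (rule permutes_compose[OF pi \<tau>(1)])
  have "inv_into UNIV \<sigma> ` {1..q} = I"
    unfolding assms(2)[symmetric] image_image by (simp add: inv_f_f[OF inj])
  then have "\<rho> ` {1..q} = {1..q}" unfolding \<rho>_def image_comp[symmetric] using \<tau>(2) by simp
  then have "act P \<rho> (tree p q) = tree p q" using tree_sym \<rho> assms(3) by blast
  moreover have "\<rho> \<circ> \<sigma> = \<tau>" unfolding \<rho>_def by (auto simp: fun_eq_iff inv_f_f[OF inj])
  ultimately have "act P \<tau> (tree p q) = act P \<sigma> (tree p q)"
    using act_act[OF tree_closed[OF assms(3)] \<rho> assms(1)] by simp
  then show ?thesis unfolding bterm_def \<tau>_def[symmetric] unfolding q using assms(3) by simp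
qed

lemma ex_arrange:
  assumes "I \<subseteq> {1..n}"
  obtains \<sigma> where "\<sigma> permutes {1..n}" "\<sigma> ` I = {1..card I}" "card I \<le> n" "n = (n - card I) + card I"
proof -
  have q: "card I \<le> n" using card_mono[OF _ assms] by simp
  have "I \<in> (\<lambda>\<sigma>. inv_into UNIV \<sigma> ` {1..card I}) ` unshuffles (n - card I) (card I)"
    using unshuffles_bij[OF q] assms by (simp add: bij_betw_def)
  then obtain \<sigma> where s: "I = inv_into UNIV \<sigma> ` {1..card I}" "\<sigma> \<in> unshuffles (n - card I) (card I)" by blast
  then have p: "\<sigma> permutes {1..n}" using q by (auto simp: unshuffles_def)
  have "\<sigma> ` (inv_into UNIV \<sigma> ` {1..card I}) = {1..card I}"
    by (simp add: image_image permutes_inverses(1)[OF p])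
  then have "\<sigma> ` I = {1..card I}" using s(1) by simp
  then show thesis using that p q by simp
qed

lemma bterm_closed: "I \<subseteq> {1..n} \<Longrightarrow> bterm n I \<in> carrier (Sp P n (-2))"
  by (rule ex_arrange, assumption) (use bterm_eq tree_closed act_closed in metis)

lemma act_bterm:
  assumes "I \<subseteq> {1..n}" "\<tau> permutes {1..n}"
  shows "act P \<tau> (bterm n I) = bterm n (inv_into UNIV \<tau> ` I)"
proof -
  obtain \<sigma> where s: "\<sigma> permutes {1..n}" "\<sigma> ` I = {1..card I}" "n = (n - card I) + card I"
    using ex_arrange[OF assms(1)] by metis
  have "(\<sigma> \<circ> \<tau>) ` (inv_into UNIV \<tau> ` I) = {1..card I}"
    using s(2) by (simp add: image_image permutes_inverses(1)[OF assms(2)])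
  from bterm_eq[OF permutes_compose[OF assms(2) s(1)] this s(3)] bterm_eq[OF s]
  show ?thesis using act_act[OF tree_closed[OF s(3)] s(1) assms(2)] by simp
qed

lemma sum_bterm_closed: "finsum (Sp P n (-2)) (bterm n) (Pow {1..n}) \<in> carrier (Sp P n (-2))"
proof -
  interpret M: module K "Sp P n (-2)" by (rule module_Sp)
  show ?thesis using bterm_closed by (intro M.finsum_closed) auto
qed

lemma dl_closed: "dl n \<in> carrier (Sp P n (-2))"
  unfolding dl_def using sum_bterm_closed by simp

lemma dl_sym:
  assumes "\<tau> permutes {1..n}"
  shows "act P \<tau> (dl n) = dl n"
proof -
  interpret M: module K "Sp P n (-2)" by (rule module_Sp)
  let ?f = "\<lambda>I. inv_into UNIV \<tau> ` I"
  note pi = permutes_inv[OF assms]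
  have b: "bij_betw ?f (Pow {1..n}) (Pow {1..n})"
    using bij_betw_Pow[OF permutes_imp_bij[OF pi]] .
  have "act P \<tau> (finsum (Sp P n (-2)) (bterm n) (Pow {1..n})) = finsum (Sp P n (-2)) (\<lambda>I. act P \<tau> (bterm n I)) (Pow {1..n})"
    by (rule act_finsum[OF assms]) (use bterm_closed in auto)
  also have "\<dots> = finsum (Sp P n (-2)) (\<lambda>I. bterm n (?f I)) (Pow {1..n})"
  proof (rule M.finsum_cong')
    have "?f I \<subseteq> {1..n}" if "I \<in> Pow {1..n}" for I using bij_betwE[OF b] that by blast
    then show "(\<lambda>I. bterm n (?f I)) \<in> Pow {1..n} \<rightarrow> carrier (Sp P n (-2))" using bterm_closed by auto
  qed (use act_bterm[OF _ assms] in auto)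
  also have "\<dots> = finsum (Sp P n (-2)) (bterm n) (?f ` Pow {1..n})"
    by (rule M.finsum_reindex[symmetric])
      (use b bterm_closed in \<open>auto simp: bij_betw_def\<close>)
  also have "?f ` Pow {1..n} = Pow {1..n}" using b by (simp add: bij_betw_def)
  finally show ?thesis unfolding dl_def using act_minus[OF assms sum_bterm_closed] by simp
qed

text \<open>For each \<open>q\<close>, unshuffles correspond to subsets of size \<open>q\<close>;
  the union over all \<open>q\<close> is the power set. This connects the given formula with the sum
  over subsets.\<close>

lemma unshuffle_sum:
  "finsum (Sp P n (-2)) (\<lambda>(p, q). finsum (Sp P n (-2)) (\<lambda>\<sigma>. act P \<sigma> (tree p q)) (unshuffles p q)) {(p, q). p + q = n}
    = finsum (Sp P n (-2)) (bterm n) (Pow {1..n})"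
proof -
  interpret M: module K "Sp P n (-2)" by (rule module_Sp)
  let ?M = "Sp P n (-2)"
  let ?A = "\<lambda>q. {I. I \<subseteq> {1..n} \<and> card I = q}"
  have inner: "finsum ?M (\<lambda>\<sigma>. act P \<sigma> (tree (n - q) q)) (unshuffles (n - q) q) = finsum ?M (bterm n) (?A q)" if q: "q \<le> n" for q
  proof -
    let ?F = "\<lambda>\<sigma>. inv_into UNIV \<sigma> ` {1..q}"
    have eq: "bterm n (?F \<sigma>) = act P \<sigma> (tree (n - q) q)" if "\<sigma> \<in> unshuffles (n - q) q" for \<sigma>
    proof (rule bterm_eq)
      show p: "\<sigma> permutes {1..n}" using that q by (auto simp: unshuffles_def)
      show "\<sigma> ` ?F \<sigma> = {1..q}" by (simp add: image_image permutes_inverses(1)[OF p])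
    qed (use q in auto)
    have b: "?F ` unshuffles (n - q) q = ?A q" "inj_on ?F (unshuffles (n - q) q)"
      using unshuffles_bij[OF q] by (auto simp: bij_betw_def)
    have Fc: "bterm n (?F \<sigma>) \<in> carrier ?M" if "\<sigma> \<in> unshuffles (n - q) q" for \<sigma>
    proof -
      have "?F \<sigma> \<in> ?A q" unfolding b(1)[symmetric] using that by (rule imageI)
      then show ?thesis using bterm_closed by simp
    qed
    have "finsum ?M (\<lambda>\<sigma>. act P \<sigma> (tree (n - q) q)) (unshuffles (n - q) q) = finsum ?M (\<lambda>\<sigma>. bterm n (?F \<sigma>)) (unshuffles (n - q) q)"
      by (rule M.finsum_cong') (use eq Fc in auto)
    also have "\<dots> = finsum ?M (bterm n) (?F ` unshuffles (n - q) q)"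
      by (rule M.finsum_reindex[symmetric, OF _ b(2)]) (use Fc in auto)
    finally show ?thesis unfolding b(1) .
  qed
  have Ac: "finsum ?M (bterm n) (?A q) \<in> carrier ?M" for q using bterm_closed by (intro M.finsum_closed) auto
  have idx: "{(p, q). p + q = n} = (\<lambda>q. (n - q, q)) ` {..n}" by (auto simp: image_iff)
  have "finsum ?M (\<lambda>(p, q). finsum ?M (\<lambda>\<sigma>. act P \<sigma> (tree p q)) (unshuffles p q)) {(p, q). p + q = n} =
    finsum ?M (\<lambda>q. finsum ?M (\<lambda>\<sigma>. act P \<sigma> (tree (n - q) q)) (unshuffles (n - q) q)) {..n}"
    unfolding idx
    by (subst M.finsum_reindex) (auto simp: inj_on_def inner Ac)
  also have "\<dots> = finsum ?M (\<lambda>q. finsum ?M (bterm n) (?A q)) {..n}"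
    by (rule M.finsum_cong') (use inner Ac in auto)
  also have "\<dots> = finsum ?M (bterm n) (\<Union> (?A ` {..n}))"
  proof (rule M.add.finprod_UN_disjoint[symmetric])
    show "finite (?A i)" for i by (rule finite_subset[of _ "Pow {1..n}"]) auto
    show "pairwise (\<lambda>i j. disjnt (?A i) (?A j)) {..n}" by (auto simp: pairwise_def disjnt_def)
  qed (use bterm_closed in auto)
  also have "\<Union> (?A ` {..n}) = Pow {1..n}"
  proof -
    have "card I \<le> n" if "I \<subseteq> {1..n}" for I using card_mono[OF _ that] by simp
    then show ?thesis by auto
  qed
  finally show ?thesis .
qed

lemma bterm_empty: "bterm n {} = tree n 0"
  using bterm_eq[of id n "{}" 0 n] act_id[OF tree_closed[of n n 0]] by (simp add: permutes_id)

text \<open>A non-empty \<open>I\<close> gives the inner operation positive arity, and the outer one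
  always has a slot for it; so \<open>l 0\<close> does not occur.\<close>

lemma bterm_in_suboperad:
  assumes H: "suboperad K P H" and "\<And>n. n > 0 \<Longrightarrow> l n \<in> H n (-1)" and I: "I \<subseteq> {1..n}" "I \<noteq> {}"
  shows "bterm n I \<in> H n (-2)"
proof -
  obtain \<sigma> where s: "\<sigma> permutes {1..n}" "\<sigma> ` I = {1..card I}" "n = (n - card I) + card I"
    using ex_arrange[OF I(1)] by metis
  have "card I > 0" using I finite_subset card_gt_0_iff by blast
  then have "tree (n - card I) (card I) \<in> H n (-2)"
    unfolding tree_def by (intro suboperadD(6)[OF H assms(2) assms(2)]) (use s(3) in auto)
  then show ?thesis using bterm_eq[OF s] suboperadD(7)[OF H _ s(1)] by simp
qed

text \<open>The empty subset gives the only tree in which \<open>l 0\<close> occurs. When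
  \<open>l 0\<close> is the curvature, the splitting is the one into weight 1 and weight 0.\<close>

lemma dl_split:
  "dl n = \<ominus>\<^bsub>Sp P n (-2)\<^esub> (tree n 0 \<oplus>\<^bsub>Sp P n (-2)\<^esub> finsum (Sp P n (-2)) (bterm n) (Pow {1..n} - {{}}))"
proof -
  interpret M: module K "Sp P n (-2)" by (rule module_Sp)
  have "Pow {1..n} = insert {} (Pow {1..n} - {{}})" by auto
  then have "finsum (Sp P n (-2)) (bterm n) (Pow {1..n}) = finsum (Sp P n (-2)) (bterm n) (insert {} (Pow {1..n} - {{}}))"
    by simp
  also have "\<dots> = bterm n {} \<oplus>\<^bsub>Sp P n (-2)\<^esub> finsum (Sp P n (-2)) (bterm n) (Pow {1..n} - {{}})"
    by (rule M.finsum_insert) (use bterm_closed in auto)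
  finally show ?thesis by (simp add: dl_def bterm_empty)
qed

lemma up_image:
  assumes "I \<subseteq> {1..n}" shows "up \<sigma> ` (Suc ` I) = Suc ` (\<sigma> ` I)"
  using assms by (force simp: up_def image_image)

text \<open>A new first input is attached to the inner operation: \<open>up\<close> keeps it in
  front, where the inputs of the inner operation are.\<close>

lemma bterm_insert:
  assumes "\<sigma> permutes {1..n}" "\<sigma> ` I = {1..q}" "n = p + q" "I \<subseteq> {1..n}"
  shows "bterm (n + 1) (insert 1 (Suc ` I)) = act P (up \<sigma>) (pcomp P 1 (l (p + 1)) (l (q + 1)))"
proof -
  have "up \<sigma> ` insert 1 (Suc ` I) = {1..q + 1}"
    using up_image[OF assms(4)] assms(2) image_Suc_atLeastAtMost[of 1 q] by (auto simp: up_def)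
  from bterm_eq[OF up_permutes[OF assms(1)] this, of p] show ?thesis
    using assms(3) by (simp add: tree_def add.assoc)
qed

text \<open>A new first input is attached to the outer operation: it occupies slot 1, so the inner
  operation is now in slot 2.\<close>

lemma bterm_Suc_image:
  assumes "\<sigma> permutes {1..n}" "\<sigma> ` I = {1..q}" "n = p + q" "I \<subseteq> {1..n}"
  shows "bterm (n + 1) (Suc ` I) = act P (up \<sigma>) (pcomp P 2 (l (p + 2)) (l q))"
proof -
  have g: "gam 2 permutes {1..p + 1 + 1}" by (rule gam_permutes) auto
  have b: "block_outer 2 q (gam 2) permutes {1..n + 1}"
    using block_outer_permutes[OF g, of 2 q] assms(3) by (simp add: algebra_simps)
  \<comment> \<open>By symmetry of the outer operation, the inner one may sit in slot 2 instead of
    slot 1, at the cost of a block permutation.\<close>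
  have "l (p + 2) = act P (gam 2) (l (p + 1 + 1))" using l_sym[OF g] by (simp add: add.assoc)
  then have 1: "pcomp P 2 (l (p + 2)) (l q) = act P (block_outer 2 q (gam 2)) (tree (p + 1) q)"
    using pcomp_act_left[OF l_closed l_closed _ _ g, of 2 q] by (simp add: tree_def gam_def One_nat_def)
  have im: "block_outer 2 q (gam 2) ` Suc ` {1..q} = {1..q}"
  proof -
    have e: "block_outer 2 q (gam 2) (Suc k) = k" if "k \<in> {1..q}" for k
      using that by (auto simp: block_outer_def gam_def)
    have "(\<lambda>k. block_outer 2 q (gam 2) (Suc k)) ` {1..q} = (\<lambda>k. k) ` {1..q}"
      by (rule image_cong[OF HOL.refl e])
    then show ?thesis unfolding image_image by simp
  qed
  have "(block_outer 2 q (gam 2) \<circ> up \<sigma>) ` (Suc ` I) = {1..q}"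
    unfolding image_comp[symmetric] up_image[OF assms(4)] assms(2) by (rule im)
  from bterm_eq[OF permutes_compose[OF up_permutes[OF assms(1)] b] this, of "p + 1"]
  show ?thesis unfolding 1
    using act_act[OF tree_closed[of "n + 1" "p + 1" q] b up_permutes[OF assms(1)]] assms(3) by simp
qed

end

section \<open>The differential of the curved L-infinity operad\<close>

text \<open>With the sign placed in the left action, the prescribed differential becomes an instance
  of the general derivations.\<close>

lemma (in graded_operad) deriv_expr_eq:
  "deriv_expr K P \<rho> \<delta> t = derivation_expr (\<lambda>n d. Sp P n (d - 1)) shift_lact (\<lambda>n d m e i. pcomp P i) (act P) P \<rho> \<delta> t"
  by (induction t) (simp_all add: shift_lact_def Let_def)

context presentation_derivation
begin

lemma induced_der_simps:
  assumes "X \<in> carrier (Sp PP n d)"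
  shows induced_der_closed: "induced_der X \<in> carrier (M n d)"
    and induced_der_add: "Y \<in> carrier (Sp PP n d) \<Longrightarrow>
      induced_der (X \<oplus>\<^bsub>Sp PP n d\<^esub> Y) = induced_der X \<oplus>\<^bsub>M n d\<^esub> induced_der Y"
    and induced_der_smult: "c \<in> carrier K \<Longrightarrow>
      induced_der (c \<odot>\<^bsub>Sp PP n d\<^esub> X) = c \<odot>\<^bsub>M n d\<^esub> induced_der X"
    and induced_der_pcomp: "\<lbrakk>Y \<in> carrier (Sp PP m e); 1 \<le> i; i \<le> n\<rbrakk> \<Longrightarrow>
      induced_der (pcomp PP i X Y) = ract n d m e i (induced_der X) (induced_map T \<rho> Y)
        \<oplus>\<^bsub>M (n + m - 1) (d + e)\<^esub> lact n d m e i (induced_map T \<rho> X) (induced_der Y)"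
    and induced_der_act: "\<sigma> permutes {1..n} \<Longrightarrow> induced_der (act PP \<sigma> X) = mact \<sigma> (induced_der X)"
proof -
  obtain s where s: "X = cls s" "wfe s" "arity s = n" "degree s = d" using assms by (rule carrier_presentedE)
  show "induced_der X \<in> carrier (M n d)" using s der_in by (simp add: induced_der_cls)
  show "induced_der (X \<oplus>\<^bsub>Sp PP n d\<^esub> Y) = induced_der X \<oplus>\<^bsub>M n d\<^esub> induced_der Y"
    if Y: "Y \<in> carrier (Sp PP n d)"
  proof -
    obtain t where "Y = cls t" "wfe t" "arity t = n" "degree t = d" using Y by (rule carrier_presentedE)
    then show ?thesis using s by (simp add: add_presented induced_der_cls)
  qed
  show "induced_der (c \<odot>\<^bsub>Sp PP n d\<^esub> X) = c \<odot>\<^bsub>M n d\<^esub> induced_der X" if "c \<in> carrier K"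
    using s that by (simp add: smult_presented induced_der_cls)
  show "induced_der (act PP \<sigma> X) = mact \<sigma> (induced_der X)" if "\<sigma> permutes {1..n}"
    using s that by (simp add: act_presented induced_der_cls)
  show "induced_der (pcomp PP i X Y) = ract n d m e i (induced_der X) (induced_map T \<rho> Y)
        \<oplus>\<^bsub>M (n + m - 1) (d + e)\<^esub> lact n d m e i (induced_map T \<rho> X) (induced_der Y)"
    if Y: "Y \<in> carrier (Sp PP m e)" and i: "1 \<le> i" "i \<le> n"
  proof -
    obtain t where "Y = cls t" "wfe t" "arity t = m" "degree t = e" using Y by (rule carrier_presentedE)
    then show ?thesis using s i by (simp add: pcomp_presented induced_der_cls induced_cls)
  qed
qed

end

lemma (in graded_operad) generated_suboperad:
  assumes S: "\<And>n d. S n d \<subseteq> carrier (Sp P n d)"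
  shows "suboperad K P (generated_suboperad K P S)"
    and "S n d \<subseteq> generated_suboperad K P S n d"
    and "suboperad K P H \<Longrightarrow> (\<And>n d. S n d \<subseteq> H n d) \<Longrightarrow> generated_suboperad K P S n d \<subseteq> H n d"
proof -
  have I: "x \<in> generated_suboperad K P S n d \<longleftrightarrow> (\<forall>H. suboperad K P H \<and> (\<forall>m e. S m e \<subseteq> H m e) \<longrightarrow> x \<in> H n d)" for x n d
    by (auto simp: generated_suboperad_def)
  show "S n d \<subseteq> generated_suboperad K P S n d" using I by blast
  show "generated_suboperad K P S n d \<subseteq> H n d" if "suboperad K P H" "\<And>n d. S n d \<subseteq> H n d" for H n d
    using I that by blast
  show "suboperad K P (generated_suboperad K P S)"
  proof (rule suboperadI)
    show "generated_suboperad K P S n d \<subseteq> carrier (Sp P n d)" for n d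
      using I suboperad_carrier S by blast
  qed (auto simp: I intro: suboperadD)
qed

section \<open>The differential as a derivation\<close>

locale char_0_field = field K for K :: "('k, 'm) ring_scheme" (structure) +
  assumes char_0: "m > (0::nat) \<Longrightarrow> [m] \<cdot> \<one> \<noteq> \<zero>"
begin

abbreviation "LL \<equiv> cL_operad K"
abbreviation "\<l> \<equiv> ell K"

lemma LL_presented: "LL = presented_operad K cL_gens cL_rels"
  by (simp add: cL_operad_def)

sublocale C: presentation K cL_gens "cL_rels :: (('k, unit) expr \<times> ('k, unit) expr) set" ..

sublocale L: graded_operad K LL
  unfolding LL_presented by (rule C.presented_graded_operad)

lemma ell_wf: "wf_expr K cL_gens (Gen n (-1) ())"
  by (simp add: cL_gens_def)

sublocale L: symmetric_family K LL \<l>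
proof
  show "\<l> n \<in> carrier (Sp LL n (-1))" for n
    unfolding ell_def LL_presented by (rule C.cls_closed) (auto simp: cL_gens_def)
  show "act LL \<sigma> (\<l> n) = \<l> n" if "\<sigma> permutes {1..n}" for \<sigma> n
  proof -
    have "(Act \<sigma> (Gen n (-1) ()), Gen n (-1) ()) \<in> pres_cong K cL_gens (cL_rels :: (('k, unit) expr \<times> ('k, unit) expr) set)"
      by (rule pres_cong.rel) (use that in \<open>auto simp: cL_rels_def cL_gens_def\<close>)
    then show ?thesis unfolding ell_def LL_presented
      using that by (subst C.act_presented) (auto simp: cL_gens_def intro!: C.cls_eq)
  qed
qed

lemma presentation_evalI:
  assumes "symmetric_family K T l"
  shows "presentation_eval K cL_gens cL_rels T (\<lambda>n d u. l n)"
proof -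
  interpret T: symmetric_family K T l by fact
  show ?thesis
    by unfold_locales (auto simp: cL_gens_def cL_rels_def T.l_closed T.l_sym split: if_splits)
qed

sublocale E: presentation_eval K cL_gens cL_rels LL "\<lambda>n d u. \<l> n"
  by (rule presentation_evalI[OF L.symmetric_family_axioms])

lemma ev_ell: "wf_expr K cL_gens t \<Longrightarrow> E.ev t = C.cls t"
proof -
  assume t: "wf_expr K cL_gens t"
  have "E.ev t = eval_expr LL (\<lambda>n d g. C.cls (Gen n d g)) t"
    by (rule eval_expr_cong[OF t]) (auto simp: cL_gens_def ell_def split: if_splits)
  then show ?thesis using C.eval_presented[OF t] unfolding LL_presented by simp
qed

text \<open>Derivations were constructed along an evaluation. Here the evaluation is the identity,
  so they are derivations of the operad itself.\<close>

lemma induced_ell: "X \<in> carrier (Sp LL n d) \<Longrightarrow> induced_map LL (\<lambda>n d u. \<l> n) X = X"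
  unfolding LL_presented by (auto elim!: C.carrier_presentedE simp: E.induced_cls[unfolded LL_presented] ev_ell[unfolded LL_presented])

lemma cL_generated:
  assumes "suboperad K LL H" "\<And>n. \<l> n \<in> H n (-1)" "x \<in> carrier (Sp LL n d)"
  shows "x \<in> H n d"
proof -
  obtain t where t: "x = C.cls t" "wf_expr K cL_gens t" "arity t = n" "degree t = d"
    using assms(3) unfolding LL_presented by (rule C.carrier_presentedE)
  have "E.ev t \<in> H (arity t) (degree t)"
    by (rule L.eval_in_suboperad[OF assms(1) _ t(2)]) (use assms(2) in \<open>auto simp: cL_gens_def split: if_splits\<close>)
  then show ?thesis using t ev_ell by simp
qed

lemma cL_diff_ell_eq: "cL_diff_ell K n = L.dl n"
  unfolding cL_diff_ell_def L.dl_def L.unshuffle_sum[symmetric] L.tree_def Let_def ..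

text \<open>The relations state the symmetry of the generators, so the derivation exists because the
  sum over all subsets is symmetric.\<close>

lemma diff_derivation:
  "presentation_derivation K cL_gens cL_rels LL (\<lambda>n d u. \<l> n) (\<lambda>n d. Sp LL n (d - 1)) L.shift_lact
    (\<lambda>n d m e i. pcomp LL i) (act LL) (\<lambda>n d u. cL_diff_ell K n)"
proof -
  interpret inf_bimodule K LL "\<lambda>n d. Sp LL n (d - 1)" L.shift_lact "\<lambda>n d m e i. pcomp LL i" "act LL"
    by (rule L.shift_bimodule)
  show ?thesis
    by unfold_locales (use L.dl_closed L.dl_sym in \<open>auto simp: cL_gens_def cL_rels_def cL_diff_ell_eq split: if_splits\<close>)
qed

sublocale D: presentation_derivation K cL_gens cL_rels LL "\<lambda>n d u. \<l> n" "\<lambda>n d. Sp LL n (d - 1)" L.shift_lact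
    "\<lambda>n d m e i. pcomp LL i" "act LL" "\<lambda>n d u. cL_diff_ell K n"
  by (rule diff_derivation)

abbreviation "\<D> \<equiv> cL_diff K"

lemma cL_diff_eq: "\<D> = D.induced_der"
  by (rule ext) (simp add: cL_diff_def D.induced_der_def L.deriv_expr_eq[abs_def])

lemma diff_ell: "\<D> (\<l> n) = L.dl n"
  using D.induced_der_cls[OF ell_wf] by (simp add: cL_diff_eq cL_diff_ell_eq ell_def)

lemma diff_simps:
  assumes "X \<in> carrier (Sp LL n d)"
  shows diff_closed: "\<D> X \<in> carrier (Sp LL n (d - 1))"
    and diff_add: "Y \<in> carrier (Sp LL n d) \<Longrightarrow> \<D> (X \<oplus>\<^bsub>Sp LL n d\<^esub> Y) = \<D> X \<oplus>\<^bsub>Sp LL n (d - 1)\<^esub> \<D> Y"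
    and diff_smult: "c \<in> carrier K \<Longrightarrow> \<D> (c \<odot>\<^bsub>Sp LL n d\<^esub> X) = c \<odot>\<^bsub>Sp LL n (d - 1)\<^esub> \<D> X"
    and diff_pcomp: "\<lbrakk>Y \<in> carrier (Sp LL m e); 1 \<le> i; i \<le> n\<rbrakk> \<Longrightarrow>
      \<D> (pcomp LL i X Y) = pcomp LL i (\<D> X) Y \<oplus>\<^bsub>Sp LL (n + m - 1) (d + e - 1)\<^esub>
        (sign_of K d \<odot>\<^bsub>Sp LL (n + m - 1) (d + e - 1)\<^esub> pcomp LL i X (\<D> Y))"
    and diff_act: "\<sigma> permutes {1..n} \<Longrightarrow> \<D> (act LL \<sigma> X) = act LL \<sigma> (\<D> X)"
  using D.induced_der_simps[folded LL_presented, OF assms] induced_ell assms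
  unfolding cL_diff_eq L.shift_lact_def by auto

lemma diff_additive_maps:
  shows diff_zero: "\<D> \<zero>\<^bsub>Sp LL n d\<^esub> = \<zero>\<^bsub>Sp LL n (d - 1)\<^esub>"
    and diff_minus: "x \<in> carrier (Sp LL n d) \<Longrightarrow> \<D> (\<ominus>\<^bsub>Sp LL n d\<^esub> x) = \<ominus>\<^bsub>Sp LL n (d - 1)\<^esub> \<D> x"
  by (rule additive_zero[OF L.Sp_abelian_group L.Sp_abelian_group]; auto simp: diff_closed diff_add)
    (rule additive_minus[OF L.Sp_abelian_group L.Sp_abelian_group]; auto simp: diff_closed diff_add)

text \<open>
  Adding a further symmetric input to an operation is a derivation which sends each generator
  to the next one; it commutes with the differential, so \<open>\<D> \<circ> \<D>\<close> vanishes on all generators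
  as soon as it does on the first one.
\<close>

lemma suspend_derivation:
  "presentation_derivation K cL_gens cL_rels LL (\<lambda>n d u. \<l> n) (L.marked 0) (L.mark_lact 0)
    (L.mark_ract 0) L.mark_act (\<lambda>n d u. (\<l> (n + 1), \<zero>))"
proof -
  interpret inf_bimodule K LL "L.marked 0" "L.mark_lact 0" "L.mark_ract 0" L.mark_act
    by (rule L.marked_bimodule)
  show ?thesis
    by unfold_locales
      (use L.l_closed L.l_sym[OF up_permutes] in \<open>auto simp: cL_gens_def cL_rels_def L.mark_act_def split: if_splits\<close>)
qed

sublocale S: presentation_derivation K cL_gens cL_rels LL "\<lambda>n d u. \<l> n" "L.marked 0" "L.mark_lact 0"
    "L.mark_ract 0" L.mark_act "\<lambda>n d u. (\<l> (n + 1), \<zero>)"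
  by (rule suspend_derivation)

definition suspend :: "('k, unit) expr set \<Rightarrow> ('k, unit) expr set" where
  "suspend X = fst (S.induced_der X)"

text \<open>Generators are sent to pairs with scalar zero, and composites acquire none; the value is
  thus an honest operation of arity one higher.\<close>

lemma suspend_snd: "X \<in> carrier (Sp LL n d) \<Longrightarrow> S.induced_der X = (suspend X, \<zero>)"
proof -
  assume "X \<in> carrier (Sp LL n d)"
  then obtain t where t: "X = C.cls t" "wf_expr K cL_gens t" unfolding LL_presented by (metis C.carrier_presentedE)
  have "snd (S.der t) = \<zero>"
    using t(2)
  proof (induction t)
    case (Add s t)
    then show ?case by (cases "S.der s"; cases "S.der t") auto
  next
    case (Smult c t)
    then show ?case by (cases "S.der t") auto
  next
    case (Comp i s t)
    then show ?case by (simp add: L.mark_ract_def L.mark_lact_def)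
  next
    case (Act \<sigma> t)
    then show ?case by (simp add: L.mark_act_def)
  qed simp_all
  then show ?thesis using t S.induced_der_cls[OF t(2)] by (cases "S.der t") (simp add: suspend_def)
qed

lemma suspend_ell: "suspend (\<l> n) = \<l> (n + 1)"
  using S.induced_der_cls[OF ell_wf] by (simp add: suspend_def ell_def)

lemma suspend_simps:
  assumes X: "X \<in> carrier (Sp LL n d)"
  shows suspend_closed: "suspend X \<in> carrier (Sp LL (n + 1) d)"
    and suspend_add: "Y \<in> carrier (Sp LL n d) \<Longrightarrow>
      suspend (X \<oplus>\<^bsub>Sp LL n d\<^esub> Y) = suspend X \<oplus>\<^bsub>Sp LL (n + 1) d\<^esub> suspend Y"
    and suspend_smult: "c \<in> carrier K \<Longrightarrow> suspend (c \<odot>\<^bsub>Sp LL n d\<^esub> X) = c \<odot>\<^bsub>Sp LL (n + 1) d\<^esub> suspend X"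
    and suspend_pcomp: "\<lbrakk>Y \<in> carrier (Sp LL m e); 1 \<le> i; i \<le> n\<rbrakk> \<Longrightarrow>
      suspend (pcomp LL i X Y) = pcomp LL (i + 1) (suspend X) Y \<oplus>\<^bsub>Sp LL (n + m) (d + e)\<^esub>
        act LL (gam i) (pcomp LL i X (suspend Y))"
    and suspend_act: "\<sigma> permutes {1..n} \<Longrightarrow> suspend (act LL \<sigma> X) = act LL (up \<sigma>) (suspend X)"
proof -
  note S = S.induced_der_simps[folded LL_presented, OF X]
  note X' = suspend_snd[OF X]
  show c: "suspend X \<in> carrier (Sp LL (n + 1) d)" using S(1) X' by simp
  show "suspend (X \<oplus>\<^bsub>Sp LL n d\<^esub> Y) = suspend X \<oplus>\<^bsub>Sp LL (n + 1) d\<^esub> suspend Y" if Y: "Y \<in> carrier (Sp LL n d)"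
    using S(2)[OF Y] X' suspend_snd[OF Y] by (simp add: suspend_def[of "X \<oplus>\<^bsub>Sp LL n d\<^esub> Y"])
  show "suspend (c \<odot>\<^bsub>Sp LL n d\<^esub> X) = c \<odot>\<^bsub>Sp LL (n + 1) d\<^esub> suspend X" if "c \<in> carrier K" for c
    using S(3)[OF that] X' by (simp add: suspend_def[of "c \<odot>\<^bsub>Sp LL n d\<^esub> X"])
  show "suspend (act LL \<sigma> X) = act LL (up \<sigma>) (suspend X)" if "\<sigma> permutes {1..n}" for \<sigma>
    using S(5)[OF that] by (simp add: suspend_def L.mark_act_def)
  show "suspend (pcomp LL i X Y) = pcomp LL (i + 1) (suspend X) Y \<oplus>\<^bsub>Sp LL (n + m) (d + e)\<^esub>
        act LL (gam i) (pcomp LL i X (suspend Y))" if Y: "Y \<in> carrier (Sp LL m e)" and i: "1 \<le> i" "i \<le> n"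
  proof -
    have sY: "suspend Y \<in> carrier (Sp LL (m + 1) e)"
      using S.induced_der_simps(1)[folded LL_presented, OF Y] suspend_snd[OF Y] by simp
    have 1: "pcomp LL i X (suspend Y) \<in> carrier (Sp LL (n + m) (d + e))" by (rule L.pcomp_in[OF X sY i]) auto
    have g: "gam i permutes {1..n + m}" "gam i permutes {1..n}" using i by (auto intro!: gam_permutes)
    note 2 = L.act_closed[OF 1 g(1)]
    have 3: "pcomp LL (i + 1) (suspend X) Y \<in> carrier (Sp LL (n + m) (d + e))"
      by (rule L.pcomp_in[OF c Y]) (use i in auto)
    have 4: "n + m - 1 + 1 = n + m" using i by simp
    have "S.induced_der (pcomp LL i X Y) = L.mark_ract 0 n d m e i (suspend X, \<zero>) Y \<oplus>\<^bsub>L.marked 0 (n + m - 1) (d + e)\<^esub>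
      L.mark_lact 0 n d m e i X (suspend Y, \<zero>)"
      using S(4)[OF Y i] X' suspend_snd[OF Y] induced_ell[OF X] induced_ell[OF Y] by simp
    also have "L.mark_ract 0 n d m e i (suspend X, \<zero>) Y = (pcomp LL (i + 1) (suspend X) Y, \<zero>)"
      using 3 by (simp add: L.mark_ract_def sign_of_def)
    also have "L.mark_lact 0 n d m e i X (suspend Y, \<zero>) = (act LL (gam i) (pcomp LL i X (suspend Y)), \<zero>)"
      using 2 L.act_closed[OF X g(2)] by (auto simp: L.mark_lact_def)
    finally show ?thesis by (simp add: suspend_def[of "pcomp LL i X Y"] 4)
  qed
qed

lemma suspend_additive_maps:
  shows suspend_zero: "suspend \<zero>\<^bsub>Sp LL n d\<^esub> = \<zero>\<^bsub>Sp LL (n + 1) d\<^esub>"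
    and suspend_minus: "x \<in> carrier (Sp LL n d) \<Longrightarrow> suspend (\<ominus>\<^bsub>Sp LL n d\<^esub> x) = \<ominus>\<^bsub>Sp LL (n + 1) d\<^esub> suspend x"
    and suspend_finsum: "g \<in> A \<rightarrow> carrier (Sp LL n d) \<Longrightarrow>
      suspend (finsum (Sp LL n d) g A) = finsum (Sp LL (n + 1) d) (\<lambda>a. suspend (g a)) A"
proof -
  show "suspend \<zero>\<^bsub>Sp LL n d\<^esub> = \<zero>\<^bsub>Sp LL (n + 1) d\<^esub>"
    by (rule additive_zero[OF L.Sp_abelian_group L.Sp_abelian_group]) (auto simp: suspend_closed suspend_add)
  show "suspend (\<ominus>\<^bsub>Sp LL n d\<^esub> x) = \<ominus>\<^bsub>Sp LL (n + 1) d\<^esub> suspend x" if "x \<in> carrier (Sp LL n d)"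
    by (rule additive_minus[OF L.Sp_abelian_group L.Sp_abelian_group]) (use that in \<open>auto simp: suspend_closed suspend_add\<close>)
  show "suspend (finsum (Sp LL n d) g A) = finsum (Sp LL (n + 1) d) (\<lambda>a. suspend (g a)) A" if "g \<in> A \<rightarrow> carrier (Sp LL n d)"
    by (rule additive_finsum[OF L.Sp_abelian_group L.Sp_abelian_group _ _ that]) (auto simp: suspend_closed suspend_add)
qed

text \<open>A tree has two vertices to which the new input can be attached. Attached to the outer
  one it stays outside the shifted subset, attached to the inner one it joins it.\<close>

lemma suspend_bterm:
  assumes "I \<subseteq> {1..n}"
  shows "suspend (L.bterm n I) = L.bterm (n + 1) (Suc ` I) \<oplus>\<^bsub>Sp LL (n + 1) (-2)\<^esub> L.bterm (n + 1) (insert 1 (Suc ` I))"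
proof -
  obtain \<sigma> where s: "\<sigma> permutes {1..n}" "\<sigma> ` I = {1..card I}" "n = (n - card I) + card I"
    using L.ex_arrange[OF assms] by metis
  define p q where "p = n - card I" and "q = card I"
  have n: "n = p + q" and im: "\<sigma> ` I = {1..q}" using s by (auto simp: p_def q_def)
  have c: "pcomp LL 1 (\<l> (p + 1)) (\<l> (q + 1)) \<in> carrier (Sp LL (n + 1) (-2))"
    by (rule L.pcomp_in[OF L.l_closed L.l_closed]) (use n in auto)
  have c2: "pcomp LL 2 (\<l> (p + 2)) (\<l> q) \<in> carrier (Sp LL (n + 1) (-2))"
    by (rule L.pcomp_in[OF L.l_closed L.l_closed]) (use n in auto)
  have "suspend (L.tree p q) = pcomp LL (1 + 1) (suspend (\<l> (p + 1))) (\<l> q) \<oplus>\<^bsub>Sp LL (p + 1 + q) (- 1 + - 1)\<^esub>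
      act LL (gam 1) (pcomp LL 1 (\<l> (p + 1)) (suspend (\<l> q)))"
    unfolding L.tree_def by (rule suspend_pcomp[OF L.l_closed L.l_closed]) auto
  also have "\<dots> = pcomp LL 2 (\<l> (p + 2)) (\<l> q) \<oplus>\<^bsub>Sp LL (n + 1) (-2)\<^esub> pcomp LL 1 (\<l> (p + 1)) (\<l> (q + 1))"
  proof -
    have "p + 2 = p + 1 + 1" by simp
    then show ?thesis using L.act_id[OF c] n suspend_ell[of "p + 1"] suspend_ell[of q] by (simp only: gam_1) (simp add: ac_simps)
  qed
  finally have t: "suspend (L.tree p q) = \<dots>" .
  have "suspend (L.bterm n I) = act LL (up \<sigma>) (suspend (L.tree p q))"
    unfolding L.bterm_eq[OF s(1) im n] by (rule suspend_act[OF L.tree_closed[OF n] s(1)])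
  also have "\<dots> = act LL (up \<sigma>) (pcomp LL 2 (\<l> (p + 2)) (\<l> q)) \<oplus>\<^bsub>Sp LL (n + 1) (-2)\<^esub>
      act LL (up \<sigma>) (pcomp LL 1 (\<l> (p + 1)) (\<l> (q + 1)))"
    unfolding t by (rule L.act_add[OF c2 c up_permutes[OF s(1)]])
  finally show ?thesis
    unfolding L.bterm_insert[OF s(1) im n assms] L.bterm_Suc_image[OF s(1) im n assms] .
qed

text \<open>The subsets of \<open>{1..n + 1}\<close> are the shifted subsets of
  \<open>{1..n}\<close>, with and without the new element 1, and these are the two terms of the
  suspension of each tree.\<close>

lemma suspend_dl: "suspend (L.dl n) = L.dl (n + 1)"
proof -
  interpret M: module K "Sp LL (n + 1) (-2)" by (rule L.module_Sp)
  let ?M = "Sp LL (n + 1) (-2)"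
  let ?A = "(\<lambda>I. Suc ` I) ` Pow {1..n}" and ?B = "(\<lambda>I. insert 1 (Suc ` I)) ` Pow {1..n}"
  have sub: "Suc ` I \<subseteq> {1..n + 1}" "insert 1 (Suc ` I) \<subseteq> {1..n + 1}" if "I \<in> Pow {1..n}" for I
    using that by auto
  have c: "(\<lambda>I. L.bterm (n + 1) (Suc ` I)) \<in> Pow {1..n} \<rightarrow> carrier ?M"
    "(\<lambda>I. L.bterm (n + 1) (insert 1 (Suc ` I))) \<in> Pow {1..n} \<rightarrow> carrier ?M"
    by (rule Pi_I, rule L.bterm_closed, erule sub)+
  have inj: "inj_on (\<lambda>I. Suc ` I) (Pow {1..n})" "inj_on (\<lambda>I. insert 1 (Suc ` I)) (Pow {1..n})"
  proof -
    show "inj_on (\<lambda>I. Suc ` I) (Pow {1..n})" by (rule inj_onI) (simp add: inj_image_eq_iff)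
    show "inj_on (\<lambda>I. insert 1 (Suc ` I)) (Pow {1..n})"
    proof (rule inj_onI)
      fix I J assume IJ: "I \<in> Pow {1..n}" "J \<in> Pow {1..n}" "insert 1 (Suc ` I) = insert 1 (Suc ` J)"
      then have "1 \<notin> Suc ` I" "1 \<notin> Suc ` J" by (auto simp: One_nat_def)
      then have "Suc ` I = Suc ` J" using IJ(3) by (metis insert_ident)
      then show "I = J" by (simp add: inj_image_eq_iff)
    qed
  qed
  have "Pow {1..n + 1} = ?A \<union> ?B"
  proof
    show "?A \<union> ?B \<subseteq> Pow {1..n + 1}" using sub by blast
    show "Pow {1..n + 1} \<subseteq> ?A \<union> ?B"
    proof
      fix J assume "J \<in> Pow {1..n + 1}"
      then have J: "J \<subseteq> {1..n + 1}" by simp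
      define I where "I = {k. Suc k \<in> J \<and> 1 \<le> k}"
      have I: "I \<in> Pow {1..n}" using J by (auto simp: I_def)
      have "J - {1} = Suc ` I"
      proof (intro equalityI subsetI)
        fix x assume x: "x \<in> J - {1}"
        then have "2 \<le> x" using J by force
        then have "x - 1 \<in> I" "x = Suc (x - 1)" using x by (auto simp: I_def)
        then show "x \<in> Suc ` I" by blast
      qed (auto simp: I_def One_nat_def)
      then have "J = Suc ` I \<or> J = insert 1 (Suc ` I)" by blast
      then show "J \<in> ?A \<union> ?B" using I by blast
    qed
  qed
  then have "finsum ?M (L.bterm (n + 1)) (Pow {1..n + 1}) = finsum ?M (L.bterm (n + 1)) (?A \<union> ?B)" by simp
  also have "\<dots> = finsum ?M (L.bterm (n + 1)) ?A \<oplus>\<^bsub>?M\<^esub> finsum ?M (L.bterm (n + 1)) ?B"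
  proof (rule M.finsum_Un_disjoint)
    have "1 \<notin> X" if X: "X \<in> ?A" for X
    proof -
      obtain I where "X = Suc ` I" "I \<subseteq> {1..n}" using X by blast
      then show ?thesis by (auto simp: One_nat_def)
    qed
    then show "?A \<inter> ?B = {}" by blast
  qed (use c in auto)
  also have "finsum ?M (L.bterm (n + 1)) ?A = finsum ?M (\<lambda>I. L.bterm (n + 1) (Suc ` I)) (Pow {1..n})"
    by (rule M.finsum_reindex[OF _ inj(1)]) (use c in auto)
  also have "finsum ?M (L.bterm (n + 1)) ?B = finsum ?M (\<lambda>I. L.bterm (n + 1) (insert 1 (Suc ` I))) (Pow {1..n})"
    by (rule M.finsum_reindex[OF _ inj(2)]) (use c in auto)
  also have "finsum ?M (\<lambda>I. L.bterm (n + 1) (Suc ` I)) (Pow {1..n}) \<oplus>\<^bsub>?M\<^esub> \<dots> =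
      finsum ?M (\<lambda>I. L.bterm (n + 1) (Suc ` I) \<oplus>\<^bsub>?M\<^esub> L.bterm (n + 1) (insert 1 (Suc ` I))) (Pow {1..n})"
    by (rule M.finsum_addf[symmetric, OF c])
  also have "\<dots> = finsum ?M (\<lambda>I. suspend (L.bterm n I)) (Pow {1..n})"
    by (rule M.finsum_cong') (use suspend_bterm suspend_closed[OF L.bterm_closed] in auto)
  also have "\<dots> = suspend (finsum (Sp LL n (-2)) (L.bterm n) (Pow {1..n}))"
    by (rule suspend_finsum[symmetric]) (use L.bterm_closed in auto)
  finally show ?thesis unfolding L.dl_def using suspend_minus[OF L.sum_bterm_closed] by simp
qed

text \<open>The commutator of two derivations is a derivation, so it suffices to compare on
  generators, where the identity is \<open>suspend_dl\<close>. The suspension has degree 0, so it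
  causes no signs.\<close>

lemma suspend_diff:
  assumes "x \<in> carrier (Sp LL n d)"
  shows "suspend (\<D> x) = \<D> (suspend x)"
proof -
  define H where "H n d = {x \<in> carrier (Sp LL n d). suspend (\<D> x) = \<D> (suspend x)}" for n d
  have "suboperad K LL H"
  proof (rule L.suboperadI)
    show "\<zero>\<^bsub>Sp LL n d\<^esub> \<in> H n d" for n d by (simp add: H_def diff_zero suspend_zero)
    fix n d x assume "x \<in> H n d"
    then have x: "x \<in> carrier (Sp LL n d)" "suspend (\<D> x) = \<D> (suspend x)" by (auto simp: H_def)
    note dx = diff_closed[OF x(1)] and sx = suspend_closed[OF x(1)]
    show "x \<oplus>\<^bsub>Sp LL n d\<^esub> y \<in> H n d" if "y \<in> H n d" for y
      using that x dx sx by (auto simp: H_def diff_add[of _ n d] suspend_add[of _ n d] suspend_add[of _ n "d - 1"]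
          diff_add[of _ "n + 1" d] diff_closed suspend_closed)
    show "c \<odot>\<^bsub>Sp LL n d\<^esub> x \<in> H n d" if "c \<in> carrier K" for c
      using that x dx sx by (auto simp: H_def diff_smult[of _ n d] suspend_smult[of _ n d] suspend_smult[of _ n "d - 1"]
          diff_smult[of _ "n + 1" d])
    show "act LL \<sigma> x \<in> H n d" if s: "\<sigma> permutes {1..n}" for \<sigma>
      using x L.act_closed[OF x(1) s] diff_act[OF x(1) s] suspend_act[OF x(1) s] suspend_act[OF dx s]
        diff_act[OF sx up_permutes[OF s]] by (simp add: H_def)
    show "pcomp LL i x y \<in> H (n + m - 1) (d + e)" if "y \<in> H m e" and i: "1 \<le> i" "i \<le> n" for y m e i
    proof -
      have y: "y \<in> carrier (Sp LL m e)" "suspend (\<D> y) = \<D> (suspend y)" using that by (auto simp: H_def)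
      note dy = diff_closed[OF y(1)] and sy = suspend_closed[OF y(1)]
      have i1: "1 \<le> i + 1" "i + 1 \<le> n + 1" using i by auto
      have g: "gam i permutes {1..n + m}" using i by (auto intro!: gam_permutes)
      let ?N = "n + m" and ?D = "d + e - 1"
      let ?M = "Sp LL ?N ?D"
      have idx: "n + m - 1 + 1 = ?N" "n + 1 + m - 1 = ?N" "d - 1 + e = ?D" "d + (e - 1) = ?D" "n + (m + 1) - 1 = ?N" using i by auto
      have a: "pcomp LL i (\<D> x) y \<in> carrier (Sp LL (n + m - 1) ?D)" by (rule L.pcomp_in[OF dx y(1) i]) auto
      have b: "pcomp LL i x (\<D> y) \<in> carrier (Sp LL (n + m - 1) ?D)" by (rule L.pcomp_in[OF x(1) dy i]) auto
      define X1 X2 X3 X4 where "X1 = pcomp LL (i + 1) (suspend (\<D> x)) y"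
        and "X2 = act LL (gam i) (pcomp LL i (\<D> x) (suspend y))"
        and "X3 = pcomp LL (i + 1) (suspend x) (\<D> y)"
        and "X4 = act LL (gam i) (pcomp LL i x (suspend (\<D> y)))"
      have c2: "pcomp LL i (\<D> x) (suspend y) \<in> carrier ?M" by (rule L.pcomp_in[OF dx sy i]) auto
      have c4: "pcomp LL i x (suspend (\<D> y)) \<in> carrier ?M" by (rule L.pcomp_in[OF x(1) suspend_closed[OF dy] i]) auto
      have X: "X1 \<in> carrier ?M" "X2 \<in> carrier ?M" "X3 \<in> carrier ?M" "X4 \<in> carrier ?M"
        unfolding X1_def X2_def X3_def X4_def
        using L.act_closed[OF c2 g] L.act_closed[OF c4 g] L.pcomp_in[OF suspend_closed[OF dx] y(1) i1, of ?N ?D]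
          L.pcomp_in[OF sx dy i1, of ?N ?D] by auto
      have "suspend (\<D> (pcomp LL i x y)) = suspend (pcomp LL i (\<D> x) y) \<oplus>\<^bsub>?M\<^esub> sign_of K d \<odot>\<^bsub>?M\<^esub> suspend (pcomp LL i x (\<D> y))"
        using diff_pcomp[OF x(1) y(1) i] suspend_add[OF a, of "sign_of K d \<odot>\<^bsub>Sp LL (n + m - 1) ?D\<^esub> pcomp LL i x (\<D> y)"]
          suspend_smult[OF b, of "sign_of K d"] b idx by simp
      also have "\<dots> = (X1 \<oplus>\<^bsub>?M\<^esub> X2) \<oplus>\<^bsub>?M\<^esub> sign_of K d \<odot>\<^bsub>?M\<^esub> (X3 \<oplus>\<^bsub>?M\<^esub> X4)"
        using suspend_pcomp[OF dx y(1) i] suspend_pcomp[OF x(1) dy i] idx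
        by (simp add: X1_def X2_def X3_def X4_def)
      \<comment> \<open>The four terms are regrouped by the factor that is suspended; each group is
        then the differential of one term of the Leibniz rule for the suspension.\<close>
      also have "\<dots> = (X1 \<oplus>\<^bsub>?M\<^esub> sign_of K d \<odot>\<^bsub>?M\<^esub> X3) \<oplus>\<^bsub>?M\<^esub> (X2 \<oplus>\<^bsub>?M\<^esub> sign_of K d \<odot>\<^bsub>?M\<^esub> X4)"
        using X by (simp add: L.Sp_a_ac L.Sp_r_distr)
      also have "X1 \<oplus>\<^bsub>?M\<^esub> sign_of K d \<odot>\<^bsub>?M\<^esub> X3 = \<D> (pcomp LL (i + 1) (suspend x) y)"
        using diff_pcomp[OF sx y(1) i1] x(2) idx by (simp add: X1_def X3_def)
      also have "X2 \<oplus>\<^bsub>?M\<^esub> sign_of K d \<odot>\<^bsub>?M\<^esub> X4 = \<D> (act LL (gam i) (pcomp LL i x (suspend y)))"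
      proof -
        have p: "pcomp LL i x (suspend y) \<in> carrier (Sp LL ?N (d + e))" by (rule L.pcomp_in[OF x(1) sy i]) auto
        have "\<D> (pcomp LL i x (suspend y)) = pcomp LL i (\<D> x) (suspend y) \<oplus>\<^bsub>?M\<^esub> sign_of K d \<odot>\<^bsub>?M\<^esub> pcomp LL i x (suspend (\<D> y))"
          using diff_pcomp[OF x(1) sy i] y(2) idx by simp
        then show ?thesis using diff_act[OF p g] L.act_add[OF c2 _ g, of "sign_of K d \<odot>\<^bsub>?M\<^esub> pcomp LL i x (suspend (\<D> y))"]
            L.act_smult[OF _ c4 g, of "sign_of K d"] c4 by (simp add: X2_def X4_def)
      qed
      also have "\<D> (pcomp LL (i + 1) (suspend x) y) \<oplus>\<^bsub>?M\<^esub> \<dots> = \<D> (suspend (pcomp LL i x y))"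
      proof -
        have "pcomp LL (i + 1) (suspend x) y \<in> carrier (Sp LL ?N (d + e))" by (rule L.pcomp_in[OF sx y(1) i1]) auto
        moreover have "act LL (gam i) (pcomp LL i x (suspend y)) \<in> carrier (Sp LL ?N (d + e))"
          by (rule L.act_closed[OF L.pcomp_in[OF x(1) sy i] g]) auto
        ultimately show ?thesis using suspend_pcomp[OF x(1) y(1) i] diff_add by simp
      qed
      finally show ?thesis using L.pcomp_closed[OF x(1) y(1) i] by (simp add: H_def)
    qed
  qed (auto simp: H_def)
  moreover have "\<l> n \<in> H n (-1)" for n
    using L.l_closed by (simp add: H_def diff_ell suspend_ell suspend_dl)
  ultimately show ?thesis using cL_generated[of H x n d] assms by (simp add: H_def)
qed

lemma half_zero:
  assumes "x \<in> carrier (Sp LL n d)" "x = \<ominus>\<^bsub>Sp LL n d\<^esub> x"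
  shows "x = \<zero>\<^bsub>Sp LL n d\<^esub>"
proof -
  interpret M: module K "Sp LL n d" by (rule L.module_Sp)
  have "x \<oplus>\<^bsub>Sp LL n d\<^esub> x = \<zero>\<^bsub>Sp LL n d\<^esub>" using M.r_neg[OF assms(1)] assms(2) by simp
  moreover have "x \<oplus>\<^bsub>Sp LL n d\<^esub> x = (\<one> \<oplus> \<one>) \<odot>\<^bsub>Sp LL n d\<^esub> x" using assms(1) by (simp add: L.Sp_l_distr)
  ultimately have 1: "(\<one> \<oplus> \<one>) \<odot>\<^bsub>Sp LL n d\<^esub> x = \<zero>\<^bsub>Sp LL n d\<^esub>" by simp
  have "\<one> \<oplus> \<one> \<noteq> \<zero>" using char_0[of 2] by (simp add: numeral_2_eq_2)
  then have "\<one> \<oplus> \<one> \<in> Units K" using field_Units by simp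
  then obtain b where b: "b \<in> carrier K" "b \<otimes> (\<one> \<oplus> \<one>) = \<one>" by (metis Units_closed Units_l_inv_ex)
  have "x = (b \<otimes> (\<one> \<oplus> \<one>)) \<odot>\<^bsub>Sp LL n d\<^esub> x" using b(2) assms(1) by simp
  also have "\<dots> = b \<odot>\<^bsub>Sp LL n d\<^esub> ((\<one> \<oplus> \<one>) \<odot>\<^bsub>Sp LL n d\<^esub> x)" using b(1) assms(1) by (intro L.Sp_smult_smult) auto
  finally show ?thesis using 1 b(1) by simp
qed

end

section \<open>The differential squares to zero\<close>

context char_0_field
begin

lemma dl_0: "L.dl 0 = \<ominus>\<^bsub>Sp LL 0 (-2)\<^esub> L.tree 0 0"
proof -
  interpret M: module K "Sp LL 0 (-2)" by (rule L.module_Sp)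
  have "Pow {1..0::nat} - {{}} = {}" by auto
  then show ?thesis using L.dl_split[of 0] L.tree_closed[of 0 0 0] by (simp add: M.finsum_empty)
qed

lemma dl_1: "L.dl 1 = \<ominus>\<^bsub>Sp LL 1 (-2)\<^esub> (L.tree 1 0 \<oplus>\<^bsub>Sp LL 1 (-2)\<^esub> L.tree 0 1)"
proof -
  interpret M: module K "Sp LL 1 (-2)" by (rule L.module_Sp)
  have "Pow {1..1::nat} - {{}} = {{1}}" by auto
  moreover have "L.bterm 1 {1} = L.tree 0 1"
    using L.bterm_eq[of id 1 "{1}" 1 0] L.act_id[OF L.tree_closed[of 1 0 1]] by (simp add: permutes_id)
  ultimately show ?thesis using L.dl_split[of 1] L.tree_closed[of 1 0 1]
    by (simp add: M.finsum_insert)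
qed

text \<open>The operation is symmetric in its two inputs and both receive the same odd element, so
  the exchange shows the result to be equal to its negative; 2 is invertible.\<close>

lemma plug_ell_0_twice: "pcomp LL 1 (pcomp LL 1 (\<l> 2) (\<l> 0)) (\<l> 0) = \<zero>\<^bsub>Sp LL 0 (-3)\<^esub>"
proof (rule half_zero)
  interpret M: module K "Sp LL 0 (-3)" by (rule L.module_Sp)
  have g: "gam 2 permutes {1..2}" by (rule gam_permutes) auto
  have "block_outer 2 0 (gam 2) = id" by (auto simp: fun_eq_iff block_outer_def gam_def Let_def)
  moreover have p1: "pcomp LL 1 (\<l> 2) (\<l> 0) \<in> carrier (Sp LL 1 (-2))" by (rule L.pcomp_in[OF L.l_closed L.l_closed]) auto
  moreover have "gam 2 2 = 1" by (simp add: gam_def)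
  ultimately have "pcomp LL 2 (\<l> 2) (\<l> 0) = pcomp LL 1 (\<l> 2) (\<l> 0)"
    using L.pcomp_act_left[OF L.l_closed[of 2] L.l_closed[of 0] _ _ g, of 2] L.l_sym[OF g] L.act_id[OF p1] by simp
  moreover have "pcomp LL 1 (pcomp LL 1 (\<l> 2) (\<l> 0)) (\<l> 0) = sign_of K (- 1 * - 1) \<odot>\<^bsub>Sp LL 0 (-3)\<^esub> pcomp LL 1 (pcomp LL 2 (\<l> 2) (\<l> 0)) (\<l> 0)"
    by (rule L.pcomp_parallel'[OF L.l_closed L.l_closed L.l_closed]) auto
  moreover show c: "pcomp LL 1 (pcomp LL 1 (\<l> 2) (\<l> 0)) (\<l> 0) \<in> carrier (Sp LL 0 (-3))"
    by (rule L.pcomp_in[OF p1 L.l_closed]) auto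
  ultimately show "pcomp LL 1 (pcomp LL 1 (\<l> 2) (\<l> 0)) (\<l> 0) = \<ominus>\<^bsub>Sp LL 0 (-3)\<^esub> pcomp LL 1 (pcomp LL 1 (\<l> 2) (\<l> 0)) (\<l> 0)"
    using M.smult_l_minus[OF one_closed c] by (simp add: sign_of_def)
qed

text \<open>Up to sign this is the differential of the composite of \<open>\<l> 1\<close> with
  \<open>\<l> 0\<close>. It has three terms: one plugs \<open>\<l> 0\<close> twice into
  \<open>\<l> 2\<close> and vanishes, the other two are the bracketings of \<open>\<l> 1\<close>,
  \<open>\<l> 1\<close>, \<open>\<l> 0\<close> with opposite signs and cancel by
  associativity.\<close>

lemma diff_dl_0: "\<D> (L.dl 0) = \<zero>\<^bsub>Sp LL 0 (-3)\<^esub>"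
proof -
  interpret M: module K "Sp LL 0 (-3)" by (rule L.module_Sp)
  let ?M = "Sp LL 0 (-3)"
  have t00: "L.tree 0 0 \<in> carrier (Sp LL 0 (-2))" by (rule L.tree_closed) simp
  have t10: "L.tree 1 0 \<in> carrier (Sp LL 1 (-2))" by (rule L.tree_closed) simp
  have t01: "L.tree 0 1 \<in> carrier (Sp LL 1 (-2))" by (rule L.tree_closed) simp
  have t00': "L.tree 0 0 = pcomp LL 1 (\<l> 1) (\<l> 0)" by (simp add: L.tree_def)
  define A where "A = pcomp LL 1 (L.tree 0 1) (\<l> 0)"
  have A: "A \<in> carrier ?M" unfolding A_def by (rule L.pcomp_in[OF t01 L.l_closed]) auto
  have A': "pcomp LL 1 (\<l> 1) (L.tree 0 0) = A"
    unfolding A_def L.tree_def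
    using L.pcomp_sequential[OF L.l_closed[of 1] L.l_closed[of 1] L.l_closed[of 0], of 1 1] by (simp add: One_nat_def)
  have z: "pcomp LL 1 (L.tree 1 0) (\<l> 0) = \<zero>\<^bsub>?M\<^esub>" using plug_ell_0_twice by (simp add: L.tree_def)
  have "\<D> (pcomp LL 1 (\<l> 1) (\<l> 0)) = pcomp LL 1 (L.dl 1) (\<l> 0) \<oplus>\<^bsub>?M\<^esub> sign_of K (-1) \<odot>\<^bsub>?M\<^esub> pcomp LL 1 (\<l> 1) (L.dl 0)"
    using diff_pcomp[OF L.l_closed[of 1] L.l_closed[of 0], of 1] by (simp add: diff_ell)
  also have "pcomp LL 1 (L.dl 1) (\<l> 0) = \<ominus>\<^bsub>?M\<^esub> pcomp LL 1 (L.tree 1 0 \<oplus>\<^bsub>Sp LL 1 (-2)\<^esub> L.tree 0 1) (\<l> 0)"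
    unfolding dl_1 by (rule L.pcomp_linear_left(3)[OF L.l_closed]) (use t10 t01 in auto)
  also have "pcomp LL 1 (L.tree 1 0 \<oplus>\<^bsub>Sp LL 1 (-2)\<^esub> L.tree 0 1) (\<l> 0) = pcomp LL 1 (L.tree 1 0) (\<l> 0) \<oplus>\<^bsub>?M\<^esub> A"
    unfolding A_def by (rule L.pcomp_linear_left(1)[OF L.l_closed _ _ _ _ t10 t01]) auto
  also have "\<dots> = A" using z A by simp
  also have "pcomp LL 1 (\<l> 1) (L.dl 0) = \<ominus>\<^bsub>?M\<^esub> pcomp LL 1 (\<l> 1) (L.tree 0 0)"
    unfolding dl_0 by (rule L.pcomp_linear_right(3)[OF L.l_closed[of 1] _ _ _ _ t00]) auto
  also have "pcomp LL 1 (\<l> 1) (L.tree 0 0) = A" by (rule A')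
  also have "sign_of K (-1) \<odot>\<^bsub>?M\<^esub> \<ominus>\<^bsub>?M\<^esub> A = A"
    using M.smult_l_minus[OF one_closed, of "\<ominus>\<^bsub>?M\<^esub> A"] A by (simp add: sign_of_def)
  finally have "\<D> (pcomp LL 1 (\<l> 1) (\<l> 0)) = \<zero>\<^bsub>?M\<^esub>" using A by (simp add: M.l_neg)
  then show ?thesis unfolding dl_0 using diff_minus[OF t00] t00' by simp
qed

lemma diff_dl: "\<D> (L.dl n) = \<zero>\<^bsub>Sp LL n (-3)\<^esub>"
proof (induction n)
  case (Suc n)
  have "\<D> (L.dl (n + 1)) = suspend (\<D> (L.dl n))"
    using suspend_diff[OF L.dl_closed[of n]] by (simp add: suspend_dl)
  then show ?case using Suc suspend_zero[of n "-3"] unfolding Suc_eq_plus1 by simp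
qed (rule diff_dl_0)

text \<open>The square of an odd derivation is a derivation, hence zero once it vanishes on the
  generators.\<close>

lemma diff_diff:
  assumes "x \<in> carrier (Sp LL n d)"
  shows "\<D> (\<D> x) = \<zero>\<^bsub>Sp LL n (d - 2)\<^esub>"
proof -
  define H where "H n d = {x \<in> carrier (Sp LL n d). \<D> (\<D> x) = \<zero>\<^bsub>Sp LL n (d - 2)\<^esub>}" for n d
  have d: "d - 1 - 1 = d - 2" for d :: int by simp
  have "suboperad K LL H"
  proof (rule L.suboperadI)
    show "\<zero>\<^bsub>Sp LL n d\<^esub> \<in> H n d" for n d using diff_zero[of n "d - 1"] by (simp add: H_def diff_zero d)
    fix n d x assume "x \<in> H n d"
    then have x: "x \<in> carrier (Sp LL n d)" "\<D> (\<D> x) = \<zero>\<^bsub>Sp LL n (d - 2)\<^esub>" by (auto simp: H_def)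
    note dx = diff_closed[OF x(1)]
    show "x \<oplus>\<^bsub>Sp LL n d\<^esub> y \<in> H n d" if "y \<in> H n d" for y
    proof -
      have y: "y \<in> carrier (Sp LL n d)" "\<D> (\<D> y) = \<zero>\<^bsub>Sp LL n (d - 2)\<^esub>" using that by (auto simp: H_def)
      show ?thesis using x y diff_add[OF x(1) y(1)] diff_add[OF dx diff_closed[OF y(1)]] by (simp add: H_def d)
    qed
    show "c \<odot>\<^bsub>Sp LL n d\<^esub> x \<in> H n d" if "c \<in> carrier K" for c
      using x that diff_smult[OF x(1) that] diff_smult[OF dx that] by (simp add: H_def d)
    show "act LL \<sigma> x \<in> H n d" if s: "\<sigma> permutes {1..n}" for \<sigma>
      using x L.act_closed[OF x(1) s] diff_act[OF x(1) s] diff_act[OF dx s] L.act_zero[OF s] by (simp add: H_def)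
    show "pcomp LL i x y \<in> H (n + m - 1) (d + e)" if "y \<in> H m e" and i: "1 \<le> i" "i \<le> n" for y m e i
    proof -
      have y: "y \<in> carrier (Sp LL m e)" "\<D> (\<D> y) = \<zero>\<^bsub>Sp LL m (e - 2)\<^esub>" using that by (auto simp: H_def)
      note dy = diff_closed[OF y(1)]
      let ?N = "n + m - 1"
      let ?M1 = "Sp LL ?N (d + e - 1)" and ?M = "Sp LL ?N (d + e - 2)"
      interpret M: module K ?M by (rule L.module_Sp)
      have idx: "d - 1 + e = d + e - 1" "d + (e - 1) = d + e - 1" "d + e - 1 - 1 = d + e - 2" by auto
      have a: "pcomp LL i (\<D> x) y \<in> carrier ?M1" by (rule L.pcomp_in[OF dx y(1) i]) auto
      have b: "pcomp LL i x (\<D> y) \<in> carrier ?M1" by (rule L.pcomp_in[OF x(1) dy i]) auto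
      define Z where "Z = pcomp LL i (\<D> x) (\<D> y)"
      have Z: "Z \<in> carrier ?M" unfolding Z_def by (rule L.pcomp_in[OF dx dy i]) auto
      have z1: "pcomp LL i \<zero>\<^bsub>Sp LL n (d - 2)\<^esub> y = \<zero>\<^bsub>?M\<^esub>" by (rule L.pcomp_zero_left[OF y(1) i]) auto
      have z2: "pcomp LL i x \<zero>\<^bsub>Sp LL m (e - 2)\<^esub> = \<zero>\<^bsub>?M\<^esub>" by (rule L.pcomp_zero_right[OF x(1) i]) auto
      have "\<D> (\<D> (pcomp LL i x y)) = \<D> (pcomp LL i (\<D> x) y) \<oplus>\<^bsub>?M\<^esub> sign_of K d \<odot>\<^bsub>?M\<^esub> \<D> (pcomp LL i x (\<D> y))"
        using diff_pcomp[OF x(1) y(1) i] diff_add[OF a, of "sign_of K d \<odot>\<^bsub>?M1\<^esub> pcomp LL i x (\<D> y)"] diff_smult[OF b, of "sign_of K d"] b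
        by (simp add: idx)
      also have "\<D> (pcomp LL i (\<D> x) y) = sign_of K (d - 1) \<odot>\<^bsub>?M\<^esub> Z"
        using diff_pcomp[OF dx y(1) i] x(2) z1 Z by (simp add: idx Z_def)
      also have "\<D> (pcomp LL i x (\<D> y)) = Z"
        using diff_pcomp[OF x(1) dy i] y(2) z2 Z by (simp add: idx Z_def)
      \<comment> \<open>The two mixed terms cancel because \<open>\<D>\<close> changes the parity of
        the degree.\<close>
      also have "sign_of K (d - 1) = \<ominus> sign_of K d" by (simp add: sign_of_def)
      finally have "\<D> (\<D> (pcomp LL i x y)) = \<zero>\<^bsub>?M\<^esub>" using Z M.smult_l_minus[of "sign_of K d" Z] by (simp add: M.l_neg)
      then show ?thesis using L.pcomp_closed[OF x(1) y(1) i] by (simp add: H_def)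
    qed
  qed (auto simp: H_def)
  moreover have "\<l> n \<in> H n (-1)" for n
    using L.l_closed by (simp add: H_def diff_ell diff_dl)
  ultimately show ?thesis using cL_generated[of H x n d] assms by (simp add: H_def)
qed

lemma cL_dg_operad: "dg_operad K LL \<D>"
  by (intro dg_operad.intro L.graded_operad_axioms dg_operad_axioms.intro)
    (auto simp: diff_closed diff_add diff_smult diff_diff diff_pcomp diff_act)

section \<open>The curved L-infinity operad as a curved operad\<close>

lemma cL_base_suboperad: "suboperad K LL (cL_base K)"
  unfolding cL_base_def by (rule L.generated_suboperad(1)) (use L.l_closed in auto)

lemma ell_in_base: "n > 0 \<Longrightarrow> \<l> n \<in> cL_base K n (-1)"
  using L.generated_suboperad(2)[of "\<lambda>n d. if n > 0 \<and> d = -1 then {ell K n} else {}" n "-1"] L.l_closed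
  unfolding cL_base_def by (auto split: if_splits)

lemma cL_base_induct:
  assumes "suboperad K LL H" "\<And>n. n > 0 \<Longrightarrow> \<l> n \<in> H n (-1)" "x \<in> cL_base K n d"
  shows "x \<in> H n d"
proof -
  have "cL_base K n d \<subseteq> H n d" unfolding cL_base_def
    by (rule L.generated_suboperad(3)[OF _ assms(1)]) (use assms(2) L.l_closed in auto)
  then show ?thesis using assms(3) by blast
qed

text \<open>An operad concentrated in arity 0 and degree -1, where the curvature survives.\<close>

definition point_operad :: "('k, 'k) operad" where
  "point_operad = \<lparr>Sp = \<lambda>n d. \<lparr>carrier = (if n = 0 \<and> d = - 1 then carrier K else {\<zero>}), monoid.mult = undefined,
     one = undefined, zero = \<zero>, add = add K, smult = monoid.mult K\<rparr>, pcomp = \<lambda>i x y. \<zero>, act = \<lambda>\<sigma> x. x\<rparr>"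

lemma point_operad: "graded_operad K point_operad"
proof (intro graded_operad.intro field_axioms graded_operad_axioms.intro)
  show "module K (Sp point_operad n d)" for n d
  proof (rule module.intro)
    show "abelian_group (Sp point_operad n d)"
    proof (rule abelian_groupI)
      show "\<exists>y\<in>carrier (Sp point_operad n d). y \<oplus>\<^bsub>Sp point_operad n d\<^esub> x = \<zero>\<^bsub>Sp point_operad n d\<^esub>"
        if "x \<in> carrier (Sp point_operad n d)" for x
        using that l_neg by (intro bexI[of _ "\<ominus> x"]) (auto simp: point_operad_def split: if_splits)
    qed (auto simp: point_operad_def a_ac split: if_splits)
    show "module_axioms K (Sp point_operad n d)"
      by unfold_locales (auto simp: point_operad_def l_distr r_distr m_assoc split: if_splits)
  qed (rule is_cring)
qed (auto simp: point_operad_def split: if_splits)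

text \<open>All composites are zero in the point operad, so sending \<open>\<l> 0\<close> to 1 and
  the other generators to 0 is a homomorphism. Its kernel contains the base but not
  \<open>\<l> 0\<close>.\<close>

lemma ell_0_notin_base: "\<l> 0 \<notin> cL_base K 0 (-1)"
proof
  assume *: "\<l> 0 \<in> cL_base K 0 (-1)"
  interpret T: symmetric_family K point_operad "\<lambda>n. if n = 0 then \<one> else \<zero>"
    by (intro symmetric_family.intro point_operad symmetric_family_axioms.intro) (auto simp: point_operad_def)
  interpret E': presentation_eval K cL_gens cL_rels point_operad "\<lambda>n d u. if n = 0 then \<one> else \<zero>"
    by (rule presentation_evalI[OF T.symmetric_family_axioms])
  let ?f = "induced_map point_operad (\<lambda>n d u. if n = 0 then \<one> else \<zero>)"
  have f: "?f \<in> operad_hom K LL point_operad" using E'.induced_hom unfolding LL_presented .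
  note h = operad_homD[OF f]
  have fl: "?f (\<l> n) = (if n = 0 then \<one> else \<zero>)" for n
    using E'.induced_cls[OF ell_wf] by (simp add: ell_def)
  define H where "H n d = {x \<in> carrier (Sp LL n d). ?f x = \<zero>}" for n d
  have z: "\<zero>\<^bsub>Sp point_operad n d\<^esub> = \<zero>" "pcomp point_operad i x y = \<zero>" "act point_operad \<sigma> x = x"
    "add (Sp point_operad n d) = add K" "smult (Sp point_operad n d) = monoid.mult K" for n d i x y \<sigma>
    by (simp_all add: point_operad_def)
  have fz: "?f \<zero>\<^bsub>Sp LL n d\<^esub> = \<zero>" for n d
    using graded_hom_zero[OF L.graded_operad_axioms point_operad f[unfolded operad_hom_iff]] z by simp
  have "suboperad K LL H"
    by (rule L.suboperadI) (auto simp: H_def h z fz L.pcomp_closed L.act_closed)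
  then have "\<l> 0 \<in> H 0 (-1)" by (rule cL_base_induct[OF _ _ *]) (auto simp: H_def L.l_closed fl)
  then show False using fl[of 0] by (simp add: H_def)
qed

section \<open>Freeness over the base\<close>

abbreviation "cQ \<equiv> cL_infinity K"

lemma cQ_simps [simp]: "op cQ = LL" "diff cQ = \<D>" "curvature cQ = \<l> 0" "base cQ = cL_base K"
  by (simp_all add: cL_infinity_def)

text \<open>The inverse is constructed from the universal property of the source. That the two maps
  are inverse to each other is checked on generators, on each side by the induction that belongs to
  its presentation.\<close>

lemma cL_natural_iso: "natural_map cQ \<in> operad_iso K (base_kappa K cQ) LL"
proof -
  let ?B = "base_operad cQ" and ?k = "kappa_operad K"
  let ?G = "coproduct_gens ?B ?k" and ?R = "coproduct_rels K ?B ?k"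
  let ?C = "base_kappa K cQ"
  have Bdef: "?B = restrict_operad LL (cL_base K)" by (simp add: base_operad_def)
  interpret k: graded_operad K ?k by (rule kappa_graded_operad)
  interpret N: presentation_eval K ?G ?R LL "\<lambda>n d. case_sum (\<lambda>x. x) (induced_map LL (\<lambda>n d u. \<l> 0))"
    unfolding Bdef
    by (rule coproduct_eval[OF L.graded_operad_axioms L.restrict_hom[OF cL_base_suboperad] cL_base_suboperad
          L.kappa_hom(1)[OF L.l_closed] L.graded_operad_axioms kappa_graded_operad])
  have C: "?C = N.PP" by (simp add: base_kappa_def coproduct_def)
  interpret C: graded_operad K ?C unfolding C by (rule N.presented_graded_operad)
  have \<nu>: "natural_map cQ = induced_map LL (\<lambda>n d. case_sum (\<lambda>x. x) (induced_map LL (\<lambda>n d u. \<l> 0)))"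
    by (simp add: natural_map_def coproduct_map_def)
  have \<nu>hom: "natural_map cQ \<in> operad_hom K ?C LL" using N.induced_hom unfolding C \<nu> .
  define il where "il n d x = N.cls (Gen n d (Inl x))" for n d x
  define ir where "ir n d y = N.cls (Gen n d (Inr y))" for n d y
  have ilhom: "graded_hom K ?B ?C il" unfolding il_def[abs_def] C
    by (rule N.gen_hom) (use L.suboperadD[OF cL_base_suboperad] in \<open>auto simp: coproduct_rels_def coproduct_gens_def Bdef\<close>)
  have irhom: "graded_hom K ?k ?C ir" unfolding ir_def[abs_def] C
    by (rule N.gen_hom) (auto simp: coproduct_rels_def coproduct_gens_def k.pcomp_closed k.act_closed)
  interpret kp: presentation K kappa_gens "{}" ..
  have kk: "?k = kp.PP" by (simp add: kappa_operad_def)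
  have ke: "kappa_elem K = kp.cls (Gen 0 (-1) ())" by (simp add: kappa_elem_def)
  have kc: "kappa_elem K \<in> carrier (Sp ?k 0 (-1))" unfolding ke kk by (rule kp.cls_closed) (auto simp: kappa_gens_def)
  \<comment> \<open>The values of the inverse on generators: \<open>\<l> 0\<close> goes to the copy
    of \<open>\<kappa>\<close> in the right factor, the others to their copies in the left
    factor.\<close>
  define lC where "lC n = (if n = 0 then ir 0 (-1) (kappa_elem K) else il n (-1) (\<l> n))" for n
  have bl: "\<l> n \<in> carrier (Sp ?B n (-1))" if "n \<noteq> 0" for n using ell_in_base that by (simp add: Bdef)
  interpret T: symmetric_family K ?C lC
  proof
    show "lC n \<in> carrier (Sp ?C n (-1))" for n
      using graded_homD(1)[OF irhom kc] graded_homD(1)[OF ilhom bl] by (simp add: lC_def)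
    show "act ?C \<sigma> (lC n) = lC n" if s: "\<sigma> permutes {1..n}" for \<sigma> n
    proof (cases "n = 0")
      case True
      then have "\<sigma> = id" using s by simp
      then show ?thesis using True C.act_id[OF graded_homD(1)[OF irhom kc]] by (simp add: lC_def)
    next
      case False
      then show ?thesis using graded_homD(5)[OF ilhom bl[OF False] s] L.l_sym[OF s] by (simp add: lC_def Bdef)
    qed
  qed
  interpret \<Psi>: presentation_eval K cL_gens cL_rels ?C "\<lambda>n d u. lC n"
    by (rule presentation_evalI[OF T.symmetric_family_axioms])
  define \<psi> where "\<psi> = induced_map ?C (\<lambda>n d (u::unit). lC n)"
  have \<psi>hom: "\<psi> \<in> operad_hom K LL ?C" unfolding \<psi>_def using \<Psi>.induced_hom unfolding LL_presented .
  note \<nu>h = operad_homD[OF \<nu>hom] and \<psi>h = operad_homD[OF \<psi>hom]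
  have \<psi>l: "\<psi> (\<l> n) = lC n" for n using \<Psi>.induced_cls[OF ell_wf] by (simp add: ell_def \<psi>_def)
  have \<nu>il: "natural_map cQ (il n d x) = x" if "x \<in> cL_base K n d" for n d x
  proof -
    have "wf_expr K ?G (Gen n d (Inl x))" using that by (auto simp: coproduct_gens_def Bdef)
    then show ?thesis using N.induced_cls by (simp add: il_def \<nu>)
  qed
  have \<nu>ir: "natural_map cQ (ir n d y) = induced_map LL (\<lambda>n d u. \<l> 0) y" if "y \<in> carrier (Sp ?k n d)" for n d y
  proof -
    have "wf_expr K ?G (Gen n d (Inr y))" using that by (auto simp: coproduct_gens_def)
    then show ?thesis using N.induced_cls by (simp add: ir_def \<nu>)
  qed
  have \<nu>l: "natural_map cQ (lC n) = \<l> n" for n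
    using \<nu>il[OF ell_in_base] \<nu>ir[OF kc] L.kappa_hom(2)[OF L.l_closed[of 0]] by (simp add: lC_def)
  have left: "natural_map cQ (\<psi> x) = x" if "x \<in> carrier (Sp LL n d)" for x n d
  proof -
    define H where "H n d = {x \<in> carrier (Sp LL n d). natural_map cQ (\<psi> x) = x}" for n d
    have z: "natural_map cQ (\<psi> \<zero>\<^bsub>Sp LL n d\<^esub>) = \<zero>\<^bsub>Sp LL n d\<^esub>" for n d
      using graded_hom_zero[OF L.graded_operad_axioms C.graded_operad_axioms \<psi>hom[unfolded operad_hom_iff], of n d]
        graded_hom_zero[OF C.graded_operad_axioms L.graded_operad_axioms \<nu>hom[unfolded operad_hom_iff], of n d] by simp
    have "suboperad K LL H"
    proof (rule L.suboperadI)
      show "pcomp LL i x y \<in> H (n + m - 1) (d + e)" if "x \<in> H n d" "y \<in> H m e" "1 \<le> i" "i \<le> n" for n d m e i x y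
        using that L.pcomp_closed[of x n d y m e i] \<psi>h(4)[of x n d y m e i] \<nu>h(4)[of "\<psi> x" n d "\<psi> y" m e i] \<psi>h(1)
        by (simp add: H_def)
      show "act LL \<sigma> x \<in> H n d" if "x \<in> H n d" "\<sigma> permutes {1..n}" for n d \<sigma> x
        using that L.act_closed[of x n d \<sigma>] \<psi>h(5)[of x n d \<sigma>] \<nu>h(5)[of "\<psi> x" n d \<sigma>] \<psi>h(1) by (simp add: H_def)
    qed (auto simp: H_def z \<psi>h \<nu>h)
    moreover have "\<l> n \<in> H n (-1)" for n by (simp add: H_def L.l_closed \<psi>l \<nu>l)
    ultimately show ?thesis using cL_generated[of H x n d] that by (simp add: H_def)
  qed
  \<comment> \<open>Every element of the base is a generator of the coproduct, so agreement is
    needed on the whole base; it spreads from the \<open>\<l> n\<close> with \<open>n > 0\<close> by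
    the induction for generated suboperads.\<close>
  have \<psi>il: "\<psi> x = il n d x" if "x \<in> cL_base K n d" for x n d
  proof -
    define H where "H n d = {x \<in> cL_base K n d. \<psi> x = il n d x}" for n d
    note bD = L.suboperadD[OF cL_base_suboperad]
    have bc: "x \<in> cL_base K n d \<Longrightarrow> x \<in> carrier (Sp LL n d)" for x n d using bD(1) by blast
    have ih: "x \<in> cL_base K n d \<Longrightarrow> y \<in> cL_base K n d \<Longrightarrow> il n d (x \<oplus>\<^bsub>Sp LL n d\<^esub> y) = il n d x \<oplus>\<^bsub>Sp ?C n d\<^esub> il n d y"
      "c \<in> carrier K \<Longrightarrow> x \<in> cL_base K n d \<Longrightarrow> il n d (c \<odot>\<^bsub>Sp LL n d\<^esub> x) = c \<odot>\<^bsub>Sp ?C n d\<^esub> il n d x"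
      "x \<in> cL_base K n d \<Longrightarrow> y' \<in> cL_base K m e \<Longrightarrow> 1 \<le> i \<Longrightarrow> i \<le> n \<Longrightarrow>
        il (n + m - 1) (d + e) (pcomp LL i x y') = pcomp ?C i (il n d x) (il m e y')"
      "x \<in> cL_base K n d \<Longrightarrow> \<sigma> permutes {1..n} \<Longrightarrow> il n d (act LL \<sigma> x) = act ?C \<sigma> (il n d x)"
      for x y n d c y' m e i \<sigma>
      using graded_homD(2)[OF ilhom, of x n d y] graded_homD(3)[OF ilhom, of c x n d]
        graded_homD(4)[OF ilhom, of x n d y' m e i] graded_homD(5)[OF ilhom, of x n d \<sigma>] by (auto simp: Bdef)
    have "suboperad K LL H"
    proof (rule L.suboperadI)
      show "\<zero>\<^bsub>Sp LL n d\<^esub> \<in> H n d" for n d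
      proof -
        have "il n d \<zero>\<^bsub>Sp LL n d\<^esub> = \<zero> \<odot>\<^bsub>Sp ?C n d\<^esub> il n d \<zero>\<^bsub>Sp LL n d\<^esub>"
          using ih(2)[OF zero_closed bD(2)[of n d]] by simp
        moreover have "il n d \<zero>\<^bsub>Sp LL n d\<^esub> \<in> carrier (Sp ?C n d)"
          using graded_homD(1)[OF ilhom, of "\<zero>\<^bsub>Sp LL n d\<^esub>" n d] bD(2)[of n d] by (simp add: Bdef)
        ultimately have "il n d \<zero>\<^bsub>Sp LL n d\<^esub> = \<zero>\<^bsub>Sp ?C n d\<^esub>" by simp
        then show ?thesis
          using graded_hom_zero[OF L.graded_operad_axioms C.graded_operad_axioms \<psi>hom[unfolded operad_hom_iff], of n d] bD(2)
          by (simp add: H_def)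
      qed
      show "H n d \<subseteq> carrier (Sp LL n d)" for n d using bc by (auto simp: H_def)
      fix n d x assume "x \<in> H n d"
      then have x: "x \<in> cL_base K n d" "\<psi> x = il n d x" by (auto simp: H_def)
      show "x \<oplus>\<^bsub>Sp LL n d\<^esub> y \<in> H n d" if "y \<in> H n d" for y
        using that x ih(1)[OF x(1), of y] \<psi>h(2)[OF bc bc, OF x(1), of y] bD(3)[OF x(1), of y] by (simp add: H_def)
      show "c \<odot>\<^bsub>Sp LL n d\<^esub> x \<in> H n d" if "c \<in> carrier K" for c
        using that x ih(2)[OF that x(1)] \<psi>h(3)[OF that bc[OF x(1)]] bD(4)[OF that x(1)] by (simp add: H_def)
      show "act LL \<sigma> x \<in> H n d" if "\<sigma> permutes {1..n}" for \<sigma>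
        using that x ih(4)[OF x(1) that] \<psi>h(5)[OF bc[OF x(1)] that] bD(7)[OF x(1) that] by (simp add: H_def)
      show "pcomp LL i x y \<in> H (n + m - 1) (d + e)" if y: "y \<in> H m e" and i: "1 \<le> i" "i \<le> n" for y m e i
      proof -
        have y': "y \<in> cL_base K m e" "\<psi> y = il m e y" using y by (auto simp: H_def)
        show ?thesis
          using x(2) y'(2) ih(3)[OF x(1) y'(1) i] \<psi>h(4)[OF bc[OF x(1)] bc[OF y'(1)] i] bD(6)[OF x(1) y'(1) i HOL.refl HOL.refl] by (simp add: H_def)
      qed
    qed
    moreover have "\<l> n \<in> H n (-1)" if "n > 0" for n using that ell_in_base by (simp add: H_def \<psi>l lC_def)
    ultimately have "x \<in> H n d" using cL_base_induct that by blast
    then show ?thesis by (simp add: H_def)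
  qed
  interpret kE: presentation_eval K kappa_gens "{}" LL "\<lambda>n d u. \<l> 0" by (rule L.kappa_eval[OF L.l_closed])
  \<comment> \<open>An element of the right factor is the class of an expression in
    \<open>\<kappa>\<close>; both sides evaluate this expression at the copy of
    \<open>\<kappa>\<close>.\<close>
  have \<psi>ir: "\<psi> (induced_map LL (\<lambda>n d u. \<l> 0) y) = ir n d y" if "y \<in> carrier (Sp ?k n d)" for y n d
  proof -
    obtain s where s: "y = kp.cls s" "wf_expr K kappa_gens s" "arity s = n" "degree s = d"
      using \<open>y \<in> carrier (Sp ?k n d)\<close> unfolding kk by (rule kp.carrier_presentedE)
    have "ir n d y = eval_expr ?C (\<lambda>n d g. ir n d (kp.cls (Gen n d g))) s"
      using hom_eval[OF kappa_graded_operad C.graded_operad_axioms irhom _ s(2), of "\<lambda>n d g. kp.cls (Gen n d g)"]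
        kp.eval_presented[OF s(2)] s kp.cls_closed by (simp add: kk)
    also have "\<dots> = eval_expr ?C (\<lambda>n d g. \<psi> (\<l> 0)) s"
      by (rule eval_expr_cong[OF s(2)]) (auto simp: kappa_gens_def \<psi>l lC_def ke split: if_splits)
    also have "\<dots> = \<psi> (eval_expr LL (\<lambda>n d g. \<l> 0) s)"
    proof -
      have "\<l> 0 \<in> carrier (Sp LL n d)" if "g \<in> kappa_gens n d" for n d g
        using that L.l_closed[of 0] by (auto simp: kappa_gens_def split: if_splits)
      then show ?thesis
        using hom_eval[OF L.graded_operad_axioms C.graded_operad_axioms \<psi>hom[unfolded operad_hom_iff] _ s(2), of "\<lambda>n d g. \<l> 0"]
        by simp
    qed
    also have "eval_expr LL (\<lambda>n d g. \<l> 0) s = induced_map LL (\<lambda>n d u. \<l> 0) y"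
      using kE.induced_cls[OF s(2)] s(1) by simp
    finally show ?thesis by simp
  qed
  have right: "\<psi> (natural_map cQ X) = X" if "X \<in> carrier (Sp ?C n d)" for X n d
  proof -
    obtain t where t: "X = N.cls t" "wf_expr K ?G t" "arity t = n" "degree t = d"
      using \<open>X \<in> carrier (Sp ?C n d)\<close> unfolding C by (rule N.carrier_presentedE)
    have comp: "graded_hom K ?C ?C (\<lambda>n d x. \<psi> (natural_map cQ x))"
      by (rule graded_hom_comp[OF \<nu>hom[unfolded operad_hom_iff] \<psi>hom[unfolded operad_hom_iff]])
    have Gc: "g \<in> ?G n d \<Longrightarrow> N.cls (Gen n d g) \<in> carrier (Sp ?C n d)" for n d g
      unfolding C by (rule N.cls_closed) auto
    have eP: "eval_expr ?C (\<lambda>n d g. N.cls (Gen n d g)) t = X"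
      using N.eval_presented[OF t(2)] t(1) by (simp add: C)
    have "\<psi> (natural_map cQ X) = eval_expr ?C (\<lambda>n d g. \<psi> (natural_map cQ (N.cls (Gen n d g)))) t"
      using hom_eval[OF C.graded_operad_axioms C.graded_operad_axioms comp Gc t(2), of "\<lambda>n d g. g"] eP by simp
    also have "\<dots> = eval_expr ?C (\<lambda>n d g. N.cls (Gen n d g)) t"
    proof (rule eval_expr_cong[OF t(2)])
      fix n d g assume g: "g \<in> ?G n d"
      show "\<psi> (natural_map cQ (N.cls (Gen n d g))) = N.cls (Gen n d g)"
      proof (cases g)
        case (Inl x)
        then have "x \<in> cL_base K n d" using g by (auto simp: coproduct_gens_def Bdef)
        then show ?thesis using \<nu>il \<psi>il Inl by (simp add: il_def)
      next
        case (Inr y)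
        then have "y \<in> carrier (Sp ?k n d)" using g by (auto simp: coproduct_gens_def)
        then show ?thesis using \<nu>ir \<psi>ir Inr by (simp add: ir_def)
      qed
    qed
    finally show ?thesis unfolding eP .
  qed
  show ?thesis unfolding operad_iso_def
    using \<nu>hom left right \<nu>h(1) \<psi>h(1)
    by (auto intro!: bij_betw_byWitness[where f' = \<psi>])
qed

section \<open>Weights of the differential\<close>

sublocale G: curved_grading_char_0 K cQ
  by (intro curved_grading_char_0.intro curved_grading.intro curved_grading_axioms.intro
      curved_grading_char_0_axioms.intro char_0)
    (simp_all add: L.graded_operad_axioms cL_base_suboperad L.l_closed cL_natural_iso)

abbreviation "cweight \<equiv> weight_homogeneous K LL (cL_base K) (\<l> 0)"

lemmas weight_closed = G.weight_closed[unfolded cQ_simps]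
lemmas weight_intros = weight_homogeneous.intros[where P = LL and S = "cL_base K" and k = "\<l> 0" and K = K]

text \<open>Only the parts of the differential that raise the weight by 0 or 1 occur on
  \<open>x\<close>. This form is free of \<open>weight_component\<close> and thus suited to
  induction over expressions.\<close>

definition small_diff :: "nat \<Rightarrow> nat \<Rightarrow> int \<Rightarrow> ('k, unit) expr set \<Rightarrow> bool" where
  "small_diff w n d x \<longleftrightarrow> x \<in> carrier (Sp LL n d) \<and>
    (\<exists>y z. cweight w n (d - 1) y \<and> cweight (w + 1) n (d - 1) z \<and> \<D> x = y \<oplus>\<^bsub>Sp LL n (d - 1)\<^esub> z)"

lemma small_diff_zero: "small_diff w n d \<zero>\<^bsub>Sp LL n d\<^esub>"
  unfolding small_diff_def diff_zero
  by (auto intro!: exI[of _ "\<zero>\<^bsub>Sp LL n (d - 1)\<^esub>"] weight_intros(3))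

lemma small_diff_add:
  assumes "small_diff w n d x" "small_diff w n d x'"
  shows "small_diff w n d (x \<oplus>\<^bsub>Sp LL n d\<^esub> x')"
proof -
  let ?M = "Sp LL n (d - 1)"
  obtain y z where x: "x \<in> carrier (Sp LL n d)" "cweight w n (d - 1) y" "cweight (w + 1) n (d - 1) z" "\<D> x = y \<oplus>\<^bsub>?M\<^esub> z"
    using assms(1) by (auto simp: small_diff_def)
  obtain y' z' where x': "x' \<in> carrier (Sp LL n d)" "cweight w n (d - 1) y'" "cweight (w + 1) n (d - 1) z'" "\<D> x' = y' \<oplus>\<^bsub>?M\<^esub> z'"
    using assms(2) by (auto simp: small_diff_def)
  note c = weight_closed[OF x(2)] weight_closed[OF x(3)] weight_closed[OF x'(2)] weight_closed[OF x'(3)]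
  have "\<D> (x \<oplus>\<^bsub>Sp LL n d\<^esub> x') = (y \<oplus>\<^bsub>?M\<^esub> y') \<oplus>\<^bsub>?M\<^esub> (z \<oplus>\<^bsub>?M\<^esub> z')"
    using diff_add[OF x(1) x'(1)] x(4) x'(4) c by (simp add: L.Sp_a_ac)
  then show ?thesis unfolding small_diff_def
    using x(1) x'(1) weight_intros(4)[of w n "d - 1" y y'] weight_intros(4)[of "w + 1" n "d - 1" z z'] x x' by auto
qed

lemma small_diff_smult:
  assumes "c \<in> carrier K" "small_diff w n d x"
  shows "small_diff w n d (c \<odot>\<^bsub>Sp LL n d\<^esub> x)"
proof -
  let ?M = "Sp LL n (d - 1)"
  obtain y z where x: "x \<in> carrier (Sp LL n d)" "cweight w n (d - 1) y" "cweight (w + 1) n (d - 1) z" "\<D> x = y \<oplus>\<^bsub>?M\<^esub> z"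
    using assms(2) by (auto simp: small_diff_def)
  have "\<D> (c \<odot>\<^bsub>Sp LL n d\<^esub> x) = c \<odot>\<^bsub>?M\<^esub> y \<oplus>\<^bsub>?M\<^esub> c \<odot>\<^bsub>?M\<^esub> z"
    using diff_smult[OF x(1) assms(1)] x(4) assms(1) weight_closed[OF x(2)] weight_closed[OF x(3)] by (simp add: L.Sp_r_distr)
  then show ?thesis unfolding small_diff_def
    using x assms(1) weight_intros(5)[of c w n "d - 1" y] weight_intros(5)[of c "w + 1" n "d - 1" z] by auto
qed

lemma small_diff_act:
  assumes "\<sigma> permutes {1..n}" "small_diff w n d x"
  shows "small_diff w n d (act LL \<sigma> x)"
proof -
  let ?M = "Sp LL n (d - 1)"
  obtain y z where x: "x \<in> carrier (Sp LL n d)" "cweight w n (d - 1) y" "cweight (w + 1) n (d - 1) z" "\<D> x = y \<oplus>\<^bsub>?M\<^esub> z"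
    using assms(2) by (auto simp: small_diff_def)
  have "\<D> (act LL \<sigma> x) = act LL \<sigma> y \<oplus>\<^bsub>?M\<^esub> act LL \<sigma> z"
    using diff_act[OF x(1) assms(1)] x(4) L.act_add[OF weight_closed[OF x(2)] weight_closed[OF x(3)] assms(1)] by simp
  then show ?thesis unfolding small_diff_def
    using x L.act_closed[OF x(1) assms(1)] weight_intros(7)[OF x(2) assms(1)] weight_intros(7)[OF x(3) assms(1)] by auto
qed

text \<open>Each factor enters the Leibniz rule twice, once as it is and once through its
  differential, so homogeneity of the factors has to be assumed along with the property.\<close>

lemma small_diff_pcomp:
  assumes "small_diff v n d x" "small_diff w m e y" "cweight v n d x" "cweight w m e y" "1 \<le> i" "i \<le> n"
  shows "small_diff (v + w) (n + m - 1) (d + e) (pcomp LL i x y)"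
proof -
  let ?M = "Sp LL (n + m - 1) (d + e - 1)"
  obtain a b where x: "x \<in> carrier (Sp LL n d)" "cweight v n (d - 1) a" "cweight (v + 1) n (d - 1) b" "\<D> x = a \<oplus>\<^bsub>Sp LL n (d - 1)\<^esub> b"
    using assms(1) by (auto simp: small_diff_def)
  obtain a' b' where y: "y \<in> carrier (Sp LL m e)" "cweight w m (e - 1) a'" "cweight (w + 1) m (e - 1) b'" "\<D> y = a' \<oplus>\<^bsub>Sp LL m (e - 1)\<^esub> b'"
    using assms(2) by (auto simp: small_diff_def)
  note ca = weight_closed[OF x(2)] weight_closed[OF x(3)] and ca' = weight_closed[OF y(2)] weight_closed[OF y(3)]
  have w1: "cweight (v + w) (n + m - 1) (d + e - 1) (pcomp LL i a y)"
    using weight_intros(6)[OF x(2) assms(4-6)] by (simp add: algebra_simps)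
  have w2: "cweight (v + w + 1) (n + m - 1) (d + e - 1) (pcomp LL i b y)"
    using weight_intros(6)[OF x(3) assms(4-6)] by (simp add: algebra_simps)
  have w3: "cweight (v + w) (n + m - 1) (d + e - 1) (pcomp LL i x a')"
    using weight_intros(6)[OF assms(3) y(2) assms(5,6)] by (simp add: algebra_simps)
  have w4: "cweight (v + w + 1) (n + m - 1) (d + e - 1) (pcomp LL i x b')"
    using weight_intros(6)[OF assms(3) y(3) assms(5,6)] by (simp add: algebra_simps)
  let ?s = "sign_of K d"
  note cl = weight_closed[OF w1] weight_closed[OF w2] weight_closed[OF w3] weight_closed[OF w4]
  have "pcomp LL i (\<D> x) y = pcomp LL i a y \<oplus>\<^bsub>?M\<^esub> pcomp LL i b y"
    unfolding x(4) by (rule L.pcomp_linear_left(1)[OF y(1) assms(5,6) _ _ ca]) auto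
  moreover have "pcomp LL i x (\<D> y) = pcomp LL i x a' \<oplus>\<^bsub>?M\<^esub> pcomp LL i x b'"
    unfolding y(4) by (rule L.pcomp_linear_right(1)[OF x(1) assms(5,6) _ _ ca']) auto
  ultimately have "\<D> (pcomp LL i x y) = (pcomp LL i a y \<oplus>\<^bsub>?M\<^esub> ?s \<odot>\<^bsub>?M\<^esub> pcomp LL i x a') \<oplus>\<^bsub>?M\<^esub>
      (pcomp LL i b y \<oplus>\<^bsub>?M\<^esub> ?s \<odot>\<^bsub>?M\<^esub> pcomp LL i x b')"
    using diff_pcomp[OF x(1) y(1) assms(5,6)] cl by (simp add: L.Sp_a_ac L.Sp_r_distr)
  moreover have "cweight (v + w) (n + m - 1) (d + e - 1) (pcomp LL i a y \<oplus>\<^bsub>?M\<^esub> ?s \<odot>\<^bsub>?M\<^esub> pcomp LL i x a')"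
    using weight_intros(4)[OF w1 weight_intros(5)[OF _ w3]] by simp
  moreover have "cweight (v + w + 1) (n + m - 1) (d + e - 1) (pcomp LL i b y \<oplus>\<^bsub>?M\<^esub> ?s \<odot>\<^bsub>?M\<^esub> pcomp LL i x b')"
    using weight_intros(4)[OF w2 weight_intros(5)[OF _ w4]] by simp
  ultimately show ?thesis unfolding small_diff_def using L.pcomp_closed[OF x(1) y(1) assms(5,6)] by auto
qed

lemma tree_0_weight: "cweight 1 n (-2) (\<ominus>\<^bsub>Sp LL n (-2)\<^esub> L.tree n 0)"
proof -
  have "cweight 1 n (-2) (L.tree n 0)"
    using G.plug_weight_1[unfolded cQ_simps, of "\<l> (n + 1)" n "-2"] ell_in_base[of "n + 1"] by (simp add: L.tree_def)
  from G.weight_submodule(3)[unfolded cQ_simps, OF this] show ?thesis by simp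
qed

text \<open>The explicit differential of a generator, sorted by weight: non-empty subsets give
  weight 0, the empty one gives weight 1.\<close>

lemma dl_weight:
  "L.dl n = \<ominus>\<^bsub>Sp LL n (-2)\<^esub> finsum (Sp LL n (-2)) (L.bterm n) (Pow {1..n} - {{}}) \<oplus>\<^bsub>Sp LL n (-2)\<^esub> \<ominus>\<^bsub>Sp LL n (-2)\<^esub> L.tree n 0"
  "\<ominus>\<^bsub>Sp LL n (-2)\<^esub> finsum (Sp LL n (-2)) (L.bterm n) (Pow {1..n} - {{}}) \<in> cL_base K n (-2)"
proof -
  interpret M: module K "Sp LL n (-2)" by (rule L.module_Sp)
  let ?S = "finsum (Sp LL n (-2)) (L.bterm n) (Pow {1..n} - {{}})"
  have c: "?S \<in> carrier (Sp LL n (-2))" using L.bterm_closed by (intro M.finsum_closed) auto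
  show "L.dl n = \<ominus>\<^bsub>Sp LL n (-2)\<^esub> ?S \<oplus>\<^bsub>Sp LL n (-2)\<^esub> \<ominus>\<^bsub>Sp LL n (-2)\<^esub> L.tree n 0"
    unfolding L.dl_split using c L.tree_closed[of n n 0] by (simp add: M.minus_add L.Sp_a_ac)
  have "finsum (Sp LL n (-2)) (L.bterm n) A \<in> cL_base K n (-2)" if "finite A" "A \<subseteq> Pow {1..n} - {{}}" for A
    using that
  proof (induction A rule: finite_induct)
    case empty
    then show ?case using L.suboperadD(2)[OF cL_base_suboperad] by (simp add: M.finsum_empty)
  next
    case (insert I A)
    have "L.bterm n \<in> A \<rightarrow> carrier (Sp LL n (-2))" "L.bterm n I \<in> carrier (Sp LL n (-2))"
      using insert L.bterm_closed by auto
    moreover have "L.bterm n I \<in> cL_base K n (-2)"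
      by (rule L.bterm_in_suboperad[OF cL_base_suboperad ell_in_base]) (use insert in auto)
    ultimately show ?case using insert L.suboperadD(3)[OF cL_base_suboperad] by (simp add: M.finsum_insert)
  qed
  then show "\<ominus>\<^bsub>Sp LL n (-2)\<^esub> ?S \<in> cL_base K n (-2)"
    using L.suboperadD(5)[OF cL_base_suboperad] by simp
qed

text \<open>The outer induction runs over homogeneous elements; its base case is itself an induction
  over the suboperad generated by the \<open>\<l> n\<close> with \<open>n > 0\<close>.\<close>

lemma weight_small_diff: "cweight w n d x \<Longrightarrow> small_diff w n d x"
proof (induction rule: weight_homogeneous.induct)
  case (base x n d)
  define H where "H n d = {x \<in> cL_base K n d. small_diff 0 n d x}" for n d
  note bD = L.suboperadD[OF cL_base_suboperad]
  have "suboperad K LL H"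
  proof (rule L.suboperadI)
    show "H n d \<subseteq> carrier (Sp LL n d)" for n d using bD(1) by (auto simp: H_def)
    show "pcomp LL i x y \<in> H (n + m - 1) (d + e)" if "x \<in> H n d" "y \<in> H m e" "1 \<le> i" "i \<le> n" for n d m e i x y
      using that small_diff_pcomp[of 0 n d x 0 m e y i] bD(6)[of x n d y m e i "n + m - 1" "d + e"]
      by (auto simp: H_def intro: weight_intros(1))
  qed (auto simp: H_def small_diff_zero bD intro: small_diff_add small_diff_smult small_diff_act)
  moreover have "\<l> n \<in> H n (-1)" if "n > 0" for n
  proof -
    have "small_diff 0 n (-1) (\<l> n)" unfolding small_diff_def diff_ell
      using dl_weight[of n] tree_0_weight[of n] L.l_closed weight_intros(1)[OF dl_weight(2)[of n]] by auto
    then show ?thesis using ell_in_base[OF that] by (simp add: H_def)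
  qed
  ultimately have "x \<in> H n d" using cL_base_induct base by simp
  then show ?case by (simp add: H_def)
next
  case kappa
  have "\<D> (\<l> 0) = \<ominus>\<^bsub>Sp LL 0 (-2)\<^esub> L.tree 0 0 \<oplus>\<^bsub>Sp LL 0 (-2)\<^esub> \<zero>\<^bsub>Sp LL 0 (-2)\<^esub>"
    using diff_ell[of 0] dl_0 L.tree_closed[of 0 0 0] by simp
  then show ?case unfolding small_diff_def using tree_0_weight[of 0] L.l_closed[of 0] weight_intros(3)[of "1 + 1" 0 "-2"]
    by auto
next
  case (pcomp v n d x w m e y i)
  then show ?case using small_diff_pcomp by simp
qed (auto intro: small_diff_zero small_diff_add small_diff_smult small_diff_act)

lemma cL_curv_object: "curv_object K cQ"
  unfolding curv_object_def cQ_simps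
proof (intro conjI allI impI ballI)
  show "dg_operad K LL \<D>" by (rule cL_dg_operad)
  show "suboperad K LL (cL_base K)" by (rule cL_base_suboperad)
  show "\<l> 0 \<in> carrier (Sp LL 0 (-1)) - cL_base K 0 (-1)" using L.l_closed ell_0_notin_base by simp
  show "natural_map cQ \<in> operad_iso K (base_kappa K cQ) LL" by (rule cL_natural_iso)
  show "diff_part K cQ i n d x = \<zero>\<^bsub>Sp LL n (d - 1)\<^esub>" if i: "i \<notin> {0, 1}" and x: "x \<in> carrier (Sp LL n d)" for i n d x
    unfolding diff_part_def cQ_simps
  proof (rule L.finsum_neutral)
    fix j assume j: "j \<in> {j. 0 \<le> int j + i \<and> weight_component K cQ j n d x \<noteq> \<zero>\<^bsub>Sp LL n d\<^esub>}"
    obtain f where f: "G.decomposed n d x f" using G.ex_decomposed[unfolded cQ_simps, of x n d] x by auto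
    have wj: "cweight j n d (f j)" using f by (simp add: G.decomposed_def[unfolded cQ_simps])
    obtain y z where yz: "cweight j n (d - 1) y" "cweight (j + 1) n (d - 1) z" "\<D> (f j) = y \<oplus>\<^bsub>Sp LL n (d - 1)\<^esub> z"
      using weight_small_diff[OF wj] by (auto simp: small_diff_def)
    \<comment> \<open>The differential of a component of weight \<open>j\<close> lives in the
      weights \<open>j\<close> and \<open>j + 1\<close>, while the requested component has weight
      \<open>j + i\<close>, which is neither.\<close>
    have "nat (int j + i) \<noteq> j" "nat (int j + i) \<noteq> j + 1" using i j by auto
    then show "weight_component K cQ (nat (int j + i)) n (d - 1) (\<D> (weight_component K cQ j n d x)) = \<zero>\<^bsub>Sp LL n (d - 1)\<^esub>"
      using G.weight_component_pair[unfolded cQ_simps, OF yz(1,2)] G.weight_component_eq[unfolded cQ_simps, OF f] yz(3) by simp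
  qed
  show "diff_part K cQ 1 0 (-1) (\<l> 0) = \<zero>\<^bsub>Sp LL 0 (-2)\<^esub>"
  proof -
    have k: "cweight 1 0 (-1) (\<l> 0)" using weight_intros(2) by simp
    \<comment> \<open>With no inputs only the empty subset contributes, so the differential of the
      curvature keeps its weight 1.\<close>
    have d: "cweight 1 0 (-2) (\<D> (\<l> 0))" using tree_0_weight[of 0] dl_0 by (simp add: diff_ell)
    have "diff_part K cQ 1 0 (-1) (\<l> 0) = \<zero>\<^bsub>Sp LL 0 (-1 - 1)\<^esub>"
      unfolding diff_part_def cQ_simps
    proof (rule L.finsum_neutral)
      fix j assume "j \<in> {j. 0 \<le> int j + 1 \<and> weight_component K cQ j 0 (-1) (\<l> 0) \<noteq> \<zero>\<^bsub>Sp LL 0 (-1)\<^esub>}"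
      then have "j = 1" using G.weight_component_weight[unfolded cQ_simps, OF k, of j] by (auto split: if_splits)
      then show "weight_component K cQ (nat (int j + 1)) 0 (-1 - 1) (\<D> (weight_component K cQ j 0 (-1) (\<l> 0))) = \<zero>\<^bsub>Sp LL 0 (-1 - 1)\<^esub>"
        using G.weight_component_weight[unfolded cQ_simps, OF k, of 1] G.weight_component_weight[unfolded cQ_simps, OF d, of 2] by simp
    qed
    then show ?thesis by simp
  qed
qed

end

section \<open>Morphisms out of the curved L-infinity operad\<close>

lemma up_exists:
  assumes "\<sigma> permutes {1..n + 1}" "\<sigma> 1 = 1"
  obtains \<tau> where "\<tau> permutes {1..n}" "\<sigma> = up \<tau>"
proof -
  define \<tau> where "\<tau> k = (if k = 0 then 0 else \<sigma> (k + 1) - 1)" for k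
  have ge2: "2 \<le> \<sigma> (k + 1)" if "1 \<le> k" for k
    using permutes_ge1(1)[OF assms(1), of "k + 1"] inj_eq[OF permutes_inj[OF assms(1)], of "k + 1" 1] assms(2) that by auto
  have "\<tau> permutes {1..n}"
  proof (rule finite_inj_on_permutes)
    show "\<tau> ` {1..n} \<subseteq> {1..n}"
    proof
      fix x assume "x \<in> \<tau> ` {1..n}"
      then obtain k where k: "1 \<le> k" "k \<le> n" "x = \<tau> k" by auto
      then show "x \<in> {1..n}" using ge2[of k] permutes_ge1(2)[OF assms(1), of "k + 1"] by (auto simp: \<tau>_def)
    qed
    show "inj_on \<tau> {1..n}"
    proof (rule inj_onI)
      fix x y assume *: "x \<in> {1..n}" "y \<in> {1..n}" "\<tau> x = \<tau> y"
      then have "\<sigma> (x + 1) = \<sigma> (y + 1)" using ge2[of x] ge2[of y] by (auto simp: \<tau>_def)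
      then show "x = y" using inj_eq[OF permutes_inj[OF assms(1)], of "x + 1" "y + 1"] by simp
    qed
    fix x assume "x \<notin> {1..n}"
    then show "\<tau> x = x" using permutes_not_in[OF assms(1), of "x + 1"] by (auto simp: \<tau>_def)
  qed simp
  moreover have "\<sigma> = up \<tau>"
  proof
    fix k
    show "\<sigma> k = up \<tau> k"
    proof (cases "k \<le> 1")
      case True
      then have "k = 0 \<or> k = 1" by auto
      then show ?thesis using permutes_ge1(3)[OF assms(1)] assms(2) by (auto simp: up_def)
    next
      case False
      then have "1 \<le> k - 1" "k - 1 + 1 = k" by auto
      then have "2 \<le> \<sigma> k" using ge2[of "k - 1"] by simp
      then show ?thesis using False by (simp add: up_def \<tau>_def)
    qed
  qed
  ultimately show thesis by (rule that)
qed

text \<open>A permutation which moves 1 is reduced to one that fixes 1 by first undoing its value at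
  1, with \<open>gam 2\<close>, the exchange of 1 and 2, and a permutation fixing 1. So symmetry can
  be tested on \<open>gam 2\<close> and on the permutations that fix 1.\<close>

lemma permutes_generated:
  assumes "\<sigma> permutes {1..n + 2}"
  obtains \<alpha> \<beta> where "\<alpha> permutes {1..n + 1}" "\<beta> permutes {1..n + 1}" "\<sigma> = up \<beta>"
  | \<alpha> \<beta> where "\<alpha> permutes {1..n + 1}" "\<beta> permutes {1..n + 1}" "\<sigma> = up \<alpha> \<circ> gam 2 \<circ> up \<beta>"
proof (cases "\<sigma> 1 = 1")
  case True
  have "\<sigma> permutes {1..n + 1 + 1}" using assms by (simp add: add.assoc one_add_one)
  then obtain \<beta> where "\<beta> permutes {1..n + 1}" "\<sigma> = up \<beta>" using True by (rule up_exists)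
  then show thesis using that(1)[of id] permutes_id by blast
next
  case False
  have s: "\<sigma> permutes {1..n + 1 + 1}" using assms by (simp add: add.assoc one_add_one)
  define j where "j = \<sigma> 1"
  have j: "2 \<le> j" "j \<le> n + 2"
    using permutes_ge1(1,2)[OF assms, of 1] False by (auto simp: j_def)
  \<comment> \<open>Chosen such that \<open>up \<alpha>\<close> takes 2, the image of 1 under
    \<open>gam 2\<close>, to \<open>j\<close>; the index is lower by one because \<open>up\<close>
    shifts.\<close>
  define \<alpha> where "\<alpha> = Transposition.transpose 1 (j - 1)"
  have a: "\<alpha> permutes {1..n + 1}" unfolding \<alpha>_def by (rule permutes_swap_id) (use j in auto)
  have g: "gam 2 permutes {1..n + 1 + 1}" by (rule gam_permutes) auto
  define \<rho> where "\<rho> = up \<alpha> \<circ> gam 2"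
  have r: "\<rho> permutes {1..n + 1 + 1}" unfolding \<rho>_def by (rule permutes_compose[OF g up_permutes[OF a]])
  have r1: "\<rho> 1 = j" using j by (auto simp: \<rho>_def gam_def up_def \<alpha>_def One_nat_def)
  define \<sigma>' where "\<sigma>' = inv_into UNIV \<rho> \<circ> \<sigma>"
  have "\<sigma>' permutes {1..n + 1 + 1}" unfolding \<sigma>'_def by (rule permutes_compose[OF s permutes_inv[OF r]])
  moreover have "\<sigma>' 1 = 1" using r1 permutes_inverses(2)[OF r, of 1] by (simp add: \<sigma>'_def j_def)
  ultimately obtain \<beta> where b: "\<beta> permutes {1..n + 1}" "\<sigma>' = up \<beta>" by (rule up_exists)
  have "\<sigma> = \<rho> \<circ> \<sigma>'" unfolding \<sigma>'_def using permutes_inverses(1)[OF r] by (auto simp: fun_eq_iff)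
  then show thesis using that(2)[OF a b(1)] b(2) by (simp add: \<rho>_def)
qed

lemma symmetric_family_hom:
  assumes "symmetric_family K P l" "symmetric_family K P' l'" "f \<in> operad_hom K P P'" "\<And>n. f (l n) = l' n"
  shows symmetric_family_hom_bterm: "I \<subseteq> {1..n} \<Longrightarrow>
      f (symmetric_family.bterm P l n I) = symmetric_family.bterm P' l' n I"
    and symmetric_family_hom_tree: "f (symmetric_family.tree P l p q) = symmetric_family.tree P' l' p q"
    and symmetric_family_hom_dl: "f (symmetric_family.dl P l n) = symmetric_family.dl P' l' n"
proof -
  interpret P: symmetric_family K P l by fact
  interpret P': symmetric_family K P' l' by fact
  note h = operad_homD[OF assms(3)]
  show t: "f (P.tree p q) = P'.tree p q" for p q
    unfolding P.tree_def P'.tree_def using h(4)[OF P.l_closed[of "p + 1"] P.l_closed[of q], of 1] assms(4) by simp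
  show b: "f (P.bterm n I) = P'.bterm n I" if "I \<subseteq> {1..n}" for n I
  proof -
    obtain \<sigma> where s: "\<sigma> permutes {1..n}" "\<sigma> ` I = {1..card I}" "n = (n - card I) + card I"
      using P.ex_arrange[OF \<open>I \<subseteq> {1..n}\<close>] by metis
    show ?thesis unfolding P.bterm_eq[OF s] P'.bterm_eq[OF s] using h(5)[OF P.tree_closed[OF s(3)] s(1)] t by simp
  qed
  interpret M: module K "Sp P' n (-2)" by (rule P'.module_Sp)
  note gh = assms(3)[unfolded operad_hom_iff]
  have "f (finsum (Sp P n (-2)) (P.bterm n) (Pow {1..n})) = finsum (Sp P' n (-2)) (\<lambda>I. f (P.bterm n I)) (Pow {1..n})"
    using graded_hom_finsum[OF P.graded_operad_axioms P'.graded_operad_axioms gh, of "P.bterm n" "Pow {1..n}" n "-2"]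
      P.bterm_closed by auto
  also have "\<dots> = finsum (Sp P' n (-2)) (P'.bterm n) (Pow {1..n})"
    by (rule M.finsum_cong') (use b P'.bterm_closed in auto)
  finally show "f (P.dl n) = P'.dl n"
    unfolding P.dl_def P'.dl_def
    using graded_hom_minus[OF P.graded_operad_axioms P'.graded_operad_axioms gh P.sum_bterm_closed[of n]] by simp
qed

section \<open>The differential of an arbitrary object\<close>

locale curved_target = char_0_field K for K :: "('k, 'm) ring_scheme" (structure) +
  fixes Q :: "('k, 'a) curv"
  assumes object: "curv_object K Q"
begin

sublocale T: curved_grading_char_0 K Q
  using object
  by (intro curved_grading_char_0.intro curved_grading.intro curved_grading_axioms.intro
      curved_grading_char_0_axioms.intro char_0)
    (auto simp: curv_object_def dg_operad_def)

sublocale DQ: dg_operad K "op Q" "diff Q"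
  using object by (simp add: curv_object_def)

abbreviation "P \<equiv> op Q"
abbreviation "\<kappa> \<equiv> curvature Q"
abbreviation "B \<equiv> base Q"
abbreviation "d \<equiv> diff Q"

lemma d_additive_maps:
  shows d_zero: "d \<zero>\<^bsub>Sp P n e\<^esub> = \<zero>\<^bsub>Sp P n (e - 1)\<^esub>"
    and d_minus: "x \<in> carrier (Sp P n e) \<Longrightarrow> d (\<ominus>\<^bsub>Sp P n e\<^esub> x) = \<ominus>\<^bsub>Sp P n (e - 1)\<^esub> d x"
    and d_finsum: "g \<in> A \<rightarrow> carrier (Sp P n e) \<Longrightarrow> d (finsum (Sp P n e) g A) = finsum (Sp P n (e - 1)) (\<lambda>a. d (g a)) A"
proof -
  show "d \<zero>\<^bsub>Sp P n e\<^esub> = \<zero>\<^bsub>Sp P n (e - 1)\<^esub>"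
    by (rule additive_zero[OF T.Sp_abelian_group T.Sp_abelian_group]) (auto simp: DQ.D_closed DQ.D_add)
  show "d (\<ominus>\<^bsub>Sp P n e\<^esub> x) = \<ominus>\<^bsub>Sp P n (e - 1)\<^esub> d x" if "x \<in> carrier (Sp P n e)"
    by (rule additive_minus[OF T.Sp_abelian_group T.Sp_abelian_group]) (use that in \<open>auto simp: DQ.D_closed DQ.D_add\<close>)
  show "d (finsum (Sp P n e) g A) = finsum (Sp P n (e - 1)) (\<lambda>a. d (g a)) A" if "g \<in> A \<rightarrow> carrier (Sp P n e)"
    by (rule additive_finsum[OF T.Sp_abelian_group T.Sp_abelian_group _ _ that]) (auto simp: DQ.D_closed DQ.D_add)
qed

text \<open>For a non-zero homogeneous element the sum that defines \<open>diff_part\<close> runs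
  over its weight alone, so the conditions on an object become statements on single weight
  components.\<close>

lemma diff_part_weight:
  assumes "T.weight w n e x" "x \<noteq> \<zero>\<^bsub>Sp P n e\<^esub>" "0 \<le> int w + i"
  shows "diff_part K Q i n e x = weight_component K Q (nat (int w + i)) n (e - 1) (d x)"
proof -
  interpret M: module K "Sp P n (e - 1)" by (rule T.module_Sp)
  have "{j. 0 \<le> int j + i \<and> weight_component K Q j n e x \<noteq> \<zero>\<^bsub>Sp P n e\<^esub>} = {w}"
    using T.weight_component_weight[OF assms(1)] assms(2,3) by (auto split: if_splits)
  moreover have "weight_component K Q v n (e - 1) (d x) \<in> carrier (Sp P n (e - 1))" for v
  proof -
    obtain f where f: "T.decomposed n (e - 1) (d x) f"
      using T.ex_decomposed[OF DQ.D_closed[OF T.weight_closed[OF assms(1)]]] by blast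
    then have "T.weight v n (e - 1) (f v)" by (simp add: T.decomposed_def)
    then show ?thesis using T.weight_component_eq[OF f] T.weight_closed by simp
  qed
  ultimately show ?thesis unfolding diff_part_def
    using T.weight_component_weight[OF assms(1), of w] by (simp add: M.finsum_insert)
qed

lemma diff_part_zero: "x \<in> carrier (Sp P n e) \<Longrightarrow> i \<notin> {0, 1} \<Longrightarrow> diff_part K Q i n e x = \<zero>\<^bsub>Sp P n (e - 1)\<^esub>"
  using object by (simp add: curv_object_def)

lemma d_base:
  assumes "x \<in> B n e"
  obtains y z where "y \<in> B n (e - 1)" "T.weight 1 n (e - 1) z" "d x = y \<oplus>\<^bsub>Sp P n (e - 1)\<^esub> z"
proof -
  note xc = T.base_closed[OF assms]
  have w: "T.weight 0 n e x" using assms by (simp add: T.weight_0_iff)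
  have comp: "weight_component K Q v n (e - 1) (d x) = \<zero>\<^bsub>Sp P n (e - 1)\<^esub>" if "v \<ge> 2" for v
  proof (cases "x = \<zero>\<^bsub>Sp P n e\<^esub>")
    case True
    then show ?thesis using d_zero T.weight_component_weight[OF weight_homogeneous.zero] by simp
  next
    case False
    then show ?thesis using diff_part_weight[OF w False, of "int v"] diff_part_zero[OF xc, of "int v"] that by simp
  qed
  show thesis
  proof (rule T.decompose_01[OF DQ.D_closed[OF xc] comp])
    fix y z
    assume "T.weight 0 n (e - 1) y" "T.weight 1 n (e - 1) z" "d x = y \<oplus>\<^bsub>Sp P n (e - 1)\<^esub> z"
    then show thesis using that[of y z] by (simp add: T.weight_0_iff)
  qed
qed

lemma curvature_nonzero: "\<kappa> \<noteq> \<zero>\<^bsub>Sp P 0 (-1)\<^esub>"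
  using object T.baseD(2)[of 0 "-1"] by (auto simp: curv_object_def)

lemma curvature_weight: "T.weight 1 0 (-1) \<kappa>"
  by (rule weight_homogeneous.kappa)

text \<open>Of the components of \<open>d \<kappa>\<close>, the one in weight 2 is
  \<open>d_1 \<kappa>\<close>, which is zero by condition (3) of the category, and the one in weight
  1 is \<open>d_0 \<kappa>\<close>; all others belong to parts that vanish.\<close>

lemma d_curvature_weight: "T.weight 1 0 (-2) (d \<kappa>)"
proof -
  have c: "d \<kappa> \<in> carrier (Sp P 0 (-2))" using DQ.D_closed[OF T.curvature_closed] by simp
  have p: "diff_part K Q i 0 (-1) \<kappa> = weight_component K Q (nat (1 + i)) 0 (-2) (d \<kappa>)" if "i \<ge> -1" for i
    using diff_part_weight[OF curvature_weight curvature_nonzero, of i] that by simp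
  have "weight_component K Q v 0 (-2) (d \<kappa>) = \<zero>\<^bsub>Sp P 0 (-2)\<^esub>" if "v \<noteq> 1" for v
  proof (cases "v = 2")
    case True
    then show ?thesis using p[of 1] object by (simp add: curv_object_def)
  next
    case False
    \<comment> \<open>As \<open>\<kappa>\<close> has weight 1, the component of weight
      \<open>v\<close> comes from the part that raises weights by \<open>v - 1\<close>, which is -1
      for \<open>v = 0\<close>.\<close>
    have "diff_part K Q (int v - 1) 0 (-1) \<kappa> = \<zero>\<^bsub>Sp P 0 (-2)\<^esub>"
      using diff_part_zero[OF T.curvature_closed, of "int v - 1"] False that by auto
    then show ?thesis using p[of "int v - 1"] by simp
  qed
  note * = this
  have c2: "weight_component K Q v 0 (-2) (d \<kappa>) = \<zero>\<^bsub>Sp P 0 (-2)\<^esub>" if "v \<ge> 2" for v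
    using *[of v] that by simp
  obtain y z where "T.weight 0 0 (-2) y" "T.weight 1 0 (-2) z" "d \<kappa> = y \<oplus>\<^bsub>Sp P 0 (-2)\<^esub> z"
    "weight_component K Q 0 0 (-2) (d \<kappa>) = y"
    by (rule T.decompose_01[OF c c2])
  moreover from this have "y = \<zero>\<^bsub>Sp P 0 (-2)\<^esub>" using *[of 0] by simp
  ultimately show ?thesis using T.weight_closed by simp
qed

text \<open>
  The relation between the images of consecutive generators under a morphism: the part of
  \<open>d x\<close> of weight 1 is \<open>- z \<circ>\<^sub>1 \<kappa>\<close>, and this determines \<open>z\<close>.
\<close>

definition next_op :: "nat \<Rightarrow> 'a \<Rightarrow> 'a \<Rightarrow> bool" where
  "next_op n x z \<longleftrightarrow> z \<in> B (n + 1) (-1) \<and>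
    (\<exists>y \<in> B n (-2). d x = y \<oplus>\<^bsub>Sp P n (-2)\<^esub> \<ominus>\<^bsub>Sp P n (-2)\<^esub> pcomp P 1 z \<kappa>)"

lemma plug_weight: "z \<in> B (n + 1) (-1) \<Longrightarrow> T.weight 1 n (-2) (pcomp P 1 z \<kappa>)"
  using T.plug_weight_1[of z n "-2"] by simp

text \<open>Degree -2 excludes bare multiples of \<open>\<kappa>\<close>, so an element of weight 1
  is a plugging.\<close>

lemma weight_1_exists:
  assumes "T.weight 1 n (-2) w"
  obtains z where "z \<in> B (n + 1) (-1)" "w = \<ominus>\<^bsub>Sp P n (-2)\<^esub> pcomp P 1 z \<kappa>"
proof -
  obtain z where z: "z \<in> B (n + 1) (-1)" "w = pcomp P 1 z \<kappa>"
    using T.weight_1_plug[OF assms] by auto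
  note zc = T.base_closed[OF z(1)]
  have "pcomp P 1 (\<ominus>\<^bsub>Sp P (n + 1) (-1)\<^esub> z) \<kappa> = \<ominus>\<^bsub>Sp P n (-2)\<^esub> pcomp P 1 z \<kappa>"
    by (rule T.pcomp_linear_left(3)[OF T.curvature_closed _ _ _ _ zc]) auto
  then show thesis
    using that[OF T.baseD(5)[OF z(1)]] z(2) T.weight_closed[OF assms] by simp
qed

lemma next_op_exists:
  assumes "x \<in> B n (-1) \<or> n = 0 \<and> x = \<kappa>"
  shows "\<exists>z. next_op n x z"
  using assms
proof
  assume "x \<in> B n (-1)"
  then obtain y w where y: "y \<in> B n (-2)" "T.weight 1 n (-2) w" "d x = y \<oplus>\<^bsub>Sp P n (-2)\<^esub> w"
    using d_base[of x n "-1"] by auto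
  obtain z where "z \<in> B (n + 1) (-1)" "w = \<ominus>\<^bsub>Sp P n (-2)\<^esub> pcomp P 1 z \<kappa>" by (rule weight_1_exists[OF y(2)])
  then show ?thesis using y unfolding next_op_def by blast
next
  assume n: "n = 0 \<and> x = \<kappa>"
  obtain z where "z \<in> B (0 + 1) (-1)" "d \<kappa> = \<ominus>\<^bsub>Sp P 0 (-2)\<^esub> pcomp P 1 z \<kappa>"
    by (rule weight_1_exists[OF d_curvature_weight])
  moreover have "d \<kappa> = \<zero>\<^bsub>Sp P 0 (-2)\<^esub> \<oplus>\<^bsub>Sp P 0 (-2)\<^esub> d \<kappa>" using T.weight_closed[OF d_curvature_weight] by simp
  ultimately show ?thesis using n T.baseD(2)[of 0 "-2"] unfolding next_op_def by metis
qed

text \<open>The plugging is the weight 1 component of \<open>d x\<close>, so it is determined by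
  independence of the weights, and \<open>z\<close> is determined by injectivity of
  plugging.\<close>

lemma next_op_unique:
  assumes "next_op n x z" "next_op n x z'"
  shows "z = z'"
proof -
  obtain y where y: "z \<in> B (n + 1) (-1)" "y \<in> B n (-2)" "d x = y \<oplus>\<^bsub>Sp P n (-2)\<^esub> \<ominus>\<^bsub>Sp P n (-2)\<^esub> pcomp P 1 z \<kappa>"
    using assms(1) by (auto simp: next_op_def)
  obtain y' where y': "z' \<in> B (n + 1) (-1)" "y' \<in> B n (-2)" "d x = y' \<oplus>\<^bsub>Sp P n (-2)\<^esub> \<ominus>\<^bsub>Sp P n (-2)\<^esub> pcomp P 1 z' \<kappa>"
    using assms(2) by (auto simp: next_op_def)
  note w = plug_weight[OF y(1)] and w' = plug_weight[OF y'(1)]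
  have "weight_component K Q 1 n (-2) (d x) = \<ominus>\<^bsub>Sp P n (-2)\<^esub> pcomp P 1 z \<kappa>"
    unfolding y(3) using T.weight_component_pair[OF _ T.weight_submodule(3)[OF w], of 0 y 1] y(2) by (simp add: T.weight_0_iff)
  moreover have "weight_component K Q 1 n (-2) (d x) = \<ominus>\<^bsub>Sp P n (-2)\<^esub> pcomp P 1 z' \<kappa>"
    unfolding y'(3) using T.weight_component_pair[OF _ T.weight_submodule(3)[OF w'], of 0 y' 1] y'(2) by (simp add: T.weight_0_iff)
  ultimately have "\<ominus>\<^bsub>Sp P n (-2)\<^esub> (\<ominus>\<^bsub>Sp P n (-2)\<^esub> pcomp P 1 z \<kappa>) = \<ominus>\<^bsub>Sp P n (-2)\<^esub> (\<ominus>\<^bsub>Sp P n (-2)\<^esub> pcomp P 1 z' \<kappa>)" by simp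
  then have "pcomp P 1 z \<kappa> = pcomp P 1 z' \<kappa>" using T.weight_closed[OF w] T.weight_closed[OF w'] by simp
  then show ?thesis using T.plug_inj[of z n "-2" z'] y(1) y'(1) by simp
qed

lemma act_plug:
  assumes "\<tau> permutes {1..n}" "z \<in> carrier (Sp P (n + 1) e)"
  shows "act P \<tau> (pcomp P 1 z \<kappa>) = pcomp P 1 (act P (up \<tau>) z) \<kappa>"
proof -
  have bo: "block_outer 1 0 (up \<tau>) = \<tau>"
  proof
    fix k show "block_outer 1 0 (up \<tau>) k = \<tau> k"
      using permutes_ge1(1)[OF assms(1), of k] permutes_ge1(3)[OF assms(1)]
      by (cases "k = 0") (auto simp: block_outer_def up_def Let_def)
  qed
  have "pcomp P 1 (act P (up \<tau>) z) \<kappa> = act P (block_outer 1 0 (up \<tau>)) (pcomp P (up \<tau> 1) z \<kappa>)"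
    by (rule T.pcomp_act_left[OF assms(2) T.curvature_closed _ _ up_permutes[OF assms(1)]]) auto
  then show ?thesis using bo by (simp add: up_def)
qed

text \<open>Combined with uniqueness, it turns a symmetry of \<open>x\<close> into invariance of
  \<open>z\<close> under the permutations that fix the slot of \<open>\<kappa>\<close>.\<close>

lemma next_op_act:
  assumes "next_op n x z" "\<tau> permutes {1..n}" "x \<in> carrier (Sp P n (-1))"
  shows "next_op n (act P \<tau> x) (act P (up \<tau>) z)"
proof -
  obtain y where y: "z \<in> B (n + 1) (-1)" "y \<in> B n (-2)" "d x = y \<oplus>\<^bsub>Sp P n (-2)\<^esub> \<ominus>\<^bsub>Sp P n (-2)\<^esub> pcomp P 1 z \<kappa>"
    using assms(1) by (auto simp: next_op_def)
  note pc = T.weight_closed[OF plug_weight[OF y(1)]] and yc = T.base_closed[OF y(2)]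
  have "d (act P \<tau> x) = act P \<tau> y \<oplus>\<^bsub>Sp P n (-2)\<^esub> \<ominus>\<^bsub>Sp P n (-2)\<^esub> act P \<tau> (pcomp P 1 z \<kappa>)"
    using DQ.D_act[OF assms(3,2)] y(3) T.act_add[OF yc _ assms(2)] T.act_minus[OF assms(2) pc] pc by simp
  then show ?thesis unfolding next_op_def act_plug[OF assms(2) T.base_closed[OF y(1)]]
    using T.baseD(7)[OF y(1) up_permutes[OF assms(2)]] T.baseD(7)[OF y(2) assms(2)] by blast
qed

section \<open>The images of the generators\<close>

primrec l :: "nat \<Rightarrow> 'a" where
  "l 0 = \<kappa>"
| "l (Suc n) = (SOME z. next_op n (l n) z)"

lemma l_base: "l (n + 1) \<in> B (n + 1) (-1)" and l_next: "next_op n (l n) (l (n + 1))"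
proof -
  have "(l n \<in> B n (-1) \<or> n = 0 \<and> l n = \<kappa>) \<and> next_op n (l n) (l (n + 1))" for n
  proof (induction n)
    case 0
    show ?case using someI_ex[OF next_op_exists[of \<kappa> 0]] by (simp add: One_nat_def)
  next
    case (Suc n)
    then have b: "l (Suc n) \<in> B (Suc n) (-1)" unfolding next_op_def Suc_eq_plus1 by blast
    have "next_op (Suc n) (l (Suc n)) (l (Suc (Suc n)))"
      unfolding l.simps(2)[of "Suc n"] by (rule someI_ex[OF next_op_exists]) (use b in blast)
    then show ?case using b unfolding Suc_eq_plus1 by blast
  qed
  then show "next_op n (l n) (l (n + 1))" by blast
  then show "l (n + 1) \<in> B (n + 1) (-1)" by (simp add: next_op_def)
qed

lemma l_in_base: "n > 0 \<Longrightarrow> l n \<in> B n (-1)"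
  using l_base[of "n - 1"] by simp

lemma l_carrier: "l n \<in> carrier (Sp P n (-1))"
  using l_in_base[of n] T.base_closed T.curvature_closed by (cases "n = 0") auto

text \<open>In \<open>d (d (l n)) = 0\<close> the only term of weight 2 arises by taking the
  plugging part of \<open>d (l n)\<close> and then the plugging part of
  \<open>d (l (n + 1))\<close>. The differential of the base part and \<open>d \<kappa>\<close> stay
  in weights at most 1.\<close>

lemma l_plug_twice: "pcomp P 1 (pcomp P 1 (l (n + 2)) \<kappa>) \<kappa> = \<zero>\<^bsub>Sp P n (-3)\<^esub>"
proof -
  interpret M: module K "Sp P n (-3)" by (rule T.module_Sp)
  let ?M = "Sp P n (-3)"
  let ?p = "pcomp P 1 (l (n + 1)) \<kappa>" and ?p' = "pcomp P 1 (l (n + 2)) \<kappa>"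
  obtain y where y: "y \<in> B n (-2)" "d (l n) = y \<oplus>\<^bsub>Sp P n (-2)\<^esub> \<ominus>\<^bsub>Sp P n (-2)\<^esub> ?p"
    using l_next[of n] by (auto simp: next_op_def)
  have n2: "n + 1 + 1 = n + 2" by simp
  obtain y' where y': "y' \<in> B (n + 1) (-2)" "d (l (n + 1)) = y' \<oplus>\<^bsub>Sp P (n + 1) (-2)\<^esub> \<ominus>\<^bsub>Sp P (n + 1) (-2)\<^esub> ?p'"
    using l_next[of "n + 1"] unfolding n2 by (auto simp: next_op_def)
  obtain a b where ab: "a \<in> B n (-3)" "T.weight 1 n (-3) b" "d y = a \<oplus>\<^bsub>?M\<^esub> b"
    using d_base[OF y(1)] by auto
  have pw: "T.weight 1 n (-2) ?p" by (rule plug_weight[OF l_base])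
  have pw': "T.weight 1 (n + 1) (-2) ?p'" using plug_weight[OF l_base[of "n + 1"]] unfolding n2 .
  note pc = T.weight_closed[OF pw] and pc' = T.weight_closed[OF pw'] and yc = T.base_closed[OF y(1)] and yc' = T.base_closed[OF y'(1)]
  have w2: "T.weight 2 n (-3) (pcomp P 1 ?p' \<kappa>)"
    using weight_homogeneous.pcomp[OF pw' curvature_weight, of 1] by (simp add: one_add_one)
  have w1: "T.weight 1 n (-3) (pcomp P 1 y' \<kappa>)"
    using T.plug_weight_1[of y' n "-3"] y'(1) by simp
  have w1': "T.weight 1 n (-3) (pcomp P 1 (l (n + 1)) (d \<kappa>))"
    using weight_homogeneous.pcomp[OF weight_homogeneous.base[of "l (n + 1)" B, OF l_base] d_curvature_weight, of 1] by simp
  note c = T.weight_closed[OF w2] T.weight_closed[OF w1] T.weight_closed[OF w1'] T.weight_closed[OF ab(2)] T.base_closed[OF ab(1)]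
  have "d ?p = pcomp P 1 (d (l (n + 1))) \<kappa> \<oplus>\<^bsub>?M\<^esub> sign_of K (-1) \<odot>\<^bsub>?M\<^esub> pcomp P 1 (l (n + 1)) (d \<kappa>)"
    using DQ.D_pcomp[OF l_carrier[of "n + 1"] T.curvature_closed, of 1] by simp
  also have "sign_of K (-1) \<odot>\<^bsub>?M\<^esub> pcomp P 1 (l (n + 1)) (d \<kappa>) = \<ominus>\<^bsub>?M\<^esub> pcomp P 1 (l (n + 1)) (d \<kappa>)"
    using M.smult_l_minus[OF one_closed c(3)] c(3) by (simp add: sign_of_def)
  also have "pcomp P 1 (d (l (n + 1))) \<kappa> = pcomp P 1 y' \<kappa> \<oplus>\<^bsub>?M\<^esub> pcomp P 1 (\<ominus>\<^bsub>Sp P (n + 1) (-2)\<^esub> ?p') \<kappa>"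
    unfolding y'(2) by (rule T.pcomp_linear_left(1)[OF T.curvature_closed]) (use yc' pc' in auto)
  also have "pcomp P 1 (\<ominus>\<^bsub>Sp P (n + 1) (-2)\<^esub> ?p') \<kappa> = \<ominus>\<^bsub>?M\<^esub> pcomp P 1 ?p' \<kappa>"
    by (rule T.pcomp_linear_left(3)[OF T.curvature_closed]) (use pc' in auto)
  finally have dp: "d ?p = pcomp P 1 y' \<kappa> \<oplus>\<^bsub>?M\<^esub> \<ominus>\<^bsub>?M\<^esub> pcomp P 1 ?p' \<kappa> \<oplus>\<^bsub>?M\<^esub> \<ominus>\<^bsub>?M\<^esub> pcomp P 1 (l (n + 1)) (d \<kappa>)" .
  have "\<zero>\<^bsub>?M\<^esub> = d (d (l n))" using DQ.D_D[OF l_carrier[of n]] by simp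
  also have "\<dots> = d y \<oplus>\<^bsub>?M\<^esub> \<ominus>\<^bsub>?M\<^esub> d ?p"
    unfolding y(2) using DQ.D_add[OF yc, of "\<ominus>\<^bsub>Sp P n (-2)\<^esub> ?p"] d_minus[OF pc] pc by simp
  also have "\<dots> = a \<oplus>\<^bsub>?M\<^esub> ((b \<oplus>\<^bsub>?M\<^esub> (\<ominus>\<^bsub>?M\<^esub> pcomp P 1 y' \<kappa> \<oplus>\<^bsub>?M\<^esub> pcomp P 1 (l (n + 1)) (d \<kappa>))) \<oplus>\<^bsub>?M\<^esub> pcomp P 1 ?p' \<kappa>)"
    unfolding dp ab(3) using c by (simp add: M.minus_add T.Sp_a_ac)
  finally have sum: "a \<oplus>\<^bsub>?M\<^esub> ((b \<oplus>\<^bsub>?M\<^esub> (\<ominus>\<^bsub>?M\<^esub> pcomp P 1 y' \<kappa> \<oplus>\<^bsub>?M\<^esub> pcomp P 1 (l (n + 1)) (d \<kappa>))) \<oplus>\<^bsub>?M\<^esub> pcomp P 1 ?p' \<kappa>) = \<zero>\<^bsub>?M\<^esub>" by simp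
  \<comment> \<open>All terms of weight 1 together; with \<open>a\<close> in weight 0 and the
    twofold plugging in weight 2 they make up \<open>d (d (l n))\<close>.\<close>
  define w where "w = b \<oplus>\<^bsub>?M\<^esub> (\<ominus>\<^bsub>?M\<^esub> pcomp P 1 y' \<kappa> \<oplus>\<^bsub>?M\<^esub> pcomp P 1 (l (n + 1)) (d \<kappa>))"
  have ww: "T.weight 1 n (-3) w" unfolding w_def
    by (intro T.weight_submodule(1)[OF ab(2)] T.weight_submodule(1)[OF T.weight_submodule(3)[OF w1]] w1')
  define f where "f v = (if v = 0 then a else if v = 1 then w else pcomp P 1 ?p' \<kappa>)" for v :: nat
  have fw: "T.weight v n (-3) (f v)" if "v \<in> {0, 1, 2}" for v
    using that ab(1) ww w2 by (auto simp: f_def T.weight_0_iff)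
  have "finsum ?M f {0, 1, 2} = \<zero>\<^bsub>?M\<^esub>"
    using sum c T.weight_closed[OF ww] by (simp add: M.finsum_insert Pi_def f_def w_def[symmetric])
  from T.weight_independent[OF _ fw this, of 2] show ?thesis by (simp add: f_def)
qed

text \<open>Induction gives invariance under the permutations that fix the first input, through
  \<open>next_op_act\<close>. The exchange of the first two inputs is covered by
  \<open>l_plug_twice\<close> together with \<open>plug_plug_symmetric\<close>, and these generate
  all permutations.\<close>

lemma l_symmetric: "\<sigma> permutes {1..n} \<Longrightarrow> act P \<sigma> (l n) = l n"
proof (induction n arbitrary: \<sigma>)
  case 0
  then have "\<sigma> = id" by simp
  show ?case unfolding \<open>\<sigma> = id\<close> by (rule T.act_id[OF l_carrier])
next
  case (Suc n)
  have up: "act P (up \<tau>) (l (n + 1)) = l (n + 1)" if "\<tau> permutes {1..n}" for \<tau>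
    by (rule next_op_unique[OF _ l_next])
      (use next_op_act[OF l_next[of n] that l_carrier] in \<open>simp only: Suc.IH[OF that]\<close>)
  have s: "\<sigma> permutes {1..n + 1}" using Suc.prems unfolding Suc_eq_plus1 .
  have "act P \<sigma> (l (n + 1)) = l (n + 1)"
  proof (cases n)
    case 0
    have "\<sigma> = id" using s unfolding \<open>n = 0\<close> add_0 atLeastAtMost_singleton permutes_sing .
    show ?thesis unfolding \<open>\<sigma> = id\<close> by (rule T.act_id[OF l_carrier])
  next
    case (Suc m)
    then have nm: "n = m + 1" by simp
    have "\<sigma> permutes {1..m + 2}" using s unfolding nm by (simp add: add.assoc one_add_one)
    then show ?thesis
    proof (cases rule: permutes_generated)
      case (1 \<alpha> \<beta>)
      then show ?thesis using up nm by simp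
    next
      case (2 \<alpha> \<beta>)
      have g: "gam 2 permutes {1..n + 1}" by (rule gam_permutes) (use nm in auto)
      have gl: "act P (gam 2) (l (n + 1)) = l (n + 1)"
        using T.plug_plug_symmetric[of "l (m + 2)" m "-1"] l_in_base[of "m + 2"] l_plug_twice[of m]
        unfolding nm by (simp add: add.assoc one_add_one)
      have a: "\<alpha> permutes {1..n}" and b: "\<beta> permutes {1..n}" using 2 nm by auto
      note pa = up_permutes[OF a] and pb = up_permutes[OF b]
      have "act P \<sigma> (l (n + 1)) = act P (up \<beta>) (act P (gam 2) (act P (up \<alpha>) (l (n + 1))))"
        using T.act_act[OF T.act_closed[OF l_carrier pa] g pb] T.act_act[OF l_carrier pa permutes_compose[OF pb g]]
        by (simp add: 2(3) comp_assoc)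
      then show ?thesis using up[OF a] up[OF b] gl by simp
    qed
  qed
  then show ?case unfolding Suc_eq_plus1 .
qed

section \<open>The induced map and its compatibility with the differentials\<close>

sublocale l: symmetric_family K P l
  by unfold_locales (auto simp: l_carrier l_symmetric)

sublocale PE: presentation_eval K cL_gens cL_rels P "\<lambda>n d u. l n"
  by (rule presentation_evalI[OF l.symmetric_family_axioms])

definition \<phi> :: "('k, unit) expr set \<Rightarrow> 'a" where
  "\<phi> = induced_map P (\<lambda>n d u. l n)"

lemma \<phi>_hom: "\<phi> \<in> operad_hom K LL P"
  unfolding \<phi>_def using PE.induced_hom unfolding LL_presented .

lemma \<phi>_ell: "\<phi> (\<l> n) = l n"
  using PE.induced_cls[OF ell_wf] by (simp add: ell_def \<phi>_def)

lemmas \<phi>h = operad_homD[OF \<phi>_hom]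
lemmas \<phi>_family = symmetric_family_hom[OF L.symmetric_family_axioms l.symmetric_family_axioms \<phi>_hom \<phi>_ell]

lemma \<phi>_minus: "x \<in> carrier (Sp LL n e) \<Longrightarrow> \<phi> (\<ominus>\<^bsub>Sp LL n e\<^esub> x) = \<ominus>\<^bsub>Sp P n e\<^esub> \<phi> x"
  using graded_hom_minus[OF L.graded_operad_axioms T.graded_operad_axioms \<phi>_hom[unfolded operad_hom_iff]] .

lemma \<phi>_zero: "\<phi> \<zero>\<^bsub>Sp LL n e\<^esub> = \<zero>\<^bsub>Sp P n e\<^esub>"
  using graded_hom_zero[OF L.graded_operad_axioms T.graded_operad_axioms \<phi>_hom[unfolded operad_hom_iff]] .

lemma \<phi>_finsum: "g \<in> A \<rightarrow> carrier (Sp LL n e) \<Longrightarrow>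
    \<phi> (finsum (Sp LL n e) g A) = finsum (Sp P n e) (\<lambda>a. \<phi> (g a)) A"
  using graded_hom_finsum[OF L.graded_operad_axioms T.graded_operad_axioms \<phi>_hom[unfolded operad_hom_iff]] .

lemma bterm_sum_base: "finsum (Sp P n (-2)) (l.bterm n) (Pow {1..n} - {{}}) \<in> B n (-2)"
proof -
  interpret M: module K "Sp P n (-2)" by (rule T.module_Sp)
  have "finsum (Sp P n (-2)) (l.bterm n) A \<in> B n (-2)" if "finite A" "A \<subseteq> Pow {1..n} - {{}}" for A
    using that
  proof (induction A rule: finite_induct)
    case empty
    then show ?case using T.baseD(2) by (simp add: M.finsum_empty)
  next
    case (insert I A)
    have "l.bterm n \<in> A \<rightarrow> carrier (Sp P n (-2))" "l.bterm n I \<in> carrier (Sp P n (-2))"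
      using insert l.bterm_closed by auto
    moreover have "l.bterm n I \<in> B n (-2)"
      by (rule l.bterm_in_suboperad[OF T.base_sub l_in_base]) (use insert in auto)
    ultimately show ?case using insert T.baseD(3) by (simp add: M.finsum_insert)
  qed
  then show ?thesis by simp
qed

text \<open>The weight 1 parts of both sides agree by the choice of \<open>l (n + 1)\<close>, and
  what is left on each side lies in the base.\<close>

lemma d_l_defect: "\<exists>r \<in> B n (-2). d (l n) = l.dl n \<oplus>\<^bsub>Sp P n (-2)\<^esub> r"
proof -
  interpret M: module K "Sp P n (-2)" by (rule T.module_Sp)
  let ?M = "Sp P n (-2)" and ?S = "finsum (Sp P n (-2)) (l.bterm n) (Pow {1..n} - {{}})"
  obtain y where y: "y \<in> B n (-2)" "d (l n) = y \<oplus>\<^bsub>?M\<^esub> \<ominus>\<^bsub>?M\<^esub> pcomp P 1 (l (n + 1)) \<kappa>"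
    using l_next[of n] by (auto simp: next_op_def)
  have t: "l.tree n 0 = pcomp P 1 (l (n + 1)) \<kappa>" by (simp add: l.tree_def)
  have c: "?S \<in> carrier ?M" "y \<in> carrier ?M" "l.tree n 0 \<in> carrier ?M"
    using T.base_closed[OF bterm_sum_base] T.base_closed[OF y(1)] l.tree_closed[of n n 0] by auto
  have "d (l n) = l.dl n \<oplus>\<^bsub>?M\<^esub> (?S \<oplus>\<^bsub>?M\<^esub> y)"
  proof -
    have "l.dl n \<oplus>\<^bsub>?M\<^esub> (?S \<oplus>\<^bsub>?M\<^esub> y) = (\<ominus>\<^bsub>?M\<^esub> l.tree n 0 \<oplus>\<^bsub>?M\<^esub> y) \<oplus>\<^bsub>?M\<^esub> (\<ominus>\<^bsub>?M\<^esub> ?S \<oplus>\<^bsub>?M\<^esub> ?S)"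
      unfolding l.dl_split using c by (simp add: M.minus_add T.Sp_a_ac)
    also have "\<dots> = y \<oplus>\<^bsub>?M\<^esub> \<ominus>\<^bsub>?M\<^esub> l.tree n 0" using c by (simp add: M.l_neg M.r_neg T.Sp_a_ac)
    finally show ?thesis using y(2) t by simp
  qed
  then show ?thesis using T.baseD(3)[OF bterm_sum_base y(1)] by blast
qed

lemma d_tree:
  assumes "n = p + q"
  shows "d (l.tree p q) = pcomp P 1 (d (l (p + 1))) (l q) \<oplus>\<^bsub>Sp P n (-3)\<^esub> sign_of K (-1) \<odot>\<^bsub>Sp P n (-3)\<^esub> pcomp P 1 (l (p + 1)) (d (l q))"
    and "\<phi> (\<D> (L.tree p q)) = pcomp P 1 (l.dl (p + 1)) (l q) \<oplus>\<^bsub>Sp P n (-3)\<^esub> sign_of K (-1) \<odot>\<^bsub>Sp P n (-3)\<^esub> pcomp P 1 (l (p + 1)) (l.dl q)"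
proof -
  show "d (l.tree p q) = pcomp P 1 (d (l (p + 1))) (l q) \<oplus>\<^bsub>Sp P n (-3)\<^esub> sign_of K (-1) \<odot>\<^bsub>Sp P n (-3)\<^esub> pcomp P 1 (l (p + 1)) (d (l q))"
    using DQ.D_pcomp[OF l_carrier[of "p + 1"] l_carrier[of q], of 1] assms by (simp add: l.tree_def)
  have 1: "pcomp LL 1 (L.dl (p + 1)) (\<l> q) \<in> carrier (Sp LL n (-3))"
    by (rule L.pcomp_in[OF L.dl_closed L.l_closed]) (use assms in auto)
  have 2: "pcomp LL 1 (\<l> (p + 1)) (L.dl q) \<in> carrier (Sp LL n (-3))"
    by (rule L.pcomp_in[OF L.l_closed L.dl_closed]) (use assms in auto)
  have "\<D> (L.tree p q) = pcomp LL 1 (L.dl (p + 1)) (\<l> q) \<oplus>\<^bsub>Sp LL n (-3)\<^esub> sign_of K (-1) \<odot>\<^bsub>Sp LL n (-3)\<^esub> pcomp LL 1 (\<l> (p + 1)) (L.dl q)"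
    using diff_pcomp[OF L.l_closed[of "p + 1"] L.l_closed[of q], of 1] assms by (simp add: L.tree_def diff_ell)
  then show "\<phi> (\<D> (L.tree p q)) = pcomp P 1 (l.dl (p + 1)) (l q) \<oplus>\<^bsub>Sp P n (-3)\<^esub> sign_of K (-1) \<odot>\<^bsub>Sp P n (-3)\<^esub> pcomp P 1 (l (p + 1)) (l.dl q)"
    using \<phi>h(2)[OF 1, of "sign_of K (-1) \<odot>\<^bsub>Sp LL n (-3)\<^esub> pcomp LL 1 (\<l> (p + 1)) (L.dl q)"] \<phi>h(3)[OF _ 2, of "sign_of K (-1)"] 2
      \<phi>h(4)[OF L.dl_closed[of "p + 1"] L.l_closed[of q], of 1] \<phi>h(4)[OF L.l_closed[of "p + 1"] L.dl_closed[of q], of 1]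
    by (simp add: \<phi>_ell \<phi>_family(3))
qed

text \<open>To reach \<open>n = N + 1\<close>, the vanishing of \<open>d (d (l N))\<close> is
  compared with the image under \<open>\<phi>\<close> of the same identity in the source. By
  induction all terms agree except the plugging of \<open>\<kappa>\<close> into
  \<open>d (l n)\<close>, so these pluggings agree as well and injectivity of plugging removes the
  defect.\<close>

lemma d_l: "d (l n) = l.dl n"
proof (induction n rule: less_induct)
  case (less n)
  show ?case
  proof (cases n)
    case 0
    interpret M: module K "Sp P 0 (-2)" by (rule T.module_Sp)
    obtain y where y: "y \<in> B 0 (-2)" "d \<kappa> = y \<oplus>\<^bsub>Sp P 0 (-2)\<^esub> \<ominus>\<^bsub>Sp P 0 (-2)\<^esub> pcomp P 1 (l 1) \<kappa>"
      using l_next[of 0] by (auto simp: next_op_def)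
    have w: "T.weight 1 0 (-2) (\<ominus>\<^bsub>Sp P 0 (-2)\<^esub> pcomp P 1 (l 1) \<kappa>)"
      using T.weight_submodule(3)[OF plug_weight[OF l_base[of 0]]] by simp
    have "weight_component K Q 0 0 (-2) (d \<kappa>) = y"
      unfolding y(2) using T.weight_component_pair[OF _ w, of 0 y 0] y(1) by (simp add: T.weight_0_iff)
    then have "y = \<zero>\<^bsub>Sp P 0 (-2)\<^esub>" using T.weight_component_weight[OF d_curvature_weight, of 0] by simp
    moreover have "Pow {1..0::nat} - {{}} = {}" by auto
    moreover have t: "l.tree 0 0 = pcomp P 1 (l 1) \<kappa>" by (simp add: l.tree_def)
    moreover note l.tree_closed[of 0 0 0]
    ultimately show ?thesis using 0 y(2) l.dl_split[of 0] by (simp add: M.finsum_empty)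
  next
    case (Suc N)
    then have n: "n = N + 1" by simp
    let ?M = "Sp P N (-3)" and ?A = "Pow {1..N} - {{}}"
    interpret M: module K ?M by (rule T.module_Sp)
    interpret NL: module K "Sp LL N (-2)" by (rule L.module_Sp)
    interpret NP: module K "Sp P N (-2)" by (rule T.module_Sp)
    have bt: "d (l.bterm N I) = \<phi> (\<D> (L.bterm N I))" if I: "I \<in> ?A" for I
    proof -
      have I': "I \<subseteq> {1..N}" using I by auto
      obtain \<sigma> where s: "\<sigma> permutes {1..N}" "\<sigma> ` I = {1..card I}" "N = (N - card I) + card I"
        using l.ex_arrange[OF I'] by metis
      have "finite I" by (rule finite_subset[OF I']) simp
      then have "card I > 0" using I by (simp add: card_gt_0_iff)
      \<comment> \<open>For a non-empty subset both operations in the tree have arity at most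
        \<open>N\<close>, so the induction hypothesis covers them.\<close>
      then have lt: "N - card I + 1 < n" "card I < n" using s(3) n by auto
      have "d (l.bterm N I) = act P \<sigma> (d (l.tree (N - card I) (card I)))"
        unfolding l.bterm_eq[OF s] by (rule DQ.D_act[OF l.tree_closed[OF s(3)] s(1)])
      also have "d (l.tree (N - card I) (card I)) = \<phi> (\<D> (L.tree (N - card I) (card I)))"
        unfolding d_tree[OF s(3)] less.IH[OF lt(1)] less.IH[OF lt(2)] ..
      also have "act P \<sigma> \<dots> = \<phi> (\<D> (L.bterm N I))"
        unfolding L.bterm_eq[OF s]
        using diff_act[OF L.tree_closed[OF s(3)] s(1)] \<phi>h(5)[OF diff_closed[OF L.tree_closed[OF s(3)]] s(1)] by simp
      finally show ?thesis .
    qed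
    let ?S = "finsum (Sp P N (-2)) (l.bterm N) ?A" and ?SL = "finsum (Sp LL N (-2)) (L.bterm N) ?A"
    have Lc: "L.bterm N \<in> ?A \<rightarrow> carrier (Sp LL N (-2))" and Pc: "l.bterm N \<in> ?A \<rightarrow> carrier (Sp P N (-2))"
      using L.bterm_closed l.bterm_closed by auto
    have dSL: "\<D> ?SL = finsum (Sp LL N (-3)) (\<lambda>I. \<D> (L.bterm N I)) ?A"
      using additive_finsum[OF L.Sp_abelian_group L.Sp_abelian_group _ _ Lc, of \<D> N "-3"] diff_closed[of _ N "-2"] diff_add[of _ N "-2"] by simp
    have "d ?S = finsum ?M (\<lambda>I. d (l.bterm N I)) ?A" using d_finsum[OF Pc] by simp
    also have "\<dots> = finsum ?M (\<lambda>I. \<phi> (\<D> (L.bterm N I))) ?A"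
    proof (rule M.finsum_cong')
      show "(\<lambda>I. \<phi> (\<D> (L.bterm N I))) \<in> ?A \<rightarrow> carrier ?M"
      proof (rule Pi_I)
        fix I assume "I \<in> ?A"
        then have "\<D> (L.bterm N I) \<in> carrier (Sp LL N (-3))" using diff_closed[OF L.bterm_closed, of I N] by simp
        then show "\<phi> (\<D> (L.bterm N I)) \<in> carrier ?M" by (rule \<phi>h(1))
      qed
    qed (use bt in auto)
    also have "\<dots> = \<phi> (\<D> ?SL)"
    proof -
      have "(\<lambda>I. \<D> (L.bterm N I)) \<in> ?A \<rightarrow> carrier (Sp LL N (-3))" using diff_closed[OF L.bterm_closed, of _ N] by auto
      then show ?thesis unfolding dSL by (rule \<phi>_finsum[symmetric])
    qed
    finally have dS: "d ?S = \<phi> (\<D> ?SL)" .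
    have Sc: "?S \<in> carrier (Sp P N (-2))" "?SL \<in> carrier (Sp LL N (-2))"
      using Pc Lc by (auto intro: NP.finsum_closed NL.finsum_closed)
    have tc: "l.tree N 0 \<in> carrier (Sp P N (-2))" "L.tree N 0 \<in> carrier (Sp LL N (-2))"
      using l.tree_closed[of N N 0] L.tree_closed[of N N 0] by auto
    have cl: "d ?S \<in> carrier ?M" "d (l.tree N 0) \<in> carrier ?M"
      using DQ.D_closed[OF Sc(1)] DQ.D_closed[OF tc(1)] by auto
    have clL: "\<D> ?SL \<in> carrier (Sp LL N (-3))" "\<D> (L.tree N 0) \<in> carrier (Sp LL N (-3))"
      using diff_closed[OF Sc(2)] diff_closed[OF tc(2)] by auto
    have "\<zero>\<^bsub>?M\<^esub> = d (d (l N))" using DQ.D_D[OF l_carrier[of N]] by simp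
    \<comment> \<open>This expansion and the one of \<open>\<phi> (\<D> (L.dl N))\<close> below
      differ at most in the tree for the empty subset, which involves
      \<open>l (N + 1)\<close>.\<close>
    also have "d (l N) = l.dl N" using less.IH[of N] n by simp
    also have "d (l.dl N) = \<ominus>\<^bsub>?M\<^esub> (d (l.tree N 0) \<oplus>\<^bsub>?M\<^esub> d ?S)"
      unfolding l.dl_split using d_minus[of "l.tree N 0 \<oplus>\<^bsub>Sp P N (-2)\<^esub> ?S" N "-2"] DQ.D_add[OF tc(1) Sc(1)] tc Sc by simp
    finally have 1: "\<ominus>\<^bsub>?M\<^esub> (d (l.tree N 0) \<oplus>\<^bsub>?M\<^esub> d ?S) = \<zero>\<^bsub>?M\<^esub>" by simp
    have "\<zero>\<^bsub>?M\<^esub> = \<phi> (\<D> (L.dl N))" using diff_dl \<phi>_zero by simp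
    also have "\<D> (L.dl N) = \<ominus>\<^bsub>Sp LL N (-3)\<^esub> (\<D> (L.tree N 0) \<oplus>\<^bsub>Sp LL N (-3)\<^esub> \<D> ?SL)"
      unfolding L.dl_split using diff_minus[of "L.tree N 0 \<oplus>\<^bsub>Sp LL N (-2)\<^esub> ?SL" N "-2"] diff_add[OF tc(2) Sc(2)] tc Sc by simp
    also have "\<phi> \<dots> = \<ominus>\<^bsub>?M\<^esub> (\<phi> (\<D> (L.tree N 0)) \<oplus>\<^bsub>?M\<^esub> d ?S)"
      using \<phi>_minus[of "\<D> (L.tree N 0) \<oplus>\<^bsub>Sp LL N (-3)\<^esub> \<D> ?SL" N "-3"] \<phi>h(2)[OF clL(2,1)] clL dS by simp
    finally have 2: "\<ominus>\<^bsub>?M\<^esub> (\<phi> (\<D> (L.tree N 0)) \<oplus>\<^bsub>?M\<^esub> d ?S) = \<zero>\<^bsub>?M\<^esub>" by simp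
    have ft: "\<phi> (\<D> (L.tree N 0)) \<in> carrier ?M" by (rule \<phi>h(1)[OF clL(2)])
    have "d (l.tree N 0) \<oplus>\<^bsub>?M\<^esub> d ?S = \<phi> (\<D> (L.tree N 0)) \<oplus>\<^bsub>?M\<^esub> d ?S"
      using 1 2 cl ft by (metis M.add.inv_inv M.a_closed)
    then have eq: "d (l.tree N 0) = \<phi> (\<D> (L.tree N 0))"
      using M.add.right_cancel[of "d ?S"] cl ft by simp
    have n0: "N = N + 0" by simp
    \<comment> \<open>The term with \<open>d (l 0)\<close> is known by induction and cancels; what
      remains is the plugging of \<open>\<kappa>\<close> into \<open>d (l n)\<close> and into
      \<open>l.dl n\<close>.\<close>
    have d0: "d (l 0) = l.dl 0" using less.IH[of 0] n by simp
    let ?z = "sign_of K (-1) \<odot>\<^bsub>?M\<^esub> pcomp P 1 (l (N + 1)) (l.dl 0)"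
    have dc: "d (l n) \<in> carrier (Sp P (N + 1) (-2))" "l.dl n \<in> carrier (Sp P (N + 1) (-2))"
      using DQ.D_closed[OF l_carrier[of n]] l.dl_closed[of n] n by auto
    have pc: "pcomp P 1 (d (l n)) \<kappa> \<in> carrier ?M" "pcomp P 1 (l.dl n) \<kappa> \<in> carrier ?M"
      using T.pcomp_in[OF dc(1) T.curvature_closed, of 1 N "-3"] T.pcomp_in[OF dc(2) T.curvature_closed, of 1 N "-3"] by auto
    have zc: "?z \<in> carrier ?M" using T.pcomp_in[OF l_carrier[of "N + 1"] l.dl_closed[of 0], of 1 N "-3"] by simp
    have "pcomp P 1 (d (l n)) \<kappa> \<oplus>\<^bsub>?M\<^esub> ?z = pcomp P 1 (l.dl n) \<kappa> \<oplus>\<^bsub>?M\<^esub> ?z"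
      using eq unfolding d_tree[OF n0] d0 n by simp
    then have pp: "pcomp P 1 (d (l n)) \<kappa> = pcomp P 1 (l.dl n) \<kappa>"
      using M.add.right_cancel[OF zc pc] by simp
    obtain r where r: "r \<in> B (N + 1) (-2)" "d (l n) = l.dl n \<oplus>\<^bsub>Sp P (N + 1) (-2)\<^esub> r"
      using d_l_defect[of n] n by auto
    \<comment> \<open>The defect \<open>r\<close> lies in the base and is killed by plugging, hence
      zero.\<close>
    note rc = T.base_closed[OF r(1)]
    have rk: "pcomp P 1 r \<kappa> \<in> carrier ?M" using T.pcomp_in[OF rc T.curvature_closed, of 1 N "-3"] by simp
    have "pcomp P 1 (d (l n)) \<kappa> = pcomp P 1 (l.dl n) \<kappa> \<oplus>\<^bsub>?M\<^esub> pcomp P 1 r \<kappa>"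
      unfolding r(2) by (rule T.pcomp_linear_left(1)[OF T.curvature_closed _ _ _ _ dc(2) rc]) auto
    then have "\<zero>\<^bsub>?M\<^esub> \<oplus>\<^bsub>?M\<^esub> pcomp P 1 (l.dl n) \<kappa> = pcomp P 1 r \<kappa> \<oplus>\<^bsub>?M\<^esub> pcomp P 1 (l.dl n) \<kappa>"
      using pp pc M.a_comm[OF pc(2) rk] by simp
    then have "\<zero>\<^bsub>?M\<^esub> = pcomp P 1 r \<kappa>" using M.add.right_cancel[OF pc(2) M.zero_closed rk] by simp
    moreover have "pcomp P 1 \<zero>\<^bsub>Sp P (N + 1) (-2)\<^esub> \<kappa> = \<zero>\<^bsub>?M\<^esub>"
      by (rule T.pcomp_zero_left[OF T.curvature_closed]) auto
    ultimately have k: "pcomp P 1 r \<kappa> = pcomp P 1 \<zero>\<^bsub>Sp P (N + 1) (-2)\<^esub> \<kappa>" by simp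
    have "r \<in> B (N + 1) (-3 + 1)" "\<zero>\<^bsub>Sp P (N + 1) (-2)\<^esub> \<in> B (N + 1) (-3 + 1)"
      using r(1) T.baseD(2)[of "N + 1" "-2"] by auto
    then have rz: "r = \<zero>\<^bsub>Sp P (N + 1) (-2)\<^esub>" by (rule T.plug_inj[OF _ _ k])
    interpret M': module K "Sp P (N + 1) (-2)" by (rule T.module_Sp)
    show ?thesis using r(2) M'.r_zero[OF dc(2)] by (simp only: rz)
  qed
qed

text \<open>Both sides are derivations along \<open>\<phi>\<close>, so agreement on the generators
  is enough.\<close>

lemma \<phi>_diff:
  assumes "x \<in> carrier (Sp LL n e)"
  shows "\<phi> (\<D> x) = d (\<phi> x)"
proof -
  define H where "H n e = {x \<in> carrier (Sp LL n e). \<phi> (\<D> x) = d (\<phi> x)}" for n e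
  have "suboperad K LL H"
  proof (rule L.suboperadI)
    show "\<zero>\<^bsub>Sp LL n e\<^esub> \<in> H n e" for n e by (simp add: H_def diff_zero \<phi>_zero d_zero)
    fix n e x assume "x \<in> H n e"
    then have x: "x \<in> carrier (Sp LL n e)" "\<phi> (\<D> x) = d (\<phi> x)" by (auto simp: H_def)
    note dx = diff_closed[OF x(1)] and fx = \<phi>h(1)[OF x(1)]
    show "x \<oplus>\<^bsub>Sp LL n e\<^esub> y \<in> H n e" if "y \<in> H n e" for y
    proof -
      have y: "y \<in> carrier (Sp LL n e)" "\<phi> (\<D> y) = d (\<phi> y)" using that by (auto simp: H_def)
      show ?thesis using x y diff_add[OF x(1) y(1)] \<phi>h(2)[OF dx diff_closed[OF y(1)]] \<phi>h(2)[OF x(1) y(1)]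
          DQ.D_add[OF fx \<phi>h(1)[OF y(1)]] by (simp add: H_def)
    qed
    show "c \<odot>\<^bsub>Sp LL n e\<^esub> x \<in> H n e" if "c \<in> carrier K" for c
      using that x diff_smult[OF x(1) that] \<phi>h(3)[OF that dx] \<phi>h(3)[OF that x(1)] DQ.D_smult[OF that fx] by (simp add: H_def)
    show "act LL \<sigma> x \<in> H n e" if s: "\<sigma> permutes {1..n}" for \<sigma>
      using x L.act_closed[OF x(1) s] diff_act[OF x(1) s] \<phi>h(5)[OF dx s] \<phi>h(5)[OF x(1) s] DQ.D_act[OF fx s] by (simp add: H_def)
    show "pcomp LL i x y \<in> H (n + m - 1) (e + e')" if "y \<in> H m e'" and i: "1 \<le> i" "i \<le> n" for y m e' i
    proof -
      have y: "y \<in> carrier (Sp LL m e')" "\<phi> (\<D> y) = d (\<phi> y)" using that by (auto simp: H_def)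
      note dy = diff_closed[OF y(1)] and fy = \<phi>h(1)[OF y(1)]
      let ?N = "n + m - 1" and ?E = "e + e' - 1"
      have 1: "pcomp LL i (\<D> x) y \<in> carrier (Sp LL ?N ?E)" by (rule L.pcomp_in[OF dx y(1) i]) auto
      have 2: "pcomp LL i x (\<D> y) \<in> carrier (Sp LL ?N ?E)" by (rule L.pcomp_in[OF x(1) dy i]) auto
      have "\<phi> (\<D> (pcomp LL i x y)) = \<phi> (pcomp LL i (\<D> x) y) \<oplus>\<^bsub>Sp P ?N ?E\<^esub> sign_of K e \<odot>\<^bsub>Sp P ?N ?E\<^esub> \<phi> (pcomp LL i x (\<D> y))"
        using diff_pcomp[OF x(1) y(1) i] \<phi>h(2)[OF 1, of "sign_of K e \<odot>\<^bsub>Sp LL ?N ?E\<^esub> pcomp LL i x (\<D> y)"]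
          \<phi>h(3)[OF _ 2, of "sign_of K e"] 2 by simp
      then show ?thesis using x y \<phi>h(4)[OF dx y(1) i] \<phi>h(4)[OF x(1) dy i] \<phi>h(4)[OF x(1) y(1) i] DQ.D_pcomp[OF fx fy i]
          L.pcomp_closed[OF x(1) y(1) i] by (simp add: H_def)
    qed
  qed (auto simp: H_def)
  moreover have "\<l> n \<in> H n (-1)" for n
    using L.l_closed by (simp add: H_def diff_ell \<phi>_ell \<phi>_family(3) d_l)
  ultimately show ?thesis using cL_generated[of H x n e] assms by (simp add: H_def)
qed

lemma \<phi>_base: "x \<in> cL_base K n e \<Longrightarrow> \<phi> x \<in> B n e"
proof -
  assume x: "x \<in> cL_base K n e"
  define H where "H n e = {x \<in> carrier (Sp LL n e). \<phi> x \<in> B n e}" for n e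
  have "suboperad K LL H"
  proof (rule L.suboperadI)
    show "pcomp LL i x y \<in> H (n + m - 1) (e + e')" if "x \<in> H n e" "y \<in> H m e'" "1 \<le> i" "i \<le> n" for n e m e' i x y
      using that \<phi>h(4)[of x n e y m e' i] T.baseD(6)[of "\<phi> x" n e "\<phi> y" m e' i "n + m - 1" "e + e'"] L.pcomp_closed[of x n e y m e' i]
      by (simp add: H_def)
    show "act LL \<sigma> x \<in> H n e" if "x \<in> H n e" "\<sigma> permutes {1..n}" for \<sigma> n e x
      using that \<phi>h(5)[of x n e \<sigma>] T.baseD(7)[of "\<phi> x" n e \<sigma>] L.act_closed[of x n e \<sigma>] by (simp add: H_def)
  qed (auto simp: H_def \<phi>_zero T.baseD \<phi>h(2,3))
  moreover have "\<l> n \<in> H n (-1)" if "n > 0" for n using that by (simp add: H_def L.l_closed \<phi>_ell l_in_base)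
  ultimately have "x \<in> H n e" using cL_base_induct x by blast
  then show ?thesis by (simp add: H_def)
qed

text \<open>A morphism preserves the base and the curvature, so it maps the weight splitting of the
  differential of \<open>\<l> n\<close> to that of \<open>d (l n)\<close>. Thus the image of
  \<open>\<l> (n + 1)\<close> is a solution of \<open>next_op\<close>, and the solution is
  unique.\<close>

lemma hom_unique:
  assumes h: "\<Psi> \<in> operad_hom K LL P" and diff: "\<And>n e x. x \<in> carrier (Sp LL n e) \<Longrightarrow> \<Psi> (\<D> x) = d (\<Psi> x)"
    and curv: "\<Psi> (\<l> 0) = \<kappa>" and base: "\<And>n e. \<Psi> ` cL_base K n e \<subseteq> B n e"
    and x: "x \<in> carrier (Sp LL n e)"
  shows "\<Psi> x = \<phi> x"
proof -
  note \<Psi>h = operad_homD[OF h]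
  have gen: "\<Psi> (\<l> n) = l n" for n
  proof (induction n)
    case (Suc n)
    let ?y = "\<ominus>\<^bsub>Sp LL n (-2)\<^esub> finsum (Sp LL n (-2)) (L.bterm n) (Pow {1..n} - {{}})"
    have tc: "L.tree n 0 \<in> carrier (Sp LL n (-2))" using L.tree_closed[of n n 0] by simp
    have yc: "?y \<in> carrier (Sp LL n (-2))" using dl_weight(2) L.suboperadD(1)[OF cL_base_suboperad] by blast
    have "d (l n) = \<Psi> (L.dl n)" using diff[OF L.l_closed[of n]] Suc by (simp add: diff_ell)
    also have "\<dots> = \<Psi> ?y \<oplus>\<^bsub>Sp P n (-2)\<^esub> \<Psi> (\<ominus>\<^bsub>Sp LL n (-2)\<^esub> L.tree n 0)"
      unfolding dl_weight(1) by (rule \<Psi>h(2)[OF yc]) (use tc in simp)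
    also have "\<Psi> (\<ominus>\<^bsub>Sp LL n (-2)\<^esub> L.tree n 0) = \<ominus>\<^bsub>Sp P n (-2)\<^esub> \<Psi> (L.tree n 0)"
      using graded_hom_minus[OF L.graded_operad_axioms T.graded_operad_axioms h[unfolded operad_hom_iff] tc] by simp
    also have "\<Psi> (L.tree n 0) = pcomp P 1 (\<Psi> (\<l> (n + 1))) \<kappa>"
      unfolding L.tree_def using \<Psi>h(4)[OF L.l_closed[of "n + 1"] L.l_closed[of 0], of 1] curv by simp
    finally have dln: "d (l n) = \<Psi> ?y \<oplus>\<^bsub>Sp P n (-2)\<^esub> \<ominus>\<^bsub>Sp P n (-2)\<^esub> pcomp P 1 (\<Psi> (\<l> (n + 1))) \<kappa>" .
    have "\<Psi> (\<l> (n + 1)) \<in> B (n + 1) (-1)"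
      by (rule subsetD[OF base], rule imageI, rule ell_in_base) simp
    moreover have "\<Psi> ?y \<in> B n (-2)"
      by (rule subsetD[OF base], rule imageI, rule dl_weight(2))
    ultimately have "next_op n (l n) (\<Psi> (\<l> (n + 1)))"
      unfolding next_op_def using dln by blast
    then show ?case unfolding Suc_eq_plus1 by (rule next_op_unique[OF _ l_next])
  qed (simp add: curv)
  have wf: "graded_hom K LL P (\<lambda>n d. \<Psi>)" "graded_hom K LL P (\<lambda>n d. \<phi>)"
    using h \<phi>_hom unfolding operad_hom_iff by blast+
  define H where "H n e = {x \<in> carrier (Sp LL n e). \<Psi> x = \<phi> x}" for n e
  have "suboperad K LL H"
  proof (rule L.suboperadI)
    show "\<zero>\<^bsub>Sp LL n e\<^esub> \<in> H n e" for n e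
      using graded_hom_zero[OF L.graded_operad_axioms T.graded_operad_axioms wf(1), of n e] by (simp add: H_def \<phi>_zero)
    show "pcomp LL i x y \<in> H (n + m - 1) (e + e')" if "x \<in> H n e" "y \<in> H m e'" "1 \<le> i" "i \<le> n" for n e m e' i x y
      using that \<phi>h(4)[of x n e y m e' i] \<Psi>h(4)[of x n e y m e' i] L.pcomp_closed[of x n e y m e' i] by (simp add: H_def)
    show "act LL \<sigma> x \<in> H n e" if "x \<in> H n e" "\<sigma> permutes {1..n}" for \<sigma> n e x
      using that \<phi>h(5)[of x n e \<sigma>] \<Psi>h(5)[of x n e \<sigma>] L.act_closed[of x n e \<sigma>] by (simp add: H_def)
  qed (auto simp: H_def \<phi>h(2,3) \<Psi>h(2,3))
  moreover have "\<l> n \<in> H n (-1)" for n using gen by (simp add: H_def L.l_closed \<phi>_ell)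
  ultimately show ?thesis using cL_generated[of H x n e] x by (simp add: H_def)
qed

lemma ex1_hom: "\<exists>!\<Phi>. \<Phi> \<in> curv_hom K cQ Q"
proof (rule ex1I)
  let ?U = "\<Union>n e. carrier (Sp LL n e)"
  \<comment> \<open>Morphisms are extensional, so \<open>\<phi>\<close> is cut down to the
    operations; outside them its value is arbitrary.\<close>
  define \<Phi> where "\<Phi> = restrict \<phi> ?U"
  have r: "\<Phi> x = \<phi> x" if "x \<in> carrier (Sp LL n e)" for x n e using that by (auto simp: \<Phi>_def)
  have "\<Phi> \<in> operad_hom K LL P"
    unfolding operad_hom_def
    by (auto simp: \<phi>h r[OF L.Sp_closed(2)] r[OF L.Sp_closed(4)] r[OF L.pcomp_closed] r[OF L.act_closed] r)
  moreover have "\<Phi> (\<D> x) = d (\<Phi> x)" if "x \<in> carrier (Sp LL n e)" for x n e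
    using r[OF that] r[OF diff_closed[OF that]] \<phi>_diff[OF that] by simp
  moreover have "\<Phi> (\<l> 0) = \<kappa>" using r[OF L.l_closed[of 0]] \<phi>_ell[of 0] by simp
  moreover have "\<Phi> ` cL_base K n e \<subseteq> B n e" for n e
    using \<phi>_base r[of _ n e] L.suboperadD(1)[OF cL_base_suboperad, of n e] by (auto simp: subset_iff)
  moreover have "\<Phi> \<in> extensional ?U" by (simp add: \<Phi>_def)
  ultimately show "\<Phi> \<in> curv_hom K cQ Q" unfolding curv_hom_def by simp
  fix \<Psi> assume \<Psi>: "\<Psi> \<in> curv_hom K cQ Q"
  show "\<Psi> = \<Phi>"
  proof (rule extensionalityI)
    show "\<Psi> \<in> extensional ?U" using \<Psi> by (simp add: curv_hom_def)
    show "\<Phi> \<in> extensional ?U" by (simp add: \<Phi>_def)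
    show "\<Psi> x = \<Phi> x" if "x \<in> ?U" for x
    proof -
      obtain n e where x: "x \<in> carrier (Sp LL n e)" using \<open>x \<in> ?U\<close> by blast
      have "\<Psi> x = \<phi> x" by (rule hom_unique[OF _ _ _ _ x]) (use \<Psi> in \<open>auto simp: curv_hom_def\<close>)
      then show ?thesis using r[OF x] by simp
    qed
  qed
qed

end

theorem theorem1p3:
  fixes K :: "('k, 'm) ring_scheme"
  assumes "field K"
    and "\<And>m :: nat. m > 0 \<Longrightarrow> [m] \<cdot>\<^bsub>K\<^esub> \<one>\<^bsub>K\<^esub> \<noteq> \<zero>\<^bsub>K\<^esub>"
  shows "curv_object K (cL_infinity K) \<and>
    (\<forall>Q :: ('k, 'a) curv. curv_object K Q \<longrightarrow> (\<exists>!\<Phi>. \<Phi> \<in> curv_hom K (cL_infinity K) Q))"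
proof -
  interpret char_0_field K
    by (intro char_0_field.intro char_0_field_axioms.intro assms)
  show ?thesis
  proof (intro conjI allI impI)
    show "curv_object K (cL_infinity K)" by (rule cL_curv_object)
    fix Q :: "('k, 'a) curv" assume "curv_object K Q"
    then interpret curved_target K Q
      by (intro curved_target.intro char_0_field_axioms curved_target_axioms.intro)
    show "\<exists>!\<Phi>. \<Phi> \<in> curv_hom K (cL_infinity K) Q" by (rule ex1_hom)
  qed
qed

end
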